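(* 1. (Lower bound.) Suppose $\lim_{x\to\infty}\varepsilon(x)=0$ (infinite disorder). Then $\varepsilon^{-1}$ is defined on a (right) neighborhood of $0$ and $\lim_{u\to0}\varepsilon^{-1}(u)=+\infty$. Moreover there exist two constants $c_0,c_0'>0$, not depending on $\beta$, such that for all $u\in(0,1)$ and all $\beta>0$ $$\mathtt F(\beta,-\beta+u)\ge c_0'\,A_u\,\hat{\mathbb P}(\xi_1\ge A_u)\,\mathtt F(u),\qquad A_u:=\varepsilon^{-1}(c_0\mathtt F(u)),$$ where $A_u\to\infty$ as $u\to0$. In particular $h_c(\beta)=-\beta$, and the right-hand side is $o(\mathtt F(u))$ as $u\to0$. 2. (Upper bounds.) Whether $h_c(\beta)=-\beta$ or not, there exist constants $C_1,c_1,\mathbf c>0$, not depending on $\beta$, such that for all $\beta\in(0,1)$ and $u\in(0,c_1\beta)$ $$\mathtt F(\beta,-\beta+u)\le C_1\,\beta^{1-\nu^{\rm pur}}\,\mathtt F(u)\,\hat{\mathbb E}\Big[\frac{T_{L(u)}}{L(u)}\mathbf 1_{\{T_{L(u)}>4\hat{\mathbb E}[T_2]L(u)\}}\Big],\qquad L(u):=\lfloor\mathbf c\,\beta^{\nu^{\rm pur}}\mathtt F(u)^{-1}\rfloor,$$ and also, for all $\beta\in(0,1)$ and $u\in(0,c_1\beta)$, $$\mathtt F(\beta,-\beta+u)\le C_1\,u\,\hat{\mathbb E}\big[\xi_1\mathbf 1_{\{\xi_1>\mathbf c\beta u^{-1}\}}\big].$$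
   Context: Renewal process: $\tau=(\tau_i)_{i\ge 0}$ has law $\mathbf P$ (expectation $\mathbf E$), $\tau_0=0$, and the increments $(\tau_i-\tau_{i-1})_{i\ge1}$ are i.i.d. with values in $\mathbb N=\{1,2,\ldots\}$ and law $K(n):=\mathbf P(\tau_1=n)$. The renewal is recurrent, $\mathbf P(\tau_1=+\infty)=0$, and $K(n)=(1+o(1))\,c_K n^{-(1+\alpha)}$ as $n\to\infty$ for some $\alpha>0$, $\alpha\neq1$, and $c_K>0$. Set $\delta_n:=\mathbf 1_{\{n\in\{\tau_0,\tau_1,\ldots\}\}}$ and $\nu^{\rm pur}:=\max(1,1/\alpha)$. Environment: $\omega=(\omega_i)_{i\ge0}$ is a stationary ergodic random sequence with values in $\{-1,+1\}$, with law $\mathbb P$ (independent of $\tau$), non-trivial in the sense that $\mathbb P(\omega_1=+1)>0$ and $\mathbb P(\omega_1=-1)>0$. Pinning model: for $h\in\mathbb R$, $\beta\ge0$, $Z_{N,h}^{\omega,\beta}:=\mathbf E\big[\exp\big(\sum_{n=1}^N(h+\beta\omega_n)\delta_n\big)\big]$. The quenched free energy $\mathtt F(\beta,h):=\lim_{N\to\infty}\frac1N\log Z_{N,h}^{\omega,\beta}$ exists and is $\mathbb P$-a.s. constant; $h\mapsto\mathtt F(\beta,h)$ is convex, non-negative and non-decreasing. The quenched critical point $h_c(\beta)$ is such that $\mathtt F(\beta,h)>0$ if and only if $h>h_c(\beta)$. Write $\mathtt F(u):=\mathtt F(0,u)$. Blocks: let $\hat{\mathbb P}:=\mathbb P(\,\cdot\mid\omega_0=-1,\omega_1=+1)$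 with expectation $\hat{\mathbb E}$. Set $T_0:=0$ and for $n\ge1$, $T_n:=\inf\{i>T_{n-1}:\ \omega_{i+1}\ne\omega_i\}$, $\xi_n:=T_n-T_{n-1}$. Thus under $\hat{\mathbb P}$ the environment is constant on each block $(T_{n-1},T_n]$, equal to $+1$ for odd $n$ and to $-1$ for even $n$; one has $\hat{\mathbb E}[\xi_1],\hat{\mathbb E}[\xi_2]<\infty$. Rate function: $\varepsilon(x):=\inf\{-\frac1n\log\hat{\mathbb P}(\xi_1\ge n):\ n\in\mathbb N,\ n\le x,\ \hat{\mathbb P}(\xi_1\ge n)<1\}$ (with $\inf\emptyset=+\infty$ and $-\log 0=+\infty$), which is non-increasing in $x\ge1$; its generalized inverse is $\varepsilon^{-1}(u):=\sup\{x\ge1:\ \varepsilon(x)\ge u\}$. *)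

theory Defs
  imports "HOL-Probability.Probability" "HOL-Library.Landau_Symbols"
begin

(* The arrival times are natural numbers, hence finite: this is how P(tau_1 = infinity) = 0
   enters. *)
definition renewal_process :: "'r measure \<Rightarrow> (nat \<Rightarrow> 'r \<Rightarrow> nat) \<Rightarrow> bool" where
  "renewal_process R \<tau> \<longleftrightarrow>
     prob_space R \<and>
     (\<forall>y\<in>space R. \<tau> 0 y = 0 \<and> (\<forall>i. \<tau> i y < \<tau> (Suc i) y)) \<and>
     prob_space.indep_vars R (\<lambda>_. count_space UNIV) (\<lambda>i y. \<tau> (Suc i) y - \<tau> i y) UNIV \<and>
     (\<forall>i. distr R (count_space UNIV) (\<lambda>y. \<tau> (Suc i) y - \<tau> i y) =
          distr R (count_space UNIV) (\<tau> 1))"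

definition interarrival_law :: "'r measure \<Rightarrow> (nat \<Rightarrow> 'r \<Rightarrow> nat) \<Rightarrow> nat \<Rightarrow> real" where
  "interarrival_law R \<tau> n = \<P>(y in R. \<tau> 1 y = n)"

definition seq_shift :: "(nat \<Rightarrow> real) \<Rightarrow> nat \<Rightarrow> real" where
  "seq_shift w = (\<lambda>i. w (Suc i))"

abbreviation seq_space :: "(nat \<Rightarrow> real) measure" where
  "seq_space \<equiv> Pi\<^sub>M UNIV (\<lambda>_. borel)"

definition stationary_sequence :: "'w measure \<Rightarrow> (nat \<Rightarrow> 'w \<Rightarrow> real) \<Rightarrow> bool" where
  "stationary_sequence P \<omega> \<longleftrightarrow>
     (\<forall>i. \<omega> i \<in> borel_measurable P) \<and>
     distr P seq_space (\<lambda>x. seq_shift (\<lambda>i. \<omega> i x)) = distr P seq_space (\<lambda>x i. \<omega> i x)"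

definition ergodic_sequence :: "'w measure \<Rightarrow> (nat \<Rightarrow> 'w \<Rightarrow> real) \<Rightarrow> bool" where
  "ergodic_sequence P \<omega> \<longleftrightarrow>
     (\<forall>A\<in>sets seq_space. seq_shift -` A = A \<longrightarrow>
        \<P>(x in P. (\<lambda>i. \<omega> i x) \<in> A) = 0 \<or> \<P>(x in P. (\<lambda>i. \<omega> i x) \<in> A) = 1)"

definition nontrivial_pm1_environment :: "'w measure \<Rightarrow> (nat \<Rightarrow> 'w \<Rightarrow> real) \<Rightarrow> bool" where
  "nontrivial_pm1_environment P \<omega> \<longleftrightarrow>
     prob_space P \<and>
     (\<forall>i. \<forall>x\<in>space P. \<omega> i x \<in> {-1, 1}) \<and>
     stationary_sequence P \<omega> \<and> ergodic_sequence P \<omega> \<and>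
     \<P>(x in P. \<omega> 1 x = 1) > 0 \<and> \<P>(x in P. \<omega> 1 x = -1) > 0"

(* The environment w is quenched: the integral is over the renewal only. Since the renewal and the
   environment live on two different probability spaces, they are independent by construction. *)
definition partition_function ::
    "'r measure \<Rightarrow> (nat \<Rightarrow> 'r \<Rightarrow> nat) \<Rightarrow> real \<Rightarrow> real \<Rightarrow> (nat \<Rightarrow> real) \<Rightarrow> nat \<Rightarrow> real" where
  "partition_function R \<tau> \<beta> h w N =
     (\<integral>y. exp (\<Sum>n=1..N. (h + \<beta> * w n) * indicator (range (\<lambda>i. \<tau> i y)) n) \<partial>R)"

definition free_energy ::
    "'w measure \<Rightarrow> (nat \<Rightarrow> 'w \<Rightarrow> real) \<Rightarrow> 'r measure \<Rightarrow> (nat \<Rightarrow> 'r \<Rightarrow> nat) \<Rightarrow> real \<Rightarrow> real \<Rightarrow> real" where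
  "free_energy P \<omega> R \<tau> \<beta> h =
     (THE f. AE x in P.
        (\<lambda>N. 1 / real N * ln (partition_function R \<tau> \<beta> h (\<lambda>i. \<omega> i x) N)) \<longlonglongrightarrow> f)"

definition critical_point ::
    "'w measure \<Rightarrow> (nat \<Rightarrow> 'w \<Rightarrow> real) \<Rightarrow> 'r measure \<Rightarrow> (nat \<Rightarrow> 'r \<Rightarrow> nat) \<Rightarrow> real \<Rightarrow> real" where
  "critical_point P \<omega> R \<tau> \<beta> = (THE c. \<forall>h. free_energy P \<omega> R \<tau> \<beta> h > 0 \<longleftrightarrow> h > c)"

(* In nat the infimum of the empty set is 0 rather than infinity. This only affects environments
   that are eventually constant, which form a null set by stationarity, ergodicity and
   non-triviality. *)
primrec switch_time :: "(nat \<Rightarrow> real) \<Rightarrow> nat \<Rightarrow> nat" where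
  "switch_time w 0 = 0"
| "switch_time w (Suc n) = Inf {i. i > switch_time w n \<and> w (i + 1) \<noteq> w i}"

(* Used for n \<ge> 1 only. *)
definition block_length :: "(nat \<Rightarrow> real) \<Rightarrow> nat \<Rightarrow> nat" where
  "block_length w n = switch_time w n - switch_time w (n - 1)"

definition conditioned_env :: "'w measure \<Rightarrow> (nat \<Rightarrow> 'w \<Rightarrow> real) \<Rightarrow> 'w measure" where
  "conditioned_env P \<omega> = uniform_measure P {x \<in> space P. \<omega> 0 x = -1 \<and> \<omega> 1 x = 1}"

definition block_tail :: "'w measure \<Rightarrow> (nat \<Rightarrow> 'w \<Rightarrow> real) \<Rightarrow> real \<Rightarrow> real" where
  "block_tail P \<omega> a = \<P>(x in conditioned_env P \<omega>. real (block_length (\<lambda>i. \<omega> i x) 1) \<ge> a)"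

definition neg_ln :: "real \<Rightarrow> ereal" where
  "neg_ln p = (if p = 0 then \<infinity> else ereal (- ln p))"

definition rate :: "'w measure \<Rightarrow> (nat \<Rightarrow> 'w \<Rightarrow> real) \<Rightarrow> real \<Rightarrow> ereal" where
  "rate P \<omega> x =
     (INF n\<in>{n::nat. 1 \<le> n \<and> real n \<le> x \<and> block_tail P \<omega> (real n) < 1}.
        neg_ln (block_tail P \<omega> (real n)) / ereal (real n))"

(* Extended-real valued, so that being defined at u means being finite there. *)
definition rate_inv :: "'w measure \<Rightarrow> (nat \<Rightarrow> 'w \<Rightarrow> real) \<Rightarrow> real \<Rightarrow> ereal" where
  "rate_inv P \<omega> u = (SUP x\<in>{x::real. 1 \<le> x \<and> rate P \<omega> x \<ge> ereal u}. ereal x)"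

end

theory Submission
  imports Defs "HOL-Real_Asymp.Real_Asymp"
begin

text \<open>
  Conditioning on the environment turns the model into a recursion: the partition function of a
  renewal started at \<open>x\<close> satisfies \<open>Z x = P(no renewal in (x, N]) + sum_n K(n - x) W(n) Z n\<close>,
  where \<open>W\<close> is the sequence of site weights (lemma \<open>partition_function_eq_Z\<close>). Everything that
  concerns the renewal is a statement about this recursion, proved by backward induction on the
  starting point; the asymptotics of the kernel only enters as two-sided polynomial bounds.

  Free energy. Two renewals that jump over the same point from different places have comparable
  futures, up to a polynomial factor (\<open>T_compare\<close>). Hence \<open>ln Z\<close> is additive under concatenation up
  to a logarithmic error (\<open>Z_near_additive\<close>), so that \<open>ln Z / N\<close> is close, uniformly in the
  environment, to a Birkhoff average of a bounded function. The ergodic theorem then shows that the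
  almost sure limit exists and is the limit of \<open>E[ln Z] / N\<close> (\<open>free_energy_exists\<close>). All bounds are
  proved for the latter.

  Scales. With \<open>G n\<close> the expected number of renewals up to \<open>n\<close>, which is of order \<open>n^\<gamma>\<close> with
  \<open>\<gamma> = min(1, \<alpha>)\<close>, a homogeneous reward \<open>u\<close> becomes visible on the scale where \<open>u G n\<close> is of order
  one; so the homogeneous free energy is of order \<open>u^\<nu>\<close> with \<open>\<nu> = 1/\<gamma>\<close> (\<open>FE_hom_bounds\<close>).

  Upper bounds. At \<open>h = -\<beta> + u\<close> a plus site has weight \<open>e^u\<close> and a minus site \<open>e^(u - 2\<beta>)\<close>. The
  line is cut into windows of length \<open>M\<close>. Each weight is a product of a factor for the windows with
  even index and one for those with odd index; by the arithmetic-geometric mean inequality it is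
  enough to treat reward in windows of one parity only and penalty in the others. A rewarding window
  gains at most a factor \<open>1 + 4 v G M\<close> with \<open>v = e^(2u) - 1\<close>, whereas the next one loses at least
  \<open>(1 - e^(-4\<beta>))\<close> times the probability that the renewal hits one of its minus sites. If this
  hitting probability is large enough the pair contributes nothing, so that only the bad windows,
  those with too few minus sites, count (\<open>Z_le_bad_windows\<close>, \<open>FE_upper_windows\<close>). The bound with
  the first block takes \<open>M\<close> of order \<open>\<beta>/u\<close>, and a window is bad if all its sites, except
  possibly a bounded number at its left end, are plus
  (\<open>upper_bound_first_block\<close>). The bound with \<open>L\<close> blocks takes \<open>M\<close> of order \<open>L(u)\<close>, and a window is
  bad if it has fewer than \<open>L/4\<close> cycles (\<open>upper_bound_cycles\<close>). The probability that a window is bad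
  is expressed through the law conditioned on a cycle start at the origin by counting cycle starts
  to the left of the window: \<open>plus_prob_step\<close> and \<open>prob_few_cycles\<close>.

  Lower bound. Let the renewal visit only plus blocks of length at least \<open>A\<close>, of density
  \<open>\<rho> = p P(\<xi>_1 \<ge> A)\<close>, where \<open>p\<close> is the probability that a minus block ends and a plus block begins
  at a given site. Each visit gains about \<open>A F(u)\<close> and costs the logarithm of the gap before it;
  as the logarithm is concave, the total cost per visit is about \<open>ln (1/\<rho>)\<close> (\<open>Z_segment_chain\<close>). The
  choice \<open>A = A_u\<close> makes \<open>ln (1/\<rho>)\<close>, up to a constant, at most a small multiple of \<open>A F(u)\<close>
  (\<open>rate_inv_attained\<close>, \<open>lower_bound_long_blocks\<close>). This works for small \<open>u\<close>; the other values
  follow by monotonicity of the free energy, because the right-hand side is bounded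
  (\<open>lower_bound\<close>).
\<close>

section \<open>Sums of powers\<close>

lemma powr_increment_mvt:
  fixes x s :: real assumes "x > 0" and t: "t = s - 1"
  obtains z where "x < z" "z < x + 1" "(x + 1) powr s - x powr s = s * z powr t"
proof -
  have "\<exists>z>x. z < x + 1 \<and> (x+1) powr s - x powr s = (x + 1 - x) * (s * z powr (s - 1))"
    using assms by (intro MVT2) (auto intro!: DERIV_fun_powr derivative_eq_intros simp: field_simps)
  then show ?thesis using that t by auto
qed

lemma sum_convolution_swap:
  fixes F :: "nat \<Rightarrow> nat \<Rightarrow> 'b::comm_monoid_add"
  shows "(\<Sum>a\<in>{1..n}. \<Sum>j\<in>{1..a}. F j (a - j)) = (\<Sum>j\<in>{1..n}. \<Sum>i\<le>n - j. F j i)"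
proof -
  have "(\<Sum>a\<in>{1..n}. \<Sum>j\<in>{1..a}. F j (a - j)) = (\<Sum>(a,j)\<in>Sigma {1..n} (\<lambda>a. {1..a}). F j (a - j))"
    by (simp add: sum.Sigma)
  also have "\<dots> = (\<Sum>(j,i)\<in>Sigma {1..n} (\<lambda>j. {..n - j}). F j i)"
    by (rule sum.reindex_bij_witness[where i="\<lambda>(j,i). (j+i,j)" and j="\<lambda>(a,j). (j,a-j)"]) auto
  also have "\<dots> = (\<Sum>j\<in>{1..n}. \<Sum>i\<le>n - j. F j i)"
    by (simp add: sum.Sigma)
  finally show ?thesis .
qed

lemma sum_powr_tail_le:
  fixes a :: real assumes "a > 0" and "1 \<le> n"
  shows "(\<Sum>j\<in>{n..<n+m}. real j powr (- 1 - a)) \<le> (2 powr (1+a) / a) * real n powr (-a)"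
proof -
  have step: "real j powr (- 1 - a) \<le> (2 powr (1+a) / a) * (real j powr (-a) - real (Suc j) powr (-a))" if "j \<ge> 1" for j :: nat
  proof -
    obtain z where z: "real j < z" "z < real j + 1" "(real j + 1) powr (-a) - real j powr (-a) = (-a) * z powr (- 1 - a)"
      using powr_increment_mvt[of "real j" "- 1 - a" "-a"] \<open>j \<ge> 1\<close> by auto
    have "(2 * real j) powr (- 1 - a) \<le> z powr (- 1 - a)"
      using z that assms by (intro powr_mono2') auto
    hence le: "2 powr (- 1 - a) * real j powr (- 1 - a) \<le> z powr (- 1 - a)"
      using that by (simp add: powr_mult)
    have "2 powr (- 1 - a) * 2 powr (1 + a) = (1::real)" by (simp flip: powr_add)
    hence "real j powr (- 1 - a) = 2 powr (1+a) * (2 powr (- 1 - a) * real j powr (- 1 - a))"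
      by (metis mult.assoc mult.commute mult_1)
    also have "\<dots> \<le> 2 powr (1+a) * z powr (- 1 - a)" using le by (intro mult_left_mono) auto
    finally have "real j powr (- 1 - a) \<le> 2 powr (1+a) * z powr (- 1 - a)" .
    also have "\<dots> = (2 powr (1+a) / a) * (real j powr (-a) - real (Suc j) powr (-a))"
    proof -
      have "real j powr (-a) - real (Suc j) powr (-a) = a * z powr (- 1 - a)" using z(3) by (simp add: add.commute)
      thus ?thesis using assms by simp
    qed
    finally show ?thesis .
  qed
  have "(\<Sum>j\<in>{n..<n+m}. real j powr (- 1 - a)) \<le> (2 powr (1+a) / a) * (real n powr (-a) - real (n+m) powr (-a))"
  proof (induction m)
    case (Suc m)
    have "(\<Sum>j\<in>{n..<n+Suc m}. real j powr (- 1 - a)) = (\<Sum>j\<in>{n..<n+m}. real j powr (- 1 - a)) + real (n+m) powr (- 1 - a)"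
      by simp
    also have "\<dots> \<le> (2 powr (1+a) / a) * (real n powr (-a) - real (n+m) powr (-a)) + (2 powr (1+a) / a) * (real (n+m) powr (-a) - real (Suc (n+m)) powr (-a))"
      using Suc step[of "n+m"] assms by (intro add_mono) auto
    finally show ?case by (simp add: algebra_simps)
  qed simp
  also have "\<dots> \<le> (2 powr (1+a) / a) * real n powr (-a)"
    using assms by (intro mult_left_mono) auto
  finally show ?thesis .
qed

lemma sum_powr_tail_ge:
  fixes a :: real assumes "a > 0" and "1 \<le> n"
  shows "(1 / a) * (real n powr (-a) - real (n+m) powr (-a)) \<le> (\<Sum>j\<in>{n..<n+m}. real j powr (- 1 - a))"
proof (induction m)
  case (Suc m)
  define j where "j = n + m"
  have j: "j \<ge> 1" using assms by (simp add: j_def)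
  obtain z where z: "real j < z" "z < real j + 1" "(real j + 1) powr (-a) - real j powr (-a) = (-a) * z powr (- 1 - a)"
    using powr_increment_mvt[of "real j" "- 1 - a" "-a"] j by auto
  have "z powr (- 1 - a) \<le> real j powr (- 1 - a)"
    using z j assms by (intro powr_mono2') auto
  moreover have "(1 / a) * (real j powr (-a) - real (Suc j) powr (-a)) = z powr (- 1 - a)"
    using z(3) assms by (simp add: field_simps add.commute)
  ultimately have "(1 / a) * (real j powr (-a) - real (Suc j) powr (-a)) \<le> real j powr (- 1 - a)" by simp
  thus ?case using Suc by (simp add: j_def algebra_simps)
qed simp

lemma sum_powr_le:
  fixes a :: real assumes "a > 0" "a \<noteq> 1"
  shows "\<exists>C>0. \<forall>n. (\<Sum>i\<le>n. (real i + 1) powr (-a)) \<le> C * (real n + 1) powr (1 - min 1 a)"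
proof (cases "a < 1")
  case True
  have "(\<Sum>i\<le>n. (real i + 1) powr (-a)) \<le> (1 / (1-a)) * (real n + 1) powr (1 - a)" for n
  proof (induction n)
    case 0
    then show ?case using True assms by (simp add: field_simps)
  next
    case (Suc n)
    obtain z where z: "real n + 1 < z" "z < real n + 1 + 1" "(real n + 1 + 1) powr (1-a) - (real n + 1) powr (1-a) = (1-a) * z powr (-a)"
      using powr_increment_mvt[of "real n + 1" "-a" "1-a"] by auto
    have "(real n + 2) powr (-a) \<le> z powr (-a)"
      using z assms by (intro powr_mono2') auto
    hence "(1-a) * (real n + 2) powr (-a) \<le> (real n + 2) powr (1-a) - (real n + 1) powr (1-a)"
      using z True by (simp add: add.assoc)
    hence "(real n + 2) powr (-a) \<le> (1/(1-a)) * ((real n + 2) powr (1-a) - (real n + 1) powr (1-a))"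
      using True by (simp add: field_simps)
    thus ?case using Suc by (simp add: algebra_simps)
  qed
  thus ?thesis using True by (intro exI[of _ "1/(1-a)"]) (auto simp: min_def)
next
  case False
  hence a: "a > 1" using assms by auto
  define C where "C = 1 + 2 powr (1+(a-1)) / (a-1)"
  have "(\<Sum>i\<le>n. (real i + 1) powr (-a)) \<le> C" for n
  proof -
    have "(\<Sum>i\<le>n. (real i + 1) powr (-a)) = (\<Sum>j\<in>{1..<1+Suc n}. real j powr (- 1 - (a-1)))"
      by (rule sum.reindex_bij_witness[where i="\<lambda>j. j - 1" and j=Suc]) (auto simp: add.commute)
    also have "\<dots> \<le> C" using sum_powr_tail_le[of "a-1" 1 "Suc n"] a by (simp add: C_def)
    finally show ?thesis .
  qed
  moreover have "C > 0" using a by (auto simp: C_def intro!: add_pos_nonneg)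
  ultimately show ?thesis using a by (intro exI[of _ C]) (auto simp: min_def)
qed

section \<open>Renewal kernels with polynomial tail\<close>

text \<open>The lower bound holds from \<open>n0\<close> on only, as \<open>K\<close> may vanish at small arguments.\<close>

locale renewal_kernel =
  fixes K :: "nat \<Rightarrow> real" and \<alpha> k1 k2 :: real and n0 :: nat
  assumes K_0 [simp]: "K 0 = 0"
    and K_nonneg: "K n \<ge> 0"
    and K_sums: "K sums 1"
    and alpha_pos: "\<alpha> > 0" and alpha_ne1: "\<alpha> \<noteq> 1"
    and k1_pos: "k1 > 0" and n0_pos: "n0 \<ge> 1"
    and K_lower: "n \<ge> n0 \<Longrightarrow> k1 * real n powr (- 1 - \<alpha>) \<le> K n"
    and K_upper: "n \<ge> 1 \<Longrightarrow> K n \<le> k2 * real n powr (- 1 - \<alpha>)"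
begin

text \<open>The probability that a jump is longer than \<open>n\<close>.\<close>

definition kbar :: "nat \<Rightarrow> real" where "kbar n = 1 - (\<Sum>j\<le>n. K j)"

lemma k2_pos: "k2 > 0"
proof -
  have "0 < k1 * real n0 powr (- 1 - \<alpha>)" using k1_pos n0_pos by auto
  also have "\<dots> \<le> k2 * real n0 powr (- 1 - \<alpha>)" using K_lower[of n0] K_upper[of n0] n0_pos by linarith
  finally show ?thesis by (simp add: zero_less_mult_iff)
qed

lemma kbar_tendsto: "(\<lambda>m. \<Sum>j\<in>{Suc n..<Suc n+m}. K j) \<longlonglongrightarrow> kbar n"
proof -
  have "(\<lambda>m. (\<Sum>j<m + Suc n. K j) - (\<Sum>j<Suc n. K j)) \<longlonglongrightarrow> 1 - (\<Sum>j<Suc n. K j)"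
    using K_sums unfolding sums_def by (intro tendsto_intros LIMSEQ_ignore_initial_segment)
  moreover have "(\<Sum>j<m + Suc n. K j) - (\<Sum>j<Suc n. K j) = (\<Sum>j\<in>{Suc n..<Suc n+m}. K j)" for m
    using sum_diff_nat_ivl[of 0 "Suc n" "Suc n + m" K] by (simp add: atLeast0LessThan add.commute)
  ultimately show ?thesis by (simp add: kbar_def lessThan_Suc_atMost)
qed

lemma kbar_le: "kbar n \<le> (k2 * 2 powr (1+\<alpha>) / \<alpha>) * (real n + 1) powr (-\<alpha>)"
proof (rule LIMSEQ_le_const2[OF kbar_tendsto], intro exI allI impI)
  fix m
  have "(\<Sum>j\<in>{Suc n..<Suc n+m}. K j) \<le> (\<Sum>j\<in>{Suc n..<Suc n+m}. k2 * real j powr (- 1 - \<alpha>))"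
    by (intro sum_mono K_upper) auto
  also have "\<dots> = k2 * (\<Sum>j\<in>{Suc n..<Suc n+m}. real j powr (- 1 - \<alpha>))" by (rule sum_distrib_left[symmetric])
  also have "\<dots> \<le> k2 * ((2 powr (1+\<alpha>) / \<alpha>) * real (Suc n) powr (-\<alpha>))"
    using k2_pos alpha_pos by (intro mult_left_mono sum_powr_tail_le) auto
  finally show "(\<Sum>j\<in>{Suc n..<Suc n+m}. K j) \<le> (k2 * 2 powr (1+\<alpha>) / \<alpha>) * (real n + 1) powr (-\<alpha>)"
    by (simp add: add.commute)
qed

lemma kbar_ge: "kbar n \<ge> (k1 / \<alpha> * real n0 powr (-\<alpha>)) * (real n + 1) powr (-\<alpha>)"
proof -
  define N where "N = n0 + n"
  have N: "N \<ge> n0" "N \<ge> 1" "N \<ge> Suc n" using n0_pos by (auto simp: N_def)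
  have le: "(k1 / \<alpha>) * (real N powr (-\<alpha>) - real (N+m) powr (-\<alpha>)) \<le> (\<Sum>j\<in>{Suc n..<Suc n+(N+m-Suc n)}. K j)" for m
  proof -
    have "(k1 / \<alpha>) * (real N powr (-\<alpha>) - real (N+m) powr (-\<alpha>)) = k1 * ((1 / \<alpha>) * (real N powr (-\<alpha>) - real (N+m) powr (-\<alpha>)))" by simp
    also have "\<dots> \<le> k1 * (\<Sum>j\<in>{N..<N+m}. real j powr (- 1 - \<alpha>))"
      using k1_pos alpha_pos N by (intro mult_left_mono sum_powr_tail_ge) auto
    also have "\<dots> \<le> (\<Sum>j\<in>{N..<N+m}. K j)"
      unfolding sum_distrib_left using N by (intro sum_mono K_lower) auto
    also have "\<dots> \<le> (\<Sum>j\<in>{Suc n..<Suc n+(N+m-Suc n)}. K j)"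
      using N by (intro sum_mono2 K_nonneg) auto
    finally show ?thesis .
  qed
  have lim1: "(\<lambda>m. (k1 / \<alpha>) * (real N powr (-\<alpha>) - real (N+m) powr (-\<alpha>))) \<longlonglongrightarrow> (k1 / \<alpha>) * (real N powr (-\<alpha>) - 0)"
  proof (intro tendsto_intros tendsto_neg_powr)
    show "filterlim (\<lambda>x. real (N + x)) at_top sequentially"
      by (subst add.commute) (rule filterlim_compose[OF filterlim_real_sequentially filterlim_add_const_nat_at_top])
  qed (use alpha_pos in auto)
  have lim2: "(\<lambda>m. (\<Sum>j\<in>{Suc n..<Suc n+(N+m-Suc n)}. K j)) \<longlonglongrightarrow> kbar n"
  proof (rule filterlim_compose[OF kbar_tendsto])
    have "filterlim (\<lambda>m. m + (N - Suc n)) at_top sequentially" by (rule filterlim_add_const_nat_at_top)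
    thus "filterlim (\<lambda>m. N + m - Suc n) at_top sequentially"
      using N by (simp add: add.commute)
  qed
  have "(k1 / \<alpha>) * real N powr (-\<alpha>) \<le> kbar n"
    using LIMSEQ_le[OF lim1 lim2] le by auto
  moreover have "(real n0 * (real n + 1)) powr (-\<alpha>) \<le> real N powr (-\<alpha>)"
  proof (rule powr_mono2')
    have "n0 + n \<le> n0 * (n + 1)" using n0_pos by (cases n0) auto
    hence "real (n0 + n) \<le> real (n0 * (n + 1))" by (rule of_nat_mono)
    thus "real N \<le> real n0 * (real n + 1)" by (simp add: N_def algebra_simps)
  qed (use alpha_pos N in auto)
  hence "(k1/\<alpha>) * (real n0 powr (-\<alpha>) * (real n + 1) powr (-\<alpha>)) \<le> (k1/\<alpha>) * real N powr (-\<alpha>)"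
    using k1_pos alpha_pos by (intro mult_left_mono) (auto simp: powr_mult)
  ultimately show ?thesis by (simp add: mult.assoc)
qed

lemma kbar_pos: "kbar n > 0"
  by (rule less_le_trans[OF _ kbar_ge]) (use k1_pos alpha_pos n0_pos in auto)

lemma sum_K_le_1: "finite A \<Longrightarrow> (\<Sum>j\<in>A. K j) \<le> 1"
  using sum_le_suminf[OF sums_summable[OF K_sums], of A] K_nonneg sums_unique[OF K_sums] by auto

lemma kbar_antimono: "m \<le> n \<Longrightarrow> kbar n \<le> kbar m"
  unfolding kbar_def by (intro diff_left_mono sum_mono2 K_nonneg) auto

lemma kbar_le_1: "kbar n \<le> 1"
  unfolding kbar_def by (simp add: sum_nonneg K_nonneg)

lemma kbar_alt: "kbar n + (\<Sum>j\<in>{1..n}. K j) = 1"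
proof -
  have "(\<Sum>j\<le>n. K j) = (\<Sum>j\<in>{1..n}. K j)" by (intro sum.mono_neutral_right) (auto simp: not_le)
  thus ?thesis by (simp add: kbar_def)
qed

section \<open>Renewal mass function\<close>

text \<open>The growth exponent of the number of renewals: linear growth if the mean jump is finite, and
  \<open>n^\<alpha>\<close> if \<open>\<alpha> < 1\<close>.\<close>

definition \<gamma> :: real where "\<gamma> = min 1 \<alpha>"

lemma gamma_pos: "\<gamma> > 0" and gamma_le_1: "\<gamma> \<le> 1"
  using alpha_pos by (auto simp: \<gamma>_def)

text \<open>The renewal mass function: \<open>U n\<close> is the probability that \<open>n\<close> is a renewal.\<close>

fun U :: "nat \<Rightarrow> real" where
  "U n = (if n = 0 then 1 else \<Sum>j\<in>{1..n}. K j * U (n - j))"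

declare U.simps [simp del]

lemma U_0 [simp]: "U 0 = 1" by (simp add: U.simps)

lemma U_rec: "n \<ge> 1 \<Longrightarrow> U n = (\<Sum>j\<in>{1..n}. K j * U (n - j))" by (subst U.simps) simp

lemma U_nonneg: "U n \<ge> 0"
proof (induction n rule: less_induct)
  case (less n)
  show ?case
  proof (cases "n = 0")
    case False
    thus ?thesis using less by (subst U_rec) (auto intro!: sum_nonneg mult_nonneg_nonneg K_nonneg)
  qed simp
qed

lemma U_le_1: "U n \<le> 1"
proof (induction n rule: less_induct)
  case (less n)
  show ?case
  proof (cases "n = 0")
    case False
    hence "U n = (\<Sum>j\<in>{1..n}. K j * U (n - j))" by (simp add: U_rec)
    also have "\<dots> \<le> (\<Sum>j\<in>{1..n}. K j * 1)"
      using less False by (intro sum_mono mult_left_mono K_nonneg) auto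
    also have "\<dots> \<le> 1" using sum_K_le_1 by simp
    finally show ?thesis .
  qed simp
qed

lemma U_supermult: "U m * U n \<le> U (m + n)"
proof (induction m arbitrary: n rule: less_induct)
  case (less m)
  show ?case
  proof (cases "m = 0")
    case False
    have "U m * U n = (\<Sum>j\<in>{1..m}. K j * (U (m - j) * U n))"
      using False by (subst U_rec) (auto simp: sum_distrib_right mult.assoc)
    also have "\<dots> \<le> (\<Sum>j\<in>{1..m}. K j * U (m - j + n))"
      using False by (intro sum_mono mult_left_mono K_nonneg less) auto
    also have "\<dots> = (\<Sum>j\<in>{1..m}. K j * U (m + n - j))" by (intro sum.cong) auto
    also have "\<dots> \<le> (\<Sum>j\<in>{1..m+n}. K j * U (m + n - j))"
      by (intro sum_mono2) (auto intro!: mult_nonneg_nonneg K_nonneg U_nonneg)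
    also have "\<dots> = U (m + n)" using False by (simp add: U_rec)
    finally show ?thesis .
  qed simp
qed

lemma K_le_U: "n \<ge> 1 \<Longrightarrow> K n \<le> U n"
  using member_le_sum[of n "{1..n}" "\<lambda>j. K j * U (n - j)"] 
  by (auto simp: U_rec K_nonneg U_nonneg)

text \<open>The convolution with \<open>U\<close> solves the renewal equation: a chain of jumps followed by \<open>Q\<close> is either
  empty or starts with a jump.\<close>

lemma renewal_convolution:
  fixes Q V :: "nat \<Rightarrow> real"
  assumes V: "\<And>n. V n = (\<Sum>a\<le>n. U a * Q (n - a))"
  shows "V n = Q n + (\<Sum>j\<in>{1..n}. K j * V (n - j))"
proof -
  have split: "{..n} = insert 0 {1..n}" by auto
  have "V n = Q n + (\<Sum>a\<in>{1..n}. U a * Q (n - a))"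
    unfolding V split by (simp add: sum.insert)
  also have "(\<Sum>a\<in>{1..n}. U a * Q (n - a)) = (\<Sum>a\<in>{1..n}. \<Sum>j\<in>{1..a}. K j * (U (a - j) * Q (n - j - (a - j))))"
  proof (rule sum.cong[OF refl])
    fix a assume "a \<in> {1..n}"
    thus "U a * Q (n - a) = (\<Sum>j\<in>{1..a}. K j * (U (a - j) * Q (n - j - (a - j))))"
      by (subst U_rec) (auto simp: sum_distrib_right mult.assoc intro!: sum.cong)
  qed
  also have "\<dots> = (\<Sum>j\<in>{1..n}. \<Sum>i\<le>n - j. K j * (U i * Q (n - j - i)))"
    by (rule sum_convolution_swap[where F="\<lambda>j i. K j * (U i * Q (n - j - i))"])
  also have "\<dots> = (\<Sum>j\<in>{1..n}. K j * V (n - j))"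
    by (simp add: V sum_distrib_left)
  finally show ?thesis .
qed

text \<open>The terms are the probabilities that the last renewal up to \<open>n\<close> is at \<open>a\<close>.\<close>

lemma last_renewal: "(\<Sum>a\<le>n. U a * kbar (n - a)) = 1"
proof (induction n rule: less_induct)
  case (less n)
  define V where "V n = (\<Sum>a\<le>n. U a * kbar (n - a))" for n
  have "V n = kbar n + (\<Sum>j\<in>{1..n}. K j * V (n - j))"
    by (rule renewal_convolution) (simp add: V_def)
  also have "(\<Sum>j\<in>{1..n}. K j * V (n - j)) = (\<Sum>j\<in>{1..n}. K j)"
    unfolding V_def by (intro sum.cong) (auto simp: less simp del: diff_diff_left)
  finally show ?case using kbar_alt[of n] by (simp add: V_def)
qed

text \<open>The expected number of renewals in \<open>{0..n}\<close>.\<close>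

definition G :: "nat \<Rightarrow> real" where "G n = (\<Sum>j\<le>n. U j)"

lemma G_mono: "m \<le> n \<Longrightarrow> G m \<le> G n"
  unfolding G_def by (intro sum_mono2 U_nonneg) auto

lemma G_ge_1: "G n \<ge> 1" using G_mono[of 0 n] by (simp add: G_def)

text \<open>In \<open>last_renewal\<close> each factor \<open>kbar (n - a)\<close> is at least \<open>kbar n\<close>, which is of order \<open>n^(-\<alpha>)\<close>;
  for \<open>\<alpha> > 1\<close> the trivial bound \<open>U \<le> 1\<close> has the right order.\<close>

lemma G_upper: "\<exists>C>0. \<forall>n. G n \<le> C * (real n + 1) powr \<gamma>"
proof (cases "\<alpha> < 1")
  case True
  define c where "c = k1 / \<alpha> * real n0 powr (-\<alpha>)"
  have c: "c > 0" using k1_pos alpha_pos n0_pos by (auto simp: c_def)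
  have "G n \<le> (1/c) * (real n + 1) powr \<alpha>" for n
  proof -
    have "G n * (c * (real n + 1) powr (-\<alpha>)) \<le> G n * kbar n"
      using kbar_ge[of n] G_ge_1[of n] by (intro mult_left_mono) (auto simp: c_def)
    also have "\<dots> = (\<Sum>a\<le>n. U a * kbar n)" by (simp add: G_def sum_distrib_right)
    also have "\<dots> \<le> (\<Sum>a\<le>n. U a * kbar (n - a))"
      by (intro sum_mono mult_left_mono kbar_antimono U_nonneg) auto
    also have "\<dots> = 1" by (rule last_renewal)
    finally show ?thesis using c by (simp add: powr_minus field_simps)
  qed
  thus ?thesis using c True by (intro exI[of _ "1/c"]) (auto simp: \<gamma>_def min_def)
next
  case False
  have "G n \<le> real n + 1" for n
    using sum_bounded_above[of "{..n}" U 1] U_le_1 by (simp add: G_def add.commute)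
  thus ?thesis using False by (intro exI[of _ 1]) (auto simp: \<gamma>_def min_def)
qed

text \<open>Summing \<open>last_renewal\<close> over all endpoints up to \<open>n\<close> gives \<open>n + 1\<close>, and the sum is at most \<open>G n\<close>
  times the truncated mean jump, which is of order \<open>n^(1 - \<gamma>)\<close>.\<close>

lemma G_lower: "\<exists>c>0. \<forall>n. G n \<ge> c * (real n + 1) powr \<gamma>"
proof -
  obtain C where C: "C > 0" "\<And>n. (\<Sum>i\<le>n. (real i + 1) powr (-\<alpha>)) \<le> C * (real n + 1) powr (1 - \<gamma>)"
    using sum_powr_le[OF alpha_pos alpha_ne1] by (auto simp: \<gamma>_def)
  define D where "D = (k2 * 2 powr (1+\<alpha>) / \<alpha>) * C"
  have D: "D > 0" using k2_pos alpha_pos C by (auto simp: D_def)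
  have "G n \<ge> (1/D) * (real n + 1) powr \<gamma>" for n
  proof -
    have kb: "(\<Sum>i\<le>n. kbar i) \<le> D * (real n + 1) powr (1 - \<gamma>)"
    proof -
      have "(\<Sum>i\<le>n. kbar i) \<le> (\<Sum>i\<le>n. (k2 * 2 powr (1+\<alpha>) / \<alpha>) * (real i + 1) powr (-\<alpha>))"
        by (intro sum_mono kbar_le)
      also have "\<dots> \<le> (k2 * 2 powr (1+\<alpha>) / \<alpha>) * (C * (real n + 1) powr (1 - \<gamma>))"
        unfolding sum_distrib_left[symmetric] using k2_pos alpha_pos C(2) by (intro mult_left_mono) auto
      finally show ?thesis by (simp add: D_def mult.assoc)
    qed
    have "real n + 1 = (\<Sum>m\<le>n. \<Sum>a\<le>m. U a * kbar (m - a))" by (simp add: last_renewal add.commute)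
    also have "\<dots> = (\<Sum>(m,a)\<in>Sigma {..n} (\<lambda>m. {..m}). U a * kbar (m - a))" by (simp add: sum.Sigma)
    also have "\<dots> = (\<Sum>(a,i)\<in>Sigma {..n} (\<lambda>a. {..n-a}). U a * kbar i)"
      by (rule sum.reindex_bij_witness[where i="\<lambda>(a,i). (a+i,a)" and j="\<lambda>(m,a). (a,m-a)"]) auto
    also have "\<dots> = (\<Sum>a\<le>n. U a * (\<Sum>i\<le>n-a. kbar i))" by (simp add: sum.Sigma[symmetric] sum_distrib_left)
    also have "\<dots> \<le> (\<Sum>a\<le>n. U a * (\<Sum>i\<le>n. kbar i))"
      by (intro sum_mono mult_left_mono sum_mono2 U_nonneg less_imp_le[OF kbar_pos]) auto
    also have "\<dots> = G n * (\<Sum>i\<le>n. kbar i)" by (simp add: G_def sum_distrib_right)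
    also have "\<dots> \<le> G n * (D * (real n + 1) powr (1 - \<gamma>))"
      using kb G_ge_1[of n] by (intro mult_left_mono) auto
    finally have "(real n + 1) * (real n + 1) powr (\<gamma> - 1) \<le> G n * (D * (real n + 1) powr (1 - \<gamma>)) * (real n + 1) powr (\<gamma> - 1)"
      by (intro mult_right_mono) auto
    also have "\<dots> = G n * D * ((real n + 1) powr (1 - \<gamma>) * (real n + 1) powr (\<gamma> - 1))" by simp
    also have "(real n + 1) powr (1 - \<gamma>) * (real n + 1) powr (\<gamma> - 1) = 1" by (simp flip: powr_add)
    also have "(real n + 1) * (real n + 1) powr (\<gamma> - 1) = (real n + 1) powr \<gamma>"
      using powr_mult_base[of "real n + 1" "\<gamma> - 1"] by simp
    finally show ?thesis using D by (simp add: field_simps)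
  qed
  thus ?thesis using D by (intro exI[of _ "1/D"]) auto
qed

text \<open>Two jumps longer than \<open>B\<close> do not fit into a path to \<open>D\<close>. The left-hand side is the probability that
  \<open>D\<close> is reached with such a jump, decomposed at its left endpoint \<open>a\<close>.\<close>

lemma U_ge_big_jump:
  assumes "D \<le> 2 * B + 1"
  shows "(\<Sum>a\<le>D. U a * (\<Sum>j\<in>{B<..D - a}. K j * U (D - a - j))) \<le> U D"
proof -
  define Q where "Q m = (\<Sum>j\<in>{B<..m}. K j * U (m - j))" for m
  define V where "V n = (\<Sum>a\<le>n. U a * Q (n - a))" for n
  have Q0: "Q m = 0" if "m \<le> B" for m using that by (simp add: Q_def)
  have V0: "V m = 0" if "m \<le> B" for m unfolding V_def using that by (intro sum.neutral) (auto simp: Q0)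
  have "V D \<le> U D" if "D \<le> 2 * B + 1" for D
    using that
  proof (induction D rule: less_induct)
    case (less D)
    show ?case
    proof (cases "D \<le> B")
      case True thus ?thesis using V0 U_nonneg by simp
    next
      case False
      have "V D = Q D + (\<Sum>j\<in>{1..D}. K j * V (D - j))"
        by (rule renewal_convolution) (simp add: V_def)
      also have "(\<Sum>j\<in>{1..D}. K j * V (D - j)) = (\<Sum>j\<in>{1..B}. K j * V (D - j))"
        using False less.prems by (intro sum.mono_neutral_right) (auto intro!: V0)
      also have "\<dots> \<le> (\<Sum>j\<in>{1..B}. K j * U (D - j))"
        using less False by (intro sum_mono mult_left_mono K_nonneg) auto
      also have "Q D + \<dots> = (\<Sum>j\<in>{1..D}. K j * U (D - j))"
      proof -
        have "{1..D} = {1..B} \<union> {B<..D}" using False by auto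
        thus ?thesis unfolding Q_def by (simp only:) (subst sum.union_disjoint; auto)
      qed
      also have "\<dots> = U D" using False by (simp add: U_rec)
      finally show ?thesis by simp
    qed
  qed
  thus ?thesis using assms by (simp add: V_def Q_def)
qed

text \<open>For \<open>\<alpha> < 1\<close> the dominant way to reach \<open>n\<close> is one big jump: both endpoints of it may be chosen
  within distance \<open>n/8\<close> of \<open>0\<close> and \<open>n\<close>, which gives \<open>G(n)^2 K(n)\<close> and hence order \<open>n^(\<alpha> - 1)\<close>.
  For \<open>\<alpha> > 1\<close> the renewals have bounded gaps with positive probability: by \<open>last_renewal\<close> and the
  summability of \<open>kbar\<close>, the last renewal before \<open>n - n0\<close> is close to it with probability at least
  one half, and a single jump joins it to \<open>n\<close>.\<close>

lemma U_lower: "\<exists>c>0. \<exists>d0\<ge>n0. \<forall>n\<ge>d0. U n \<ge> c * real n powr (\<gamma> - 1)"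
proof (cases "\<alpha> < 1")
  case True
  obtain c where c: "c > 0" "\<And>n. G n \<ge> c * (real n + 1) powr \<gamma>" using G_lower by auto
  define e where "e = k1 * (c * (1/8) powr \<alpha>)\<^sup>2"
  have e: "e > 0" using k1_pos c by (auto simp: e_def)
  have "U D \<ge> e * real D powr (\<gamma> - 1)" if D: "D \<ge> 2 * n0 + 1" for D
  proof -
    define m where "m = D div 8"
    define B where "B = D div 2"
    have Dp: "D \<ge> 1" using D by simp
    have "e * real D powr (\<gamma> - 1) = k1 * real D powr (- 1 - \<alpha>) * (c * (real D / 8) powr \<alpha>)\<^sup>2"
    proof -
      have "real D powr (- 1 - \<alpha>) * (real D powr \<alpha>)\<^sup>2 = real D powr (\<gamma> - 1)"
        using Dp True by (simp add: power2_eq_square \<gamma>_def min_def flip: powr_add)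
      moreover have "(real D / 8) powr \<alpha> = real D powr \<alpha> * (1/8) powr \<alpha>"
        using powr_mult[of "real D" "1/8" \<alpha>] by simp
      ultimately show ?thesis unfolding e_def by (simp add: power_mult_distrib algebra_simps)
    qed
    also have "\<dots> \<le> k1 * real D powr (- 1 - \<alpha>) * (G m)\<^sup>2"
    proof -
      have "c * (real D / 8) powr \<alpha> \<le> c * (real m + 1) powr \<alpha>"
        using c(1) alpha_pos by (intro mult_left_mono powr_mono2) (auto simp: m_def)
      also have "\<dots> \<le> G m" using c(2)[of m] True by (simp add: \<gamma>_def min_def)
      finally show ?thesis using k1_pos c(1) by (intro mult_left_mono power_mono) auto
    qed
    also have "\<dots> = (\<Sum>a\<le>m. U a * (\<Sum>b\<le>m. (k1 * real D powr (- 1 - \<alpha>)) * U b))"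
      by (simp add: G_def power2_eq_square sum_distrib_left[symmetric] sum_distrib_right[symmetric])
    also have "\<dots> \<le> (\<Sum>a\<le>m. U a * (\<Sum>j\<in>{B<..D - a}. K j * U (D - a - j)))"
    proof (intro sum_mono mult_left_mono U_nonneg)
      fix a assume a: "a \<in> {..m}"
      have "(\<Sum>b\<le>m. (k1 * real D powr (- 1 - \<alpha>)) * U b) \<le> (\<Sum>b\<le>m. K (D - a - b) * U b)"
      proof (intro sum_mono mult_right_mono U_nonneg)
        fix b assume b: "b \<in> {..m}"
        have *: "D - a - b \<ge> n0" "D - a - b \<ge> 1" using a b D n0_pos by (auto simp: m_def)
        have "real D powr (- 1 - \<alpha>) \<le> real (D - a - b) powr (- 1 - \<alpha>)"
          using * alpha_pos by (intro powr_mono2') auto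
        hence "k1 * real D powr (- 1 - \<alpha>) \<le> k1 * real (D - a - b) powr (- 1 - \<alpha>)" using k1_pos by simp
        also have "\<dots> \<le> K (D - a - b)" using * by (intro K_lower)
        finally show "k1 * real D powr (- 1 - \<alpha>) \<le> K (D - a - b)" .
      qed
      also have "\<dots> = (\<Sum>j\<in>{D-a-m..D-a}. K j * U (D - a - j))"
        by (rule sum.reindex_bij_witness[where i="\<lambda>j. D - a - j" and j="\<lambda>b. D - a - b"]) (use a in \<open>auto simp: m_def\<close>)
      also have "\<dots> \<le> (\<Sum>j\<in>{B<..D - a}. K j * U (D - a - j))"
        using a Dp by (intro sum_mono2) (auto intro!: mult_nonneg_nonneg K_nonneg U_nonneg simp: B_def m_def)
      finally show "(\<Sum>b\<le>m. (k1 * real D powr (- 1 - \<alpha>)) * U b) \<le> (\<Sum>j\<in>{B<..D - a}. K j * U (D - a - j))" .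
    qed
    also have "\<dots> \<le> (\<Sum>a\<le>D. U a * (\<Sum>j\<in>{B<..D - a}. K j * U (D - a - j)))"
      by (intro sum_mono2) (auto intro!: mult_nonneg_nonneg sum_nonneg K_nonneg U_nonneg simp: m_def)
    also have "\<dots> \<le> U D" by (rule U_ge_big_jump) (simp add: B_def)
    finally show ?thesis .
  qed
  thus ?thesis using e by (intro exI[of _ e] conjI exI[of _ "2*n0+1"]) auto
next
  case False
  hence a: "\<alpha> > 1" using alpha_ne1 by auto
  hence g: "\<gamma> = 1" by (simp add: \<gamma>_def)
  define C where "C = k2 * 2 powr (1+\<alpha>) / \<alpha>"
  have C: "C > 0" using k2_pos alpha_pos by (auto simp: C_def)
  have kb: "kbar j \<le> C * real (Suc j) powr (- 1 - (\<alpha> - 1))" for j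
    using kbar_le[of j] by (simp add: C_def add.commute)
  define E where "E = C * (2 powr (1+(\<alpha>-1)) / (\<alpha>-1))"
  have E: "E > 0" using C a by (auto simp: E_def)
  \<comment> \<open>Since \<open>\<alpha> > 1\<close>, the tails \<open>kbar\<close> are summable, so \<open>M\<close> can be chosen such that gaps longer than \<open>M\<close> have total weight below one half.\<close>
  have tail: "(\<Sum>j\<in>{M..<M+m}. kbar j) \<le> E * real (Suc M) powr (-(\<alpha>-1))" for M m
  proof -
    have "(\<Sum>j\<in>{M..<M+m}. kbar j) \<le> (\<Sum>j\<in>{M..<M+m}. C * real (Suc j) powr (- 1 - (\<alpha> - 1)))"
      by (intro sum_mono kb)
    also have "\<dots> = C * (\<Sum>j\<in>{Suc M..<Suc M+m}. real j powr (- 1 - (\<alpha> - 1)))"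
      by (simp only: sum_distrib_left[symmetric] sum.shift_bounds_Suc_ivl add_Suc)
    also have "\<dots> \<le> C * ((2 powr (1+(\<alpha>-1)) / (\<alpha>-1)) * real (Suc M) powr (-(\<alpha>-1)))"
      using C a by (intro mult_left_mono sum_powr_tail_le) auto
    finally show ?thesis by (simp add: E_def mult.assoc)
  qed
  have "((\<lambda>M. E * real (Suc M) powr (-(\<alpha>-1))) \<longlongrightarrow> E * 0) sequentially"
    using a by (intro tendsto_intros tendsto_neg_powr filterlim_compose[OF filterlim_real_sequentially filterlim_Suc]) auto
  hence "eventually (\<lambda>M. E * real (Suc M) powr (-(\<alpha>-1)) < 1/2) sequentially"
    by (intro order_tendstoD) auto
  then obtain M where M: "E * real (Suc M) powr (-(\<alpha>-1)) < 1/2" by (auto simp: eventually_sequentially)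
  define k where "k = k1 * real (n0 + M) powr (- 1 - \<alpha>)"
  have k: "k > 0" using k1_pos n0_pos by (auto simp: k_def)
  have "U n \<ge> k / (2 * (real M + 1)) * real n powr (\<gamma> - 1)" if n: "n \<ge> n0 + M" for n
  proof -
    define m where "m = n - n0"
    have m: "m \<ge> M" "n = m + n0" using n by (auto simp: m_def)
    have "(\<Sum>a\<le>m. U a * kbar (m - a)) = (\<Sum>a\<in>{..m-M}. U a * kbar (m - a)) + (\<Sum>a\<in>{m-M<..m}. U a * kbar (m - a))"
    proof -
      have "{..m} = {..m-M} \<union> {m-M<..m}" by auto
      thus ?thesis by (simp only:) (subst sum.union_disjoint; auto)
    qed
    also have "(\<Sum>a\<in>{..m-M}. U a * kbar (m - a)) \<le> (\<Sum>a\<in>{..m-M}. 1 * kbar (m - a))"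
      by (intro sum_mono mult_right_mono U_le_1 less_imp_le[OF kbar_pos])
    also have "\<dots> = (\<Sum>j\<in>{M..<M+(m-M+1)}. kbar j)"
      by (rule sum.reindex_bij_witness[where i="\<lambda>j. m - j" and j="\<lambda>a. m - a"]) (use m in auto)
    also have "\<dots> \<le> 1/2" using tail[of M "m-M+1"] M by linarith
    finally have "1/2 \<le> (\<Sum>a\<in>{m-M<..m}. U a * kbar (m - a))" using last_renewal[of m] by simp
    also have "\<dots> \<le> (\<Sum>a\<in>{m-M<..m}. U a * 1)"
      by (intro sum_mono mult_left_mono kbar_le_1 U_nonneg)
    also have "\<dots> \<le> (\<Sum>a\<in>{m-M<..m}. U n / k)"
    proof (intro sum_mono)
      fix a assume a': "a \<in> {m-M<..m}"
      have *: "n - a \<ge> n0" "n - a \<le> n0 + M" "n - a \<ge> 1" using a' m n0_pos by auto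
      have "real (n0 + M) powr (- 1 - \<alpha>) \<le> real (n - a) powr (- 1 - \<alpha>)"
        using * alpha_pos by (intro powr_mono2') auto
      hence "k \<le> k1 * real (n - a) powr (- 1 - \<alpha>)" using k1_pos by (simp add: k_def)
      also have "\<dots> \<le> K (n - a)" using * by (intro K_lower)
      also have "\<dots> \<le> U (n - a)" using * by (intro K_le_U)
      finally have "U a * k \<le> U a * U (n - a)" by (intro mult_left_mono U_nonneg)
      also have "\<dots> \<le> U n" using U_supermult[of a "n - a"] a' m by simp
      finally show "U a * 1 \<le> U n / k" using k by (simp add: field_simps)
    qed
    also have "\<dots> = real (card {m-M<..m}) * (U n / k)" by simp
    also have "\<dots> \<le> (real M + 1) * (U n / k)"
      using m k U_nonneg[of n] by (intro mult_right_mono) auto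
    finally show ?thesis using k n0_pos m by (simp add: g field_simps)
  qed
  thus ?thesis using k by (intro exI[of _ "k / (2 * (real M + 1))"] conjI exI[of _ "n0+M"]) auto
qed

section \<open>Partition functions\<close>

text \<open>The expectation, over a renewal started at \<open>x\<close>, of the product of the weights \<open>W n\<close> over its
  renewals \<open>n\<close> in \<open>{x<..N}\<close>, decomposed according to the first renewal after \<open>x\<close>.\<close>

function Z :: "(nat \<Rightarrow> real) \<Rightarrow> nat \<Rightarrow> nat \<Rightarrow> real" where
  "Z W N x = kbar (N - x) + (\<Sum>n\<in>{x<..N}. K (n - x) * W n * Z W N n)"
  by auto
termination by (relation "Wellfounded.measure (\<lambda>(W,N,x). N - x)") auto

declare Z.simps [simp del]

lemma backward_induct [case_names step]:
  fixes x N :: nat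
  assumes "\<And>x. (\<And>n. x < n \<Longrightarrow> n \<le> N \<Longrightarrow> Q n) \<Longrightarrow> Q x"
  shows "Q x"
proof (induction "N - x" arbitrary: x rule: less_induct)
  case less show ?case by (rule assms) (auto intro!: less)
qed

lemma Z_outside [simp]: "N \<le> x \<Longrightarrow> Z W N x = 1"
  by (subst Z.simps) (simp add: kbar_def)

lemma Z_nonneg: "(\<And>n. x < n \<Longrightarrow> n \<le> N \<Longrightarrow> W n \<ge> 0) \<Longrightarrow> Z W N x \<ge> 0"
proof (induction x rule: backward_induct[where N=N])
  case (step x)
  show ?case
    by (subst Z.simps) (auto intro!: add_nonneg_nonneg sum_nonneg mult_nonneg_nonneg K_nonneg less_imp_le[OF kbar_pos] step)
qed

lemma Z_ge_kbar: "(\<And>n. x < n \<Longrightarrow> n \<le> N \<Longrightarrow> W n \<ge> 0) \<Longrightarrow> Z W N x \<ge> kbar (N - x)"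
  by (subst Z.simps) (auto intro!: sum_nonneg mult_nonneg_nonneg K_nonneg Z_nonneg)

lemma Z_pos: "(\<And>n. x < n \<Longrightarrow> n \<le> N \<Longrightarrow> W n \<ge> 0) \<Longrightarrow> Z W N x > 0"
  by (rule less_le_trans[OF kbar_pos Z_ge_kbar])

lemma Z_ge_jump:
  assumes "\<And>n. x < n \<Longrightarrow> n \<le> N \<Longrightarrow> W n \<ge> 0" "x < y" "y \<le> N"
  shows "Z W N x \<ge> K (y - x) * W y * Z W N y"
proof -
  have "K (y - x) * W y * Z W N y \<le> (\<Sum>n\<in>{x<..N}. K (n - x) * W n * Z W N n)"
    by (rule member_le_sum[where f="\<lambda>n. K (n - x) * W n * Z W N n"])
       (use assms in \<open>auto intro!: mult_nonneg_nonneg K_nonneg Z_nonneg\<close>)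
  thus ?thesis using kbar_pos[of "N - x"] by (subst (2) Z.simps) linarith
qed

lemma Z_mono:
  assumes "\<And>n. x < n \<Longrightarrow> n \<le> N \<Longrightarrow> 0 \<le> W n \<and> W n \<le> W' n"
  shows "Z W N x \<le> Z W' N x"
  using assms
proof (induction x rule: backward_induct[where N=N])
  case (step x)
  have "Z W N n \<ge> 0" if "n > x" for n using step.prems that by (intro Z_nonneg) auto
  moreover have "0 \<le> W n \<and> W n \<le> W' n" if "n > x" "n \<le> N" for n using step.prems that by auto
  moreover have "0 \<le> W' n" if "n > x" "n \<le> N" for n using step.prems[OF that] by linarith
  moreover have "Z W N n \<le> Z W' N n" if "n > x" "n \<le> N" for n
    using that by (intro step) (auto intro: step.prems)
  ultimately show ?case
    by (subst (1 2) Z.simps) (auto intro!: sum_mono mult_mono mult_nonneg_nonneg K_nonneg)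
qed

lemma Z_cong:
  assumes "\<And>n. x < n \<Longrightarrow> n \<le> N \<Longrightarrow> W n = W' n"
  shows "Z W N x = Z W' N x"
  using assms
proof (induction x rule: backward_induct[where N=N])
  case (step x)
  have "Z W N n = Z W' N n" if "n > x" "n \<le> N" for n
    using that by (intro step) (auto intro: step.prems)
  thus ?case using step.prems by (subst (1 2) Z.simps) (auto intro!: sum.cong)
qed

lemma Z_shift: "Z W (N + s) (x + s) = Z (\<lambda>n. W (n + s)) N x"
proof (induction x rule: backward_induct[where N=N])
  case (step x)
  have "(\<Sum>n\<in>{x+s<..N+s}. K (n - (x+s)) * W n * Z W (N+s) n) = (\<Sum>n\<in>{x<..N}. K (n - x) * W (n+s) * Z (\<lambda>n. W (n + s)) N n)"
    by (rule sum.reindex_bij_witness[where i="\<lambda>n. n + s" and j="\<lambda>n. n - s"])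
       (auto simp: step[symmetric] add.commute)
  thus ?case by (subst (1 2) Z.simps) simp
qed

lemma kbar_split:
  assumes "e \<le> a" "a \<le> N"
  shows "kbar (a - e) = kbar (N - e) + (\<Sum>n\<in>{a<..N}. K (n - e))"
proof -
  have "(\<Sum>n\<in>{a<..N}. K (n - e)) = (\<Sum>j\<in>{a-e<..N-e}. K j)"
    by (rule sum.reindex_bij_witness[where i="\<lambda>n. n + e" and j="\<lambda>n. n - e"]) (use assms in auto)
  moreover have "{..N-e} = {..a-e} \<union> {a-e<..N-e}" using assms by auto
  hence "(\<Sum>j\<le>N-e. K j) = (\<Sum>j\<le>a-e. K j) + (\<Sum>j\<in>{a-e<..N-e}. K j)"
    by (simp only:) (subst sum.union_disjoint; auto)
  ultimately show ?thesis by (simp add: kbar_def)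
qed

lemma kbar_plus_K: "x \<le> N \<Longrightarrow> kbar (N - x) + (\<Sum>n\<in>{x<..N}. K (n - x)) = 1"
  using kbar_split[of x x N] by (simp add: kbar_def)

lemma Z_one: "Z (\<lambda>_. 1) N x = 1"
proof (induction x rule: backward_induct[where N=N])
  case (step x)
  show ?case
  proof (cases "x \<le> N")
    case True
    thus ?thesis using step kbar_plus_K[OF True] by (subst Z.simps) simp
  qed simp
qed

lemma Z_le_1: "(\<And>n. x < n \<Longrightarrow> n \<le> N \<Longrightarrow> 0 \<le> W n \<and> W n \<le> 1) \<Longrightarrow> Z W N x \<le> 1"
  using Z_mono[of x N W "\<lambda>_. 1"] by (simp add: Z_one)

lemma Z_ge_1: "(\<And>n. x < n \<Longrightarrow> n \<le> N \<Longrightarrow> 1 \<le> W n) \<Longrightarrow> Z W N x \<ge> 1"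
  using Z_mono[of x N "\<lambda>_. 1" W] by (simp add: Z_one)

text \<open>The inequality of arithmetic and geometric means, applied pathwise to the weights \<open>V\<close> and \<open>V'\<close>. The
  factors \<open>a\<close> and \<open>b\<close> carry the weights collected so far, which the induction on the first jump
  needs.\<close>

lemma Z_product_le:
  fixes V V' :: "nat \<Rightarrow> real"
  shows "a * b * Z (\<lambda>n. V n * V' n) N x \<le> (a\<^sup>2 * Z (\<lambda>n. (V n)\<^sup>2) N x + b\<^sup>2 * Z (\<lambda>n. (V' n)\<^sup>2) N x) / 2"
proof (induction x arbitrary: a b rule: backward_induct[where N=N])
  case (step x)
  have "a * b * Z (\<lambda>n. V n * V' n) N x = a * b * kbar (N - x) + (\<Sum>n\<in>{x<..N}. K (n - x) * ((a * V n) * (b * V' n) * Z (\<lambda>n. V n * V' n) N n))"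
    by (subst Z.simps) (simp add: algebra_simps sum_distrib_left)
  also have "\<dots> \<le> (a\<^sup>2 + b\<^sup>2) / 2 * kbar (N - x) + (\<Sum>n\<in>{x<..N}. K (n - x) * (((a * V n)\<^sup>2 * Z (\<lambda>n. (V n)\<^sup>2) N n + (b * V' n)\<^sup>2 * Z (\<lambda>n. (V' n)\<^sup>2) N n) / 2))"
  proof (intro add_mono sum_mono mult_left_mono mult_right_mono K_nonneg less_imp_le[OF kbar_pos] step)
    show "a * b \<le> (a\<^sup>2 + b\<^sup>2) / 2" using sum_squares_bound[of a b] by simp
  qed auto
  also have "\<dots> = (a\<^sup>2 * Z (\<lambda>n. (V n)\<^sup>2) N x + b\<^sup>2 * Z (\<lambda>n. (V' n)\<^sup>2) N x) / 2"
    by (subst (3 4) Z.simps) (simp add: algebra_simps sum_distrib_left sum.distrib add_divide_distrib power_mult_distrib flip: sum_divide_distrib)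
  finally show ?case .
qed

text \<open>The weight of a renewal at \<open>e \<le> a\<close> whose next jump leads beyond \<open>a\<close>, together with all that
  happens afterwards up to \<open>N\<close>.\<close>

definition T :: "(nat \<Rightarrow> real) \<Rightarrow> nat \<Rightarrow> nat \<Rightarrow> nat \<Rightarrow> real" where
  "T W N a e = kbar (N - e) + (\<Sum>n\<in>{a<..N}. K (n - e) * W n * Z W N n)"

lemma Z_split:
  assumes "e \<le> a" "a \<le> N"
  shows "Z W N e = T W N a e + (\<Sum>n\<in>{e<..a}. K (n - e) * W n * Z W N n)"
proof -
  have "{e<..N} = {e<..a} \<union> {a<..N}" using assms by auto
  hence "(\<Sum>n\<in>{e<..N}. K (n - e) * W n * Z W N n) = (\<Sum>n\<in>{e<..a}. K (n - e) * W n * Z W N n) + (\<Sum>n\<in>{a<..N}. K (n - e) * W n * Z W N n)"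
    by (simp only:) (subst sum.union_disjoint; auto)
  thus ?thesis by (subst Z.simps) (simp add: T_def)
qed

text \<open>The path is cut at its last renewal \<open>e\<close> up to \<open>a\<close>. Replacing the future weight \<open>T W N a e\<close> by the
  bare probability \<open>kbar (a - e)\<close> of jumping over \<open>a\<close> gives the partition function up to \<open>a\<close>.\<close>

lemma Z_le_crossing:
  assumes "\<And>n. 0 \<le> W n" "a \<le> N" "\<And>e. x \<le> e \<Longrightarrow> e \<le> a \<Longrightarrow> T W N a e \<le> m * kbar (a - e)" "x \<le> a"
  shows "Z W N x \<le> Z W a x * m"
  using assms(3,4)
proof (induction x rule: backward_induct[where N=a])
  case (step x)
  have "Z W N x \<le> m * kbar (a - x) + (\<Sum>n\<in>{x<..a}. K (n - x) * W n * (Z W a n * m))"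
    unfolding Z_split[OF \<open>x \<le> a\<close> \<open>a \<le> N\<close>]
    using step assms(1) by (intro add_mono sum_mono mult_left_mono mult_nonneg_nonneg K_nonneg) auto
  also have "\<dots> = Z W a x * m"
    by (subst (2) Z.simps) (simp add: algebra_simps sum_distrib_left)
  finally show ?case .
qed

lemma Z_ge_crossing:
  assumes "\<And>n. 0 \<le> W n" "a \<le> N" "\<And>e. x \<le> e \<Longrightarrow> e \<le> a \<Longrightarrow> T W N a e \<ge> m * kbar (a - e)" "x \<le> a"
  shows "Z W N x \<ge> Z W a x * m"
  using assms(3,4)
proof (induction x rule: backward_induct[where N=a])
  case (step x)
  have "Z W a x * m = m * kbar (a - x) + (\<Sum>n\<in>{x<..a}. K (n - x) * W n * (Z W a n * m))"
    by (subst Z.simps) (simp add: algebra_simps sum_distrib_left)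
  also have "\<dots> \<le> Z W N x"
    unfolding Z_split[OF \<open>x \<le> a\<close> \<open>a \<le> N\<close>]
    using step assms(1) by (intro add_mono sum_mono mult_left_mono mult_nonneg_nonneg K_nonneg) auto
  finally show ?case .
qed

lemma Z_submultiplicative:
  assumes W: "\<And>n. 0 \<le> W n" and "x \<le> a" "a \<le> N" "m \<ge> 1" and m: "\<And>z. a < z \<Longrightarrow> z \<le> N \<Longrightarrow> W z * Z W N z \<le> m"
  shows "Z W N x \<le> Z W a x * m"
proof (rule Z_le_crossing[OF W])
  fix e assume e: "x \<le> e" "e \<le> a"
  have "T W N a e \<le> kbar (N - e) * m + (\<Sum>n\<in>{a<..N}. K (n - e) * m)"
    unfolding T_def mult.assoc using m \<open>m \<ge> 1\<close> kbar_pos[of "N - e"]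
    by (intro add_mono sum_mono mult_left_mono K_nonneg) auto
  also have "\<dots> = m * kbar (a - e)"
    by (subst kbar_split[of e a N]) (use e assms in \<open>auto simp: algebra_simps sum_distrib_left\<close>)
  finally show "T W N a e \<le> m * kbar (a - e)" .
qed (use assms in auto)

lemma Z_mono_length:
  assumes W: "\<And>n. 1 \<le> W n" and "x \<le> a" "a \<le> N"
  shows "Z W a x \<le> Z W N x"
proof -
  have W0: "0 \<le> W n" for n using W[of n] by simp
  have "Z W a x * 1 \<le> Z W N x"
  proof (rule Z_ge_crossing[OF W0])
    fix e assume e: "x \<le> e" "e \<le> a"
    have "1 * kbar (a - e) = kbar (N - e) + (\<Sum>n\<in>{a<..N}. K (n - e) * (1 * 1))"
      by (subst kbar_split[of e a N]) (use e assms in \<open>auto simp: algebra_simps sum_distrib_left\<close>)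
    also have "\<dots> \<le> T W N a e"
      unfolding T_def mult.assoc using W by (intro add_mono sum_mono mult_left_mono mult_mono K_nonneg Z_ge_1) (auto intro: W0)
    finally show "T W N a e \<ge> 1 * kbar (a - e)" .
  qed (use assms in auto)
  thus ?thesis by simp
qed

lemma Z_le_pow:
  assumes "E \<ge> 1" "\<And>n. 0 \<le> W n \<and> W n \<le> E"
  shows "Z W N x \<le> E ^ (N - x)"
proof (induction x rule: backward_induct[where N=N])
  case (step x)
  show ?case
  proof (cases "x \<le> N")
    case True
    have "Z W N x \<le> kbar (N - x) * E ^ (N - x) + (\<Sum>n\<in>{x<..N}. K (n - x) * E ^ (N - x))"
    proof (subst Z.simps, intro add_mono sum_mono)
      show "kbar (N - x) \<le> kbar (N - x) * E ^ (N - x)"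
        using assms(1) kbar_pos[of "N - x"] by (simp add: one_le_power)
      fix n assume n: "n \<in> {x<..N}"
      have "W n * Z W N n \<le> E * E ^ (N - n)"
        using n assms by (intro mult_mono step Z_nonneg) auto
      also have "\<dots> = E ^ Suc (N - n)" by simp
      also have "\<dots> \<le> E ^ (N - x)" using n assms by (intro power_increasing) auto
      finally show "K (n - x) * W n * Z W N n \<le> K (n - x) * E ^ (N - x)"
        unfolding mult.assoc by (intro mult_left_mono K_nonneg)
    qed
    also have "\<dots> = (kbar (N - x) + (\<Sum>n\<in>{x<..N}. K (n - x))) * E ^ (N - x)"
      by (simp add: algebra_simps sum_distrib_left)
    finally show ?thesis using True by (simp add: kbar_plus_K)
  qed simp
qed

lemma Z_ge_pow:
  assumes "0 < E" "E \<le> 1" "\<And>n. E \<le> W n"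
  shows "Z W N x \<ge> E ^ (N - x)"
proof (induction x rule: backward_induct[where N=N])
  case (step x)
  show ?case
  proof (cases "x \<le> N")
    case True
    have "E ^ (N - x) = (kbar (N - x) + (\<Sum>n\<in>{x<..N}. K (n - x))) * E ^ (N - x)"
      using True by (simp add: kbar_plus_K)
    also have "\<dots> = kbar (N - x) * E ^ (N - x) + (\<Sum>n\<in>{x<..N}. K (n - x) * E ^ (N - x))"
      by (simp add: algebra_simps sum_distrib_left)
    also have "\<dots> \<le> Z W N x"
    proof (subst Z.simps, intro add_mono sum_mono)
      show "kbar (N - x) * E ^ (N - x) \<le> kbar (N - x)"
        using assms(1,2) kbar_pos[of "N - x"] by (simp add: power_le_one)
      fix n assume n: "n \<in> {x<..N}"
      have "E ^ (N - x) \<le> E ^ Suc (N - n)" using n assms by (intro power_decreasing) auto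
      also have "\<dots> = E * E ^ (N - n)" by simp
      also have "\<dots> \<le> W n * Z W N n"
        using n assms by (intro mult_mono step) (auto intro: order_trans[OF less_imp_le])
      finally show "K (n - x) * E ^ (N - x) \<le> K (n - x) * W n * Z W N n"
        unfolding mult.assoc by (intro mult_left_mono K_nonneg)
    qed
    finally show ?thesis .
  qed simp
qed

text \<open>There are at most \<open>N - a\<close> renewals beyond \<open>a\<close>, and each of them changes the weight of a path by a
  factor between \<open>1/E\<close> and \<open>E\<close>.\<close>

lemma Z_length_compare:
  assumes E: "E \<ge> 1" and W: "\<And>n. 1/E \<le> W n \<and> W n \<le> E" and "x \<le> a" "a \<le> N"
  shows "Z W N x \<le> Z W a x * E ^ (N - a)" "Z W a x \<le> Z W N x * E ^ (N - a)"
proof -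
  have W0: "0 \<le> W n" for n using W[of n] E by (meson divide_nonneg_nonneg order_trans zero_le_one)
  have E': "0 < 1/E" "1/E \<le> 1" using E by auto
  show "Z W N x \<le> Z W a x * E ^ (N - a)"
  proof (rule Z_submultiplicative[OF W0 assms(3,4)])
    show "1 \<le> E ^ (N - a)" using E by (rule one_le_power)
    fix z assume z: "a < z" "z \<le> N"
    have "W z * Z W N z \<le> E * E ^ (N - z)" using W W0 E by (intro mult_mono Z_le_pow Z_nonneg) auto
    also have "\<dots> = E ^ Suc (N - z)" by simp
    also have "\<dots> \<le> E ^ (N - a)" using z E by (intro power_increasing) auto
    finally show "W z * Z W N z \<le> E ^ (N - a)" .
  qed
  have "Z W N x \<ge> Z W a x * (1/E) ^ (N - a)"
  proof (rule Z_ge_crossing[OF W0 \<open>a \<le> N\<close> _ \<open>x \<le> a\<close>])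
    fix e assume e: "x \<le> e" "e \<le> a"
    have "(1/E) ^ (N - a) * kbar (a - e) = (1/E) ^ (N - a) * kbar (N - e) + (\<Sum>n\<in>{a<..N}. K (n - e) * (1/E) ^ (N - a))"
      by (subst kbar_split[of e a N]) (use e assms in \<open>auto simp: algebra_simps sum_distrib_left\<close>)
    also have "\<dots> \<le> T W N a e"
      unfolding T_def
    proof (intro add_mono sum_mono)
      have "(1/E) ^ (N - a) \<le> 1" using E' by (intro power_le_one) auto
      thus "(1/E) ^ (N - a) * kbar (N - e) \<le> kbar (N - e)"
        using kbar_pos[of "N - e"] mult_right_mono[of "(1/E)^(N-a)" 1 "kbar (N - e)"] by simp
      fix n assume n: "n \<in> {a<..N}"
      have "(1/E) ^ (N - a) \<le> (1/E) ^ Suc (N - n)" using n E' by (intro power_decreasing) auto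
      also have "\<dots> = (1/E) * (1/E) ^ (N - n)" by simp
      also have "\<dots> \<le> W n * Z W N n"
        using n W E' W0 by (intro mult_mono Z_ge_pow) auto
      finally show "K (n - e) * (1/E) ^ (N - a) \<le> K (n - e) * W n * Z W N n"
        unfolding mult.assoc by (intro mult_left_mono K_nonneg)
    qed
    finally show "(1/E) ^ (N - a) * kbar (a - e) \<le> T W N a e" .
  qed
  thus "Z W a x \<le> Z W N x * E ^ (N - a)" using E by (simp add: power_divide field_simps)
qed

section \<open>Near additivity of the log partition function\<close>

text \<open>Both sides are sums over the landing point \<open>n > b\<close> of the jump that crosses \<open>b\<close>. The jump lengths
  satisfy \<open>n - e2 \<le> (b - e2 + 1) (n - e1)\<close>, and \<open>K\<close> is a power function up to constants.
  The distance \<open>n0\<close> between \<open>e2\<close> and \<open>b\<close> makes the lower bound on \<open>K\<close> available.\<close>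

lemma T_compare: "\<exists>C\<ge>1. \<forall>W N b e1 e2. (\<forall>n. 0 \<le> W n) \<longrightarrow> e1 \<le> b \<longrightarrow> e2 + n0 \<le> b \<longrightarrow> b \<le> N \<longrightarrow>
   T W N b e1 \<le> C * (real (b - e2) + 1) powr (1 + \<alpha>) * T W N b e2"
proof -
  define cL where "cL = k1 / \<alpha> * real n0 powr (-\<alpha>)"
  define cU where "cU = k2 * 2 powr (1+\<alpha>) / \<alpha>"
  have c: "cL > 0" "cU > 0" using k1_pos alpha_pos n0_pos k2_pos by (auto simp: cL_def cU_def)
  define C where "C = 1 + k2/k1 + cU/cL"
  have C: "C \<ge> 1" "C \<ge> k2 / k1" "C \<ge> cU / cL" using c k1_pos k2_pos by (auto simp: C_def)
  have "T W N b e1 \<le> C * (real (b - e2) + 1) powr (1 + \<alpha>) * T W N b e2"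
    if W: "\<And>n. 0 \<le> W n" and e: "e1 \<le> b" "e2 + n0 \<le> b" "b \<le> N" for W N b e1 e2
  proof -
    define r where "r = real (b - e2) + 1"
    have r: "r \<ge> 1" by (simp add: r_def)
    have T1: "kbar (N - e1) \<le> C * r powr (1 + \<alpha>) * kbar (N - e2)"
    proof -
      have "real (N - e2) + 1 \<le> r * (real (N - e1) + 1)"
      proof -
        have "real (N - e2) + 1 = real (b - e2) + (real (N - b) + 1)" using e by simp
        also have "\<dots> \<le> real (b - e2) * (real (N - e1) + 1) + (real (N - e1) + 1)"
          using e by (intro add_mono) (auto simp: mult_le_cancel_left1)
        finally show ?thesis by (simp add: r_def algebra_simps)
      qed
      hence "(real (N - e1) + 1) powr (-\<alpha>) * r powr (-\<alpha>) \<le> (real (N - e2) + 1) powr (-\<alpha>)"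
        using r alpha_pos by (subst powr_mult[symmetric]) (auto intro!: powr_mono2' simp: mult.commute)
      hence "r powr \<alpha> * ((real (N - e1) + 1) powr (-\<alpha>) * r powr (-\<alpha>)) \<le> r powr \<alpha> * (real (N - e2) + 1) powr (-\<alpha>)"
        by (intro mult_left_mono) auto
      moreover have "r powr \<alpha> * r powr (-\<alpha>) = 1" using r by (simp flip: powr_add)
      hence "r powr \<alpha> * ((real (N - e1) + 1) powr (-\<alpha>) * r powr (-\<alpha>)) = (real (N - e1) + 1) powr (-\<alpha>)"
        by (metis mult.commute mult.left_commute mult_1_right)
      ultimately have 1: "(real (N - e1) + 1) powr (-\<alpha>) \<le> r powr \<alpha> * (real (N - e2) + 1) powr (-\<alpha>)" by simp
      have "kbar (N - e1) \<le> cU * (real (N - e1) + 1) powr (-\<alpha>)" using kbar_le by (simp add: cU_def)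
      also have "\<dots> \<le> cU * (r powr \<alpha> * (real (N - e2) + 1) powr (-\<alpha>))"
        using 1 c by (intro mult_left_mono) auto
      also have "\<dots> = cU / cL * r powr \<alpha> * (cL * (real (N - e2) + 1) powr (-\<alpha>))" using c by simp
      also have "\<dots> \<le> C * r powr (1 + \<alpha>) * kbar (N - e2)"
      proof (intro mult_mono powr_mono)
        show "cL * (real (N - e2) + 1) powr (-\<alpha>) \<le> kbar (N - e2)" using kbar_ge[of "N - e2"] by (simp add: cL_def)
      qed (use C c r in auto)
      finally show ?thesis .
    qed
    have T2: "K (n - e1) \<le> C * r powr (1 + \<alpha>) * K (n - e2)" if n: "b < n" for n
    proof -
      have "real (n - e2) = real (b - e2) + real (n - b)" using e n by simp
      also have "\<dots> \<le> real (b - e2) * real (n - e1) + real (n - e1)"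
        using e n by (intro add_mono) (auto simp: mult_le_cancel_left1)
      finally have *: "real (n - e2) \<le> r * real (n - e1)" by (simp add: r_def algebra_simps)
      have "(real (n - e1)) powr (- 1 - \<alpha>) * r powr (- 1 - \<alpha>) \<le> (real (n - e2)) powr (- 1 - \<alpha>)"
        using * r alpha_pos e n n0_pos by (subst powr_mult[symmetric]) (auto intro!: powr_mono2' simp: mult.commute)
      hence "r powr (1+\<alpha>) * ((real (n - e1)) powr (- 1 - \<alpha>) * r powr (- 1 - \<alpha>)) \<le> r powr (1+\<alpha>) * (real (n - e2)) powr (- 1 - \<alpha>)"
        by (intro mult_left_mono) auto
      moreover have "r powr (1+\<alpha>) * r powr (- 1 - \<alpha>) = 1" using r by (simp flip: powr_add)
      hence "r powr (1+\<alpha>) * ((real (n - e1)) powr (- 1 - \<alpha>) * r powr (- 1 - \<alpha>)) = (real (n - e1)) powr (- 1 - \<alpha>)"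
        by (metis mult.commute mult.left_commute mult_1_right)
      ultimately have 1: "(real (n - e1)) powr (- 1 - \<alpha>) \<le> r powr (1+\<alpha>) * (real (n - e2)) powr (- 1 - \<alpha>)" by simp
      have "K (n - e1) \<le> k2 * real (n - e1) powr (- 1 - \<alpha>)" using e n by (intro K_upper) auto
      also have "\<dots> \<le> k2 * (r powr (1+\<alpha>) * (real (n - e2)) powr (- 1 - \<alpha>))"
        using 1 k2_pos by (intro mult_left_mono) auto
      also have "\<dots> = k2 / k1 * r powr (1+\<alpha>) * (k1 * (real (n - e2)) powr (- 1 - \<alpha>))" using k1_pos by simp
      also have "\<dots> \<le> C * r powr (1 + \<alpha>) * K (n - e2)"
        using C k1_pos r e n by (intro mult_mono K_lower) auto
      finally show ?thesis .
    qed
    have "T W N b e1 \<le> C * r powr (1 + \<alpha>) * kbar (N - e2) + (\<Sum>n\<in>{b<..N}. C * r powr (1 + \<alpha>) * K (n - e2) * (W n * Z W N n))"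
      unfolding T_def mult.assoc[of "K _" "W _"]
      using W by (intro add_mono T1 sum_mono mult_right_mono mult_nonneg_nonneg Z_nonneg T2) auto
    also have "\<dots> = C * r powr (1 + \<alpha>) * T W N b e2"
      by (simp add: T_def algebra_simps sum_distrib_left)
    finally show ?thesis by (simp add: r_def)
  qed
  thus ?thesis using C(1) by blast
qed

lemma T_nonneg: "(\<And>n. 0 \<le> W n) \<Longrightarrow> T W N a e \<ge> 0"
  unfolding T_def by (intro add_nonneg_nonneg sum_nonneg mult_nonneg_nonneg K_nonneg Z_nonneg less_imp_le[OF kbar_pos])

text \<open>By \<open>T_compare\<close> the future beyond \<open>b = a + n0\<close> is the same, up to a polynomial factor, for a path
  whose last renewal before \<open>a\<close> is at \<open>e\<close> and for a path that has a renewal at \<open>a\<close>. The \<open>n0\<close>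
  sites between \<open>a\<close> and \<open>b\<close> contribute a constant factor, as the weights are bounded.\<close>

lemma Z_near_additive:
  assumes E: "E \<ge> 1"
  shows "\<exists>C\<ge>1. \<forall>W x a N. (\<forall>n. 1/E \<le> W n \<and> W n \<le> E) \<longrightarrow> x \<le> a \<longrightarrow> a + n0 \<le> N \<longrightarrow>
     Z W N x \<le> C * (real (a - x) + 1) powr (1+\<alpha>) * (Z W a x * Z W N a) \<and>
     Z W a x * Z W N a \<le> C * (real (a - x) + 1) powr (1+\<alpha>) * Z W N x"
proof -
  obtain C0 where C0: "C0 \<ge> 1" "\<And>W N b e1 e2. (\<And>n. 0 \<le> W n) \<Longrightarrow> e1 \<le> b \<Longrightarrow> e2 + n0 \<le> b \<Longrightarrow> b \<le> N \<Longrightarrow>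
     T W N b e1 \<le> C0 * (real (b - e2) + 1) powr (1 + \<alpha>) * T W N b e2" using T_compare by blast
  define cL where "cL = k1 / \<alpha> * real n0 powr (-\<alpha>)"
  have cL: "cL > 0" using k1_pos alpha_pos n0_pos k2_pos by (auto simp: cL_def)
  define C4 where "C4 = C0 * (real n0 + 1) powr (1+\<alpha>)"
  have C4: "C4 \<ge> 1" using C0(1) alpha_pos unfolding C4_def
    by (intro mult_ge1_I ge_one_powr_ge_zero) auto
  define C3 where "C3 = C4 * (1 + E * (1+E) ^ n0)"
  have C3: "C3 \<ge> 1" unfolding C3_def using C4 E by (intro mult_ge1_I) auto
  define C where "C = C3 / cL + (1+E)^n0 * C4 + 1"
  have C: "C \<ge> 1" "C3 / cL \<le> C" "(1+E)^n0 * C4 \<le> C" using C3 cL C4 E by (auto simp: C_def)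
  have main: "Z W N x \<le> C * (real (a - x) + 1) powr (1+\<alpha>) * (Z W a x * Z W N a) \<and>
     Z W a x * Z W N a \<le> C * (real (a - x) + 1) powr (1+\<alpha>) * Z W N x"
    if W: "\<And>n. 1/E \<le> W n \<and> W n \<le> E" and x: "x \<le> a" and a: "a + n0 \<le> N" for W x a N
  proof -
    have W0: "0 \<le> W n" for n using W[of n] E by (meson divide_nonneg_nonneg order_trans zero_le_one)
    define b where "b = a + n0"
    \<comment> \<open>A path starting between \<open>a\<close> and \<open>b\<close> makes at most \<open>n0\<close> steps before it crosses \<open>b\<close>, each of weight at most \<open>E\<close>.\<close>
    have Zb: "Z W N y \<le> (1+E)^n0 * m" if m: "\<And>e. a \<le> e \<Longrightarrow> e \<le> b \<Longrightarrow> T W N b e \<le> m" and y: "a \<le> y" "y \<le> b" for m y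
    proof -
      have m0: "m \<ge> 0" using m[of a] T_nonneg[where W=W and N=N and a=b and e=a, OF W0] by (simp add: b_def)
      have "Z W N y \<le> (1+E)^(b-y) * m" using y
      proof (induction y rule: backward_induct[where N=b])
        case (step y)
        show ?case
        proof (cases "y = b")
          case True
          thus ?thesis using m[of b] Z_split[where e=b and a=b and N=N and W=W] a by (simp add: b_def)
        next
          case False
          have "Z W N y = T W N b y + (\<Sum>n\<in>{y<..b}. K (n - y) * (W n * Z W N n))"
            using a step.prems by (subst Z_split[of y b]) (auto simp: b_def mult.assoc)
          also have "\<dots> \<le> m + (\<Sum>n\<in>{y<..b}. K (n - y) * (E * ((1+E)^(b-y-1) * m)))"
          proof (intro add_mono sum_mono mult_left_mono K_nonneg mult_mono)
            fix n assume n: "n \<in> {y<..b}"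
            have "Z W N n \<le> (1+E)^(b-n) * m" using n step.prems by (intro step) auto
            also have "\<dots> \<le> (1+E)^(b-y-1) * m" using n E m0 by (intro mult_right_mono power_increasing) auto
            finally show "Z W N n \<le> (1+E)^(b-y-1) * m" .
          qed (use step.prems m W W0 E Z_nonneg in auto)
          also have "\<dots> = m + (\<Sum>n\<in>{y<..b}. K (n - y)) * (E * ((1+E)^(b-y-1) * m))"
            by (simp add: sum_distrib_right)
          also have "\<dots> \<le> m + 1 * (E * ((1+E)^(b-y-1) * m))"
            using kbar_plus_K[of y b] step.prems kbar_pos[of "b-y"] E m0
            by (intro add_left_mono mult_right_mono) auto
          also have "\<dots> \<le> (1+E)^(b-y-1) * m + E * ((1+E)^(b-y-1) * m)"
          proof -
            have "1 * m \<le> (1+E)^(b-y-1) * m" using E m0 by (intro mult_right_mono one_le_power) auto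
            thus ?thesis by simp
          qed
          also have "\<dots> = (1+E)^Suc (b-y-1) * m" by (simp add: algebra_simps)
          also have "Suc (b-y-1) = b - y" using False step.prems by simp
          finally show ?thesis .
        qed
      qed
      also have "\<dots> \<le> (1+E)^n0 * m" using y E m0 by (intro mult_right_mono power_increasing) (auto simp: b_def)
      finally show ?thesis .
    qed
    have Tba: "T W N b e \<le> C4 * T W N b a" if "e \<le> b" for e
      using C0(2)[where W=W and N=N and b=b and ?e1.0=e and ?e2.0=a] W0 that a by (simp add: C4_def b_def)
    have TbaZ: "T W N b a \<le> Z W N a"
      using a W0 Z_nonneg by (subst Z_split[of a b N]) (auto simp: b_def intro!: sum_nonneg mult_nonneg_nonneg K_nonneg)
    \<comment> \<open>The path either jumps directly over \<open>b\<close> or visits one of the sites in between.\<close>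
    have up: "T W N a e \<le> C3 * Z W N a" if e: "e \<le> a" for e
    proof -
      have "{a<..N} = {a<..b} \<union> {b<..N}" using a by (auto simp: b_def)
      hence "T W N a e = T W N b e + (\<Sum>n\<in>{a<..b}. K (n - e) * (W n * Z W N n))"
        unfolding T_def by (simp only:) (subst sum.union_disjoint; auto simp: mult.assoc)
      also have "\<dots> \<le> C4 * T W N b a + (\<Sum>n\<in>{a<..b}. K (n - e) * (E * ((1+E)^n0 * (C4 * T W N b a))))"
        using e W W0 Tba E by (intro add_mono sum_mono mult_left_mono mult_mono K_nonneg Z_nonneg Zb) (auto simp: b_def)
      also have "\<dots> = C4 * T W N b a + (\<Sum>n\<in>{a<..b}. K (n - e)) * (E * ((1+E)^n0 * (C4 * T W N b a)))"
        by (simp add: sum_distrib_right)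
      also have "\<dots> \<le> C4 * T W N b a + 1 * (E * ((1+E)^n0 * (C4 * T W N b a)))"
      proof (intro add_left_mono mult_right_mono)
        have "(\<Sum>n\<in>{a<..b}. K (n - e)) \<le> kbar (a - e)" using kbar_split[of e a b] kbar_pos[of "b-e"] e by (simp add: b_def)
        thus "(\<Sum>n\<in>{a<..b}. K (n - e)) \<le> 1" using kbar_le_1[of "a-e"] by simp
      qed (use E C4 T_nonneg[where W=W and N=N and a=b and e=a, OF W0] in auto)
      also have "\<dots> = C3 * T W N b a" by (simp add: C3_def algebra_simps)
      also have "\<dots> \<le> C3 * Z W N a" using TbaZ C3 by (intro mult_left_mono) auto
      finally show ?thesis .
    qed
    have Za: "Z W N a \<ge> 0" "Z W a x \<ge> 0" using W0 by (auto intro!: Z_nonneg)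
    define r where "r = real (a - x) + 1"
    have r: "r \<ge> 1" by (simp add: r_def)
    have "Z W N x \<le> Z W a x * (C3 * Z W N a / (cL * r powr (-\<alpha>)))"
    proof (rule Z_le_crossing[OF W0])
      fix e assume e: "x \<le> e" "e \<le> a"
      have "cL * r powr (-\<alpha>) \<le> kbar (a - x)" using kbar_ge[of "a - x"] by (simp add: cL_def r_def)
      also have "\<dots> \<le> kbar (a - e)" using e by (intro kbar_antimono) auto
      finally have "1 \<le> kbar (a - e) / (cL * r powr (-\<alpha>))" using cL r by (simp add: field_simps)
      hence "C3 * Z W N a * 1 \<le> C3 * Z W N a * (kbar (a - e) / (cL * r powr (-\<alpha>)))"
        using C3 Za by (intro mult_left_mono) auto
      thus "T W N a e \<le> C3 * Z W N a / (cL * r powr (-\<alpha>)) * kbar (a - e)" using up[OF e(2)] by simp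
    qed (use a x in auto)
    also have "\<dots> = (C3 / cL) * r powr \<alpha> * (Z W a x * Z W N a)" using r cL by (simp add: powr_minus field_simps)
    also have "\<dots> \<le> C * r powr (1+\<alpha>) * (Z W a x * Z W N a)"
      using C C3 cL r Za by (intro mult_mono mult_right_mono powr_mono) auto
    finally have 1: "Z W N x \<le> C * r powr (1+\<alpha>) * (Z W a x * Z W N a)" .
    define m where "m = Z W N a / (C * r powr (1+\<alpha>))"
    have m0: "m \<ge> 0" using Za C by (simp add: m_def)
    have "Z W a x * m \<le> Z W N x"
    proof (rule Z_ge_crossing[OF W0])
      fix e assume e: "x \<le> e" "e \<le> a"
      have "Z W N a \<le> (1+E)^n0 * (C0 * (real (b - e) + 1) powr (1 + \<alpha>) * T W N b e)"
        using e a W0 by (intro Zb C0(2)) (auto simp: b_def)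
      also have "\<dots> \<le> (1+E)^n0 * (C0 * ((real n0 + 1) powr (1+\<alpha>) * r powr (1 + \<alpha>)) * T W N b e)"
      proof (intro mult_left_mono mult_right_mono T_nonneg[OF W0])
        have "real (b - e) + 1 \<le> (real n0 + 1) * r"
        proof -
          have "real (b - e) + 1 \<le> real n0 + r" using e by (simp add: b_def r_def)
          also have "\<dots> \<le> real n0 * r + r" using r by (intro add_right_mono) (simp add: mult_le_cancel_left1)
          finally show ?thesis by (simp add: algebra_simps)
        qed
        hence "(real (b - e) + 1) powr (1+\<alpha>) \<le> ((real n0 + 1) * r) powr (1+\<alpha>)" using alpha_pos by (intro powr_mono2) auto
        thus "(real (b - e) + 1) powr (1+\<alpha>) \<le> (real n0 + 1) powr (1+\<alpha>) * r powr (1 + \<alpha>)"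
          using r by (simp add: powr_mult)
      qed (use E C0 in auto)
      also have "\<dots> = ((1+E)^n0 * C4) * (r powr (1 + \<alpha>) * T W N b e)" by (simp add: C4_def mult.assoc)
      also have "\<dots> \<le> C * (r powr (1 + \<alpha>) * T W N b e)"
        using C T_nonneg[OF W0] by (intro mult_right_mono) auto
      finally have "m \<le> T W N b e" using C r by (simp add: m_def field_simps)
      also have "\<dots> \<le> T W N a e"
        unfolding T_def using a W0 Z_nonneg by (intro add_left_mono sum_mono2) (auto intro!: mult_nonneg_nonneg K_nonneg simp: b_def)
      finally show "m * kbar (a - e) \<le> T W N a e"
        using m0 kbar_le_1[of "a - e"] mult_left_mono[of "kbar (a-e)" 1 m] by linarith
    qed (use a x in auto)
    hence "Z W a x * Z W N a \<le> C * r powr (1+\<alpha>) * Z W N x" using C r by (simp add: m_def field_simps)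
    thus ?thesis using 1 by (simp add: r_def)
  qed
  show ?thesis using C(1) main by blast
qed

section \<open>The homogeneous model\<close>

text \<open>The partition function of the homogeneous model with reward \<open>ln (1 + v)\<close> per renewal.\<close>

definition X :: "real \<Rightarrow> nat \<Rightarrow> real" where "X v n = Z (\<lambda>_. 1 + v) n 0"

lemma Z_const: "x \<le> N \<Longrightarrow> Z (\<lambda>_. 1 + v) N x = X v (N - x)"
  using Z_shift[of "\<lambda>_. 1 + v" "N - x" x 0] by (simp add: X_def)

lemma X_0 [simp]: "X v 0 = 1" by (simp add: X_def)

lemma X_ge_1: "v \<ge> 0 \<Longrightarrow> X v n \<ge> 1"
  unfolding X_def by (intro Z_ge_1) auto

lemma X_mono: "v \<ge> 0 \<Longrightarrow> m \<le> n \<Longrightarrow> X v m \<le> X v n"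
  unfolding X_def by (intro Z_mono_length) auto

lemma X_first_step: "X v n = kbar n + (\<Sum>j\<in>{1..n}. K j * ((1 + v) * X v (n - j)))"
proof -
  have "{0<..n} = {1..n}" by auto
  thus ?thesis
    by (subst X_def, subst Z.simps) (auto simp: mult.assoc Z_const intro!: sum.cong)
qed

text \<open>Expanding the product of the factors \<open>1 + v\<close> at the first renewal for which the summand \<open>v\<close> is
  chosen.\<close>

lemma X_renewal: "X v n = 1 + v * (\<Sum>j\<in>{1..n}. U j * X v (n - j))"
proof -
  define V where "V n = (\<Sum>a\<le>n. U a * X v (n - a))" for n
  have V: "V n = X v n + (\<Sum>j\<in>{1..n}. K j * V (n - j))" for n
    by (rule renewal_convolution) (simp add: V_def)
  have split: "{..n} = insert 0 {1..n}" for n :: nat by auto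
  have VX: "V n - X v n = (\<Sum>j\<in>{1..n}. U j * X v (n - j))" for n
    unfolding V_def split by simp
  have "X v n = 1 + v * (V n - X v n)"
  proof (induction n rule: less_induct)
    case (less n)
    define S where "S = (\<Sum>j\<in>{1..n}. K j * X v (n - j))"
    have "X v n = kbar n + S + v * S"
      unfolding S_def by (subst X_first_step) (simp add: algebra_simps sum.distrib sum_distrib_left)
    moreover have "S = (\<Sum>j\<in>{1..n}. K j * (1 + v * (V (n-j) - X v (n-j))))"
      unfolding S_def by (intro sum.cong arg_cong2[where f="(*)"] refl less) auto
    hence "S = (\<Sum>j\<in>{1..n}. K j) + v * (\<Sum>j\<in>{1..n}. K j * V (n-j)) - v * S"
      by (simp add: S_def algebra_simps sum.distrib sum_subtractf sum_distrib_left)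
    ultimately have "X v n = 1 + v * (\<Sum>j\<in>{1..n}. K j * V (n-j))"
      using kbar_alt[of n] by linarith
    thus ?case using V[of n] by simp
  qed
  thus ?thesis by (simp add: VX)
qed

lemma G_alt: "G n = 1 + (\<Sum>j\<in>{1..n}. U j)"
proof -
  have "{..n} = insert 0 {1..n}" by auto
  thus ?thesis by (simp add: G_def)
qed

text \<open>As long as \<open>v G M\<close> is small, \<open>X_renewal\<close> and monotonicity give
  \<open>X \<le> 1 + v (G M - 1) X\<close>, a geometric series of which only the first order remains.\<close>

lemma X_upper:
  assumes v: "v \<ge> 0" "v * G M \<le> 1/2" and m: "m \<le> M"
  shows "(1 + v) * X v m \<le> 1 + 4 * v * G M"
proof -
  have "X v m \<le> 1 + v * (\<Sum>j\<in>{1..m}. U j * X v m)"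
    by (subst X_renewal) (intro add_left_mono mult_left_mono sum_mono U_nonneg X_mono v; auto)
  also have "(\<Sum>j\<in>{1..m}. U j * X v m) = (G m - 1) * X v m" by (simp add: G_alt sum_distrib_right)
  also have "v * ((G m - 1) * X v m) \<le> v * ((G M - 1) * X v m)"
    using G_mono[OF m] X_ge_1[OF v(1), of m] v by (intro mult_left_mono mult_right_mono) auto
  finally have "X v m * (1 + v - v * G M) \<le> 1" by (simp add: algebra_simps)
  define y where "y = v * G M"
  have y: "v \<le> y" "y \<ge> 0" "y \<le> 1/2" using G_ge_1[of M] v mult_left_mono[of 1 "G M" v] by (auto simp: y_def)
  have "(1 + v) * X v m \<le> (1 + 4 * y) * (1 + v - y) * X v m"
  proof (intro mult_right_mono)
    have "0 \<le> y * (3 - 4 * y) + 4 * y * v - 0" using y v(1) by (intro diff_ge_0_iff_ge[THEN iffD2] add_nonneg_nonneg mult_nonneg_nonneg) auto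
    thus "1 + v \<le> (1 + 4 * y) * (1 + v - y)" by (simp add: algebra_simps)
  qed (use X_ge_1[OF v(1), of m] in auto)
  also have "\<dots> = (1 + 4 * y) * (X v m * (1 + v - v * G M))" by (simp add: y_def)
  also have "\<dots> \<le> (1 + 4 * y) * 1" using \<open>X v m * (1 + v - v * G M) \<le> 1\<close> y by (intro mult_left_mono) auto
  finally show ?thesis by (simp add: y_def)
qed

lemma X_growth:
  assumes v: "v \<ge> 0" shows "X v (n + M) \<ge> v * (G M - 1) * X v n"
proof -
  have X0: "X v k \<ge> 0" for k using X_ge_1[OF v, of k] by linarith
  have "v * (G M - 1) * X v n = v * (\<Sum>j\<in>{1..M}. U j * X v n)" by (simp add: G_alt sum_distrib_right)
  also have "\<dots> \<le> v * (\<Sum>j\<in>{1..M}. U j * X v (n + M - j))"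
    by (intro mult_left_mono sum_mono U_nonneg X_mono v) auto
  also have "\<dots> \<le> v * (\<Sum>j\<in>{1..n+M}. U j * X v (n + M - j))"
    by (intro mult_left_mono sum_mono2 v) (auto intro!: mult_nonneg_nonneg U_nonneg X0)
  also have "\<dots> \<le> X v (n + M)" by (subst (2) X_renewal) simp
  finally show ?thesis .
qed

lemma X_submult: 
  assumes v: "v \<ge> 0" shows "X v (n + m) \<le> X v n * ((1 + v) * X v m)"
  unfolding X_def
proof (rule Z_submultiplicative[where N="n+m" and a=n])
  show "1 \<le> (1 + v) * Z (\<lambda>_. 1 + v) m 0" using X_ge_1[OF v, of m] v mult_ge1_I[of "1+v" "X v m"] by (simp add: X_def)
  fix z assume "n < z" "z \<le> n + m"
  thus "(1 + v) * Z (\<lambda>_. 1 + v) (n + m) z \<le> (1 + v) * Z (\<lambda>_. 1 + v) m 0"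
    using X_mono[OF v, of "n+m-z" m] v by (intro mult_left_mono) (simp_all add: Z_const)
qed (use v in simp_all)

definition \<nu> :: real where "\<nu> = 1 / \<gamma>"

lemma nu_ge_1: "\<nu> \<ge> 1" using gamma_pos gamma_le_1 by (simp add: \<nu>_def)
lemma nu_gamma: "\<nu> * \<gamma> = 1" using gamma_pos by (simp add: \<nu>_def)

lemma exp_minus1_bounds: "0 \<le> (u::real) \<Longrightarrow> u \<le> exp u - 1" "0 \<le> u \<Longrightarrow> u \<le> 1 \<Longrightarrow> exp u - 1 \<le> 2 * u"
proof -
  show "0 \<le> u \<Longrightarrow> u \<le> exp u - 1" using exp_ge_add_one_self[of u] by linarith
  assume u: "0 \<le> u" "u \<le> 1"
  have "u * u \<le> u * 1" using u by (intro mult_left_mono) auto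
  hence "u\<^sup>2 \<le> u" by (simp add: power2_eq_square)
  moreover have "exp u \<le> 1 + u + u\<^sup>2" by (rule exp_bound) (use u in auto)
  ultimately show "exp u - 1 \<le> 2 * u" by linarith
qed

text \<open>On blocks of length \<open>M\<close> of order \<open>u^(-\<nu>)\<close> one has \<open>v (G M - 1) \<ge> 2\<close>, so that \<open>X\<close> at least doubles
  from block to block by \<open>X_growth\<close>.\<close>

lemma X_log_lower: "\<exists>c>0. c \<le> 1 \<and> (\<forall>u. 0 < u \<longrightarrow> u < 1 \<longrightarrow> (\<forall>n. ln (X (exp u - 1) n) \<ge> c * u powr \<nu> * real n - ln 2))"
proof -
  obtain c where c: "c > 0" "\<And>n. G n \<ge> c * (real n + 1) powr \<gamma>" using G_lower by auto
  define C where "C = (3 / c) powr \<nu> + 1"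
  have C: "C \<ge> 1" by (simp add: C_def)
  have "ln (X (exp u - 1) n) \<ge> (ln 2 / C) * u powr \<nu> * real n - ln 2" if u: "0 < u" "u < 1" for u n
  proof -
    define v where "v = exp u - 1"
    have v: "v \<ge> u" "v \<ge> 0" using exp_minus1_bounds(1)[of u] u by (auto simp: v_def)
    define M where "M = nat \<lceil>(3 / (c * u)) powr \<nu>\<rceil>"
    have pos: "(3 / (c * u)) powr \<nu> > 0" using c u by simp
    have "real M \<ge> (3 / (c * u)) powr \<nu>" unfolding M_def by linarith
    hence M1: "M \<ge> 1" using pos by (cases M) auto
    have M2: "real M \<le> C * u powr (-\<nu>)"
    proof -
      have "real M \<le> (3 / (c * u)) powr \<nu> + 1" using pos by (simp add: M_def)
      also have "(3 / (c * u)) powr \<nu> = (3 / c) powr \<nu> * u powr (-\<nu>)"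
      proof -
        have "3 / (c * u) = (3 / c) / u" by simp
        hence "(3 / (c * u)) powr \<nu> = (3 / c) powr \<nu> / u powr \<nu>" using c u by (simp only: powr_divide)
        thus ?thesis by (simp add: powr_minus_divide)
      qed
      also have "\<dots> + 1 \<le> (3 / c) powr \<nu> * u powr (-\<nu>) + u powr (-\<nu>)"
        using u nu_ge_1 powr_mono2'[of "- \<nu>" u 1] by simp
      finally show ?thesis by (simp add: C_def algebra_simps)
    qed
    have vG: "v * (G M - 1) \<ge> 2"
    proof -
      have "((3 / (c * u)) powr \<nu>) powr \<gamma> \<le> (real M + 1) powr \<gamma>"
        using gamma_pos pos unfolding M_def by (intro powr_mono2) linarith+
      hence "3 / (c * u) \<le> (real M + 1) powr \<gamma>" using c u by (simp add: powr_powr nu_gamma)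
      hence "3 / u \<le> c * (real M + 1) powr \<gamma>" using c u by (simp add: field_simps)
      hence "G M \<ge> 3 / u" using c(2)[of M] by linarith
      hence "u * (G M - 1) \<ge> u * (3 / u - 1)" using u by (intro mult_left_mono) auto
      moreover have "u * (3 / u - 1) \<ge> 2" using u by (simp add: algebra_simps)
      moreover have "v * (G M - 1) \<ge> u * (G M - 1)" using v G_ge_1[of M] by (intro mult_right_mono) auto
      ultimately show ?thesis by linarith
    qed
    have pw: "X v (j * M) \<ge> 2 ^ j" for j
    proof (induction j)
      case (Suc j)
      have "2 * 2 ^ j \<le> v * (G M - 1) * X v (j * M)" using vG Suc by (intro mult_mono) auto
      also have "\<dots> \<le> X v (j * M + M)" by (rule X_growth) (use v in auto)
      finally show ?case by (simp add: add.commute)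
    qed simp
    have "real (n div M) \<ge> real n / real M - 1"
    proof -
      have "n = n div M * M + n mod M" by simp
      also have "\<dots> < n div M * M + M" using M1 by (intro add_strict_left_mono mod_less_divisor) auto
      also have "\<dots> = (n div M + 1) * M" by simp
      finally have "n < (n div M + 1) * M" .
      hence "real n \<le> (real (n div M) + 1) * real M"
        by (metis less_imp_le of_nat_1 of_nat_add of_nat_le_iff of_nat_mult)
      thus ?thesis using M1 by (simp add: field_simps)
    qed
    moreover have "real n / real M \<ge> real n * (u powr \<nu> / C)"
    proof -
      have "u powr \<nu> / C \<le> 1 / real M" using M2 M1 C u by (simp add: powr_minus field_simps)
      thus ?thesis using mult_left_mono[of "u powr \<nu> / C" "1 / real M" "real n"] by simp
    qed
    ultimately have "ln 2 * (real n * (u powr \<nu> / C) - 1) \<le> ln 2 * real (n div M)" by (intro mult_left_mono) auto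
    also have "\<dots> = ln (2 ^ (n div M))" by (simp add: ln_realpow)
    also have "\<dots> \<le> ln (X v (n div M * M))" using pw[of "n div M"] X_ge_1[OF v(2), of "n div M * M"] by simp
    also have "\<dots> \<le> ln (X v n)" using X_ge_1[OF v(2), of "n div M * M"] X_mono[OF v(2), of "n div M * M" n] by simp
    finally show ?thesis by (simp add: v_def algebra_simps)
  qed
  moreover have "ln 2 / C \<le> 1" using C ln_2_less_1 by (simp add: field_simps)
  moreover have "ln 2 / C > 0" using C by simp
  ultimately show ?thesis by blast
qed

text \<open>On blocks of length \<open>M\<close> of order \<open>u^(-\<nu>)\<close>, chosen such that \<open>v G M \<le> 1/2\<close>, \<open>X\<close> at most
  triples from block to block.\<close>

lemma X_log_upper: "\<exists>C>0. \<forall>u. 0 < u \<longrightarrow> u < 1 \<longrightarrow> (\<forall>n. ln (X (exp u - 1) n) \<le> C * u powr \<nu> * real n + ln 3)"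
proof -
  obtain C where C: "C > 0" "\<And>n. G n \<le> C * (real n + 1) powr \<gamma>" using G_upper by auto
  define D where "D = 4 * ln 3 * (4 * C) powr \<nu> + 2 * (4 * C) powr \<nu>"
  have D: "D > 0" using C by (auto simp: D_def intro!: add_pos_pos)
  have "ln (X (exp u - 1) n) \<le> D * u powr \<nu> * real n + ln 3" if u: "0 < u" "u < 1" for u n
  proof -
    define v where "v = exp u - 1"
    have v: "v \<ge> 0" "v \<le> 2 * u" using exp_minus1_bounds[of u] u by (auto simp: v_def)
    define y where "y = (1 / (4 * C * u)) powr \<nu>"
    have yu: "y = 1 / ((4 * C) powr \<nu> * u powr \<nu>)" using C u by (simp add: y_def powr_divide powr_mult)
    show ?thesis
    proof (cases "y \<ge> 2")
      case False
      have "ln (X v n) \<le> ln (exp u ^ n)"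
      proof -
        have "X v n \<le> exp u ^ (n - 0)" unfolding X_def v_def using u by (intro Z_le_pow) auto
        thus ?thesis using X_ge_1[OF v(1), of n] by simp
      qed
      also have "\<dots> = u * real n" by (simp add: ln_realpow)
      also have "\<dots> \<le> 1 * real n" using u by (intro mult_right_mono) auto
      also have "\<dots> \<le> (2 * (4 * C) powr \<nu> * u powr \<nu>) * real n"
        using False yu C u by (intro mult_right_mono) (auto simp: field_simps)
      also have "\<dots> \<le> D * u powr \<nu> * real n"
        using C by (intro mult_right_mono) (auto simp: D_def)
      finally show ?thesis by (simp add: v_def add_increasing2)
    next
      case True
      define M where "M = nat (\<lfloor>y\<rfloor> - 1)"
      have M1: "M \<ge> 1" using True by (simp add: M_def le_nat_iff le_floor_iff)
      have M2: "real M + 1 \<le> y" using True unfolding M_def by linarith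
      have "\<lfloor>y\<rfloor> \<ge> 2" using True by (simp add: le_floor_iff)
      hence "real M = real_of_int \<lfloor>y\<rfloor> - 1" by (simp add: M_def)
      moreover have "real_of_int \<lfloor>y\<rfloor> \<ge> 2" using \<open>\<lfloor>y\<rfloor> \<ge> 2\<close> by linarith
      moreover have "real_of_int \<lfloor>y\<rfloor> > y - 1" by linarith
      ultimately have M3: "real M \<ge> y / 4" by linarith
      have vG: "v * G M \<le> 1/2"
      proof -
        have "(real M + 1) powr \<gamma> \<le> y powr \<gamma>" using M2 gamma_pos by (intro powr_mono2) auto
        also have "\<dots> = 1 / (4 * C * u)" using C u by (simp add: y_def powr_powr nu_gamma)
        finally have "C * (real M + 1) powr \<gamma> \<le> C * (1 / (4 * C * u))" using C by (intro mult_left_mono) auto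
        hence "G M \<le> 1 / (4 * u)" using C(2)[of M] C(1) by simp
        hence "v * G M \<le> (2 * u) * (1 / (4 * u))" using v u G_ge_1[of M] by (intro mult_mono) auto
        thus ?thesis using u by simp
      qed
      have step: "X v (n + M) \<le> 3 * X v n" for n
      proof -
        have "X v (n + M) \<le> X v n * ((1 + v) * X v M)" by (rule X_submult[OF v(1)])
        also have "\<dots> \<le> X v n * 3" using X_upper[OF v(1) vG order.refl] vG X_ge_1[OF v(1), of n] by (intro mult_left_mono) auto
        finally show ?thesis by simp
      qed
      have pw: "X v (j * M) \<le> 3 ^ j" for j
      proof (induction j)
        case (Suc j)
        have "X v (j * M + M) \<le> 3 * 3 ^ j" using step[of "j * M"] Suc by linarith
        thus ?case by (simp add: add.commute)
      qed simp
      have "n = n div M * M + n mod M" by simp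
      also have "\<dots> \<le> n div M * M + M" using M1 by (intro add_left_mono less_imp_le mod_less_divisor) auto
      also have "\<dots> = (n div M + 1) * M" by simp
      finally have "n \<le> (n div M + 1) * M" .
      hence "X v n \<le> X v ((n div M + 1) * M)" by (rule X_mono[OF v(1)])
      hence "ln (X v n) \<le> ln (X v ((n div M + 1) * M))" using X_ge_1[OF v(1), of n] by (intro ln_mono) linarith+
      also have "\<dots> \<le> ln (3 ^ (n div M + 1))" 
        using pw[of "n div M + 1"] X_ge_1[OF v(1), of "(n div M + 1) * M"] by (subst ln_le_cancel_iff) auto
      also have "\<dots> = ln 3 * real (n div M) + ln 3" by (simp add: ln_realpow algebra_simps ln_mult)
      also have "\<dots> \<le> ln 3 * (real n / (y / 4)) + ln 3"
      proof (intro add_right_mono mult_left_mono)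
        have "real (n div M) \<le> real n / real M" by (rule of_nat_div_le_of_nat)
        also have "\<dots> \<le> real n / (y / 4)" using M3 True by (intro divide_left_mono) auto
        finally show "real (n div M) \<le> real n / (y / 4)" .
      qed auto
      also have "ln 3 * (real n / (y / 4)) = (4 * ln 3 * (4 * C) powr \<nu>) * u powr \<nu> * real n"
        using C u by (simp add: yu)
      also have "\<dots> \<le> D * u powr \<nu> * real n" by (intro mult_right_mono) (auto simp: D_def)
      finally show ?thesis by (simp add: v_def)
    qed
  qed
  thus ?thesis using D by blast
qed

section \<open>Hitting probabilities\<close>

text \<open>The probability that a renewal started at \<open>x\<close> visits \<open>D \<inter> {x<..N}\<close>.\<close>

definition hit :: "nat set \<Rightarrow> nat \<Rightarrow> nat \<Rightarrow> real" where
  "hit D N x = 1 - Z (\<lambda>n. if n \<in> D then 0 else 1) N x"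

lemma hit_nonneg: "hit D N x \<ge> 0"
  unfolding hit_def using Z_le_1[of x N "\<lambda>n. if n \<in> D then 0 else 1"] by auto

lemma hit_first_step:
  assumes "x \<le> N"
  shows "hit D N x = (\<Sum>n\<in>{x<..N}. K (n - x) * (if n \<in> D then 1 else hit D N n))"
proof -
  have "hit D N x = (\<Sum>n\<in>{x<..N}. K (n - x)) - (\<Sum>n\<in>{x<..N}. K (n - x) * (if n \<in> D then 0 else 1) * Z (\<lambda>n. if n \<in> D then 0 else 1) N n)"
    unfolding hit_def using kbar_plus_K[OF assms] by (subst Z.simps) linarith
  also have "\<dots> = (\<Sum>n\<in>{x<..N}. K (n - x) * (if n \<in> D then 1 else hit D N n))"
    by (subst sum_subtractf[symmetric], intro sum.cong) (auto simp: hit_def algebra_simps)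
  finally show ?thesis .
qed

text \<open>The expected number of visits to \<open>D\<close> is at most the probability of a first visit times the
  expected number \<open>g\<close> of visits from then on.\<close>

lemma hit_lower:
  assumes g: "\<And>m. m \<in> D \<Longrightarrow> m \<le> N \<Longrightarrow> (\<Sum>n\<in>D \<inter> {m..N}. U (n - m)) \<le> g" and "x \<le> N"
  shows "(\<Sum>m\<in>D \<inter> {x<..N}. U (m - x)) \<le> g * hit D N x"
  using \<open>x \<le> N\<close>
proof (induction x rule: backward_induct[where N=N])
  case (step x)
  define d where "d n = (if n \<in> D then 1 else 0::real)" for n
  have conv: "(\<Sum>m\<in>D \<inter> A. f m) = (\<Sum>m\<in>A. d m * f m)" if "finite A" for A and f :: "nat \<Rightarrow> real"
  proof -
    have "(\<Sum>m\<in>A \<inter> D. f m) = (\<Sum>m\<in>A. if m \<in> D then f m else 0)" using that by (rule sum.inter_restrict)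
    also have "\<dots> = (\<Sum>m\<in>A. d m * f m)" by (intro sum.cong) (auto simp: d_def)
    finally show ?thesis by (simp add: Int_commute)
  qed
  have "(\<Sum>m\<in>D \<inter> {x<..N}. U (m - x)) = (\<Sum>m\<in>{x<..N}. d m * U (m - x))" by (simp add: conv)
  also have "\<dots> = (\<Sum>m\<in>{x<..N}. \<Sum>n\<in>{x<..m}. d m * (K (n - x) * U (m - n)))"
  proof (intro sum.cong refl)
    fix m assume m: "m \<in> {x<..N}"
    hence "U (m - x) = (\<Sum>j\<in>{1..m-x}. K j * U (m - x - j))" by (intro U_rec) auto
    also have "\<dots> = (\<Sum>n\<in>{x<..m}. K (n - x) * U (m - n))"
      by (rule sum.reindex_bij_witness[where i="\<lambda>n. n - x" and j="\<lambda>j. j + x"]) (use m in \<open>auto simp: add.commute\<close>)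
    finally show "d m * U (m - x) = (\<Sum>n\<in>{x<..m}. d m * (K (n - x) * U (m - n)))" by (simp add: sum_distrib_left)
  qed
  also have "\<dots> = (\<Sum>(m,n)\<in>Sigma {x<..N} (\<lambda>m. {x<..m}). d m * (K (n - x) * U (m - n)))" by (simp add: sum.Sigma)
  also have "\<dots> = (\<Sum>(n,m)\<in>Sigma {x<..N} (\<lambda>n. {n..N}). d m * (K (n - x) * U (m - n)))"
    by (rule sum.reindex_bij_witness[where i="\<lambda>(n,m). (m,n)" and j="\<lambda>(m,n). (n,m)"]) auto
  also have "\<dots> = (\<Sum>n\<in>{x<..N}. K (n - x) * (\<Sum>m\<in>{n..N}. d m * U (m - n)))"
    by (simp add: sum.Sigma[symmetric] sum_distrib_left mult.left_commute)
  also have "\<dots> \<le> (\<Sum>n\<in>{x<..N}. K (n - x) * (g * (if n \<in> D then 1 else hit D N n)))"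
  proof (intro sum_mono mult_left_mono K_nonneg)
    fix n assume n: "n \<in> {x<..N}"
    show "(\<Sum>m\<in>{n..N}. d m * U (m - n)) \<le> g * (if n \<in> D then 1 else hit D N n)"
    proof (cases "n \<in> D")
      case True
      thus ?thesis using g[of n] n by (simp add: conv)
    next
      case False
      have "D \<inter> {n..N} = D \<inter> {n<..N}" using False by (auto simp: le_less)
      hence "(\<Sum>m\<in>{n..N}. d m * U (m - n)) = (\<Sum>m\<in>D \<inter> {n<..N}. U (m - n))" by (simp add: conv[symmetric])
      also have "\<dots> \<le> g * hit D N n" using n by (intro step) auto
      finally show ?thesis using False by simp
    qed
  qed
  also have "\<dots> = g * hit D N x" using step.prems by (simp add: hit_first_step sum_distrib_left mult.left_commute)
  finally show ?case .
qed

text \<open>Rewards up to \<open>a\<close> and penalties on \<open>D\<close> between \<open>a\<close> and \<open>b\<close>: in the homogeneous model every path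
  keeps at least weight one, and a path that visits \<open>D\<close> loses at least \<open>p\<close> of it.\<close>

lemma Z_gain_penalty:
  assumes V0: "\<And>n. 0 \<le> V n" and Va: "\<And>n. n \<le> a \<Longrightarrow> V n \<le> 1 + v"
    and Vb: "\<And>n. a < n \<Longrightarrow> n \<le> b \<Longrightarrow> V n \<le> 1" and VD: "\<And>n. n \<in> D \<Longrightarrow> a < n \<and> V n \<le> 1 - p"
    and p: "0 \<le> p" and v: "0 \<le> v" and "a \<le> b" "x \<le> b"
  shows "Z V b x \<le> Z (\<lambda>_. 1 + v) a x - p * hit D b x"
  using \<open>x \<le> b\<close>
proof (induction x rule: backward_induct[where N=b])
  case (step x)
  \<comment> \<open>The homogeneous partition function up to \<open>a\<close>, written as a first-jump decomposition up to \<open>b\<close>, so that both sides can be compared jump by jump.\<close>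
  define Y where "Y n = (if n \<le> a then (1 + v) * Z (\<lambda>_. 1 + v) a n else 1)" for n
  have eq: "Z (\<lambda>_. 1 + v) a x = kbar (b - x) + (\<Sum>n\<in>{x<..b}. K (n - x) * Y n)"
  proof (cases "x \<le> a")
    case True
    have "{x<..b} = {x<..a} \<union> {a<..b}" using True \<open>a \<le> b\<close> by auto
    hence "(\<Sum>n\<in>{x<..b}. K (n - x) * Y n) = (\<Sum>n\<in>{x<..a}. K (n - x) * Y n) + (\<Sum>n\<in>{a<..b}. K (n - x) * Y n)"
      by (simp only:) (subst sum.union_disjoint; auto)
    also have "(\<Sum>n\<in>{a<..b}. K (n - x) * Y n) = (\<Sum>n\<in>{a<..b}. K (n - x))" by (intro sum.cong) (auto simp: Y_def)
    also have "(\<Sum>n\<in>{x<..a}. K (n - x) * Y n) = (\<Sum>n\<in>{x<..a}. K (n - x) * (1 + v) * Z (\<lambda>_. 1 + v) a n)"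
      by (intro sum.cong) (auto simp: Y_def)
    finally show ?thesis using kbar_split[of x a b] True \<open>a \<le> b\<close> by (subst Z.simps) simp
  next
    case False
    thus ?thesis using kbar_plus_K[of x b] step.prems by (simp add: Y_def)
  qed
  have "Z V b x \<le> kbar (b - x) + (\<Sum>n\<in>{x<..b}. K (n - x) * (Y n - p * (if n \<in> D then 1 else hit D b n)))"
  proof (subst Z.simps, unfold mult.assoc, intro add_left_mono sum_mono mult_left_mono K_nonneg)
    fix n assume n: "n \<in> {x<..b}"
    have IH: "Z V b n \<le> Z (\<lambda>_. 1 + v) a n - p * hit D b n" using n by (intro step) auto
    have Z0: "Z V b n \<ge> 0" using V0 by (intro Z_nonneg)
    show "V n * Z V b n \<le> Y n - p * (if n \<in> D then 1 else hit D b n)"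
    proof (cases "n \<le> a")
      case True
      hence nD: "n \<notin> D" using VD by (auto simp: not_less[symmetric])
      have "V n * Z V b n \<le> (1 + v) * (Z (\<lambda>_. 1 + v) a n - p * hit D b n)"
        using Va[OF True] IH Z0 v by (intro mult_mono) auto
      also have "\<dots> \<le> (1 + v) * Z (\<lambda>_. 1 + v) a n - p * hit D b n"
        using v p hit_nonneg[of D b n] by (simp add: algebra_simps)
      finally show ?thesis using nD True by (simp add: Y_def)
    next
      case False
      hence Z1: "Z V b n \<le> 1 - p * hit D b n" using IH by simp
      show ?thesis
      proof (cases "n \<in> D")
        case True
        have "0 \<le> p * hit D b n" using p hit_nonneg[of D b n] by simp
        hence "V n * Z V b n \<le> V n * 1" using Z1 V0 by (intro mult_left_mono) auto
        thus ?thesis using VD[OF True] False True by (simp add: Y_def)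
      next
        case nD: False
        have "V n * Z V b n \<le> 1 * Z V b n" using Vb[of n] n False Z0 by (intro mult_right_mono) auto
        thus ?thesis using Z1 nD False by (simp add: Y_def)
      qed
    qed
  qed
  also have "\<dots> = Z (\<lambda>_. 1 + v) a x - p * hit D b x"
    using step.prems by (simp add: eq hit_first_step algebra_simps sum_subtractf sum_distrib_left)
  finally show ?case .
qed

section \<open>Windows of alternating gain and penalty\<close>

lemma window_index: "k * M < n \<Longrightarrow> n \<le> (k + 1) * M \<Longrightarrow> (n - 1) div M = (k::nat)"
  by (intro div_nat_eqI) (auto simp: mult.commute)

text \<open>Pairs consisting of a rewarding and a penalizing window of length \<open>M\<close>, after an initial stretch of
  length \<open>s\<close> without reward. By submultiplicativity the bounds on the pairs multiply. A path that
  enters a pair in its second half collects no reward there, so only starting points \<open>z\<close> in the first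
  half need the bound on the pair.\<close>

lemma Z_paired_windows:
  fixes Bad :: "nat \<Rightarrow> bool"
  assumes V0: "\<And>n. 0 \<le> V n" and Q: "Q \<ge> 0" and M: "M \<ge> 1"
    and gain: "\<And>j z. j < J \<Longrightarrow> s + 2*j*M < z \<Longrightarrow> z \<le> s + 2*j*M + M \<Longrightarrow> 
       V z * Z V (s + 2*j*M + 2*M) z \<le> (if Bad j then exp Q else 1)"
    and penalty: "\<And>j z. j < J \<Longrightarrow> s + 2*j*M + M < z \<Longrightarrow> z \<le> s + 2*j*M + 2*M \<Longrightarrow> V z \<le> 1"
    and start: "\<And>z. 0 < z \<Longrightarrow> z \<le> s \<Longrightarrow> V z \<le> 1"
  shows "Z V (s + 2*J*M) 0 \<le> exp (Q * real (card {j\<in>{..<J}. Bad j}))"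
proof -
  define N where "N = s + 2*J*M"
  define m where "m j = exp (Q * real (card {i\<in>{j..<J}. Bad i}))" for j
  have m1: "m j \<ge> 1" for j using Q by (simp add: m_def)
  have main: "V z * Z V N z \<le> m (J - i)" if "i \<le> J" "s + 2*(J-i)*M < z" "z \<le> N" for i z
    using that
  proof (induction i arbitrary: z)
    case 0 thus ?case by (simp add: N_def)
  next
    case (Suc i)
    define j where "j = J - Suc i"
    define t where "t = s + 2*j*M"
    have j: "j < J" "J - i = Suc j" using Suc.prems by (auto simp: j_def)
    have tN: "t + 2*M \<le> N"
    proof -
      have "2*(j+1)*M \<le> 2*J*M" using j by (intro mult_le_mono) auto
      thus ?thesis by (simp add: t_def N_def algebra_simps)
    qed
    have mm: "m j = (if Bad j then exp Q else 1) * m (Suc j)"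
    proof -
      have "{i\<in>{j..<J}. Bad i} = (if Bad j then {j} else {}) \<union> {i\<in>{Suc j..<J}. Bad i}"
        using j by (auto simp: le_less Suc_le_eq)
      hence "card {i\<in>{j..<J}. Bad i} = (if Bad j then 1 else 0) + card {i\<in>{Suc j..<J}. Bad i}"
        by (simp only:) (subst card_Un_disjoint; auto)
      thus ?thesis by (simp add: m_def exp_add[symmetric] algebra_simps)
    qed
    have IH: "V y * Z V N y \<le> m (Suc j)" if "t + 2*M < y" "y \<le> N" for y
      using Suc.IH[of y] that Suc.prems j by (simp add: t_def algebra_simps)
    show ?case
    proof (cases "t + 2*M < z")
      case True
      have "1 * m (Suc j) \<le> m j" unfolding mm using Q m1[of "Suc j"] by (intro mult_right_mono) auto
      thus ?thesis using IH[OF True Suc.prems(3)] by (simp add: j_def)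
    next
      case False
      have "V z * Z V N z \<le> V z * (Z V (t + 2*M) z * m (Suc j))"
        using False tN m1 IH by (intro mult_left_mono Z_submultiplicative V0) auto
      also have "\<dots> = (V z * Z V (t + 2*M) z) * m (Suc j)" by simp
      also have "\<dots> \<le> (if Bad j then exp Q else 1) * m (Suc j)"
      proof (intro mult_right_mono)
        show "V z * Z V (t + 2*M) z \<le> (if Bad j then exp Q else 1)"
        proof (cases "z \<le> t + M")
          case True
          thus ?thesis using gain[OF j(1), of z] Suc.prems by (simp add: t_def j_def)
        next
          case F: False
          have "V z * Z V (t + 2*M) z \<le> 1 * 1"
            using F False penalty[OF j(1)] V0 by (intro mult_mono Z_le_1 Z_nonneg) (auto simp: t_def)
          also have "\<dots> \<le> (if Bad j then exp Q else 1)" using Q by simp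
          finally show ?thesis .
        qed
      qed (use m1[of "Suc j"] in auto)
      finally have "V z * Z V N z \<le> m j" unfolding mm .
      thus ?thesis by (simp add: j_def)
    qed
  qed
  have "Z V N 0 \<le> Z V s 0 * m 0"
    using main[of J] m1 by (intro Z_submultiplicative V0) (auto simp: N_def)
  also have "\<dots> \<le> 1 * m 0"
    using start V0 m1[of 0] by (intro mult_right_mono Z_le_1) auto
  finally show ?thesis by (simp add: N_def m_def atLeast0LessThan)
qed

text \<open>Writing the weight \<open>e^u\<close> or \<open>e^(u - 2b)\<close> as a product over the two parities of the window index and
  squaring by \<open>Z_product_le\<close> leaves, for each parity, rewards \<open>1 + v = e^(2u)\<close> in one half of the windows
  and penalties \<open>1 - p = e^(-4b)\<close> in the other half. The hypothesis \<open>4 v G M \<le> p h0\<close> says that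
  the loss in a good window compensates the gain in the window before it.\<close>

lemma Z_le_bad_windows:
  fixes D :: "nat set" and Good :: "nat \<Rightarrow> bool"
  assumes u: "0 \<le> u" and b: "0 \<le> b" and M: "M \<ge> 1"
    and v: "v = exp (2*u) - 1" and p: "p = 1 - exp (-4*b)"
    and vG: "v * G M \<le> 1/2" and h0: "4 * v * G M \<le> p * h0"
    and W: "\<And>n. W n = (if n \<in> D then exp (u - 2*b) else exp u)"
    and Good: "\<And>k z. Good k \<Longrightarrow> k \<ge> 1 \<Longrightarrow> (k-1)*M < z \<Longrightarrow> z \<le> k*M \<Longrightarrow> hit (D \<inter> {k*M<..(k+1)*M}) ((k+1)*M) z \<ge> h0"
    and J: "J \<ge> 1"
  shows "Z W (2*J*M) 0 \<le> exp (4 * v * G M * (1 + real (card {k\<in>{1..2*J}. \<not> Good k})))"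
proof -
  define Q where "Q = 4 * v * G M"
  have v0: "v \<ge> 0" using u by (simp add: v)
  have Q0: "Q \<ge> 0" using v0 G_ge_1[of M] by (simp add: Q_def)
  have p0: "p \<ge> 0" using b by (simp add: p)
  define idx where "idx n = (n - 1) div M" for n
  define V where "V e n = (if even (idx n) = e then exp u else if n \<in> D then exp (-2*b) else 1)" for e :: bool and n
  define Y where "Y e n = (V e n)\<^sup>2" for e n
  have Y: "Y e n = (if even (idx n) = e then 1 + v else if n \<in> D then 1 - p else 1)" for e n
    by (simp add: Y_def V_def v p exp_double[symmetric] flip: exp_add mult_2)
  have Y0: "Y e n \<ge> 0" for e n by (simp add: Y_def)
  have p1: "1 - p \<le> 1" using p0 by simp
  have Ymax: "Y e n \<le> 1 + v" for e n using v0 p0 by (auto simp: Y)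
  have idx: "idx n = k" if "k*M < n" "n \<le> (k+1)*M" for n k using window_index[OF that] by (simp add: idx_def)
  have WV: "W = (\<lambda>n. V True n * V False n)"
    by (auto simp: fun_eq_iff W V_def simp flip: exp_add)
  \<comment> \<open>A rewarding window followed by a penalizing one.\<close>
  have pair: "Y e z * Z (Y e) ((k+2)*M) z \<le> (if \<not> Good (k+1) then exp Q else 1)"
    if e: "even k = e" and z: "k*M < z" "z \<le> (k+1)*M" for e k z
  proof -
    define a where "a = (k+1)*M"
    define Vt where "Vt n = (if n \<le> a then 1 + v else if n \<le> (k+2)*M \<and> n \<in> D then 1 - p else if n \<le> (k+2)*M then 1 else 0)" for n
    define E where "E = D \<inter> {(k+1)*M<..(k+2)*M}"
    have "Z (Y e) ((k+2)*M) z = Z Vt ((k+2)*M) z"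
    proof (rule Z_cong)
      fix n assume n: "z < n" "n \<le> (k+2)*M"
      show "Y e n = Vt n"
      proof (cases "n \<le> a")
        case True
        hence "idx n = k" using n z by (intro idx) (auto simp: a_def)
        thus ?thesis using True e by (simp add: Y Vt_def)
      next
        case False
        hence "idx n = k + 1" using n z by (intro idx) (auto simp: a_def)
        thus ?thesis using False n e by (auto simp: Y Vt_def)
      qed
    qed
    also have "\<dots> \<le> Z (\<lambda>_. 1 + v) a z - p * hit E ((k+2)*M) z"
    proof (rule Z_gain_penalty)
      have "1 - p \<ge> 0" by (simp add: p)
      thus "0 \<le> Vt n" for n using v0 by (auto simp: Vt_def)
    qed (use v0 p0 z M in \<open>auto simp: Vt_def a_def E_def\<close>)
    finally have le: "Z (Y e) ((k+2)*M) z \<le> X v (a - z) - p * hit E ((k+2)*M) z"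
      using z by (simp add: Z_const a_def)
    have up: "(1 + v) * X v (a - z) \<le> 1 + Q"
      using X_upper[OF v0 vG, of "a - z"] z by (simp add: Q_def a_def)
    have "Y e z * Z (Y e) ((k+2)*M) z \<le> (1 + v) * (X v (a - z) - p * hit E ((k+2)*M) z)"
      using le Ymax v0 Y0 by (intro mult_mono Z_nonneg) auto
    also have "\<dots> \<le> 1 + Q - p * hit E ((k+2)*M) z"
    proof -
      have "0 \<le> v * (p * hit E ((k+2)*M) z)" using v0 p0 hit_nonneg by (intro mult_nonneg_nonneg)
      moreover have "(1 + v) * (X v (a - z) - p * hit E ((k+2)*M) z) = (1 + v) * X v (a - z) - p * hit E ((k+2)*M) z - v * (p * hit E ((k+2)*M) z)"
        by (simp only: algebra_simps)
      ultimately show ?thesis using up by linarith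
    qed
    finally have fin: "Y e z * Z (Y e) ((k+2)*M) z \<le> 1 + Q - p * hit E ((k+2)*M) z" .
    show ?thesis
    proof (cases "Good (k+1)")
      case True
      have "hit E ((k+2)*M) z \<ge> h0" using Good[OF True, of z] z by (simp add: E_def)
      hence "p * h0 \<le> p * hit E ((k+2)*M) z" using p0 by (intro mult_left_mono)
      thus ?thesis using fin h0 True by (simp add: Q_def)
    next
      case False
      have "0 \<le> p * hit E ((k+2)*M) z" using p0 hit_nonneg by (intro mult_nonneg_nonneg)
      hence "Y e z * Z (Y e) ((k+2)*M) z \<le> 1 + Q" using fin by linarith
      also have "\<dots> \<le> exp Q" by simp
      finally show ?thesis using False by simp
    qed
  qed
  define B where "B = real (card {k\<in>{1..2*J}. \<not> Good k})"
  \<comment> \<open>Rewards in the windows with even index: the pairs are \<open>(0, 1), (2, 3), \<dots>\<close>.\<close>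
  have even: "Z (Y True) (2*J*M) 0 \<le> exp (Q * (1 + B))"
  proof -
    have "Z (Y True) (0 + 2*J*M) 0 \<le> exp (Q * real (card {j\<in>{..<J}. \<not> Good (2*j+1)}))"
    proof (rule Z_paired_windows[OF Y0 Q0 M])
      fix j z assume j: "j < J" and z: "0 + 2*j*M < z" "z \<le> 0 + 2*j*M + M"
      show "Y True z * Z (Y True) (0 + 2*j*M + 2*M) z \<le> (if \<not> Good (2*j+1) then exp Q else 1)"
        using pair[of "2*j" True z] z by (simp add: algebra_simps)
    next
      fix j z assume j: "j < J" and z: "0 + 2*j*M + M < z" "z \<le> 0 + 2*j*M + 2*M"
      hence "idx z = 2*j+1" by (intro idx) (auto simp: algebra_simps)
      thus "Y True z \<le> 1" using p1 by (simp add: Y)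
    next
      fix z :: nat assume "0 < z" "z \<le> 0" thus "Y True z \<le> 1" by simp
    qed
    also have "\<dots> \<le> exp (Q * (1 + B))"
    proof -
      have "card {j\<in>{..<J}. \<not> Good (2*j+1)} \<le> card {k\<in>{1..2*J}. \<not> Good k}"
        by (rule card_inj_on_le[where f="\<lambda>j. 2*j+1"]) (auto simp: inj_on_def)
      hence "Q * real (card {j\<in>{..<J}. \<not> Good (2*j+1)}) \<le> Q * (1 + B)"
        using Q0 unfolding B_def by (intro mult_left_mono) auto
      thus ?thesis by simp
    qed
    finally show ?thesis by simp
  qed
  \<comment> \<open>Rewards in the windows with odd index: window \<open>0\<close> is the initial stretch, the pairs are \<open>(1, 2), (3, 4), \<dots>\<close>, and the unpaired last window costs the additional factor \<open>exp Q\<close>.\<close>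
  have odd: "Z (Y False) (2*J*M) 0 \<le> exp (Q * (1 + B))"
  proof -
    have 1: "Z (Y False) (M + 2*(J-1)*M) 0 \<le> exp (Q * real (card {j\<in>{..<J-1}. \<not> Good (2*j+2)}))"
    proof (rule Z_paired_windows[OF Y0 Q0 M])
      fix j z assume j: "j < J-1" and z: "M + 2*j*M < z" "z \<le> M + 2*j*M + M"
      show "Y False z * Z (Y False) (M + 2*j*M + 2*M) z \<le> (if \<not> Good (2*j+2) then exp Q else 1)"
        using pair[of "2*j+1" False z] z by (simp add: algebra_simps)
    next
      fix j z assume j: "j < J-1" and z: "M + 2*j*M + M < z" "z \<le> M + 2*j*M + 2*M"
      hence "idx z = 2*j+2" by (intro idx) (auto simp: algebra_simps)
      thus "Y False z \<le> 1" using p1 by (simp add: Y)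
    next
      fix z :: nat assume "z \<le> M" 
      hence "idx z = 0" using M by (auto simp: idx_def)
      thus "Y False z \<le> 1" using p1 by (simp add: Y)
    qed
    define N' where "N' = M + 2*(J-1)*M"
    have N': "2*J*M = N' + M" using J by (cases J) (auto simp: N'_def algebra_simps)
    have "Z (Y False) (2*J*M) 0 \<le> Z (Y False) N' 0 * exp Q"
    proof (rule Z_submultiplicative[OF Y0])
      fix z assume z: "N' < z" "z \<le> 2*J*M"
      have "Y False z * Z (Y False) (2*J*M) z \<le> (1 + v) * Z (\<lambda>_. 1 + v) (2*J*M) z"
        using v0 Ymax Y0 by (intro mult_mono Z_mono Z_nonneg) auto
      also have "\<dots> = (1 + v) * X v (2*J*M - z)" using z by (simp add: Z_const)
      also have "\<dots> \<le> 1 + Q" unfolding Q_def using z N' by (intro X_upper v0 vG) auto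
      also have "\<dots> \<le> exp Q" by simp
      finally show "Y False z * Z (Y False) (2*J*M) z \<le> exp Q" .
    qed (use N' Q0 in auto)
    also have "\<dots> \<le> exp (Q * real (card {j\<in>{..<J-1}. \<not> Good (2*j+2)})) * exp Q"
      using 1 by (intro mult_right_mono) (auto simp: N'_def)
    also have "\<dots> = exp (Q * (1 + real (card {j\<in>{..<J-1}. \<not> Good (2*j+2)})))"
      by (simp add: exp_add[symmetric] algebra_simps)
    also have "\<dots> \<le> exp (Q * (1 + B))"
    proof -
      have "card {j\<in>{..<J-1}. \<not> Good (2*j+2)} \<le> card {k\<in>{1..2*J}. \<not> Good k}"
        by (rule card_inj_on_le[where f="\<lambda>j. 2*j+2"]) (auto simp: inj_on_def)
      hence "Q * (1 + real (card {j\<in>{..<J-1}. \<not> Good (2*j+2)})) \<le> Q * (1 + B)"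
        using Q0 unfolding B_def by (intro mult_left_mono) auto
      thus ?thesis by simp
    qed
    finally show ?thesis .
  qed
  have "Z W (2*J*M) 0 \<le> (Z (Y True) (2*J*M) 0 + Z (Y False) (2*J*M) 0) / 2"
    using Z_product_le[of 1 1 "V True" "V False" "2*J*M" 0] by (simp add: WV Y_def[abs_def])
  also have "\<dots> \<le> exp (Q * (1 + B))" using even odd by simp
  finally show ?thesis by (simp add: Q_def B_def)
qed

section \<open>Visiting selected segments\<close>

text \<open>The segments \<open>{s+1..s+A}\<close> with \<open>s\<close> in \<open>S\<close> carry a weight of at least \<open>1 + v\<close>. The path jumps to the
  first site of every segment and then follows the homogeneous model up to distance \<open>n0\<close> from its
  end, so that the jump to the next segment has length at least \<open>n0\<close> and \<open>K_lower\<close> applies. The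
  cost \<open>(1 + \<alpha>) ln d\<close> of a gap \<open>d\<close> is at most \<open>(1 + \<alpha>) (\<rho> d + ln (1/\<rho>))\<close>; the parts \<open>\<rho> d\<close> add up to at most \<open>\<rho> N\<close>, whatever the positions of the segments.\<close>

lemma Z_segment_chain:
  fixes S :: "nat set"
  assumes W0: "\<And>n. 0 \<le> W n" and v: "v \<ge> 0" and A: "A \<ge> n0 + 2"
    and WS: "\<And>s i. s \<in> S \<Longrightarrow> i \<in> {1..A} \<Longrightarrow> 1 + v \<le> W (s + i)"
    and sep: "\<And>s s'. s \<in> S \<Longrightarrow> s' \<in> S \<Longrightarrow> s < s' \<Longrightarrow> s + A \<le> s'"
    and \<rho>: "0 < \<rho>"
    and g: "g = ln (X v (A - n0 - 1)) + ln k1 - (1+\<alpha>) * ln (1/\<rho>)"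
  shows "ln (Z W N 0) \<ge> g * real (card {s\<in>S. n0 \<le> s \<and> s + A \<le> N}) - \<bar>g\<bar> - (1+\<alpha>) * \<rho> * real N
            - (\<bar>ln k1\<bar> + (1+\<alpha>) * ln (real N + 1) - ln (kbar N))"
proof -
  define R where "R s = {s'\<in>S. s < s' \<and> s' + A \<le> N}" for s
  have finR: "finite (R s)" for s by (rule finite_subset[of _ "{..N}"]) (auto simp: R_def)
  have Zp: "Z W N x > 0" for x by (intro Z_pos W0)
  \<comment> \<open>The logarithm lies below its tangent at \<open>1/\<rho>\<close>.\<close>
  have lnd: "ln d \<le> \<rho> * d + ln (1/\<rho>)" if "d > 0" for d :: real
  proof -
    have "ln (\<rho> * d) \<le> \<rho> * d - 1" using \<rho> that by (intro ln_le_minus_one) auto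
    thus ?thesis using \<rho> that by (simp add: ln_mult ln_div)
  qed
  have chain: "ln (Z W N (s+1)) \<ge> ln (kbar N) + g * real (card (R s)) - (1+\<alpha>) * \<rho> * real (N - s)" if "s \<in> S" "s + A \<le> N" for s
    using that
  proof (induction s rule: backward_induct[where N=N])
    case (step s)
    show ?case
    proof (cases "R s = {}")
      case True
      have "kbar N \<le> kbar (N - (s+1))" by (intro kbar_antimono) auto
      also have "\<dots> \<le> Z W N (s+1)" by (intro Z_ge_kbar W0)
      finally have "ln (kbar N) \<le> ln (Z W N (s+1))" using kbar_pos[of N] by (intro ln_mono) auto
      moreover have "(1+\<alpha>) * \<rho> * real (N - s) \<ge> 0" using alpha_pos \<rho> by simp
      ultimately show ?thesis using True by simp
    next
      case False
      define s' where "s' = Min (R s)"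
      have s': "s' \<in> R s" unfolding s'_def using finR False by (intro Min_in)
      hence s'2: "s' \<in> S" "s < s'" "s' + A \<le> N" by (auto simp: R_def)
      have As: "s + A \<le> s'" using sep[OF step.prems(1) s'2(1,2)] .
      have Req: "R s = insert s' (R s')"
      proof -
        have "x = s' \<or> x \<in> R s'" if "x \<in> R s" for x
        proof -
          have "s' \<le> x" using Min_le[OF finR that] by (simp add: s'_def)
          thus ?thesis using that by (auto simp: R_def)
        qed
        thus ?thesis using s' by (auto simp: R_def)
      qed
      have card: "card (R s) = Suc (card (R s'))" unfolding Req using finR by (subst card_insert_disjoint) (auto simp: R_def)
      define m where "m = k1 * real (s' - s) powr (- 1 - \<alpha>) * Z W N (s'+1)"
      have m0: "m > 0" using k1_pos s'2 Zp by (auto simp: m_def)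
      have A': "s + 1 \<le> s + (A - n0)" "s + (A - n0) \<le> N" using A As s'2 by auto
      have "Z W N (s+1) \<ge> Z W (s + (A - n0)) (s+1) * m"
      proof (rule Z_ge_crossing[OF W0 A'(2) _ A'(1)])
        fix e assume e: "s + 1 \<le> e" "e \<le> s + (A - n0)"
        have "m * kbar (s + (A - n0) - e) \<le> m * 1" using m0 kbar_le_1 by (intro mult_left_mono) auto
        also have "m \<le> K (s' + 1 - e) * W (s'+1) * Z W N (s'+1)"
        proof -
          have "k1 * real (s' - s) powr (- 1 - \<alpha>) \<le> k1 * real (s' + 1 - e) powr (- 1 - \<alpha>)"
            using e As A n0_pos k1_pos alpha_pos by (intro mult_left_mono powr_mono2') auto
          also have "\<dots> \<le> K (s' + 1 - e)" using e As A by (intro K_lower) auto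
          also have "\<dots> \<le> K (s' + 1 - e) * W (s'+1)"
            using WS[OF s'2(1), of 1] A v K_nonneg[of "s' + 1 - e"] mult_left_mono[of 1 "W (s'+1)" "K (s' + 1 - e)"] by simp
          finally show ?thesis unfolding m_def using Zp[of "s'+1"] by (intro mult_right_mono) auto
        qed
        also have "\<dots> \<le> (\<Sum>n\<in>{s + (A - n0)<..N}. K (n - e) * W n * Z W N n)"
          by (rule member_le_sum[where f="\<lambda>n. K (n - e) * W n * Z W N n"])
             (use As A n0_pos s'2 W0 in \<open>auto intro!: mult_nonneg_nonneg K_nonneg Z_nonneg\<close>)
        also have "\<dots> \<le> T W N (s + (A - n0)) e" using kbar_pos[of "N - e"] by (simp add: T_def)
        finally show "m * kbar (s + (A - n0) - e) \<le> T W N (s + (A - n0)) e" by simp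
      qed
      moreover have "Z W (s + (A - n0)) (s+1) \<ge> X v (A - n0 - 1)"
      proof -
        have "X v (A - n0 - 1) = Z (\<lambda>_. 1 + v) (s + (A - n0)) (s+1)" using A' by (subst Z_const) auto
        also have "\<dots> \<le> Z W (s + (A - n0)) (s+1)"
        proof (rule Z_mono)
          fix n assume n: "s + 1 < n" "n \<le> s + (A - n0)"
          hence "n - s \<in> {1..A}" using A As by auto
          thus "0 \<le> 1 + v \<and> 1 + v \<le> W n" using WS[OF step.prems(1), of "n - s"] v n by auto
        qed
        finally show ?thesis .
      qed
      ultimately have "Z W N (s+1) \<ge> X v (A - n0 - 1) * m"
        using m0 mult_right_mono[of "X v (A - n0 - 1)" "Z W (s + (A - n0)) (s+1)" m] by linarith
      hence "ln (X v (A - n0 - 1) * m) \<le> ln (Z W N (s+1))"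
        using m0 X_ge_1[OF v, of "A - n0 - 1"] by (intro ln_mono mult_pos_pos) linarith+
      moreover have "ln (X v (A - n0 - 1) * m) = ln (X v (A - n0 - 1)) + (ln k1 - (1+\<alpha>) * ln (real (s' - s)) + ln (Z W N (s'+1)))"
      proof -
        have "X v (A - n0 - 1) > 0" using X_ge_1[OF v, of "A - n0 - 1"] by linarith
        thus ?thesis using m0 k1_pos Zp[of "s'+1"] s'2 by (simp add: m_def ln_mult ln_powr algebra_simps)
      qed
      moreover have "(1+\<alpha>) * ln (real (s' - s)) \<le> (1+\<alpha>) * (\<rho> * real (s' - s) + ln (1/\<rho>))"
        using alpha_pos s'2 by (intro mult_left_mono lnd) auto
      moreover have "ln (Z W N (s'+1)) \<ge> ln (kbar N) + g * real (card (R s')) - (1+\<alpha>) * \<rho> * real (N - s')"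
        using s'2 by (intro step.IH) auto
      moreover have "real (N - s) = real (N - s') + real (s' - s)" using s'2 by simp
      ultimately show ?thesis by (simp add: card g algebra_simps)
    qed
  qed
  define S0 where "S0 = {s\<in>S. n0 \<le> s \<and> s + A \<le> N}"
  have finS0: "finite S0" by (rule finite_subset[of _ "{..N}"]) (auto simp: S0_def)
  have nn: "\<bar>g\<bar> \<ge> 0" "\<bar>ln k1\<bar> \<ge> 0" "(1+\<alpha>) * \<rho> * real N \<ge> 0" "(1+\<alpha>) * ln (real N + 1) \<ge> 0"
    using alpha_pos \<rho> by auto
  show ?thesis
  proof (cases "S0 = {}")
    case True
    have "kbar N \<le> Z W N 0" using Z_ge_kbar[of 0 N W] W0 by simp
    hence "ln (kbar N) \<le> ln (Z W N 0)" using kbar_pos[of N] by (intro ln_mono) auto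
    thus ?thesis unfolding S0_def[symmetric] using True nn by simp
  next
    case False
    define s where "s = Min S0"
    have s: "s \<in> S0" unfolding s_def using finS0 False by (intro Min_in)
    hence s2: "s \<in> S" "n0 \<le> s" "s + A \<le> N" by (auto simp: S0_def)
    have S0eq: "S0 = insert s (R s)"
    proof -
      have "x = s \<or> x \<in> R s" if "x \<in> S0" for x
      proof -
        have "s \<le> x" using Min_le[OF finS0 that] by (simp add: s_def)
        thus ?thesis using that by (auto simp: R_def S0_def)
      qed
      thus ?thesis using s s2 by (auto simp: R_def S0_def)
    qed
    have card: "card S0 = Suc (card (R s))" unfolding S0eq using finR by (subst card_insert_disjoint) (auto simp: R_def)
    have "Z W N 0 \<ge> K (s + 1 - 0) * W (s+1) * Z W N (s+1)" using s2 A W0 by (intro Z_ge_jump) auto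
    moreover have "k1 * (real N + 1) powr (- 1 - \<alpha>) \<le> K (s + 1 - 0) * W (s+1)"
    proof -
      have "k1 * (real N + 1) powr (- 1 - \<alpha>) \<le> k1 * real (s + 1) powr (- 1 - \<alpha>)"
        using s2 k1_pos alpha_pos by (intro mult_left_mono powr_mono2') auto
      also have "\<dots> \<le> K (s + 1)" using s2 by (intro K_lower) auto
      also have "\<dots> \<le> K (s + 1) * W (s+1)"
        using WS[OF s2(1), of 1] A v K_nonneg[of "s + 1"] mult_left_mono[of 1 "W (s+1)" "K (s + 1)"] by simp
      finally show ?thesis by simp
    qed
    ultimately have "Z W N 0 \<ge> k1 * (real N + 1) powr (- 1 - \<alpha>) * Z W N (s+1)"
      using Zp[of "s+1"] mult_right_mono[of "k1 * (real N + 1) powr (- 1 - \<alpha>)" "K (s + 1 - 0) * W (s+1)" "Z W N (s+1)"] by linarith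
    hence "ln (k1 * (real N + 1) powr (- 1 - \<alpha>) * Z W N (s+1)) \<le> ln (Z W N 0)"
      using k1_pos Zp by (intro ln_mono) auto
    moreover have "ln (k1 * (real N + 1) powr (- 1 - \<alpha>) * Z W N (s+1)) = ln k1 - (1+\<alpha>) * ln (real N + 1) + ln (Z W N (s+1))"
      using k1_pos Zp[of "s+1"] by (simp add: ln_mult ln_powr algebra_simps)
    moreover have "ln (Z W N (s+1)) \<ge> ln (kbar N) + g * real (card (R s)) - (1+\<alpha>) * \<rho> * real (N - s)"
      using s2 by (intro chain) auto
    moreover have "(1+\<alpha>) * \<rho> * real (N - s) \<le> (1+\<alpha>) * \<rho> * real N" using alpha_pos \<rho> by (intro mult_left_mono) auto
    moreover have "g * real (card S0) = g * real (card (R s)) + g" by (simp add: card algebra_simps)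
    moreover have "g \<le> \<bar>g\<bar>" "- ln k1 \<le> \<bar>ln k1\<bar>" by auto
    ultimately show ?thesis unfolding S0_def[symmetric] by linarith
  qed
qed

end

section \<open>The ergodic theorem for bounded functions\<close>

lemma birkhoff_partial_sum_shift:
  fixes f :: "'a \<Rightarrow> real"
  shows "(\<Sum>i<m + n. f ((T ^^ i) x)) = (\<Sum>i<m. f ((T ^^ i) x)) + (\<Sum>i<n. f ((T ^^ i) ((T ^^ m) x)))"
proof (induction n)
  case (Suc n)
  have "(T ^^ (m + n)) x = (T ^^ n) ((T ^^ m) x)" by (metis add.commute comp_apply funpow_add)
  thus ?case using Suc by simp
qed simp

locale ergodic_map = prob_space M for M :: "'a measure" +
  fixes T :: "'a \<Rightarrow> 'a"
  assumes T_meas [measurable]: "T \<in> measurable M M"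
    and T_pres: "distr M M T = M"
    and T_erg: "A \<in> sets M \<Longrightarrow> T -` A \<inter> space M = A \<Longrightarrow> prob A = 0 \<or> prob A = 1"
begin

lemma T_pow_meas [measurable]: "(T ^^ n) \<in> measurable M M"
  by (induction n) (auto intro: measurable_comp[OF _ T_meas])

lemma T_pow_pres: "distr M M (T ^^ n) = M"
proof (induction n)
  case (Suc n)
  have "distr M M (T ^^ Suc n) = distr (distr M M (T ^^ n)) M T"
    by (subst distr_distr) auto
  also have "\<dots> = M" using Suc T_pres by simp
  finally show ?case .
qed (simp add: distr_id2)

lemma T_pow_integral:
  fixes f :: "'a \<Rightarrow> real"
  assumes [measurable]: "f \<in> borel_measurable M"
  shows "(\<integral>x. f ((T ^^ n) x) \<partial>M) = (\<integral>x. f x \<partial>M)"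
  using integral_distr[of "T ^^ n" M M f] T_pow_pres[of n] by simp

text \<open>The proof of Katznelson and Weiss. Suppose that the upper limit \<open>L\<close> of the averages exceeds \<open>c'\<close> on a
  set of positive probability; this set is invariant, hence has full measure. Then every
  orbit can be cut into pieces of length at most \<open>N\<close> on which the average is at least \<open>c'\<close>, apart
  from the points of the small set \<open>D N\<close> where no such piece starts. Integrating gives an expectation
  of at least \<open>c'\<close>, up to a small error.\<close>

lemma birkhoff_limsup:
  fixes f :: "'a \<Rightarrow> real"
  assumes f [measurable]: "f \<in> borel_measurable M" and B: "\<And>x. x \<in> space M \<Longrightarrow> \<bar>f x\<bar> \<le> B" and c: "(\<integral>x. f x \<partial>M) < c"
  shows "AE x in M. eventually (\<lambda>n. (\<Sum>i<n. f ((T ^^ i) x)) / real n < c) sequentially"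
proof -
  define S where "S n x = (\<Sum>i<n. f ((T ^^ i) x))" for n x
  have S_meas [measurable]: "S n \<in> borel_measurable M" for n unfolding S_def by measurable
  have S_add: "S (m + n) x = S m x + S n ((T ^^ m) x)" for m n x
    unfolding S_def by (rule birkhoff_partial_sum_shift)
  have T_sp: "(T ^^ i) x \<in> space M" if "x \<in> space M" for x i using measurable_space[OF T_pow_meas that] .
  obtain x0 where "x0 \<in> space M" using not_empty by auto
  hence B0: "B \<ge> 0" using B[of x0] by linarith
  have S_bound: "\<bar>S n x\<bar> \<le> B * real n" if "x \<in> space M" for n x
  proof -
    have "\<bar>S n x\<bar> \<le> (\<Sum>i<n. B)" unfolding S_def using B T_sp[OF that] by (intro sum_abs[THEN order_trans] sum_mono) auto
    thus ?thesis by (simp add: mult.commute)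
  qed
  define c' where "c' = ((\<integral>x. f x \<partial>M) + c) / 2"
  have c': "(\<integral>x. f x \<partial>M) < c'" "c' < c" using c by (auto simp: c'_def)
  define L where "L x = limsup (\<lambda>n. ereal (S n x / real n))" for x
  define E where "E = {x \<in> space M. L x > ereal c'}"
  have E_meas [measurable]: "E \<in> sets M" unfolding E_def L_def by measurable
  have inv: "L (T x) = L x" if x: "x \<in> space M" for x
  proof -
    have "(\<lambda>n. S n (T x) / real n - S (Suc n) x / real (Suc n)) \<longlonglongrightarrow> 0"
    proof (rule Lim_null_comparison)
      show "\<forall>\<^sub>F n in sequentially. norm (S n (T x) / real n - S (Suc n) x / real (Suc n)) \<le> 2 * B * (1 / real n)"
      proof (rule eventually_mono[OF eventually_gt_at_top[of 0]])
        fix n :: nat assume n: "n > 0"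
        have s: "S (Suc n) x = f x + S n (T x)" using S_add[of 1 n x] by (simp add: S_def)
        have "S n (T x) / real n - S (Suc n) x / real (Suc n) = S n (T x) / (real n * real (Suc n)) - f x / real (Suc n)"
        proof -
          have *: "a / r - (b + a) / (r + 1) = a / (r * (r + 1)) - b / (r + 1)" if "r > 0" for a b r :: real
          proof -
            have "r \<noteq> 0" "r + 1 \<noteq> 0" using that by auto
            thus ?thesis by (simp add: divide_simps) (simp add: algebra_simps)
          qed
          show ?thesis using *[of "real n" "S n (T x)" "f x"] n unfolding s by (simp add: add.commute)
        qed
        also have "\<bar>\<dots>\<bar> \<le> \<bar>S n (T x)\<bar> / (real n * real (Suc n)) + \<bar>f x\<bar> / real (Suc n)"
          by (rule order_trans[OF abs_triangle_ineq4]) (simp add: abs_mult)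
        also have "\<dots> \<le> (B * real n) / (real n * real (Suc n)) + B / real (Suc n)"
          using S_bound[of "T x" n] T_sp[OF x, of 1] B[OF x] by (intro add_mono divide_right_mono) auto
        also have "(B * real n) / (real n * real (Suc n)) = B / real (Suc n)" using n by (simp del: of_nat_Suc)
        also have "B / real (Suc n) + B / real (Suc n) = 2 * B * (1 / real (Suc n))" by (simp del: of_nat_Suc)
        also have "\<dots> \<le> 2 * B * (1 / real n)" using n B0 by (intro mult_left_mono divide_left_mono) auto
        finally show "norm (S n (T x) / real n - S (Suc n) x / real (Suc n)) \<le> 2 * B * (1 / real n)" by simp
      qed
      show "(\<lambda>n. 2 * B * (1 / real n)) \<longlonglongrightarrow> 0" by (intro tendsto_mult_right_zero lim_1_over_n)
    qed
    hence lim: "(\<lambda>n. ereal (S n (T x) / real n - S (Suc n) x / real (Suc n))) \<longlonglongrightarrow> 0"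
      by (simp add: zero_ereal_def)
    have "L (T x) = limsup (\<lambda>n. ereal (S n (T x) / real n - S (Suc n) x / real (Suc n)) + ereal (S (Suc n) x / real (Suc n)))"
      by (simp add: L_def)
    also have "\<dots> = 0 + limsup (\<lambda>n. ereal (S (Suc n) x / real (Suc n)))"
      by (rule ereal_limsup_lim_add[OF lim]) auto
    also have "limsup (\<lambda>n. ereal (S (Suc n) x / real (Suc n))) = L x"
      unfolding L_def using limsup_shift[of "\<lambda>n. ereal (S n x / real n)"] by simp
    finally show ?thesis by simp
  qed
  have "T -` E \<inter> space M = E"
    using inv T_sp[of _ 1] by (auto simp: E_def)
  hence "prob E = 0 \<or> prob E = 1" by (intro T_erg) auto
  moreover have "prob E \<noteq> 1"
  proof
    assume "prob E = 1"
    hence AE_E: "AE x in M. x \<in> E" by (simp add: prob_eq_1)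
    define D where "D N = {x \<in> space M. \<forall>n\<in>{1..N}. S n x < real n * c'}" for N
    have D_meas [measurable]: "D N \<in> sets M" for N unfolding D_def by measurable
    have Dlim: "(\<lambda>N. prob (D N)) \<longlonglongrightarrow> prob (\<Inter>N. D N)"
      by (rule finite_Lim_measure_decseq) (auto simp: decseq_def D_def)
    have "AE x in M. x \<notin> (\<Inter>N. D N)"
      using AE_E
    proof eventually_elim
      case (elim x)
      show ?case
      proof
        assume xD: "x \<in> (\<Inter>N. D N)"
        have "S n x < real n * c'" if "n \<ge> 1" for n
        proof -
          have "x \<in> D n" using xD by blast
          thus ?thesis using that by (auto simp: D_def)
        qed
        hence "\<forall>\<^sub>F n in sequentially. ereal (S n x / real n) \<le> ereal c'"
          by (intro eventually_mono[OF eventually_ge_at_top[of 1]]) (auto simp: field_simps intro!: less_imp_le)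
        hence "L x \<le> ereal c'" unfolding L_def by (intro Limsup_bounded)
        thus False using elim by (simp add: E_def not_less[symmetric])
      qed
    qed
    hence "prob (\<Inter>N. D N) = 0" by (subst prob_eq_0) auto
    hence Dlim0: "(\<lambda>N. prob (D N)) \<longlonglongrightarrow> 0" using Dlim by simp
    define K where "K = \<bar>c'\<bar> + B"
    have K0: "K \<ge> 0" using B0 by (simp add: K_def)
    have "(\<lambda>N. (\<integral>x. f x \<partial>M) + K * prob (D N)) \<longlonglongrightarrow> (\<integral>x. f x \<partial>M) + K * 0"
      by (intro tendsto_intros Dlim0)
    hence "\<forall>\<^sub>F N in sequentially. (\<integral>x. f x \<partial>M) + K * prob (D N) < c'"
      using c'(1) by (intro order_tendstoD) auto
    then obtain N where N: "(\<integral>x. f x \<partial>M) + K * prob (D N) < c'" by (auto simp: eventually_sequentially)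
    \<comment> \<open>On \<open>D N\<close> the function is raised such that a piece of length one suffices.\<close>
    define g where "g x = f x + K * indicator (D N) x" for x
    have g_meas [measurable]: "g \<in> borel_measurable M" unfolding g_def by measurable
    have g_ge: "g x \<ge> - B" "f x \<le> g x" if "x \<in> space M" for x 
      using B[OF that] K0 by (auto simp: g_def indicator_def abs_le_iff)
    have sum_ge: "(\<Sum>i<l. g ((T ^^ i) x)) \<ge> c' * real l - K * real N" if "x \<in> space M" for l x
      using that
    proof (induction l arbitrary: x rule: less_induct)
      case (less l)
      show ?case
      proof (cases "l = 0")
        case True thus ?thesis using K0 by simp
      next
        case l: False
        show ?thesis
        proof (cases "x \<in> D N")
          case True
          have "(\<Sum>i<1 + (l - 1). g ((T ^^ i) x)) = g x + (\<Sum>i<l-1. g ((T ^^ i) (T x)))"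
            by (subst birkhoff_partial_sum_shift) simp
          moreover have "g x \<ge> c'" using True B[OF less.prems] by (auto simp: g_def K_def abs_le_iff)
          moreover have "(\<Sum>i<l-1. g ((T ^^ i) (T x))) \<ge> c' * real (l-1) - K * real N"
            using l less.prems T_sp[of x 1] by (intro less.IH) auto
          ultimately show ?thesis using l by (simp add: algebra_simps of_nat_diff)
        next
          case False
          then obtain n where n: "n \<in> {1..N}" "S n x \<ge> real n * c'" using less.prems by (auto simp: D_def not_less)
          show ?thesis
          proof (cases "n \<le> l")
            case True
            have "(\<Sum>i<n + (l - n). g ((T ^^ i) x)) = (\<Sum>i<n. g ((T ^^ i) x)) + (\<Sum>i<l-n. g ((T ^^ i) ((T ^^ n) x)))"
              by (rule birkhoff_partial_sum_shift)
            moreover have "(\<Sum>i<n. g ((T ^^ i) x)) \<ge> S n x"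
              unfolding S_def using g_ge(2) T_sp[OF less.prems] by (intro sum_mono) auto
            moreover have "(\<Sum>i<l-n. g ((T ^^ i) ((T ^^ n) x))) \<ge> c' * real (l-n) - K * real N"
              using l n less.prems T_sp[of x n] by (intro less.IH) auto
            ultimately show ?thesis using n True by (simp add: algebra_simps of_nat_diff)
          next
            case F: False
            have "(\<Sum>i<l. g ((T ^^ i) x)) \<ge> (\<Sum>i<l. - B)"
              using g_ge(1) T_sp[OF less.prems] by (intro sum_mono) auto
            moreover have "(c' + B) * real l \<le> K * real l" by (intro mult_right_mono) (auto simp: K_def)
            moreover have "K * real l \<le> K * real N" using F n K0 by (intro mult_left_mono) auto
            ultimately show ?thesis by (simp add: algebra_simps)
          qed
        qed
      qed
    qed
    have int_f: "integrable M f" by (rule integrable_const_bound[of _ B]) (use B in auto)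
    have int_D: "integrable M (indicat_real (D N))" by (rule integrable_const_bound[of _ 1]) auto
    have int_g: "integrable M g" unfolding g_def using int_f int_D by (intro Bochner_Integration.integrable_add integrable_mult_right) auto
    have "(\<integral>x. g x \<partial>M) = (\<integral>x. f x \<partial>M) + K * prob (D N)"
      unfolding g_def using int_f int_D by (subst Bochner_Integration.integral_add) auto
    hence gc: "(\<integral>x. g x \<partial>M) < c'" using N by simp
    have int_gT: "integrable M (\<lambda>x. g ((T ^^ i) x))" for i
      using integrable_distr[of "T ^^ i" M M g] T_pow_pres[of i] int_g by simp
    have le: "c' * real l - K * real N \<le> real l * (\<integral>x. g x \<partial>M)" for l
    proof -
      have "(\<integral>x. c' * real l - K * real N \<partial>M) \<le> (\<integral>x. (\<Sum>i<l. g ((T ^^ i) x)) \<partial>M)"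
        using int_gT sum_ge by (intro integral_mono) auto
      also have "\<dots> = (\<Sum>i<l. \<integral>x. g ((T ^^ i) x) \<partial>M)" using int_gT by (intro Bochner_Integration.integral_sum)
      also have "\<dots> = real l * (\<integral>x. g x \<partial>M)" by (simp add: T_pow_integral)
      finally show ?thesis by (simp add: prob_space)
    qed
    obtain l :: nat where l: "real l > K * real N / (c' - (\<integral>x. g x \<partial>M))" using reals_Archimedean2 by blast
    hence "real l * (c' - (\<integral>x. g x \<partial>M)) > K * real N" using gc by (simp add: field_simps)
    thus False using le[of l] by (simp add: algebra_simps)
  qed
  ultimately have "prob E = 0" by simp
  hence "AE x in M. x \<notin> E" by (simp add: prob_eq_0)
  thus ?thesis
  proof (rule AE_mp, intro AE_I2 impI)
    fix x assume x: "x \<in> space M" "x \<notin> E"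
    hence "limsup (\<lambda>n. ereal (S n x / real n)) \<le> ereal c'" by (auto simp: E_def L_def not_less)
    hence "limsup (\<lambda>n. ereal (S n x / real n)) < ereal c" using c'(2) by (meson ereal_less_eq(3) le_less_trans less_ereal.simps(1))
    from Limsup_lessD[OF this] show "\<forall>\<^sub>F n in sequentially. (\<Sum>i<n. f ((T ^^ i) x)) / real n < c"
      by (simp add: S_def)
  qed
qed

theorem birkhoff_bounded:
  fixes f :: "'a \<Rightarrow> real"
  assumes f [measurable]: "f \<in> borel_measurable M" and B: "\<And>x. x \<in> space M \<Longrightarrow> \<bar>f x\<bar> \<le> B"
  shows "AE x in M. (\<lambda>n. (\<Sum>i<n. f ((T ^^ i) x)) / real n) \<longlonglongrightarrow> (\<integral>x. f x \<partial>M)"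
proof -
  define I where "I = (\<integral>x. f x \<partial>M)"
  have 1: "AE x in M. \<forall>k::nat. eventually (\<lambda>n. (\<Sum>i<n. f ((T ^^ i) x)) / real n < I + 1 / real (Suc k)) sequentially"
    by (subst AE_all_countable, intro allI birkhoff_limsup[OF f B]) (auto simp: I_def)
  have 2: "AE x in M. \<forall>k::nat. eventually (\<lambda>n. (\<Sum>i<n. - f ((T ^^ i) x)) / real n < - I + 1 / real (Suc k)) sequentially"
    by (subst AE_all_countable, intro allI birkhoff_limsup[where f="\<lambda>x. - f x" and B=B]) (use B in \<open>auto simp: I_def\<close>)
  from 1 2 show ?thesis
  proof eventually_elim
    case (elim x)
    show ?case
    proof (rule tendstoI)
      fix e :: real assume "e > 0"
      then obtain k where k: "1 / real (Suc k) < e" using reals_Archimedean[of e] by (auto simp: inverse_eq_divide)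
      show "\<forall>\<^sub>F n in sequentially. dist ((\<Sum>i<n. f ((T ^^ i) x)) / real n) (\<integral>x. f x \<partial>M) < e"
        using elim(1)[rule_format, of k] elim(2)[rule_format, of k]
        by eventually_elim (use k in \<open>auto simp: dist_real_def sum_negf I_def[symmetric] abs_less_iff\<close>)
    qed
  qed
qed

end

section \<open>Existence of the free energy\<close>

lemma seq_shift_measurable [measurable]: "seq_shift \<in> measurable seq_space seq_space"
  unfolding seq_shift_def by (rule measurable_PiM_single') auto

lemma seq_shift_pow: "(seq_shift ^^ k) w = (\<lambda>i. w (i + k))"
  by (induction k arbitrary: w) (auto simp: seq_shift_def funpow_swap1[symmetric])

locale environment = ergodic_map \<mu> seq_shift for \<mu> :: "(nat \<Rightarrow> real) measure" +
  assumes sets_mu [measurable_cong]: "sets \<mu> = sets seq_space"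
    and pm: "AE w in \<mu>. \<forall>i. w i = 1 \<or> w i = -1"
    and plus_pos: "prob {w \<in> space \<mu>. w 1 = 1} > 0"
    and minus_pos: "prob {w \<in> space \<mu>. w 1 = -1} > 0"
begin

lemma space_mu [simp]: "space \<mu> = UNIV"
  using sets_eq_imp_space_eq[OF sets_mu] by (simp add: space_PiM)

lemma prob_UNIV [simp]: "prob UNIV = 1"
  using prob_space by simp

lemma coord_measurable [measurable]: "(\<lambda>w. w i) \<in> borel_measurable \<mu>"
proof -
  have "(\<lambda>w. w i) \<in> borel_measurable seq_space" by simp
  thus ?thesis by (simp cong: measurable_cong_sets add: sets_mu)
qed

end

locale pinning = renewal_kernel K \<alpha> k1 k2 n0 + environment \<mu>
  for K \<alpha> k1 k2 n0 \<mu>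
begin

text \<open>The sign of the site is read off by a case distinction, so that the weight is bounded for every
  sequence and not just for sequences of signs.\<close>

definition weight :: "real \<Rightarrow> real \<Rightarrow> (nat \<Rightarrow> real) \<Rightarrow> nat \<Rightarrow> real" where
  "weight \<beta> h w n = exp (h + \<beta> * (if w n = 1 then 1 else -1))"

definition z :: "real \<Rightarrow> real \<Rightarrow> nat \<Rightarrow> (nat \<Rightarrow> real) \<Rightarrow> real" where
  "z \<beta> h N w = ln (Z (weight \<beta> h w) N 0)"

lemma weight_pos [simp]: "weight \<beta> h w n > 0" and weight_nonneg [simp]: "weight \<beta> h w n \<ge> 0"
  by (auto simp: weight_def)

lemma weight_bounds: 
  "1 / exp (\<bar>h\<bar> + \<bar>\<beta>\<bar>) \<le> weight \<beta> h w n" "weight \<beta> h w n \<le> exp (\<bar>h\<bar> + \<bar>\<beta>\<bar>)"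
proof -
  have "1 / exp (\<bar>h\<bar> + \<bar>\<beta>\<bar>) = exp (- (\<bar>h\<bar> + \<bar>\<beta>\<bar>))" by (simp only: exp_minus inverse_eq_divide)
  also have "\<dots> \<le> weight \<beta> h w n" unfolding weight_def by (subst exp_le_cancel_iff) auto
  finally show "1 / exp (\<bar>h\<bar> + \<bar>\<beta>\<bar>) \<le> weight \<beta> h w n" .
  show "weight \<beta> h w n \<le> exp (\<bar>h\<bar> + \<bar>\<beta>\<bar>)" unfolding weight_def by (subst exp_le_cancel_iff) auto
qed

lemma weight_shift: "weight \<beta> h ((seq_shift ^^ k) w) n = weight \<beta> h w (n + k)"
  by (simp add: weight_def seq_shift_pow)

lemma Z_weight_pos: "Z (weight \<beta> h w) N x > 0" by (intro Z_pos) auto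

lemma Z_weight_measurable [measurable]: "(\<lambda>w. Z (weight \<beta> h w) N x) \<in> borel_measurable \<mu>"
proof (induction x rule: backward_induct[where N=N])
  case (step x)
  have [measurable]: "(\<lambda>w. weight \<beta> h w n) \<in> borel_measurable \<mu>" for n unfolding weight_def by measurable
  show ?case
    by (subst Z.simps, intro borel_measurable_add borel_measurable_sum borel_measurable_times) (auto intro: step)
qed

lemma z_measurable [measurable]: "z \<beta> h N \<in> borel_measurable \<mu>"
  unfolding z_def by measurable

lemma z_compare:
  assumes "m \<le> n" shows "\<bar>z \<beta> h n w - z \<beta> h m w\<bar> \<le> (\<bar>h\<bar> + \<bar>\<beta>\<bar>) * real (n - m)"
proof -
  define E where "E = exp (\<bar>h\<bar> + \<bar>\<beta>\<bar>)"
  have E: "E \<ge> 1" by (simp add: E_def)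
  have W: "1/E \<le> weight \<beta> h w n \<and> weight \<beta> h w n \<le> E" for n using weight_bounds by (simp add: E_def)
  have lnE: "ln (E ^ (n - m)) = (\<bar>h\<bar> + \<bar>\<beta>\<bar>) * real (n - m)" by (simp add: E_def ln_realpow)
  have p: "Z (weight \<beta> h w) n 0 > 0" "Z (weight \<beta> h w) m 0 > 0" "E ^ (n-m) > 0" using Z_weight_pos E by auto
  have "z \<beta> h n w \<le> ln (Z (weight \<beta> h w) m 0 * E ^ (n - m))"
    unfolding z_def by (intro ln_mono Z_length_compare(1)[OF E W] p) (use assms in auto)
  moreover have "z \<beta> h m w \<le> ln (Z (weight \<beta> h w) n 0 * E ^ (n - m))"
    unfolding z_def by (intro ln_mono Z_length_compare(2)[OF E W] p) (use assms in auto)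
  ultimately show ?thesis using lnE
    unfolding ln_mult_pos[OF p(1,3)] ln_mult_pos[OF p(2,3)] z_def by linarith
qed

lemma z_0 [simp]: "z \<beta> h 0 w = 0" by (simp add: z_def)

lemma z_bound: "\<bar>z \<beta> h n w\<bar> \<le> (\<bar>h\<bar> + \<bar>\<beta>\<bar>) * real n"
  using z_compare[of 0 n \<beta> h w] by simp

lemma z_integrable: "integrable \<mu> (z \<beta> h n)"
  by (rule integrable_const_bound[of _ "(\<bar>h\<bar> + \<bar>\<beta>\<bar>) * real n"]) (use z_bound in auto)

lemma z_near_additive:
  "\<exists>c\<ge>0. \<forall>w a m. m \<ge> n0 \<longrightarrow> \<bar>z \<beta> h (a + m) w - z \<beta> h a w - z \<beta> h m ((seq_shift ^^ a) w)\<bar> \<le> c + (1+\<alpha>) * ln (real a + 1)"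
proof -
  define E where "E = exp (\<bar>h\<bar> + \<bar>\<beta>\<bar>)"
  have E: "E \<ge> 1" by (simp add: E_def)
  obtain C where C: "C \<ge> 1" "\<And>W x a N. (\<forall>n. 1/E \<le> W n \<and> W n \<le> E) \<Longrightarrow> x \<le> a \<Longrightarrow> a + n0 \<le> N \<Longrightarrow>
     Z W N x \<le> C * (real (a - x) + 1) powr (1+\<alpha>) * (Z W a x * Z W N a) \<and>
     Z W a x * Z W N a \<le> C * (real (a - x) + 1) powr (1+\<alpha>) * Z W N x"
    using Z_near_additive[OF E] by blast
  have "\<bar>z \<beta> h (a + m) w - z \<beta> h a w - z \<beta> h m ((seq_shift ^^ a) w)\<bar> \<le> ln C + (1+\<alpha>) * ln (real a + 1)" if m: "m \<ge> n0" for w a m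
  proof -
    define W where "W = weight \<beta> h w"
    have W: "\<forall>n. 1/E \<le> W n \<and> W n \<le> E" using weight_bounds by (simp add: E_def W_def)
    have zm: "z \<beta> h m ((seq_shift ^^ a) w) = ln (Z W (a+m) a)"
      using Z_shift[of W m a 0] by (simp add: z_def weight_shift[abs_def] W_def add.commute)
    have Zp: "Z W N x > 0" for N x unfolding W_def by (rule Z_weight_pos)
    have *: "Z W (a+m) 0 \<le> C * (real a + 1) powr (1+\<alpha>) * (Z W a 0 * Z W (a+m) a)"
       "Z W a 0 * Z W (a+m) a \<le> C * (real a + 1) powr (1+\<alpha>) * Z W (a+m) 0"
      using C(2)[OF W, of 0 a "a+m"] m by auto
    have p: "C * (real a + 1) powr (1+\<alpha>) > 0" using C by simp
    have lnp: "ln (C * (real a + 1) powr (1+\<alpha>)) = ln C + (1+\<alpha>) * ln (real a + 1)"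
      using C by (simp add: ln_mult ln_powr)
    have "ln (Z W (a+m) 0) \<le> ln (C * (real a + 1) powr (1+\<alpha>) * (Z W a 0 * Z W (a+m) a))"
      by (intro ln_mono * Zp)
    also have "\<dots> = ln (C * (real a + 1) powr (1+\<alpha>)) + (ln (Z W a 0) + ln (Z W (a+m) a))"
      using p Zp by (simp add: ln_mult_pos)
    finally have 1: "ln (Z W (a+m) 0) \<le> ln (C * (real a + 1) powr (1+\<alpha>)) + (ln (Z W a 0) + ln (Z W (a+m) a))" .
    have "ln (Z W a 0 * Z W (a+m) a) \<le> ln (C * (real a + 1) powr (1+\<alpha>) * Z W (a+m) 0)"
      using Zp by (intro ln_mono * mult_pos_pos)
    also have "\<dots> = ln (C * (real a + 1) powr (1+\<alpha>)) + ln (Z W (a+m) 0)"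
      using p Zp by (simp add: ln_mult_pos)
    also have "ln (Z W a 0 * Z W (a+m) a) = ln (Z W a 0) + ln (Z W (a+m) a)" using Zp by (simp add: ln_mult_pos)
    finally show ?thesis using 1 unfolding lnp zm unfolding z_def W_def[symmetric] by linarith
  qed
  moreover have "ln C \<ge> 0" using C(1) by simp
  ultimately show ?thesis by blast
qed

text \<open>The interval is cut into \<open>N/M\<close> pieces of length \<open>M\<close>, with an offset \<open>r < M\<close>; near additivity bounds
  the error by \<open>c + (1 + \<alpha>) ln (M + 1)\<close> per piece. Averaging over all offsets turns the sum over the
  pieces into a Birkhoff sum.\<close>

lemma z_birkhoff_comparison:
  "\<exists>\<delta>. (\<delta> \<longlonglongrightarrow> 0) \<and> (\<forall>M\<ge>1. \<exists>c. \<forall>N\<ge>1. \<forall>w. 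
     \<bar>z \<beta> h N w / real N - (\<Sum>i<N. z \<beta> h M ((seq_shift ^^ i) w)) / real N / real M\<bar> \<le> \<delta> M + c / real N)"
proof -
  define b where "b = \<bar>h\<bar> + \<bar>\<beta>\<bar>"
  have b0: "b \<ge> 0" by (simp add: b_def)
  have zb: "\<bar>z \<beta> h n w\<bar> \<le> b * real n" for n w using z_bound by (simp add: b_def)
  have zc: "\<bar>z \<beta> h n w - z \<beta> h m w\<bar> \<le> b * real (n - m)" if "m \<le> n" for m n w using z_compare[OF that] by (simp add: b_def)
  obtain c0 where c0: "c0 \<ge> 0" "\<And>w a m. m \<ge> n0 \<Longrightarrow> \<bar>z \<beta> h (a + m) w - z \<beta> h a w - z \<beta> h m ((seq_shift ^^ a) w)\<bar> \<le> c0 + (1+\<alpha>) * ln (real a + 1)"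
    using z_near_additive by blast
  define d where "d M = c0 + (1+\<alpha>) * ln (real M + 1)" for M :: nat
  have d0: "d M \<ge> 0" for M using c0 alpha_pos by (auto simp: d_def intro!: add_nonneg_nonneg mult_nonneg_nonneg)
  have d_mono: "d r \<le> d M" if "r \<le> M" for r M using that alpha_pos by (auto simp: d_def intro!: mult_left_mono)
  have lim: "(\<lambda>M. d M / real M) \<longlonglongrightarrow> 0" unfolding d_def by real_asymp
  have "\<exists>c. \<forall>N\<ge>1. \<forall>w. \<bar>z \<beta> h N w / real N - (\<Sum>i<N. z \<beta> h M ((seq_shift ^^ i) w)) / real N / real M\<bar> \<le> d M / real M + c / real N" if M: "M \<ge> 1" for M
  proof -
    define \<psi> where "\<psi> w = z \<beta> h M w" for w
    have sh: "(seq_shift ^^ i) ((seq_shift ^^ j) w) = (seq_shift ^^ (i + j)) w" for i j and w :: "nat \<Rightarrow> real"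
      by (simp add: funpow_add)
    \<comment> \<open>Pieces are split off from the left: the error in \<open>z_near_additive\<close> depends on the length of the left part only.\<close>
    have peel: "\<bar>z \<beta> h (J * M + m) w - (\<Sum>j<J. \<psi> ((seq_shift ^^ (j * M)) w)) - z \<beta> h m ((seq_shift ^^ (J * M)) w)\<bar> \<le> real J * d M"
      if m: "m \<ge> n0" for J m w
    proof (induction J arbitrary: w)
      case (Suc J)
      have "\<bar>z \<beta> h (M + (J * M + m)) w - \<psi> w - z \<beta> h (J * M + m) ((seq_shift ^^ M) w)\<bar> \<le> d M"
        using c0(2)[of "J * M + m" M w] m by (simp add: \<psi>_def d_def)
      moreover have "\<bar>z \<beta> h (J * M + m) ((seq_shift ^^ M) w) - (\<Sum>j<J. \<psi> ((seq_shift ^^ (j * M + M)) w)) - z \<beta> h m ((seq_shift ^^ (J * M + M)) w)\<bar> \<le> real J * d M"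
        using Suc[of "(seq_shift ^^ M) w"] by (simp add: sh)
      moreover have "(\<Sum>j<Suc J. \<psi> ((seq_shift ^^ (j * M)) w)) = \<psi> w + (\<Sum>j<J. \<psi> ((seq_shift ^^ (j * M + M)) w))"
        by (subst sum.lessThan_Suc_shift) (simp add: add.commute)
      moreover have "real (Suc J) * d M = d M + real J * d M" by (simp add: algebra_simps)
      moreover have "Suc J * M + m = M + (J * M + m)" "Suc J * M = J * M + M" by simp_all
      ultimately show ?case by (simp only:)
    qed simp
    define c1 where "c1 = d M + 2 * b * (real M + real n0)"
    \<comment> \<open>The last \<open>n0\<close> sites are appended because \<open>z_near_additive\<close> needs a right part of length at least \<open>n0\<close>.\<close>
    have off: "\<bar>z \<beta> h (J * M) w - (\<Sum>j<J. \<psi> ((seq_shift ^^ (r + j * M)) w))\<bar> \<le> real J * d M + c1" if r: "r < M" for J r w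
    proof -
      have 1: "\<bar>z \<beta> h (r + (J * M + n0)) w - z \<beta> h r w - z \<beta> h (J * M + n0) ((seq_shift ^^ r) w)\<bar> \<le> d M"
        using c0(2)[of "J * M + n0" r w] d_mono[of r M] r by (simp add: d_def)
      have 2: "\<bar>z \<beta> h (J * M + n0) ((seq_shift ^^ r) w) - (\<Sum>j<J. \<psi> ((seq_shift ^^ (r + j * M)) w)) - z \<beta> h n0 ((seq_shift ^^ (r + J * M)) w)\<bar> \<le> real J * d M"
        using peel[of n0 J "(seq_shift ^^ r) w"] by (simp add: sh add.commute)
      have 3: "\<bar>z \<beta> h (r + (J * M + n0)) w - z \<beta> h (J * M) w\<bar> \<le> b * (real r + real n0)"
        using zc[of "J * M" "r + (J * M + n0)" w] by simp
      have "\<bar>z \<beta> h r w\<bar> \<le> b * real r" "\<bar>z \<beta> h n0 ((seq_shift ^^ (r + J * M)) w)\<bar> \<le> b * real n0" using zb by auto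
      moreover have "b * real r \<le> b * real M" using r b0 by (intro mult_left_mono) auto
      moreover have "b * (real r + real n0) = b * real r + b * real n0"
        and "c1 = d M + 2 * (b * real M) + 2 * (b * real n0)" by (simp_all add: c1_def algebra_simps)
      ultimately show ?thesis using 1 2 3 by linarith
    qed
    have grp: "(\<Sum>r<M. \<Sum>j<J. \<psi> ((seq_shift ^^ (r + j * M)) w)) = (\<Sum>i<J * M. \<psi> ((seq_shift ^^ i) w))" for J w
    proof -
      have "(\<Sum>i<J * M. \<psi> ((seq_shift ^^ i) w)) = (\<Sum>j<J. \<Sum>i\<in>{j * M..<j * M + M}. \<psi> ((seq_shift ^^ i) w))"
        by (rule sum.nat_group[symmetric])
      also have "\<dots> = (\<Sum>j<J. \<Sum>r<M. \<psi> ((seq_shift ^^ (r + j * M)) w))"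
      proof (rule sum.cong[OF refl])
        fix j
        show "(\<Sum>i\<in>{j * M..<j * M + M}. \<psi> ((seq_shift ^^ i) w)) = (\<Sum>r<M. \<psi> ((seq_shift ^^ (r + j * M)) w))"
          by (rule sum.reindex_bij_witness[where i="\<lambda>r. r + j * M" and j="\<lambda>i. i - j * M"]) auto
      qed
      finally show ?thesis by (subst sum.swap) simp
    qed
    define c where "c = c1 + 2 * b * real M"
    have "\<bar>z \<beta> h N w / real N - (\<Sum>i<N. \<psi> ((seq_shift ^^ i) w)) / real N / real M\<bar> \<le> d M / real M + c / real N" if N: "N \<ge> 1" for N w
    proof -
      define J where "J = N div M"
      have NJ: "J * M \<le> N" "N - J * M = N mod M" by (simp_all add: J_def minus_div_mult_eq_mod)
      have modM: "N mod M < M" using M by simp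
      have "\<bar>real M * z \<beta> h (J * M) w - (\<Sum>i<J * M. \<psi> ((seq_shift ^^ i) w))\<bar> = \<bar>\<Sum>r<M. (z \<beta> h (J * M) w - (\<Sum>j<J. \<psi> ((seq_shift ^^ (r + j * M)) w)))\<bar>"
        by (simp add: sum_subtractf grp)
      also have "\<dots> \<le> (\<Sum>r<M. real J * d M + c1)"
        using off by (intro sum_abs[THEN order_trans] sum_mono) auto
      finally have 1: "\<bar>real M * z \<beta> h (J * M) w - (\<Sum>i<J * M. \<psi> ((seq_shift ^^ i) w))\<bar> \<le> real M * (real J * d M + c1)" by simp
      have 2: "\<bar>(\<Sum>i<N. \<psi> ((seq_shift ^^ i) w)) - (\<Sum>i<J * M. \<psi> ((seq_shift ^^ i) w))\<bar> \<le> real M * (b * real M)"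
      proof -
        have "(\<Sum>i<N. \<psi> ((seq_shift ^^ i) w)) = (\<Sum>i<J * M. \<psi> ((seq_shift ^^ i) w)) + (\<Sum>i\<in>{J*M..<N}. \<psi> ((seq_shift ^^ i) w))"
          unfolding lessThan_atLeast0 using NJ(1) by (intro sum.atLeastLessThan_concat[symmetric]) auto
        moreover have "\<bar>\<Sum>i\<in>{J*M..<N}. \<psi> ((seq_shift ^^ i) w)\<bar> \<le> (\<Sum>i\<in>{J*M..<N}. b * real M)"
          using zb by (intro sum_abs[THEN order_trans] sum_mono) (auto simp: \<psi>_def)
        moreover have "(\<Sum>i\<in>{J*M..<N}. b * real M) = real (N mod M) * (b * real M)"
          using NJ by simp
        moreover have "real (N mod M) * (b * real M) \<le> real M * (b * real M)"
          using modM b0 by (intro mult_right_mono) auto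
        ultimately show ?thesis by linarith
      qed
      have 3: "\<bar>real M * z \<beta> h N w - real M * z \<beta> h (J * M) w\<bar> \<le> real M * (b * real M)"
      proof -
        have "\<bar>z \<beta> h N w - z \<beta> h (J * M) w\<bar> \<le> b * real (N - J * M)" using NJ by (intro zc) auto
        also have "N - J * M = N mod M" by (rule NJ)
        also have "b * real (N mod M) \<le> b * real M" using modM b0 by (intro mult_left_mono) auto
        finally have "real M * \<bar>z \<beta> h N w - z \<beta> h (J * M) w\<bar> \<le> real M * (b * real M)" by (intro mult_left_mono) auto
        thus ?thesis by (simp add: abs_mult flip: right_diff_distrib)
      qed
      have "\<bar>real M * z \<beta> h N w - (\<Sum>i<N. \<psi> ((seq_shift ^^ i) w))\<bar> \<le> real M * (real J * d M + c1) + real M * (b * real M) + real M * (b * real M)"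
        using 1 2 3 by linarith
      also have "\<dots> = (real J * real M) * d M + real M * c" by (simp add: c_def algebra_simps)
      also have "\<dots> \<le> real N * d M + real M * c"
      proof -
        have "real J * real M \<le> real N" using NJ(1) by (metis of_nat_le_iff of_nat_mult)
        thus ?thesis using d0 by (intro add_right_mono mult_right_mono) auto
      qed
      finally have "\<bar>real M * z \<beta> h N w - (\<Sum>i<N. \<psi> ((seq_shift ^^ i) w))\<bar> / (real N * real M) \<le> (real N * d M + real M * c) / (real N * real M)"
        by (intro divide_right_mono) auto
      also have "(real N * d M + real M * c) / (real N * real M) = d M / real M + c / real N" using M N by (simp add: field_simps)
      also have "\<bar>real M * z \<beta> h N w - (\<Sum>i<N. \<psi> ((seq_shift ^^ i) w))\<bar> / (real N * real M) = \<bar>z \<beta> h N w / real N - (\<Sum>i<N. \<psi> ((seq_shift ^^ i) w)) / real N / real M\<bar>"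
      proof -
        have "z \<beta> h N w / real N - (\<Sum>i<N. \<psi> ((seq_shift ^^ i) w)) / real N / real M = (real M * z \<beta> h N w - (\<Sum>i<N. \<psi> ((seq_shift ^^ i) w))) / (real N * real M)"
          using M N by (simp add: field_simps)
        thus ?thesis by (simp add: abs_divide abs_mult)
      qed
      finally show ?thesis .
    qed
    thus ?thesis unfolding \<psi>_def by blast
  qed
  thus ?thesis using lim by blast
qed

text \<open>Integrating \<open>z_birkhoff_comparison\<close> shows that \<open>E[ln Z] / N\<close> is a Cauchy sequence; together with the
  ergodic theorem it gives the same limit almost surely.\<close>

theorem free_energy_exists:
  "\<exists>F. (\<lambda>N. (\<integral>w. z \<beta> h N w \<partial>\<mu>) / real N) \<longlonglongrightarrow> F \<and> (AE w in \<mu>. (\<lambda>N. z \<beta> h N w / real N) \<longlonglongrightarrow> F)"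
proof -
  obtain \<delta> where \<delta>: "\<delta> \<longlonglongrightarrow> 0" "\<And>M. M \<ge> 1 \<Longrightarrow> \<exists>c. \<forall>N\<ge>1. \<forall>w. 
     \<bar>z \<beta> h N w / real N - (\<Sum>i<N. z \<beta> h M ((seq_shift ^^ i) w)) / real N / real M\<bar> \<le> \<delta> M + c / real N"
    using z_birkhoff_comparison by blast
  define a where "a N = (\<integral>w. z \<beta> h N w \<partial>\<mu>) / real N" for N
  have comp: "\<exists>c. \<forall>N\<ge>1. \<bar>a N - a M\<bar> \<le> \<delta> M + c / real N" if M: "M \<ge> 1" for M
  proof -
    obtain c where c: "\<And>N w. N \<ge> 1 \<Longrightarrow> \<bar>z \<beta> h N w / real N - (\<Sum>i<N. z \<beta> h M ((seq_shift ^^ i) w)) / real N / real M\<bar> \<le> \<delta> M + c / real N"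
      using \<delta>(2)[OF M] by blast
    have "\<bar>a N - a M\<bar> \<le> \<delta> M + c / real N" if N: "N \<ge> 1" for N
    proof -
      have int: "integrable \<mu> (\<lambda>w. z \<beta> h M ((seq_shift ^^ i) w))" for i
        by (rule integrable_const_bound[of _ "(\<bar>h\<bar> + \<bar>\<beta>\<bar>) * real M"]) (use z_bound in auto)
      have "(\<integral>w. (\<Sum>i<N. z \<beta> h M ((seq_shift ^^ i) w)) \<partial>\<mu>) = (\<Sum>i<N. (\<integral>w. z \<beta> h M ((seq_shift ^^ i) w) \<partial>\<mu>))"
        using int by (intro Bochner_Integration.integral_sum)
      also have "\<dots> = real N * (\<integral>w. z \<beta> h M w \<partial>\<mu>)" by (simp add: T_pow_integral)
      finally have S: "(\<integral>w. (\<Sum>i<N. z \<beta> h M ((seq_shift ^^ i) w)) \<partial>\<mu>) = real N * (\<integral>w. z \<beta> h M w \<partial>\<mu>)" .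
      define d where "d w = z \<beta> h N w / real N - (\<Sum>i<N. z \<beta> h M ((seq_shift ^^ i) w)) / real N / real M" for w
      have i1: "integrable \<mu> (\<lambda>w. z \<beta> h N w / real N)" by (intro integrable_divide z_integrable)
      have i2: "integrable \<mu> (\<lambda>w. (\<Sum>i<N. z \<beta> h M ((seq_shift ^^ i) w)) / real N / real M)"
        by (intro integrable_divide Bochner_Integration.integrable_sum int)
      have i3: "integrable \<mu> d" unfolding d_def by (rule Bochner_Integration.integrable_diff[OF i1 i2])
      have "real N * (\<integral>w. z \<beta> h M w \<partial>\<mu>) / real N / real M = a M" using N by (simp add: a_def)
      hence eq: "(\<integral>w. d w \<partial>\<mu>) = a N - a M"
        unfolding d_def by (subst Bochner_Integration.integral_diff[OF i1 i2]) (use N in \<open>simp add: S a_def\<close>)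
      have "\<bar>\<integral>w. d w \<partial>\<mu>\<bar> \<le> (\<integral>w. \<bar>d w\<bar> \<partial>\<mu>)" by (rule integral_abs_bound)
      also have "\<dots> \<le> (\<integral>w. \<delta> M + c / real N \<partial>\<mu>)"
      proof (rule integral_mono)
        show "integrable \<mu> (\<lambda>w. \<bar>d w\<bar>)" by (rule integrable_abs[OF i3])
        show "integrable \<mu> (\<lambda>w. \<delta> M + c / real N)" by simp
      qed (unfold d_def, rule c[OF N])
      also have "\<dots> = \<delta> M + c / real N" by simp
      finally show ?thesis unfolding eq .
    qed
    thus ?thesis by blast
  qed
  have small: "\<forall>\<^sub>F M in sequentially. M \<ge> 1 \<and> \<delta> M < e" if "e > 0" for e
    using order_tendstoD(2)[OF \<delta>(1) that] eventually_ge_at_top[of 1] by eventually_elim auto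
  have "Cauchy a"
  proof (rule metric_CauchyI)
    fix e :: real assume e: "e > 0"
    obtain M where M: "M \<ge> 1" "\<delta> M < e / 4" using eventually_happens'[OF sequentially_bot small[of "e/4"]] e by auto
    obtain c where c: "\<And>N. N \<ge> 1 \<Longrightarrow> \<bar>a N - a M\<bar> \<le> \<delta> M + c / real N" using comp[OF M(1)] by blast
    have "(\<lambda>N. c / real N) \<longlonglongrightarrow> 0" by (rule lim_const_over_n)
    hence "\<forall>\<^sub>F N in sequentially. c / real N < e / 4" using e by (intro order_tendstoD) auto
    then obtain N0 where N0: "\<And>N. N \<ge> N0 \<Longrightarrow> c / real N < e / 4" by (auto simp: eventually_sequentially)
    have "dist (a m) (a n) < e" if "m \<ge> max 1 N0" "n \<ge> max 1 N0" for m n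
    proof -
      have "1 \<le> m" "N0 \<le> m" "1 \<le> n" "N0 \<le> n" using that by auto
      thus ?thesis using c[of m] c[of n] N0[of m] N0[of n] M(2) unfolding dist_real_def by linarith
    qed
    thus "\<exists>M. \<forall>m\<ge>M. \<forall>n\<ge>M. dist (a m) (a n) < e" by blast
  qed
  then obtain F where F: "a \<longlonglongrightarrow> F" using Cauchy_convergent convergent_def by blast
  have Fa: "\<bar>F - a M\<bar> \<le> \<delta> M" if M: "M \<ge> 1" for M
  proof -
    obtain c where c: "\<And>N. N \<ge> 1 \<Longrightarrow> \<bar>a N - a M\<bar> \<le> \<delta> M + c / real N" using comp[OF M] by blast
    have "(\<lambda>N. \<bar>a N - a M\<bar>) \<longlonglongrightarrow> \<bar>F - a M\<bar>" by (intro tendsto_intros F)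
    moreover have "(\<lambda>N. \<delta> M + c / real N) \<longlonglongrightarrow> \<delta> M + 0" by (intro tendsto_intros lim_const_over_n)
    ultimately show ?thesis using c by (intro LIMSEQ_le) auto
  qed
  have "AE w in \<mu>. \<forall>M. (\<lambda>N. (\<Sum>i<N. z \<beta> h M ((seq_shift ^^ i) w)) / real N) \<longlonglongrightarrow> (\<integral>w. z \<beta> h M w \<partial>\<mu>)"
    by (subst AE_all_countable, intro allI birkhoff_bounded) (use z_bound in auto)
  hence "AE w in \<mu>. (\<lambda>N. z \<beta> h N w / real N) \<longlonglongrightarrow> F"
  proof eventually_elim
    case (elim w)
    show ?case
    proof (rule tendstoI)
      fix e :: real assume e: "e > 0"
      obtain M where M: "M \<ge> 1" "\<delta> M < e / 4" using eventually_happens'[OF sequentially_bot small[of "e/4"]] e by auto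
      obtain c where c: "\<And>N w. N \<ge> 1 \<Longrightarrow> \<bar>z \<beta> h N w / real N - (\<Sum>i<N. z \<beta> h M ((seq_shift ^^ i) w)) / real N / real M\<bar> \<le> \<delta> M + c / real N"
        using \<delta>(2)[OF M(1)] by blast
      have "(\<lambda>N. c / real N) \<longlonglongrightarrow> 0" by (rule lim_const_over_n)
      hence 1: "\<forall>\<^sub>F N in sequentially. c / real N < e / 4" using e by (intro order_tendstoD) auto
      have "(\<lambda>N. (\<Sum>i<N. z \<beta> h M ((seq_shift ^^ i) w)) / real N / real M) \<longlonglongrightarrow> a M"
        unfolding a_def by (intro tendsto_divide elim[rule_format] tendsto_const) (use M in auto)
      hence 2: "\<forall>\<^sub>F N in sequentially. dist ((\<Sum>i<N. z \<beta> h M ((seq_shift ^^ i) w)) / real N / real M) (a M) < e / 4"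
        using e by (intro tendstoD) auto
      show "\<forall>\<^sub>F N in sequentially. dist (z \<beta> h N w / real N) F < e"
        using 1 2 eventually_ge_at_top[of 1]
      proof eventually_elim
        case (elim N)
        thus ?case using c[OF elim(3), of w] Fa[OF M(1)] M(2) unfolding dist_real_def by linarith
      qed
    qed
  qed
  thus ?thesis using F unfolding a_def by blast
qed

end

section \<open>Switches of the environment\<close>

text \<open>The elements with fewer than \<open>j\<close> larger ones are the \<open>j\<close> largest.\<close>

lemma card_few_above:
  fixes C :: "nat set"
  assumes "finite C"
  shows "card {s\<in>C. card {t\<in>C. s < t} < j} = min j (card C)"
  using assms
proof (induction C rule: finite_linorder_min_induct)
  case (insert b A)
  have 1: "{t\<in>insert b A. s < t} = {t\<in>A. s < t}" if "s \<in> A" for s using insert that by auto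
  have 2: "{t\<in>insert b A. b < t} = A" using insert by auto
  have "{s\<in>insert b A. card {t\<in>insert b A. s < t} < j} = (if card A < j then {b} else {}) \<union> {s\<in>A. card {t\<in>A. s < t} < j}"
    using 1 2 by auto
  hence "card {s\<in>insert b A. card {t\<in>insert b A. s < t} < j} = (if card A < j then 1 else 0) + card {s\<in>A. card {t\<in>A. s < t} < j}"
    using insert by (simp only:) (subst card_Un_disjoint; auto)
  also have "\<dots> = min j (card (insert b A))" using insert by auto
  finally show ?case .
qed simp

lemma (in prob_space) integrable_nat_of_tail_sum:
  fixes Y :: "'a \<Rightarrow> nat"
  assumes [measurable]: "Y \<in> measurable M (count_space UNIV)" and C: "\<And>m. (\<Sum>k<m. prob {x\<in>space M. k < Y x}) \<le> C"
  shows "integrable M (\<lambda>x. real (Y x))"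
proof (rule integrableI_nonneg)
  have "(\<integral>\<^sup>+x. ennreal (real (Y x)) \<partial>M) = (\<Sum>t. emeasure M {x\<in>space M. t < Y x})"
    using nn_integral_nat_function[of Y M] by (simp add: ennreal_of_nat_eq_real_of_nat)
  also have "\<dots> \<le> ennreal C"
  proof (rule suminf_le_const)
    fix m
    have "(\<Sum>t<m. emeasure M {x\<in>space M. t < Y x}) = ennreal (\<Sum>t<m. prob {x\<in>space M. t < Y x})"
      by (simp add: emeasure_eq_measure)
    also have "\<dots> \<le> ennreal C" by (intro ennreal_leI C)
    finally show "(\<Sum>t<m. emeasure M {x\<in>space M. t < Y x}) \<le> ennreal C" .
  qed simp
  also have "\<dots> < \<infinity>" by simp
  finally show "(\<integral>\<^sup>+x. ennreal (real (Y x)) \<partial>M) < \<infinity>" .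
qed auto

lemma (in prob_space) tail_sum_le_truncated_mean:
  fixes Y :: "'a \<Rightarrow> nat"
  assumes [measurable]: "Y \<in> measurable M (count_space UNIV)" and int: "integrable M (\<lambda>x. real (Y x))"
  shows "(\<Sum>k<m. prob {x\<in>space M. n + k < Y x}) \<le> (\<integral>x. real (Y x) * indicator {x. n < Y x} x \<partial>M)"
proof -
  have ind: "integrable M (\<lambda>x. indicator {x\<in>space M. n + k < Y x} x :: real)" for k
    by (rule integrable_const_bound[of _ 1]) auto
  have "(\<Sum>k<m. prob {x\<in>space M. n + k < Y x}) = (\<integral>x. (\<Sum>k<m. indicator {x\<in>space M. n + k < Y x} x) \<partial>M)"
    using ind by (subst Bochner_Integration.integral_sum) auto
  also have "\<dots> \<le> (\<integral>x. real (Y x) * indicator {x. n < Y x} x \<partial>M)"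
  proof (rule integral_mono)
    show "integrable M (\<lambda>x. (\<Sum>k<m. indicator {x\<in>space M. n + k < Y x} x :: real))" using ind by simp
    show "integrable M (\<lambda>x. real (Y x) * indicator {x. n < Y x} x)"
    proof (rule Bochner_Integration.integrable_bound[OF int])
      show "(\<lambda>x. real (Y x) * indicator {x. n < Y x} x) \<in> borel_measurable M" by measurable
      show "AE x in M. norm (real (Y x) * indicator {x. n < Y x} x) \<le> norm (real (Y x))"
        by (intro AE_I2) (simp split: split_indicator)
    qed
    fix x assume x: "x \<in> space M"
    have "(\<Sum>k<m. indicator {x\<in>space M. n + k < Y x} x :: real) = (\<Sum>k<m. if n + k < Y x then 1 else 0)"
      using x by (intro sum.cong) simp_all
    also have "\<dots> = real (card {k\<in>{..<m}. n + k < Y x})"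
      by (simp add: sum.inter_filter[symmetric])
    also have "\<dots> \<le> real (Y x) * indicator {x. n < Y x} x"
    proof (cases "n < Y x")
      case True
      have "card {k\<in>{..<m}. n + k < Y x} \<le> card {..<Y x}" by (intro card_mono) auto
      thus ?thesis using True by simp
    next
      case False
      hence "{k\<in>{..<m}. n + k < Y x} = {}" by auto
      thus ?thesis by (simp only: card.empty of_nat_0) simp
    qed
    finally show "(\<Sum>k<m. indicator {x\<in>space M. n + k < Y x} x) \<le> real (Y x) * indicator {x. n < Y x} x" .
  qed
  finally show ?thesis .
qed

text \<open>The almost sure properties of the environment under which all switch times are finite and
  increasing.\<close>

definition regular :: "(nat \<Rightarrow> real) \<Rightarrow> bool" where
  "regular w \<longleftrightarrow> (\<forall>i. w i = 1 \<or> w i = -1) \<and> (\<forall>n. \<exists>i\<ge>n. w i = 1) \<and> (\<forall>n. \<exists>i\<ge>n. w i = -1)"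

text \<open>A cycle consists of a block of plus sites and the following block of minus sites; it starts after
  the last minus site before it, which is the position of the origin under the conditioned law.\<close>

definition cycle_start :: "(nat \<Rightarrow> real) \<Rightarrow> nat \<Rightarrow> bool" where
  "cycle_start w i \<longleftrightarrow> w i = -1 \<and> w (Suc i) = 1"

text \<open>The counting function of the switch times.\<close>

definition switches :: "(nat \<Rightarrow> real) \<Rightarrow> nat \<Rightarrow> nat" where
  "switches w n = card {i\<in>{1..n}. w (Suc i) \<noteq> w i}"

lemma regular_shift: "regular w \<Longrightarrow> regular ((seq_shift ^^ k) w)"
  unfolding regular_def seq_shift_pow
proof (intro conjI allI)
  assume w: "(\<forall>i. w i = 1 \<or> w i = -1) \<and> (\<forall>n. \<exists>i\<ge>n. w i = 1) \<and> (\<forall>n. \<exists>i\<ge>n. w i = -1)"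
  show "w (i + k) = 1 \<or> w (i + k) = -1" for i using w by auto
  fix n
  obtain i where "i \<ge> n + k" "w i = 1" using w by blast
  thus "\<exists>i\<ge>n. w (i + k) = 1" by (intro exI[of _ "i - k"]) auto
  obtain i where "i \<ge> n + k" "w i = -1" using w by blast
  thus "\<exists>i\<ge>n. w (i + k) = -1" by (intro exI[of _ "i - k"]) auto
qed

lemma regular_ex_switch_to:
  assumes "regular w" "c = 1 \<or> c = -1"
  shows "\<exists>i\<ge>n. w i = -c \<and> w (Suc i) = c"
proof -
  obtain a where a: "a \<ge> n" "w a = -c" using assms unfolding regular_def by (metis minus_minus)
  obtain b where b: "b \<ge> a" "w b = c" using assms unfolding regular_def by metis
  have "\<exists>i\<ge>a. w i = -c \<and> w (Suc i) = c"
  proof (rule ccontr)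
    assume H: "\<not> ?thesis"
    have "w (a + j) = -c" for j
    proof (induction j)
      case (Suc j)
      have "w (Suc (a + j)) \<noteq> c" using H Suc by auto
      thus ?case using assms unfolding regular_def by (metis add_Suc_right minus_minus)
    qed (use a in simp)
    from this[of "b - a"] show False using b assms by auto
  qed
  then obtain i where "i \<ge> a" "w i = -c \<and> w (Suc i) = c" by blast
  thus ?thesis using a by (intro exI[of _ i]) auto
qed

lemma switch_time_step:
  assumes "regular w"
  shows "switch_time w n < switch_time w (Suc n)" (is ?A)
    and "w (Suc (switch_time w (Suc n))) \<noteq> w (switch_time w (Suc n))" (is ?B)
    and "\<And>i. switch_time w n < i \<Longrightarrow> i < switch_time w (Suc n) \<Longrightarrow> w (Suc i) = w i"
proof -
  define S where "S = {i. i > switch_time w n \<and> w (i + 1) \<noteq> w i}"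
  obtain i where "i \<ge> Suc (switch_time w n)" "w i = -1 \<and> w (Suc i) = 1" using regular_ex_switch_to[OF assms, of 1] by auto
  hence "i \<in> S" by (auto simp: S_def)
  hence ne: "S \<noteq> {}" by auto
  have T: "switch_time w (Suc n) = Inf S" by (simp add: S_def)
  have "Inf S \<in> S" using ne by (rule Inf_nat_def1)
  thus ?A ?B unfolding T by (auto simp: S_def)
  fix i assume i: "switch_time w n < i" "i < switch_time w (Suc n)"
  have "i \<notin> S" using i(2) unfolding T by (metis cInf_lower bdd_below_bot not_less)
  thus "w (Suc i) = w i" using i(1) by (auto simp: S_def)
qed

lemma switches_mono: "m \<le> n \<Longrightarrow> switches w m \<le> switches w n"
  unfolding switches_def by (intro card_mono) auto

lemma switches_Suc: "switches w (Suc n) = switches w n + (if w (Suc (Suc n)) \<noteq> w (Suc n) then 1 else 0)"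
proof -
  have "{i\<in>{1..Suc n}. w (Suc i) \<noteq> w i} = {i\<in>{1..n}. w (Suc i) \<noteq> w i} \<union> (if w (Suc (Suc n)) \<noteq> w (Suc n) then {Suc n} else {})"
    by (auto simp: le_Suc_eq)
  thus ?thesis unfolding switches_def by (simp only:) (subst card_Un_disjoint; auto)
qed

lemma switches_at_switch_time:
  assumes "regular w" shows "switches w (switch_time w k) = k"
proof (induction k)
  case 0 show ?case by (simp add: switches_def)
next
  case (Suc k)
  note st = switch_time_step[OF assms, of k]
  have "{i\<in>{1..switch_time w (Suc k)}. w (Suc i) \<noteq> w i} = insert (switch_time w (Suc k)) {i\<in>{1..switch_time w k}. w (Suc i) \<noteq> w i}"
  proof (intro equalityI subsetI)
    fix i assume i: "i \<in> {i\<in>{1..switch_time w (Suc k)}. w (Suc i) \<noteq> w i}"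
    have "i \<le> switch_time w k \<or> i = switch_time w (Suc k)"
    proof (rule ccontr)
      assume "\<not> ?thesis"
      hence "switch_time w k < i" "i < switch_time w (Suc k)" using i by (auto simp del: switch_time.simps)
      thus False using st(3)[of i] i by auto
    qed
    thus "i \<in> insert (switch_time w (Suc k)) {i\<in>{1..switch_time w k}. w (Suc i) \<noteq> w i}" using i by auto
  qed (use st in \<open>auto simp del: switch_time.simps\<close>)
  hence "switches w (switch_time w (Suc k)) = Suc (card {i\<in>{1..switch_time w k}. w (Suc i) \<noteq> w i})"
    unfolding switches_def using st(1) by (simp del: switch_time.simps)
  thus ?case using Suc unfolding switches_def by (simp del: switch_time.simps)
qed

lemma less_switch_time_iff:
  assumes w: "regular w"
  shows "n < switch_time w k \<longleftrightarrow> switches w n < k"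
proof
  assume n: "n < switch_time w k"
  then obtain k' where k': "k = Suc k'" by (cases k) auto
  obtain t where t: "switch_time w k = Suc t" using n by (cases "switch_time w k") auto
  have "switches w n \<le> switches w t" using n t by (intro switches_mono) auto
  moreover have "switches w (Suc t) = k" using switches_at_switch_time[OF w, of k] t by simp
  moreover have "w (Suc (Suc t)) \<noteq> w (Suc t)" using switch_time_step(2)[OF w, of k'] t unfolding k' by (simp del: switch_time.simps)
  ultimately show "switches w n < k" by (simp add: switches_Suc)
next
  assume n: "switches w n < k"
  show "n < switch_time w k"
  proof (rule ccontr)
    assume "\<not> ?thesis"
    hence "switches w (switch_time w k) \<le> switches w n" by (intro switches_mono) auto
    thus False using n switches_at_switch_time[OF w, of k] by simp
  qed
qed

text \<open>Switches alternate in direction, and the upward ones are the cycle starts.\<close>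

lemma switches_cycle_starts:
  assumes "\<And>i. w i = 1 \<or> w i = -1" and "w 1 = 1"
  shows "switches w n = 2 * card {i\<in>{1..n}. cycle_start w i} + (if w (Suc n) = 1 then 0 else 1)"
proof (induction n)
  case 0 thus ?case using assms by (simp add: switches_def)
next
  case (Suc n)
  have "{i\<in>{1..Suc n}. cycle_start w i} = {i\<in>{1..n}. cycle_start w i} \<union> (if cycle_start w (Suc n) then {Suc n} else {})"
    by (auto simp: le_Suc_eq)
  hence "card {i\<in>{1..Suc n}. cycle_start w i} = card {i\<in>{1..n}. cycle_start w i} + (if cycle_start w (Suc n) then 1 else 0)"
    by (simp only:) (subst card_Un_disjoint; auto)
  thus ?case using Suc assms(1)[of "Suc n"] assms(1)[of "Suc (Suc n)"] by (auto simp: switches_Suc cycle_start_def)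
qed

context environment begin

lemma coord_eq_const_measurable [measurable]: "Measurable.pred \<mu> (\<lambda>w. w i = c)"
  unfolding pred_def by (rule borel_measurable_eq) simp_all

lemma coord_eq_coord_measurable [measurable]: "Measurable.pred \<mu> (\<lambda>w. w i = w j)"
  unfolding pred_def by (rule borel_measurable_eq) simp_all

lemma shift_pow_measurable [measurable]: "(seq_shift ^^ k) \<in> measurable \<mu> \<mu>"
  by (rule T_pow_meas)

lemma prob_shift:
  assumes [measurable]: "Measurable.pred \<mu> Q"
  shows "prob {w. Q ((seq_shift ^^ k) w)} = prob {w. Q w}"
proof -
  have "prob {w. Q w} = measure (distr \<mu> \<mu> (seq_shift ^^ k)) {w. Q w}" by (simp add: T_pow_pres)
  also have "\<dots> = prob ((seq_shift ^^ k) -` {w. Q w} \<inter> space \<mu>)"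
    by (rule measure_distr) (use assms in \<open>auto simp: pred_def\<close>)
  finally show ?thesis by (simp add: vimage_def)
qed

lemma AE_shift:
  assumes "AE w in \<mu>. Q w" and [measurable]: "Measurable.pred \<mu> Q"
  shows "AE w in \<mu>. Q ((seq_shift ^^ k) w)"
proof -
  have "Measurable.pred \<mu> (\<lambda>w. Q ((seq_shift ^^ k) w))" by measurable
  hence s: "{w. Q w} \<in> sets \<mu>" "{w. Q ((seq_shift ^^ k) w)} \<in> sets \<mu>" using assms(2) by (auto simp: pred_def)
  have "prob {w. Q w} = 1" using assms(1) s(1) prob_Collect_eq_1[of Q] by simp
  hence "prob {w. Q ((seq_shift ^^ k) w)} = 1" by (simp add: prob_shift assms(2))
  thus ?thesis using s(2) prob_Collect_eq_1[of "\<lambda>w. Q ((seq_shift ^^ k) w)"] by simp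
qed

text \<open>Being eventually constant is an invariant event. If it had probability one, then by stationarity
  \<open>w 1 = c\<close> would hold with probability one.\<close>

lemma not_eventually_constant:
  assumes pos: "prob {w. w 1 \<noteq> c} > 0"
  shows "AE w in \<mu>. \<forall>n. \<exists>i\<ge>n. w i \<noteq> c"
proof -
  define A where "A = {w :: nat \<Rightarrow> real. \<exists>n. \<forall>i\<ge>n. w i = c}"
  define An where "An n = {w :: nat \<Rightarrow> real. \<forall>i\<ge>n. w i = c}" for n
  have [measurable]: "Measurable.pred \<mu> (\<lambda>w. \<exists>n. \<forall>i\<ge>n. w i = c)" by measurable
  have A_sets: "A \<in> sets \<mu>" unfolding A_def using \<open>Measurable.pred \<mu> (\<lambda>w. \<exists>n. \<forall>i\<ge>n. w i = c)\<close> by (simp add: pred_def)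
  have "Measurable.pred \<mu> (\<lambda>w. \<forall>i\<ge>n. w i = c)" for n by measurable
  hence An_sets: "An n \<in> sets \<mu>" for n unfolding An_def by (simp add: pred_def)
  have "seq_shift -` A \<inter> space \<mu> = A"
  proof (intro equalityI subsetI)
    fix w assume "w \<in> seq_shift -` A \<inter> space \<mu>"
    then obtain n where n: "\<And>i. i \<ge> n \<Longrightarrow> w (Suc i) = c" by (auto simp: A_def seq_shift_def)
    have "w i = c" if "i \<ge> Suc n" for i using n[of "i - 1"] that by simp
    thus "w \<in> A" by (auto simp: A_def)
  next
    fix w assume "w \<in> A"
    then obtain n where "\<And>i. i \<ge> n \<Longrightarrow> w i = c" by (auto simp: A_def)
    hence "\<And>i. i \<ge> n \<Longrightarrow> w (Suc i) = c" by simp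
    thus "w \<in> seq_shift -` A \<inter> space \<mu>" by (auto simp: A_def seq_shift_def)
  qed
  hence "prob A = 0 \<or> prob A = 1" by (intro T_erg A_sets)
  moreover have "prob A \<noteq> 1"
  proof
    assume A1: "prob A = 1"
    have "A = (\<Union>n. An n)" by (auto simp: A_def An_def)
    moreover have "(\<lambda>n. prob (An n)) \<longlonglongrightarrow> prob (\<Union>n. An n)"
      using An_sets by (intro finite_Lim_measure_incseq) (auto simp: incseq_def An_def)
    ultimately have lim: "(\<lambda>n. prob (An n)) \<longlonglongrightarrow> 1" using A1 by simp
    have "prob (An (Suc n)) \<le> 1 - prob {w. w 1 \<noteq> c}" for n
    proof -
      have "prob {w. w 1 \<noteq> c} = prob {w. (seq_shift ^^ n) w 1 \<noteq> c}" by (rule prob_shift[symmetric]) measurable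
      also have "{w. (seq_shift ^^ n) w 1 \<noteq> c} = {w. w (Suc n) \<noteq> c}" by (simp add: seq_shift_pow)
      finally have 1: "prob {w. w 1 \<noteq> c} = prob {w. w (Suc n) \<noteq> c}" .
      have "Measurable.pred \<mu> (\<lambda>w. w (Suc n) \<noteq> c)" by measurable
      hence s: "{w. w (Suc n) \<noteq> c} \<in> sets \<mu>" by (simp add: pred_def)
      have "prob (An (Suc n)) \<le> prob (space \<mu> - {w. w (Suc n) \<noteq> c})"
      proof (rule finite_measure_mono)
        show "space \<mu> - {w. w (Suc n) \<noteq> c} \<in> sets \<mu>" using s by (rule sets.compl_sets)
      qed (auto simp: An_def)
      also have "\<dots> = 1 - prob {w. w (Suc n) \<noteq> c}" using s by (rule prob_compl)
      finally show ?thesis using 1 by simp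
    qed
    hence "1 \<le> 1 - prob {w. w 1 \<noteq> c}"
      using LIMSEQ_le_const2[OF LIMSEQ_Suc[OF lim]] by blast
    thus False using pos by simp
  qed
  ultimately have "prob A = 0" by simp
  hence "AE w in \<mu>. w \<notin> A" using prob_eq_0[OF A_sets] by simp
  thus ?thesis by eventually_elim (auto simp: A_def)
qed

lemma regular_measurable [measurable]: "Measurable.pred \<mu> regular"
  unfolding regular_def by measurable

lemma AE_regular: "AE w in \<mu>. regular w"
proof -
  have s: "{w. w 1 = c} \<in> sets \<mu>" "{w. w 1 \<noteq> c} \<in> sets \<mu>" for c :: real
  proof -
    have "Measurable.pred \<mu> (\<lambda>w. w 1 = c)" "Measurable.pred \<mu> (\<lambda>w. w 1 \<noteq> c)" by measurable
    thus "{w. w 1 = c} \<in> sets \<mu>" "{w. w 1 \<noteq> c} \<in> sets \<mu>" by (auto simp: pred_def)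
  qed
  have "prob {w. w 1 = 1} \<le> prob {w. w 1 \<noteq> -1}" by (intro finite_measure_mono s) auto
  hence 1: "AE w in \<mu>. \<forall>n. \<exists>i\<ge>n. w i \<noteq> -1" using plus_pos by (intro not_eventually_constant) auto
  have "prob {w. w 1 = -1} \<le> prob {w. w 1 \<noteq> 1}" by (intro finite_measure_mono s) auto
  hence 2: "AE w in \<mu>. \<forall>n. \<exists>i\<ge>n. w i \<noteq> 1" using minus_pos by (intro not_eventually_constant) auto
  from 1 2 pm show ?thesis by eventually_elim (simp add: regular_def, metis)
qed

definition B :: "(nat \<Rightarrow> real) set" where "B = {w. cycle_start w 0}"
definition p :: real where "p = prob B"

lemma cycle_start_measurable [measurable]: "Measurable.pred \<mu> (\<lambda>w. cycle_start w i)"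
  unfolding cycle_start_def by measurable

lemma cycle_start_shift: "cycle_start ((seq_shift ^^ k) w) i = cycle_start w (i + k)"
  by (simp add: cycle_start_def seq_shift_pow)

lemma B_sets [measurable]: "B \<in> sets \<mu>"
  using cycle_start_measurable[of 0] by (simp add: B_def pred_def)

text \<open>Cycle starts occur in almost every environment, hence by stationarity with positive probability at
  the origin.\<close>

lemma p_pos: "p > 0"
proof (rule ccontr)
  assume "\<not> p > 0"
  hence p0: "prob B = 0" using measure_nonneg[of \<mu> B] by (simp add: p_def)
  hence "AE w in \<mu>. \<not> cycle_start w 0" using prob_eq_0[OF B_sets] by (simp add: B_def)
  hence "AE w in \<mu>. \<not> cycle_start ((seq_shift ^^ k) w) 0" for k
    by (rule AE_shift) measurable
  hence "AE w in \<mu>. \<forall>k. \<not> cycle_start w k" by (simp add: cycle_start_shift AE_all_countable)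
  with AE_regular have "AE w in \<mu>. False"
  proof eventually_elim
    case (elim w)
    thus False using regular_ex_switch_to[OF elim(1), of 1 0] by (auto simp: cycle_start_def)
  qed
  thus False by simp
qed

definition hat :: "(nat \<Rightarrow> real) measure" where "hat = uniform_measure \<mu> B"

lemma sets_hat [simp, measurable_cong]: "sets hat = sets \<mu>" and space_hat [simp]: "space hat = UNIV"
  by (simp_all add: hat_def)

sublocale hat: prob_space hat
  unfolding hat_def using p_pos by (intro prob_space_uniform_measure) (auto simp: p_def emeasure_eq_measure)

lemma measure_hat: "A \<in> sets \<mu> \<Longrightarrow> p * measure hat A = prob (B \<inter> A)"
  using p_pos unfolding hat_def p_def by (subst measure_uniform_measure) (auto simp: emeasure_eq_measure)

lemma AE_hat: "AE w in hat. regular w \<and> cycle_start w 0"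
proof -
  have "AE w in \<mu>. w \<in> B \<longrightarrow> regular w \<and> cycle_start w 0" using AE_regular by eventually_elim (auto simp: B_def)
  thus ?thesis unfolding hat_def using p_pos
    by (intro AE_uniform_measureI) (auto simp: p_def emeasure_eq_measure)
qed

lemma switch_time_measurable [measurable]: "(\<lambda>w. switch_time w n) \<in> measurable \<mu> (count_space UNIV)"
proof (induction n)
  case (Suc n)
  note Suc [measurable]
  have eq: "switch_time w (Suc n) = (LEAST i. switch_time w n < i \<and> w (i + 1) \<noteq> w i)" for w
    by (simp add: Inf_nat_def)
  have [measurable]: "Measurable.pred \<mu> (\<lambda>w. switch_time w n < i \<and> w (i + 1) \<noteq> w i)" for i by measurable
  show ?case unfolding eq by measurable
qed simp

text \<open>The link between the conditioned law and stationary probabilities, stated with \<open>switches\<close>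
  because it is the counting function that can be shifted.\<close>

lemma tail_switch_time:
  "p * measure hat {w. n < switch_time w k} = prob {w. cycle_start w 0 \<and> switches w n < k}"
proof -
  have [measurable]: "Measurable.pred \<mu> (\<lambda>w. n < switch_time w k)" "Measurable.pred \<mu> (\<lambda>w. switches w n < k)"
    unfolding switches_def by measurable
  have "{w. n < switch_time w k} \<in> sets \<mu>" using \<open>Measurable.pred \<mu> (\<lambda>w. n < switch_time w k)\<close> by (simp add: pred_def)
  hence "p * measure hat {w. n < switch_time w k} = prob (B \<inter> {w. n < switch_time w k})" by (rule measure_hat)
  also have "\<dots> = prob {w. cycle_start w 0 \<and> switches w n < k}"
  proof (rule finite_measure_eq_AE)
    show "AE w in \<mu>. (w \<in> B \<inter> {w. n < switch_time w k}) = (w \<in> {w. cycle_start w 0 \<and> switches w n < k})"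
      using AE_regular by eventually_elim (auto simp: B_def less_switch_time_iff)
    have "Measurable.pred \<mu> (\<lambda>w. cycle_start w 0 \<and> switches w n < k)" by measurable
    thus "{w. cycle_start w 0 \<and> switches w n < k} \<in> sets \<mu>" by (simp add: pred_def)
    show "B \<inter> {w. n < switch_time w k} \<in> sets \<mu>" using \<open>{w. n < switch_time w k} \<in> sets \<mu>\<close> by simp
  qed
  finally show ?thesis .
qed

section \<open>Long blocks\<close>

lemma switches_measurable [measurable]: "(\<lambda>w. switches w n) \<in> measurable \<mu> (count_space UNIV)"
  unfolding switches_def by measurable

lemma switches_shift_less_measurable [measurable]: "Measurable.pred \<mu> (\<lambda>w. switches ((seq_shift ^^ s) w) n < L)"
proof -
  have "Measurable.pred \<mu> (\<lambda>w. switches w n < L)" by measurable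
  from measurable_compose[OF shift_pow_measurable this] show ?thesis .
qed

lemma sets_Collect [intro]: "Measurable.pred \<mu> Q \<Longrightarrow> {w. Q w} \<in> sets \<mu>"
  by (simp add: pred_def)

lemma switch_time_measurable_hat [measurable]: "(\<lambda>w. switch_time w n) \<in> measurable hat (count_space UNIV)"
  using switch_time_measurable[of n] by (simp cong: measurable_cong_sets)

definition plus_prob :: "nat \<Rightarrow> real" where "plus_prob n = prob {w. \<forall>i\<in>{1..n}. w i = 1}"

lemma plus_prob_shift: "prob {w. \<forall>i\<in>{s<..s+n}. w i = 1} = plus_prob n"
proof -
  have eq: "(\<forall>i\<in>{1..n}. (seq_shift ^^ s) w i = 1) = (\<forall>i\<in>{s<..s+n}. w i = 1)" for w
  proof
    assume H: "\<forall>i\<in>{1..n}. (seq_shift ^^ s) w i = 1"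
    show "\<forall>i\<in>{s<..s+n}. w i = 1"
    proof
      fix i assume i: "i \<in> {s<..s+n}"
      hence "i - s \<in> {1..n}" by auto
      thus "w i = 1" using H[rule_format, of "i - s"] i by (auto simp: seq_shift_pow)
    qed
  qed (auto simp: seq_shift_pow)
  have "plus_prob n = prob {w. \<forall>i\<in>{1..n}. (seq_shift ^^ s) w i = 1}"
    unfolding plus_prob_def by (rule prob_shift[symmetric]) measurable
  thus ?thesis by (simp only: eq)
qed

lemma plus_prob_tendsto_0: "plus_prob \<longlonglongrightarrow> 0"
proof -
  define A where "A n = {w :: nat \<Rightarrow> real. \<forall>i\<in>{1..n}. w i = 1}" for n
  have A: "A n \<in> sets \<mu>" for n unfolding A_def by (rule sets_Collect) measurable
  have "(\<lambda>n. prob (A n)) \<longlonglongrightarrow> prob (\<Inter>n. A n)"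
    using A by (intro finite_Lim_measure_decseq) (auto simp: decseq_def A_def)
  moreover have "AE w in \<mu>. w \<notin> (\<Inter>n. A n)"
    using AE_regular
  proof eventually_elim
    case (elim w)
    then obtain i where "i \<ge> 1" "w i = -1" unfolding regular_def by blast
    hence "w \<notin> A i" by (auto simp: A_def intro!: bexI[of _ i])
    thus ?case by blast
  qed
  hence "prob (\<Inter>n. A n) = 0" using A by (subst prob_eq_0) auto
  ultimately show ?thesis by (simp add: plus_prob_def[abs_def] A_def)
qed

lemma first_block_tail:
  assumes "regular w" "cycle_start w 0" "n \<ge> 1"
  shows "n \<le> switch_time w 1 \<longleftrightarrow> (\<forall>i\<in>{1..n}. w i = 1)"
proof -
  have "n \<le> switch_time w 1 \<longleftrightarrow> n - 1 < switch_time w 1" using assms(3) by auto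
  also have "\<dots> \<longleftrightarrow> switches w (n - 1) = 0" using less_switch_time_iff[OF assms(1), of "n-1" 1] by simp
  also have "\<dots> \<longleftrightarrow> (\<forall>i\<in>{1..n-1}. w (Suc i) = w i)" unfolding switches_def by (subst card_0_eq) auto
  also have "\<dots> \<longleftrightarrow> (\<forall>i\<in>{1..n}. w i = 1)"
  proof
    assume H: "\<forall>i\<in>{1..n-1}. w (Suc i) = w i"
    have "w (Suc j) = 1" if "Suc j \<le> n" for j
      using that by (induction j) (use H assms(2) in \<open>auto simp: cycle_start_def\<close>)
    thus "\<forall>i\<in>{1..n}. w i = 1" by (metis Suc_diff_1 atLeastAtMost_iff less_eq_Suc_le One_nat_def)
  qed auto
  finally show ?thesis .
qed

lemma first_block_prob:
  assumes "n \<ge> 1"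
  shows "p * measure hat {w. n \<le> switch_time w 1} = prob {w. w 0 = -1 \<and> (\<forall>i\<in>{1..n}. w i = 1)}"
proof -
  have "{w. n \<le> switch_time w 1} \<in> sets \<mu>" by (rule sets_Collect) measurable
  hence "p * measure hat {w. n \<le> switch_time w 1} = prob (B \<inter> {w. n \<le> switch_time w 1})" by (rule measure_hat)
  also have "\<dots> = prob {w. w 0 = -1 \<and> (\<forall>i\<in>{1..n}. w i = 1)}"
  proof (rule finite_measure_eq_AE)
    show "AE w in \<mu>. (w \<in> B \<inter> {w. n \<le> switch_time w 1}) = (w \<in> {w. w 0 = -1 \<and> (\<forall>i\<in>{1..n}. w i = 1)})"
      using AE_regular
    proof eventually_elim
      case (elim w)
      show ?case
      proof (cases "cycle_start w 0")
        case True
        thus ?thesis using first_block_tail[OF elim True assms] by (auto simp: B_def cycle_start_def)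
      next
        case False
        thus ?thesis using assms by (auto simp: B_def cycle_start_def)
      qed
    qed
    show "{w. w 0 = -1 \<and> (\<forall>i\<in>{1..n}. w i = 1)} \<in> sets \<mu>" by (rule sets_Collect) measurable
    show "B \<inter> {w. n \<le> switch_time w 1} \<in> sets \<mu>" using \<open>{w. n \<le> switch_time w 1} \<in> sets \<mu>\<close> by simp
  qed
  finally show ?thesis .
qed

text \<open>A stretch of \<open>n\<close> plus sites either extends by one site to the left or is preceded by a minus site,
  that is, by a cycle start whose first block has length at least \<open>n\<close>.\<close>

lemma plus_prob_step:
  assumes "n \<ge> 1"
  shows "plus_prob n = plus_prob (Suc n) + p * measure hat {w. n \<le> switch_time w 1}"
proof -
  have "p * measure hat {w. n \<le> switch_time w 1} = plus_prob n - plus_prob (Suc n)"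
  proof -
    have "plus_prob (Suc n) = prob {w. \<forall>i\<in>{0..n}. w i = 1}"
    proof -
      have "prob {w. \<forall>i\<in>{0..n}. w i = 1} = prob {w. \<forall>i\<in>{0..n}. (seq_shift ^^ 1) w i = 1}"
        by (rule prob_shift[symmetric]) measurable
      also have "{w. \<forall>i\<in>{0..n}. (seq_shift ^^ 1) w i = 1} = {w. \<forall>i\<in>{1..Suc n}. w i = 1}"
      proof (rule Collect_cong, rule iffI)
        fix w :: "nat \<Rightarrow> real"
        assume H: "\<forall>i\<in>{0..n}. (seq_shift ^^ 1) w i = 1"
        show "\<forall>i\<in>{1..Suc n}. w i = 1"
        proof
          fix i assume i: "i \<in> {1..Suc n}"
          hence "i - 1 \<in> {0..n}" by auto
          thus "w i = 1" using H[rule_format, of "i - 1"] i unfolding seq_shift_pow by simp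
        qed
      qed (unfold seq_shift_pow, auto)
      finally show ?thesis by (simp add: plus_prob_def)
    qed
    moreover have "plus_prob n = prob {w. w 0 = -1 \<and> (\<forall>i\<in>{1..n}. w i = 1)} + prob {w. \<forall>i\<in>{0..n}. w i = 1}"
    proof -
      have s: "{w. w 0 = -1 \<and> (\<forall>i\<in>{1..n}. w i = 1)} \<in> sets \<mu>" "{w. \<forall>i\<in>{0..n}. w i = 1} \<in> sets \<mu>" "{w. \<forall>i\<in>{1..n}. w i = 1} \<in> sets \<mu>"
        by (rule sets_Collect; measurable)+
      have disj: "{w. w 0 = -1 \<and> (\<forall>i\<in>{1..n}. w i = 1)} \<inter> {w :: nat \<Rightarrow> real. \<forall>i\<in>{0..n}. w i = 1} = {}"
        by (auto dest: bspec[of _ _ 0])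
      have "plus_prob n = prob ({w. w 0 = -1 \<and> (\<forall>i\<in>{1..n}. w i = 1)} \<union> {w. \<forall>i\<in>{0..n}. w i = 1})"
        unfolding plus_prob_def
      proof (rule finite_measure_eq_AE)
        show "AE w in \<mu>. (w \<in> {w. \<forall>i\<in>{1..n}. w i = 1}) = (w \<in> {w. w 0 = -1 \<and> (\<forall>i\<in>{1..n}. w i = 1)} \<union> {w. \<forall>i\<in>{0..n}. w i = 1})"
          using pm
        proof eventually_elim
          case (elim w)
          have "{0..n} = insert 0 {1..n}" by auto
          thus ?case using elim[rule_format, of 0] by auto
        qed
      qed (use s in auto)
      also have "\<dots> = prob {w. w 0 = -1 \<and> (\<forall>i\<in>{1..n}. w i = 1)} + prob {w. \<forall>i\<in>{0..n}. w i = 1}"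
        by (rule finite_measure_Union[OF s(1,2) disj])
      finally show ?thesis .
    qed
    ultimately show ?thesis using first_block_prob[OF assms] by linarith
  qed
  thus ?thesis by simp
qed

lemma plus_prob_sum:
  assumes "n \<ge> 1"
  shows "plus_prob n = plus_prob (n + m) + p * (\<Sum>k<m. measure hat {w. n + k \<le> switch_time w 1})"
proof (induction m)
  case (Suc m)
  thus ?case using plus_prob_step[of "n + m"] assms by (simp add: algebra_simps)
qed simp

lemma first_block_integrable: "integrable hat (\<lambda>w. real (switch_time w 1))"
proof (rule hat.integrable_nat_of_tail_sum)
  fix m
  have "p * (\<Sum>k<m. measure hat {w. 1 + k \<le> switch_time w 1}) \<le> 1"
    using plus_prob_sum[of 1 m] by (simp add: plus_prob_def) (smt (verit) prob_le_1 measure_nonneg)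
  hence "(\<Sum>k<m. measure hat {w. 1 + k \<le> switch_time w 1}) \<le> 1 / p" using p_pos by (simp add: field_simps)
  thus "(\<Sum>k<m. measure hat {w \<in> space hat. k < switch_time w 1}) \<le> 1 / p" by (simp add: Suc_le_eq)
qed measurable

text \<open>Summing \<open>plus_prob_step\<close> over all longer stretches.\<close>

lemma plus_prob_le_truncated_mean:
  assumes "n \<ge> 1"
  shows "plus_prob n \<le> p * (\<integral>w. real (switch_time w 1) * indicator {w. n \<le> switch_time w 1} w \<partial>hat)"
proof (rule LIMSEQ_le_const2[of "\<lambda>m. plus_prob n - plus_prob (n + m)" "plus_prob n"])
  have "(\<lambda>m. plus_prob (m + n)) \<longlonglongrightarrow> 0" by (rule LIMSEQ_ignore_initial_segment[OF plus_prob_tendsto_0])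
  hence "(\<lambda>m. plus_prob n - plus_prob (n + m)) \<longlonglongrightarrow> plus_prob n - 0" by (intro tendsto_intros) (simp add: add.commute)
  thus "(\<lambda>m. plus_prob n - plus_prob (n + m)) \<longlonglongrightarrow> plus_prob n" by simp
  have "(\<Sum>k<m. measure hat {w. n + k \<le> switch_time w 1}) \<le> (\<integral>w. real (switch_time w 1) * indicator {w. n \<le> switch_time w 1} w \<partial>hat)" for m
  proof -
    have eq: "(n + k \<le> switch_time w 1) = (n - 1 + k < switch_time w 1)" for k w using assms by auto
    have eq0: "(n \<le> switch_time w 1) = (n - 1 < switch_time w 1)" for w using assms by auto
    show ?thesis unfolding eq eq0
      using hat.tail_sum_le_truncated_mean[OF switch_time_measurable_hat first_block_integrable, where n="n-1" and m=m] by simp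
  qed
  hence "p * (\<Sum>k<m. measure hat {w. n + k \<le> switch_time w 1}) \<le> p * (\<integral>w. real (switch_time w 1) * indicator {w. n \<le> switch_time w 1} w \<partial>hat)" for m
    using p_pos by (intro mult_left_mono) auto
  thus "\<exists>N. \<forall>m\<ge>N. plus_prob n - plus_prob (n + m) \<le> p * (\<integral>w. real (switch_time w 1) * indicator {w. n \<le> switch_time w 1} w \<partial>hat)"
  proof (intro exI allI impI)
    fix m :: nat
    show "plus_prob n - plus_prob (n + m) \<le> p * (\<integral>w. real (switch_time w 1) * indicator {w. n \<le> switch_time w 1} w \<partial>hat)"
      using plus_prob_sum[OF assms, of m] \<open>\<And>m. p * (\<Sum>k<m. measure hat {w. n + k \<le> switch_time w 1}) \<le> p * (\<integral>w. real (switch_time w 1) * indicator {w. n \<le> switch_time w 1} w \<partial>hat)\<close>[of m]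
      by linarith
  qed
qed

section \<open>Stretches with few cycles\<close>

definition cycles :: "(nat \<Rightarrow> real) \<Rightarrow> nat \<Rightarrow> nat \<Rightarrow> nat" where
  "cycles w a b = card {i\<in>{a<..b}. cycle_start w i}"

lemma cycles_measurable [measurable]: "(\<lambda>w. cycles w a b) \<in> measurable \<mu> (count_space UNIV)"
  unfolding cycles_def by measurable

lemma cycles_shift: "cycles ((seq_shift ^^ s) w) a b = cycles w (a + s) (b + s)"
proof -
  have "{i\<in>{a + s<..b + s}. cycle_start w i} = (\<lambda>i. i + s) ` {i\<in>{a<..b}. cycle_start w (i + s)}"
  proof (intro equalityI subsetI)
    fix i assume i: "i \<in> {i\<in>{a + s<..b + s}. cycle_start w i}"
    hence "i = (i - s) + s" "i - s \<in> {a<..b}" by auto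
    thus "i \<in> (\<lambda>i. i + s) ` {i\<in>{a<..b}. cycle_start w (i + s)}"
      using i by (intro image_eqI[where x="i - s"]) auto
  qed auto
  thus ?thesis unfolding cycles_def cycle_start_shift by (simp add: card_image)
qed

lemma switches_le_cycles: "regular w \<Longrightarrow> cycle_start w 0 \<Longrightarrow> switches w n \<le> 2 * cycles w 0 n + 1"
  and cycles_le_switches: "regular w \<Longrightarrow> cycle_start w 0 \<Longrightarrow> 2 * cycles w 0 n \<le> switches w n"
proof -
  assume w: "regular w" "cycle_start w 0"
  have "{1..n} = {0<..n}" by auto
  hence "switches w n = 2 * cycles w 0 n + (if w (Suc n) = 1 then 0 else 1)"
    using switches_cycle_starts[of w n] w by (simp add: regular_def cycle_start_def cycles_def)
  thus "switches w n \<le> 2 * cycles w 0 n + 1" "2 * cycles w 0 n \<le> switches w n" by auto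
qed

lemma starts_with_few_later:
  "card {s\<in>{..m}. cycle_start w s \<and> cycles w s m < j} = min j (card {s\<in>{..m}. cycle_start w s})"
proof -
  define C where "C = {s\<in>{..m}. cycle_start w s}"
  have "cycles w s m = card {t\<in>C. s < t}" for s
    unfolding cycles_def C_def by (rule arg_cong[where f=card]) auto
  hence "{s\<in>{..m}. cycle_start w s \<and> cycles w s m < j} = {s\<in>C. card {t\<in>C. s < t} < j}"
    by (auto simp: C_def)
  thus ?thesis using card_few_above[of C j] by (simp add: C_def)
qed

lemma real_card_filter: "finite A \<Longrightarrow> real (card {s\<in>A. Q s}) = (\<Sum>s\<in>A. if Q s then 1 else 0)"
  by (subst sum.inter_filter[symmetric]) simp_all

text \<open>The expected number of cycle starts \<open>s \<le> m\<close> whose \<open>L\<close>-th subsequent switch comes after \<open>m + q\<close>.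
  Shifting every start to the origin turns the expectation into a sum of tail probabilities under the
  conditioned law.\<close>

lemma expected_starts:
  "(\<integral>w. real (card {s\<in>{..m}. cycle_start w s \<and> switches ((seq_shift ^^ s) w) (q + (m - s)) < L}) \<partial>\<mu>)
     = p * (\<Sum>k<Suc m. measure hat {w. q + k < switch_time w L})"
proof -
  define A where "A k w \<longleftrightarrow> cycle_start w 0 \<and> switches w (q + k) < L" for k w
  have A [measurable]: "Measurable.pred \<mu> (A k)" for k unfolding A_def by measurable
  have As: "{w. A (m - s) ((seq_shift ^^ s) w)} \<in> sets \<mu>" for s by (rule sets_Collect) measurable
  have "real (card {s\<in>{..m}. cycle_start w s \<and> switches ((seq_shift ^^ s) w) (q + (m - s)) < L})
     = (\<Sum>s\<le>m. indicator {w. A (m - s) ((seq_shift ^^ s) w)} w)" for w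
    unfolding real_card_filter[OF finite_atMost] by (intro sum.cong) (auto simp: indicator_def A_def cycle_start_shift)
  hence "(\<integral>w. real (card {s\<in>{..m}. cycle_start w s \<and> switches ((seq_shift ^^ s) w) (q + (m - s)) < L}) \<partial>\<mu>)
     = (\<integral>w. (\<Sum>s\<le>m. indicator {w. A (m - s) ((seq_shift ^^ s) w)} w) \<partial>\<mu>)" by simp
  also have "\<dots> = (\<Sum>s\<le>m. prob {w. A (m - s) ((seq_shift ^^ s) w)})"
    using As by (subst Bochner_Integration.integral_sum) (auto simp: emeasure_eq_measure)
  also have "\<dots> = (\<Sum>s\<le>m. p * measure hat {w. q + (m - s) < switch_time w L})"
  proof (rule sum.cong[OF refl])
    fix s
    have "prob {w. A (m - s) ((seq_shift ^^ s) w)} = prob {w. A (m - s) w}" by (rule prob_shift[OF A])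
    thus "prob {w. A (m - s) ((seq_shift ^^ s) w)} = p * measure hat {w. q + (m - s) < switch_time w L}"
      unfolding tail_switch_time A_def .
  qed
  also have "\<dots> = (\<Sum>k\<le>m. p * measure hat {w. q + k < switch_time w L})"
    by (rule sum.reindex_bij_witness[where i="\<lambda>k. m - k" and j="\<lambda>s. m - s"]) auto
  finally show ?thesis by (simp add: sum_distrib_left lessThan_Suc_atMost)
qed

lemma starts_integrable:
  assumes [measurable]: "\<And>s. Measurable.pred \<mu> (Q s)"
  shows "integrable \<mu> (\<lambda>w. real (card {s\<in>{..m::nat}. Q s w}))"
proof (rule integrable_const_bound[of _ "real (m + 1)"])
  show "AE w in \<mu>. norm (real (card {s\<in>{..m}. Q s w})) \<le> real (m + 1)"
  proof (rule AE_I2)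
    fix w
    have "card {s\<in>{..m}. Q s w} \<le> card {..m}" by (intro card_mono) auto
    thus "norm (real (card {s\<in>{..m}. Q s w})) \<le> real (m + 1)" by simp
  qed
qed measurable

text \<open>Among the cycle starts up to \<open>m\<close>, only the last \<open>L + 1\<close> can have fewer than \<open>L\<close> switches between
  them and \<open>m\<close>; so \<open>expected_starts\<close> with \<open>q = 0\<close> bounds the tail sums.\<close>

lemma switch_time_integrable: "integrable hat (\<lambda>w. real (switch_time w L))"
proof (rule hat.integrable_nat_of_tail_sum)
  fix m
  have "(\<Sum>k<Suc m. p * measure hat {w. 0 + k < switch_time w L}) \<le> real (Suc L)"
  proof -
    have "(\<integral>w. real (card {s\<in>{..m}. cycle_start w s \<and> switches ((seq_shift ^^ s) w) (0 + (m - s)) < L}) \<partial>\<mu>) \<le> (\<integral>w. real (Suc L) \<partial>\<mu>)"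
    proof (rule integral_mono_AE)
      show "AE w in \<mu>. real (card {s\<in>{..m}. cycle_start w s \<and> switches ((seq_shift ^^ s) w) (0 + (m - s)) < L}) \<le> real (Suc L)"
        using AE_regular
      proof eventually_elim
        case (elim w)
        have "cycles w s m < Suc L" if "s \<le> m" "cycle_start w s" "switches ((seq_shift ^^ s) w) (0 + (m - s)) < L" for s
          using cycles_le_switches[OF regular_shift[OF elim, of s], of "m - s"] that by (auto simp: cycle_start_shift cycles_shift)
        hence "card {s\<in>{..m}. cycle_start w s \<and> switches ((seq_shift ^^ s) w) (0 + (m - s)) < L}
            \<le> card {s\<in>{..m}. cycle_start w s \<and> cycles w s m < Suc L}" by (intro card_mono) auto
        also have "\<dots> \<le> Suc L" by (subst starts_with_few_later) simp
        finally show ?case by (rule of_nat_mono)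
      qed
      show "integrable \<mu> (\<lambda>w. real (Suc L))" by simp
    qed (rule starts_integrable, measurable)
    hence "p * (\<Sum>k<Suc m. measure hat {w. 0 + k < switch_time w L}) \<le> real (Suc L)"
      unfolding expected_starts by simp
    thus ?thesis by (simp only: sum_distrib_left)
  qed
  hence "p * (\<Sum>k<Suc m. measure hat {w. k < switch_time w L}) \<le> real (Suc L)" by (simp only: sum_distrib_left add_0)
  hence "(\<Sum>k<Suc m. measure hat {w. k < switch_time w L}) \<le> real (Suc L) / p" using p_pos by (simp add: field_simps)
  hence "(\<Sum>k<m. measure hat {w. k < switch_time w L}) \<le> real (Suc L) / p"
    using measure_nonneg[of hat "{w. m < switch_time w L}"] unfolding sum.lessThan_Suc by linarith
  thus "(\<Sum>k<m. measure hat {w \<in> space hat. k < switch_time w L}) \<le> real (Suc L) / p" by simp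
qed measurable

lemma truncated_switch_time_integrable:
  "integrable hat (\<lambda>w. real (switch_time w L) * indicator {w. Q (switch_time w L)} w)"
proof (rule Bochner_Integration.integrable_bound[OF switch_time_integrable[of L]])
  define f where "f n = real n * (if Q n then 1 else 0)" for n
  have "(\<lambda>w. f (switch_time w L)) \<in> borel_measurable hat"
    by (rule measurable_compose[OF switch_time_measurable_hat]) simp
  also have "(\<lambda>w. f (switch_time w L)) = (\<lambda>w. real (switch_time w L) * indicator {w. Q (switch_time w L)} w)"
    by (auto simp: fun_eq_iff f_def indicator_def simp del: switch_time.simps)
  finally show "(\<lambda>w. real (switch_time w L) * indicator {w. Q (switch_time w L)} w) \<in> borel_measurable hat" .
qed (intro AE_I2, simp split: split_indicator del: switch_time.simps)

lemma few_starts_tendsto_0: "(\<lambda>m. prob {w. card {s\<in>{..m}. cycle_start w s} < r}) \<longlonglongrightarrow> 0"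
proof -
  define A where "A m = {w. card {s\<in>{..m}. cycle_start w s} < r}" for m
  have A: "A n \<in> sets \<mu>" for n unfolding A_def by (rule sets_Collect) measurable
  have mono: "card {s\<in>{..m}. cycle_start w s} \<le> card {s\<in>{..n}. cycle_start w s}" if "m \<le> n" for m n w
    using that by (intro card_mono) auto
  have "(\<lambda>n. prob (A n)) \<longlonglongrightarrow> prob (\<Inter>n. A n)"
  proof (rule finite_Lim_measure_decseq)
    have "A n \<subseteq> A m" if mn: "m \<le> n" for m n
    proof
      fix w assume "w \<in> A n"
      hence "card {s\<in>{..n}. cycle_start w s} < r" unfolding A_def by (rule CollectD)
      with mono[OF mn, of w] have "card {s\<in>{..m}. cycle_start w s} < r" by (rule le_less_trans)
      thus "w \<in> A m" unfolding A_def by (simp only: mem_Collect_eq)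
    qed
    thus "decseq A" by (simp add: decseq_def)
  qed (use A in auto)
  moreover have "AE w in \<mu>. w \<notin> (\<Inter>n. A n)"
    using AE_regular
  proof eventually_elim
    case (elim w)
    have "infinite {s. cycle_start w s}"
      unfolding infinite_nat_iff_unbounded_le using regular_ex_switch_to[OF elim, of 1] by (auto simp: cycle_start_def)
    then obtain F where F: "finite F" "card F = r" "F \<subseteq> {s. cycle_start w s}" using infinite_arbitrarily_large by blast
    define m where "m = Max F"
    have m: "\<And>s. s \<in> F \<Longrightarrow> s \<le> m" unfolding m_def by (rule Max_ge[OF F(1)])
    have "card F \<le> card {s\<in>{..m}. cycle_start w s}" using F m by (intro card_mono) auto
    hence "w \<notin> A m" using F by (simp add: A_def)
    thus ?case by blast
  qed
  hence "prob (\<Inter>n. A n) = 0" using A by (subst prob_eq_0) auto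
  ultimately show ?thesis by (simp add: A_def)
qed

lemma prob_cycles_shift: "prob {w. cycles w s (s + q) < r} = prob {w. cycles w 0 q < r}"
proof -
  have "prob {w. cycles w 0 q < r} = prob {w. cycles ((seq_shift ^^ s) w) 0 q < r}"
    by (rule prob_shift[where Q="\<lambda>w. cycles w 0 q < r", symmetric]) measurable
  also have "\<dots> = prob {w. cycles w (0 + s) (q + s) < r}" by (simp only: cycles_shift)
  finally show ?thesis by (simp only: add_0 add.commute[of q s])
qed

text \<open>If the window \<open>{m<..m+q}\<close> has fewer than \<open>r\<close> cycle starts, then each of the last \<open>r\<close> cycle starts
  up to \<open>m\<close> has at most \<open>2 r - 2\<close> cycle starts between it and \<open>m + q\<close>, hence fewer than
  \<open>4 r - 2 \<le> L\<close> switches. So \<open>r\<close> times the probability of such a window is bounded by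
  \<open>expected_starts\<close>, up to the probability \<open>e m\<close> that there are fewer than \<open>r\<close> cycle starts up to
  \<open>m\<close>, which vanishes as \<open>m\<close> grows.\<close>

lemma prob_few_cycles:
  assumes L: "4 * r \<le> L + 2" and r: "r \<ge> 1"
  shows "real r * prob {w. cycles w 0 q < r} \<le> p * (\<integral>w. real (switch_time w L) * indicator {w. q < switch_time w L} w \<partial>hat)"
proof -
  define I where "I = (\<integral>w. real (switch_time w L) * indicator {w. q < switch_time w L} w \<partial>hat)"
  define e where "e m = prob {w. card {s\<in>{..m}. cycle_start w s} < r}" for m
  have main: "real r * (prob {w. cycles w 0 q < r} - e m) \<le> p * I" for m
  proof -
    define Bad where "Bad w \<longleftrightarrow> cycles w m (m + q) < r \<and> \<not> card {s\<in>{..m}. cycle_start w s} < r" for w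
    have [measurable]: "Measurable.pred \<mu> Bad" unfolding Bad_def by measurable
    have s: "{w. Bad w} \<in> sets \<mu>" "{w. cycles w m (m + q) < r} \<in> sets \<mu>" "{w. card {s\<in>{..m}. cycle_start w s} < r} \<in> sets \<mu>"
      by (rule sets_Collect; measurable)+
    have "prob {w. cycles w m (m + q) < r} \<le> prob ({w. Bad w} \<union> {w. card {s\<in>{..m}. cycle_start w s} < r})"
      using s by (intro finite_measure_mono) (auto simp: Bad_def)
    also have "\<dots> \<le> prob {w. Bad w} + e m" unfolding e_def by (rule measure_Un_le) (use s in auto)
    finally have 1: "prob {w. cycles w 0 q < r} - e m \<le> prob {w. Bad w}" by (simp add: prob_cycles_shift)
    have "real r * prob {w. Bad w} = (\<integral>w. real r * indicator {w. Bad w} w \<partial>\<mu>)" using s by simp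
    also have "\<dots> \<le> (\<integral>w. real (card {s\<in>{..m}. cycle_start w s \<and> switches ((seq_shift ^^ s) w) (q + (m - s)) < L}) \<partial>\<mu>)"
    proof (rule integral_mono_AE)
      show "integrable \<mu> (\<lambda>w. real r * indicator {w. Bad w} w)" using s by (auto simp: emeasure_eq_measure)
      show "integrable \<mu> (\<lambda>w. real (card {s\<in>{..m}. cycle_start w s \<and> switches ((seq_shift ^^ s) w) (q + (m - s)) < L}))"
        by (rule starts_integrable) measurable
      show "AE w in \<mu>. real r * indicator {w. Bad w} w \<le> real (card {s\<in>{..m}. cycle_start w s \<and> switches ((seq_shift ^^ s) w) (q + (m - s)) < L})"
        using AE_regular
      proof eventually_elim
        case (elim w)
        show ?case
        proof (cases "Bad w")
          case True
          have "r = card {s\<in>{..m}. cycle_start w s \<and> cycles w s m < r}"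
            using True by (subst starts_with_few_later) (simp add: Bad_def)
          also have "\<dots> \<le> card {s\<in>{..m}. cycle_start w s \<and> switches ((seq_shift ^^ s) w) (q + (m - s)) < L}"
          proof (intro card_mono)
            have "switches ((seq_shift ^^ s) w) (q + (m - s)) < L" if sm: "s \<le> m" "cycle_start w s" "cycles w s m < r" for s
            proof -
              have "{i\<in>{s<..m+q}. cycle_start w i} = {i\<in>{s<..m}. cycle_start w i} \<union> {i\<in>{m<..m+q}. cycle_start w i}" using sm by auto
              hence "cycles w s (m + q) \<le> cycles w s m + cycles w m (m + q)"
                unfolding cycles_def by (metis card_Un_le)
              moreover have "cycles w m (m + q) < r" using True by (simp add: Bad_def)
              ultimately have "cycles w s (m + q) \<le> 2 * r - 2" using sm(3) by linarith
              moreover have "switches ((seq_shift ^^ s) w) (q + (m - s)) \<le> 2 * cycles w s (m + q) + 1"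
                using switches_le_cycles[OF regular_shift[OF elim, of s], of "q + (m - s)"] sm
                by (simp add: cycle_start_shift cycles_shift add.commute add.left_commute)
              ultimately show ?thesis using L r by linarith
            qed
            thus "{s\<in>{..m}. cycle_start w s \<and> cycles w s m < r} \<subseteq> {s\<in>{..m}. cycle_start w s \<and> switches ((seq_shift ^^ s) w) (q + (m - s)) < L}"
              by auto
          qed auto
          finally show ?thesis using True by simp
        qed simp
      qed
    qed
    also have "\<dots> = p * (\<Sum>k<Suc m. measure hat {w. q + k < switch_time w L})" by (rule expected_starts)
    also have "\<dots> \<le> p * I"
      using hat.tail_sum_le_truncated_mean[OF switch_time_measurable_hat[of L] switch_time_integrable[of L], where n=q and m="Suc m"] p_pos
      by (intro mult_left_mono) (auto simp: I_def)
    finally show ?thesis using 1 mult_left_mono[OF 1, of "real r"] by simp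
  qed
  have "(\<lambda>m. real r * (prob {w. cycles w 0 q < r} - e m)) \<longlonglongrightarrow> real r * (prob {w. cycles w 0 q < r} - 0)"
    unfolding e_def by (intro tendsto_intros few_starts_tendsto_0)
  from LIMSEQ_le_const2[OF this] show ?thesis using main by (auto simp: I_def)
qed

end

section \<open>Upper bounds on the free energy\<close>

context pinning begin

definition FE :: "real \<Rightarrow> real \<Rightarrow> real" where
  "FE \<beta> h = lim (\<lambda>N. (\<integral>w. z \<beta> h N w \<partial>\<mu>) / real N)"

text \<open>The definition by the mean is the convenient one for estimates; it agrees with the almost sure
  limit.\<close>

lemma FE_lim: "(\<lambda>N. (\<integral>w. z \<beta> h N w \<partial>\<mu>) / real N) \<longlonglongrightarrow> FE \<beta> h"
  and FE_AE: "AE w in \<mu>. (\<lambda>N. z \<beta> h N w / real N) \<longlonglongrightarrow> FE \<beta> h"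
proof -
  obtain F where F: "(\<lambda>N. (\<integral>w. z \<beta> h N w \<partial>\<mu>) / real N) \<longlonglongrightarrow> F" "AE w in \<mu>. (\<lambda>N. z \<beta> h N w / real N) \<longlonglongrightarrow> F"
    using free_energy_exists by blast
  hence "FE \<beta> h = F" unfolding FE_def by (intro limI)
  thus "(\<lambda>N. (\<integral>w. z \<beta> h N w \<partial>\<mu>) / real N) \<longlonglongrightarrow> FE \<beta> h" "AE w in \<mu>. (\<lambda>N. z \<beta> h N w / real N) \<longlonglongrightarrow> FE \<beta> h"
    using F by auto
qed

lemma FE_le:
  assumes "\<And>N. (\<integral>w. z \<beta> h N w \<partial>\<mu>) \<le> a * real N + b"
  shows "FE \<beta> h \<le> a"
proof (rule LIMSEQ_le[OF FE_lim])
  show "(\<lambda>N. a + b / real N) \<longlonglongrightarrow> a" using tendsto_add[OF tendsto_const[of a] lim_const_over_n[of b]] by simp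
  show "\<exists>N. \<forall>n\<ge>N. (\<integral>w. z \<beta> h n w \<partial>\<mu>) / real n \<le> a + b / real n"
  proof (intro exI[of _ 1] allI impI)
    fix n :: nat assume "n \<ge> 1"
    thus "(\<integral>w. z \<beta> h n w \<partial>\<mu>) / real n \<le> a + b / real n"
      using divide_right_mono[OF assms[of n], of "real n"] by (simp add: add_divide_distrib)
  qed
qed

lemma FE_ge:
  assumes "\<And>N. (\<integral>w. z \<beta> h N w \<partial>\<mu>) \<ge> a * real N - b - c * ln (real N + 1)"
  shows "FE \<beta> h \<ge> a"
proof (rule LIMSEQ_le[OF _ FE_lim])
  have "(\<lambda>N. ln (real N + 1) / real N) \<longlonglongrightarrow> 0" by real_asymp
  from tendsto_diff[OF tendsto_diff[OF tendsto_const[of a] lim_const_over_n[of b]] tendsto_mult[OF tendsto_const[of c] this]]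
  show "(\<lambda>N. a - b / real N - c * (ln (real N + 1) / real N)) \<longlonglongrightarrow> a" by simp
  show "\<exists>N. \<forall>n\<ge>N. a - b / real n - c * (ln (real n + 1) / real n) \<le> (\<integral>w. z \<beta> h n w \<partial>\<mu>) / real n"
  proof (intro exI[of _ 1] allI impI)
    fix n :: nat assume "n \<ge> 1"
    thus "a - b / real n - c * (ln (real n + 1) / real n) \<le> (\<integral>w. z \<beta> h n w \<partial>\<mu>) / real n"
      using divide_right_mono[OF assms[of n], of "real n"] by (simp add: diff_divide_distrib)
  qed
qed

lemma FE_mono:
  assumes "h \<le> h'" shows "FE \<beta> h \<le> FE \<beta> h'"
proof (rule LIMSEQ_le[OF FE_lim FE_lim], intro exI allI impI divide_right_mono integral_mono z_integrable)
  fix n w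
  have "Z (weight \<beta> h w) n 0 \<le> Z (weight \<beta> h' w) n 0"
    using assms by (intro Z_mono) (auto simp: weight_def)
  thus "z \<beta> h n w \<le> z \<beta> h' n w" unfolding z_def by (intro ln_mono Z_weight_pos)
qed auto

lemma FE_nonpos:
  assumes "\<beta> \<ge> 0" "h \<le> - \<beta>" shows "FE \<beta> h \<le> 0"
proof (rule FE_le[where b=0])
  fix N
  have "z \<beta> h N w \<le> 0" for w
  proof -
    have "Z (weight \<beta> h w) N 0 \<le> 1" using assms by (intro Z_le_1) (auto simp: weight_def)
    thus ?thesis unfolding z_def using Z_weight_pos[of \<beta> h w N 0] by simp
  qed
  hence "(\<integral>w. z \<beta> h N w \<partial>\<mu>) \<le> (\<integral>w. 0 \<partial>\<mu>)" by (intro integral_mono z_integrable) auto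
  thus "(\<integral>w. z \<beta> h N w \<partial>\<mu>) \<le> 0 * real N + 0" by simp
qed

lemma z_hom: "z 0 u N w = ln (X (exp u - 1) N)"
  by (simp add: z_def X_def weight_def[abs_def])

lemma FE_hom_le: "u \<ge> 0 \<Longrightarrow> FE 0 u \<le> u"
proof (rule FE_le[where b=0])
  fix N assume "u \<ge> 0"
  hence "z 0 u N w \<le> u * real N" for w using z_bound[of 0 u N w] by simp
  hence "(\<integral>w. z 0 u N w \<partial>\<mu>) \<le> (\<integral>w. u * real N \<partial>\<mu>)" by (intro integral_mono z_integrable) auto
  thus "(\<integral>w. z 0 u N w \<partial>\<mu>) \<le> u * real N + 0" by simp
qed

text \<open>The last bound compares finite volumes with the free energy itself; it is possible because both
  are of order \<open>u^\<nu>\<close>.\<close>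

lemma FE_hom_bounds:
  "\<exists>c>0. \<exists>C>0. c \<le> 1 \<and> (\<forall>u. 0 < u \<longrightarrow> u < 1 \<longrightarrow> c * u powr \<nu> \<le> FE 0 u \<and> FE 0 u \<le> C * u powr \<nu> \<and>
     (\<forall>n. ln (X (exp u - 1) n) \<ge> c * FE 0 u * real n - ln 2))"
proof -
  obtain c where c: "c > 0" "c \<le> 1" "\<And>u n. 0 < u \<Longrightarrow> u < 1 \<Longrightarrow> ln (X (exp u - 1) n) \<ge> c * u powr \<nu> * real n - ln 2"
    using X_log_lower by blast
  obtain C where C: "C > 0" "\<And>u n. 0 < u \<Longrightarrow> u < 1 \<Longrightarrow> ln (X (exp u - 1) n) \<le> C * u powr \<nu> * real n + ln 3"
    using X_log_upper by blast
  define d where "d = min c (c / C)"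
  have d: "d > 0" "d \<le> c" "d * C \<le> c" "d \<le> 1" using c C by (auto simp: d_def min_def field_simps)
  have "d * u powr \<nu> \<le> FE 0 u \<and> FE 0 u \<le> C * u powr \<nu> \<and> (\<forall>n. ln (X (exp u - 1) n) \<ge> d * FE 0 u * real n - ln 2)"
    if u: "0 < u" "u < 1" for u
  proof -
    have int: "(\<integral>w. z 0 u N w \<partial>\<mu>) = ln (X (exp u - 1) N)" for N by (simp add: z_hom)
    have 1: "c * u powr \<nu> \<le> FE 0 u"
      by (rule FE_ge[where b="ln 2" and c=0]) (use c(3)[OF u] int in auto)
    have 2: "FE 0 u \<le> C * u powr \<nu>" 
      by (rule FE_le[where b="ln 3"]) (use C(2)[OF u] int in auto)
    have 3: "d * u powr \<nu> \<le> c * u powr \<nu>" using d by (intro mult_right_mono) auto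
    have "ln (X (exp u - 1) n) \<ge> d * FE 0 u * real n - ln 2" for n
    proof -
      have "d * FE 0 u \<le> d * (C * u powr \<nu>)" using 2 d by (intro mult_left_mono) auto
      also have "\<dots> = (d * C) * u powr \<nu>" by simp
      also have "\<dots> \<le> c * u powr \<nu>" using d by (intro mult_right_mono) auto
      finally have "d * FE 0 u * real n \<le> c * u powr \<nu> * real n" by (intro mult_right_mono) auto
      thus ?thesis using c(3)[OF u, of n] by linarith
    qed
    thus ?thesis using 1 2 3 by auto
  qed
  thus ?thesis using d C(1) by blast
qed

text \<open>The mean of \<open>Z_le_bad_windows\<close>: every window is bad with the same probability \<open>\<pi>\<close>. The hitting
  probability must be bounded below from every starting point \<open>y\<close> in the preceding window.\<close>

lemma FE_upper_windows:
  fixes Bad :: "nat \<Rightarrow> (nat \<Rightarrow> real) \<Rightarrow> bool"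
  assumes u: "0 \<le> u" and b: "0 \<le> \<beta>" and M: "M \<ge> 1"
    and v: "v = exp (2*u) - 1" and pe: "pe = 1 - exp (-4*\<beta>)"
    and vG: "v * G M \<le> 1/2" and h0: "4 * v * G M \<le> pe * h0"
    and hit: "\<And>w k y. \<not> Bad k w \<Longrightarrow> k \<ge> 1 \<Longrightarrow> (k-1)*M < y \<Longrightarrow> y \<le> k*M \<Longrightarrow> 
        hit ({n. w n \<noteq> 1} \<inter> {k*M<..(k+1)*M}) ((k+1)*M) y \<ge> h0"
    and Bad: "\<And>k. Measurable.pred \<mu> (Bad k)" and prob: "\<And>k. prob {w. Bad k w} = \<pi>"
  shows "FE \<beta> (-\<beta> + u) \<le> (4 * v * G M / real M) * \<pi>"
proof -
  define Q where "Q = 4 * v * G M"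
  have Q0: "Q \<ge> 0" using G_ge_1[of M] u by (auto simp: Q_def v)
  have bound: "(\<integral>w. z \<beta> (-\<beta>+u) (2*J*M) w \<partial>\<mu>) / real (2*J*M) \<le> Q / real M * \<pi> + (Q / (2 * real M)) / real J" if J: "J \<ge> 1" for J
  proof -
    have zle: "z \<beta> (-\<beta>+u) (2*J*M) w \<le> Q * (1 + (\<Sum>k\<in>{1..2*J}. indicator {w. Bad k w} w))" for w
    proof -
      have "Z (weight \<beta> (-\<beta>+u) w) (2*J*M) 0 \<le> exp (4 * v * G M * (1 + real (card {k\<in>{1..2*J}. \<not> (\<not> Bad k w)})))"
      proof (rule Z_le_bad_windows[OF u b M v pe vG h0 _ _ J])
        show "weight \<beta> (-\<beta>+u) w n = (if n \<in> {n. w n \<noteq> 1} then exp (u - 2*\<beta>) else exp u)" for n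
          by (simp add: weight_def)
      qed (rule hit)
      hence "z \<beta> (-\<beta>+u) (2*J*M) w \<le> ln (exp (4 * v * G M * (1 + real (card {k\<in>{1..2*J}. \<not> (\<not> Bad k w)}))))"
        unfolding z_def by (intro ln_mono Z_weight_pos)
      also have "\<dots> = Q * (1 + real (card {k\<in>{1..2*J}. Bad k w}))" by (simp add: Q_def)
      also have "real (card {k\<in>{1..2*J}. Bad k w}) = (\<Sum>k\<in>{1..2*J}. indicator {w. Bad k w} w)"
        unfolding real_card_filter[OF finite_atLeastAtMost] by (intro sum.cong) (auto simp: indicator_def)
      finally show ?thesis .
    qed
    have Bs: "{w. Bad k w} \<in> sets \<mu>" for k by (rule sets_Collect[OF Bad])
    have int: "integrable \<mu> (\<lambda>w. \<Sum>k\<in>{1..2*J}. indicator {w. Bad k w} w :: real)"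
      using Bs by (intro Bochner_Integration.integrable_sum) (auto simp: emeasure_eq_measure)
    have "(\<integral>w. z \<beta> (-\<beta>+u) (2*J*M) w \<partial>\<mu>) \<le> (\<integral>w. Q * (1 + (\<Sum>k\<in>{1..2*J}. indicator {w. Bad k w} w)) \<partial>\<mu>)"
      using zle int by (intro integral_mono z_integrable integrable_mult_right Bochner_Integration.integrable_add) auto
    also have "\<dots> = Q * (1 + (\<integral>w. (\<Sum>k\<in>{1..2*J}. indicator {w. Bad k w} w) \<partial>\<mu>))"
      using int by simp
    also have "(\<integral>w. (\<Sum>k\<in>{1..2*J}. indicator {w. Bad k w} w) \<partial>\<mu>) = (\<Sum>k\<in>{1..2*J}. prob {w. Bad k w})"
      using Bs by (subst Bochner_Integration.integral_sum) (auto simp: emeasure_eq_measure)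
    also have "\<dots> = real (2*J) * \<pi>" by (simp add: prob)
    finally have "(\<integral>w. z \<beta> (-\<beta>+u) (2*J*M) w \<partial>\<mu>) / real (2*J*M) \<le> Q * (1 + real (2*J) * \<pi>) / real (2*J*M)"
      by (intro divide_right_mono) auto
    also have "\<dots> = Q / real M * \<pi> + (Q / (2 * real M)) / real J" using M J by (simp add: field_simps)
    finally show ?thesis .
  qed
  have sub: "(\<lambda>J. (\<integral>w. z \<beta> (-\<beta>+u) (2*J*M) w \<partial>\<mu>) / real (2*J*M)) \<longlonglongrightarrow> FE \<beta> (-\<beta>+u)"
  proof (rule filterlim_compose[OF FE_lim])
    show "filterlim (\<lambda>J. 2*J*M) at_top sequentially"
      by (rule filterlim_at_top_mono[OF filterlim_ident]) (use M in \<open>auto intro!: always_eventually\<close>)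
  qed
  have lim: "(\<lambda>J. Q / real M * \<pi> + (Q / (2 * real M)) / real J) \<longlonglongrightarrow> Q / real M * \<pi> + 0"
    by (intro tendsto_intros lim_const_over_n)
  have "FE \<beta> (-\<beta>+u) \<le> Q / real M * \<pi> + 0"
    by (rule LIMSEQ_le[OF sub lim]) (use bound in \<open>auto intro!: exI[of _ 1]\<close>)
  thus ?thesis by (simp add: Q_def)
qed

lemma hit_mono: "D \<subseteq> D' \<Longrightarrow> hit D N x \<le> hit D' N x"
  unfolding hit_def by (intro diff_left_mono Z_mono) auto

lemma penalty_ge: "0 < \<beta> \<Longrightarrow> \<beta> < 1 \<Longrightarrow> 1 - exp (-4*\<beta>) \<ge> (4/5) * (\<beta>::real)"
proof -
  assume b: "0 < \<beta>" "\<beta> < 1"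
  have "exp (4*\<beta>) \<ge> 1 + 4*\<beta>" by simp
  hence "1 / exp (4*\<beta>) \<le> 1 / (1 + 4*\<beta>)" using b by (intro divide_left_mono) auto
  hence "exp (-4*\<beta>) \<le> 1 / (1 + 4*\<beta>)" by (simp add: exp_minus inverse_eq_divide)
  moreover have "1 - 1 / (1 + 4*\<beta>) = 4*\<beta> / (1 + 4*\<beta>)" using b by (simp add: field_simps)
  moreover have "4*\<beta> / (1 + 4*\<beta>) \<ge> 4*\<beta> / 5" using b by (intro divide_left_mono) auto
  ultimately show ?thesis by linarith
qed

lemma G_upper': "\<exists>C\<ge>1. \<forall>n\<ge>1. G n \<le> C * real n powr \<gamma>"
proof -
  obtain C where C: "C > 0" "\<And>n. G n \<le> C * (real n + 1) powr \<gamma>" using G_upper by blast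
  have "G n \<le> (2 * C) * real n powr \<gamma>" if "n \<ge> 1" for n
  proof -
    have "(real n + 1) powr \<gamma> \<le> (2 * real n) powr \<gamma>" using that gamma_pos by (intro powr_mono2) auto
    also have "\<dots> = 2 powr \<gamma> * real n powr \<gamma>" by (simp add: powr_mult)
    also have "\<dots> \<le> 2 powr 1 * real n powr \<gamma>" using gamma_le_1 by (intro mult_right_mono powr_mono) auto
    finally have "C * (real n + 1) powr \<gamma> \<le> C * (2 * real n powr \<gamma>)" using C by (intro mult_left_mono) auto
    thus ?thesis using C(2)[of n] by simp
  qed
  moreover have "2 * C \<ge> 1" using C(2)[of 0] C(1) by (simp add: G_def)
  ultimately show ?thesis by blast
qed

text \<open>For \<open>n\<close> up to \<open>2 M\<close> the mass is bounded below by its order at \<open>M\<close>: the distance between points of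
  two adjacent windows of length \<open>M\<close> is at most \<open>2 M\<close>.\<close>

lemma U_lower_window: "\<exists>c>0. \<exists>d0\<ge>n0. \<forall>M\<ge>1. \<forall>n. d0 \<le> n \<longrightarrow> n \<le> 2 * M \<longrightarrow> U n \<ge> c * real M powr (\<gamma> - 1)"
proof -
  obtain c d0 where c: "c > 0" "d0 \<ge> n0" "\<And>n. n \<ge> d0 \<Longrightarrow> U n \<ge> c * real n powr (\<gamma> - 1)" using U_lower by blast
  have "U n \<ge> (c/2) * real M powr (\<gamma> - 1)" if "M \<ge> 1" "d0 \<le> n" "n \<le> 2 * M" for M n
  proof -
    have "(c/2) * real M powr (\<gamma> - 1) = c * (2 powr (-1) * real M powr (\<gamma> - 1))" by (simp add: powr_minus)
    also have "\<dots> \<le> c * (2 powr (\<gamma> - 1) * real M powr (\<gamma> - 1))"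
      using c gamma_pos by (intro mult_left_mono mult_right_mono powr_mono) auto
    also have "\<dots> = c * (2 * real M) powr (\<gamma> - 1)" by (simp add: powr_mult)
    also have "\<dots> \<le> c * real n powr (\<gamma> - 1)"
      using c that n0_pos gamma_le_1 by (intro mult_left_mono powr_mono2') auto
    also have "\<dots> \<le> U n" using that by (intro c)
    finally show ?thesis .
  qed
  thus ?thesis using c by (intro exI[of _ "c/2"] conjI exI[of _ d0]) auto
qed

text \<open>With windows of length \<open>l\<close> close to \<open>4 c \<beta> / u\<close>, a single minus site beyond the first \<open>d0\<close> sites
  of a window is hit with probability of order \<open>l^(\<gamma> - 1)\<close>, and the gain \<open>v G l\<close> is of order
  \<open>u l l^(\<gamma> - 1)\<close>. Since \<open>u l\<close> is a small multiple of \<open>\<beta>\<close>, the penalty wins. The bound holds for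
  every sufficiently small \<open>c\<close>, so that the same constant can be used in both upper bounds.\<close>

lemma upper_bound_first_block:
  "\<exists>c'>0. \<forall>c. 0 < c \<longrightarrow> c \<le> c' \<longrightarrow> (\<exists>C>0. \<exists>c1>0. \<forall>\<beta> u. 0 < \<beta> \<longrightarrow> \<beta> < 1 \<longrightarrow> 0 < u \<longrightarrow> u < c1 * \<beta> \<longrightarrow>
     FE \<beta> (-\<beta> + u) \<le> C * u * (\<integral>w. real (switch_time w 1) * indicator {w. c * \<beta> / u < real (switch_time w 1)} w \<partial>hat))"
proof -
  obtain CG where CG: "CG \<ge> 1" "\<And>n. n \<ge> 1 \<Longrightarrow> G n \<le> CG * real n powr \<gamma>" using G_upper' by blast
  obtain cU d0 where cU: "cU > 0" "d0 \<ge> n0" "\<And>M n. M \<ge> 1 \<Longrightarrow> d0 \<le> n \<Longrightarrow> n \<le> 2 * M \<Longrightarrow> U n \<ge> cU * real M powr (\<gamma> - 1)"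
    using U_lower_window by blast
  define c' where "c' = cU / (100 * CG)"
  have c'0: "c' > 0" using cU CG by (simp add: c'_def)
  have "\<exists>C>0. \<exists>c1>0. \<forall>\<beta> u. 0 < \<beta> \<longrightarrow> \<beta> < 1 \<longrightarrow> 0 < u \<longrightarrow> u < c1 * \<beta> \<longrightarrow>
     FE \<beta> (-\<beta> + u) \<le> C * u * (\<integral>w. real (switch_time w 1) * indicator {w. c * \<beta> / u < real (switch_time w 1)} w \<partial>hat)"
    if c: "0 < c" "c \<le> c'" for c
  proof -
    \<comment> \<open>The condition \<open>u < c1 \<beta>\<close> makes the window so long that dropping its first \<open>d0\<close> sites leaves more than a quarter of it.\<close>
    define Y0 where "Y0 = 2 * real d0 + 4"
    define c1 where "c1 = min (1/2) (4 * c / Y0)"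
    have c1: "c1 > 0" "c1 \<le> 1/2" "c1 \<le> 4 * c / Y0" using c by (auto simp: c1_def Y0_def)
    have "FE \<beta> (-\<beta> + u) \<le> (16 * CG) * u * (\<integral>w. real (switch_time w 1) * indicator {w. c * \<beta> / u < real (switch_time w 1)} w \<partial>hat)"
      if b: "0 < \<beta>" "\<beta> < 1" and u: "0 < u" "u < c1 * \<beta>" for \<beta> u
    proof -
      define y where "y = 4 * c * \<beta> / u"
      have yY: "y \<ge> Y0"
      proof -
        have "u * Y0 \<le> (c1 * \<beta>) * Y0" using u by (intro mult_right_mono) (auto simp: Y0_def)
        also have "\<dots> \<le> (4 * c / Y0 * \<beta>) * Y0" using c1 b by (intro mult_right_mono) (auto simp: Y0_def)
        also have "\<dots> = 4 * c * \<beta>" by (simp add: Y0_def)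
        finally show ?thesis using u by (simp add: y_def field_simps)
      qed
      define l where "l = nat \<lfloor>y\<rfloor>"
      have y0: "y \<ge> 0" using yY by (simp add: Y0_def)
      have l: "real l \<le> y" "real l > y - 1" unfolding l_def using y0 by linarith+
      have ld: "l \<ge> d0 + 1" "l \<ge> 1" "real (l - d0) > c * \<beta> / u"
      proof -
        have "real l > real d0 + 1" using l yY unfolding Y0_def by linarith
        thus "l \<ge> d0 + 1" "l \<ge> 1" by linarith+
        have "c * \<beta> / u = y / 4" by (simp add: y_def)
        moreover have "real (l - d0) = real l - real d0" using \<open>l \<ge> d0 + 1\<close> by simp
        ultimately show "real (l - d0) > c * \<beta> / u" using l yY unfolding Y0_def by linarith
      qed
      define v where "v = exp (2*u) - 1"
      have "u \<le> 1/2" using u c1 b mult_mono[of c1 "1/2" \<beta> 1] by simp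
      hence v: "v \<ge> 0" "v \<le> 4 * u" using exp_minus1_bounds[of "2*u"] u by (auto simp: v_def)
      define pe where "pe = 1 - exp (-4*\<beta>)"
      have pe: "pe \<ge> (4/5) * \<beta>" "pe \<le> 1" using penalty_ge[OF b] by (auto simp: pe_def)
      define h0 where "h0 = cU * real l powr (\<gamma> - 1)"
      have h00: "h0 \<ge> 0" using cU by (simp add: h0_def)
      have h01: "h0 \<le> 1" using cU(3)[of l "2*l"] U_le_1[of "2*l"] ld by (simp add: h0_def)
      have vG: "4 * v * G l \<le> 16 * CG * u * real l powr \<gamma>"
      proof -
        have "4 * v * G l \<le> (4 * (4 * u)) * (CG * real l powr \<gamma>)"
          using v u CG(2)[OF ld(2)] G_ge_1[of l] by (intro mult_mono) auto
        thus ?thesis by (simp add: mult.assoc mult.left_commute)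
      qed
      have lp: "real l powr \<gamma> = real l * real l powr (\<gamma> - 1)" using ld powr_mult_base[of "real l" "\<gamma> - 1"] by simp
      have main: "4 * v * G l \<le> pe * h0"
      proof -
        have "u * real l \<le> 4 * c * \<beta>" using l(1) u by (simp add: y_def field_simps)
        also have "\<dots> \<le> 4 * c' * \<beta>" using c b by simp
        finally have "16 * CG * (u * real l) \<le> 16 * CG * (4 * c' * \<beta>)" using CG by (intro mult_left_mono) auto
        also have "\<dots> = (64/100) * cU * \<beta>" using CG by (simp add: c'_def)
        also have "\<dots> \<le> ((4/5) * \<beta>) * cU" using b cU by simp
        also have "\<dots> \<le> pe * cU" using pe cU by (intro mult_right_mono) auto
        finally have "16 * CG * (u * real l) * real l powr (\<gamma> - 1) \<le> pe * cU * real l powr (\<gamma> - 1)" by (intro mult_right_mono) auto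
        thus ?thesis using vG by (simp add: lp h0_def mult.assoc)
      qed
      have "FE \<beta> (-\<beta> + u) \<le> (4 * v * G l / real l) * plus_prob (l - d0)"
      proof (rule FE_upper_windows[OF _ _ ld(2) v_def pe_def _ main])
        have "pe * h0 \<le> 1 * 1" using pe h00 h01 by (intro mult_mono) auto
        thus "v * G l \<le> 1/2" using main by linarith
        show "Measurable.pred \<mu> (\<lambda>w. \<forall>i\<in>{k*l+d0<..k*l+d0+(l-d0)}. w i = 1)" for k by measurable
        show "prob {w. \<forall>i\<in>{k*l+d0<..k*l+d0+(l-d0)}. w i = 1} = plus_prob (l - d0)" for k by (rule plus_prob_shift)
        fix w :: "nat \<Rightarrow> real" and k x
        assume H: "\<not> (\<forall>i\<in>{k*l+d0<..k*l+d0+(l-d0)}. w i = 1)" "k \<ge> 1" "(k-1)*l < x" "x \<le> k*l"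
        then obtain i where i: "k*l+d0 < i" "i \<le> k*l+d0+(l-d0)" "w i \<noteq> 1" by auto
        have kl: "k * l \<le> (k-1)*l + l" using H(2) by (cases k) auto
        have ix: "d0 \<le> i - x" "i - x \<le> 2 * l" "i \<le> (k+1)*l" "k*l < i" "x < i" using i H(3,4) kl ld(1) by auto
        have "h0 \<le> U (i - x)" unfolding h0_def using ix ld by (intro cU) auto
        also have "\<dots> = (\<Sum>m\<in>{i} \<inter> {x<..(k+1)*l}. U (m - x))" using ix by simp
        also have "\<dots> \<le> 1 * hit {i} ((k+1)*l) x" 
          by (rule hit_lower) (use H ix in auto)
        also have "\<dots> \<le> hit ({n. w n \<noteq> 1} \<inter> {k*l<..(k+1)*l}) ((k+1)*l) x"
          using hit_mono[of "{i}"] i ix by simp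
        finally show "h0 \<le> hit ({n. w n \<noteq> 1} \<inter> {k*l<..(k+1)*l}) ((k+1)*l) x" .
      qed (use b u in auto)
      also have "\<dots> \<le> (16 * CG * u) * (p * (\<integral>w. real (switch_time w 1) * indicator {w. l - d0 \<le> switch_time w 1} w \<partial>hat))"
      proof (intro mult_mono plus_prob_le_truncated_mean)
        have "4 * v * G l / real l \<le> 16 * CG * u * real l powr \<gamma> / real l" using vG by (intro divide_right_mono) auto
        also have "\<dots> = 16 * CG * u * real l powr (\<gamma> - 1)" using ld by (simp add: lp)
        also have "\<dots> \<le> 16 * CG * u * real l powr 0" using CG u ld gamma_le_1 by (intro mult_left_mono powr_mono) auto
        finally show "4 * v * G l / real l \<le> 16 * CG * u" using ld by simp
        show "0 \<le> plus_prob (l - d0)" by (simp add: plus_prob_def)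
      qed (use ld CG u in auto)
      also have "\<dots> \<le> (16 * CG * u) * (1 * (\<integral>w. real (switch_time w 1) * indicator {w. c * \<beta> / u < real (switch_time w 1)} w \<partial>hat))"
      proof -
        have "(\<integral>w. real (switch_time w 1) * indicator {w. l - d0 \<le> switch_time w 1} w \<partial>hat)
            \<le> (\<integral>w. real (switch_time w 1) * indicator {w. c * \<beta> / u < real (switch_time w 1)} w \<partial>hat)"
        proof (rule integral_mono)
          show "integrable hat (\<lambda>w. real (switch_time w 1) * indicator {w. l - d0 \<le> switch_time w 1} w)"
            by (rule truncated_switch_time_integrable)
          show "integrable hat (\<lambda>w. real (switch_time w 1) * indicator {w. c * \<beta> / u < real (switch_time w 1)} w)"
            by (rule truncated_switch_time_integrable)
          fix w :: "nat \<Rightarrow> real"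
          have "c * \<beta> / u < real (switch_time w 1)" if "l - d0 \<le> switch_time w 1"
            using ld(3) of_nat_mono[OF that, where 'a=real] by linarith
          thus "real (switch_time w 1) * indicator {w. l - d0 \<le> switch_time w 1} w \<le> real (switch_time w 1) * indicator {w. c * \<beta> / u < real (switch_time w 1)} w"
            by (simp split: split_indicator del: switch_time.simps)
        qed
        moreover have "0 \<le> (\<integral>w. real (switch_time w 1) * indicator {w. l - d0 \<le> switch_time w 1} w \<partial>hat)"
          by (intro integral_nonneg_AE AE_I2) (simp del: switch_time.simps)
        moreover have "p \<le> 1" by (simp add: p_def)
        ultimately show ?thesis using CG u by (intro mult_left_mono mult_mono) auto
      qed
      finally show ?thesis by simp
    qed
    moreover have "16 * CG > 0" using CG by simp
    ultimately show ?thesis using c1(1) by blast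
  qed
  thus ?thesis using c'0 by blast
qed

text \<open>With windows of length \<open>M\<close> close to \<open>(4 \<kappa> + 1) L\<close>, a window with at least \<open>r = L div 4\<close> cycle starts
  contains so many minus sites that it is hit with probability bounded below: the expected number of
  visits is at least of order \<open>L M^(\<gamma> - 1)\<close>, and given one visit there are at most \<open>G M\<close>, which is
  of order \<open>M^\<gamma>\<close>. By the choice of \<open>L\<close>, \<open>u M^\<gamma>\<close> is a small multiple of \<open>\<beta>\<close>, hence the gain is
  below the penalty. The application has \<open>\<kappa> = E[T_2]\<close>.\<close>

lemma upper_bound_cycles:
  assumes \<kappa>: "\<kappa> \<ge> 0"
  shows "\<exists>c'>0. \<forall>c. 0 < c \<longrightarrow> c \<le> c' \<longrightarrow> (\<exists>C>0. \<exists>c1>0. \<forall>\<beta> u L. 0 < \<beta> \<longrightarrow> \<beta> < 1 \<longrightarrow> 0 < u \<longrightarrow> u < c1 * \<beta> \<longrightarrow>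
     L = nat \<lfloor>c * \<beta> powr \<nu> / FE 0 u\<rfloor> \<longrightarrow>
     FE \<beta> (-\<beta> + u) \<le> C * \<beta> powr (1 - \<nu>) * FE 0 u *
        (\<integral>w. real (switch_time w L) / real L * indicator {w. 4 * \<kappa> * real L < real (switch_time w L)} w \<partial>hat))"
proof -
  obtain CG where CG: "CG \<ge> 1" "\<And>n. n \<ge> 1 \<Longrightarrow> G n \<le> CG * real n powr \<gamma>" using G_upper' by blast
  obtain cU d0 where cU: "cU > 0" "d0 \<ge> n0" "\<And>M n. M \<ge> 1 \<Longrightarrow> d0 \<le> n \<Longrightarrow> n \<le> 2 * M \<Longrightarrow> U n \<ge> cU * real M powr (\<gamma> - 1)"
    using U_lower_window by blast
  obtain cF CF where F: "cF > 0" "CF > 0" "\<And>u. 0 < u \<Longrightarrow> u < 1 \<Longrightarrow> cF * u powr \<nu> \<le> FE 0 u" "\<And>u. 0 < u \<Longrightarrow> u < 1 \<Longrightarrow> FE 0 u \<le> CF * u powr \<nu>"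
    using FE_hom_bounds by blast
  \<comment> \<open>\<open>K0 L\<close> bounds the window length, \<open>h0\<close> the hitting probability, and \<open>c'\<close> is such that \<open>M^\<gamma> \<le> h0 \<beta> / (20 CG u)\<close>.\<close>
  define K0 where "K0 = 4 * \<kappa> + 2"
  have K0: "K0 \<ge> 2" using \<kappa> by (simp add: K0_def)
  define h0 where "h0 = min 1 (cU / (16 * CG * K0))"
  have h0: "h0 > 0" "h0 \<le> 1" "h0 \<le> cU / (16 * CG * K0)" using cU CG K0 by (auto simp: h0_def)
  define c' where "c' = cF / K0 * (h0 / (20 * CG)) powr \<nu>"
  have c'0: "c' > 0" using F h0 CG K0 by (simp add: c'_def)
  have "\<exists>C>0. \<exists>c1>0. \<forall>\<beta> u L. 0 < \<beta> \<longrightarrow> \<beta> < 1 \<longrightarrow> 0 < u \<longrightarrow> u < c1 * \<beta> \<longrightarrow>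
     L = nat \<lfloor>c * \<beta> powr \<nu> / FE 0 u\<rfloor> \<longrightarrow>
     FE \<beta> (-\<beta> + u) \<le> C * \<beta> powr (1 - \<nu>) * FE 0 u *
        (\<integral>w. real (switch_time w L) / real L * indicator {w. 4 * \<kappa> * real L < real (switch_time w L)} w \<partial>hat)"
    if c: "0 < c" "c \<le> c'" for c
  proof -
    define Y0 where "Y0 = 6 * real d0 + 8"
    define c1 where "c1 = min (1/2) (c / (CF * Y0))"
    have Y0: "Y0 \<ge> 8" by (simp add: Y0_def)
    have c1: "c1 \<le> 1/2" "c1 \<le> c / (CF * Y0)" "c1 > 0"
      using c F(2) Y0 unfolding c1_def by (simp_all only: min.cobounded1 min.cobounded2) simp
    have "FE \<beta> (-\<beta> + u) \<le> (32 / c) * \<beta> powr (1 - \<nu>) * FE 0 u *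
        (\<integral>w. real (switch_time w L) / real L * indicator {w. 4 * \<kappa> * real L < real (switch_time w L)} w \<partial>hat)"
      if b: "0 < \<beta>" "\<beta> < 1" and u: "0 < u" "u < c1 * \<beta>" and L_def: "L = nat \<lfloor>c * \<beta> powr \<nu> / FE 0 u\<rfloor>" for \<beta> u L
    proof -
      have u2: "u \<le> 1/2" using u c1 b mult_mono[of c1 "1/2" \<beta> 1] by simp
      hence u1: "u < 1" by simp
      define \<Phi> where "\<Phi> = FE 0 u"
      have \<Phi>: "cF * u powr \<nu> \<le> \<Phi>" "\<Phi> \<le> CF * u powr \<nu>" using F(3,4)[OF u(1) u1] by (auto simp: \<Phi>_def)
      have \<Phi>0: "\<Phi> > 0" by (rule less_le_trans[OF _ \<Phi>(1)]) (use F u in simp)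
      define y where "y = c * \<beta> powr \<nu> / \<Phi>"
      have yY: "y \<ge> Y0"
      proof -
        have "u powr \<nu> \<le> (c1 * \<beta>) powr \<nu>" using u nu_ge_1 by (intro powr_mono2) auto
        also have "\<dots> = c1 powr \<nu> * \<beta> powr \<nu>" using c1 b by (simp add: powr_mult)
        also have "\<dots> \<le> c1 powr 1 * \<beta> powr \<nu>"
        proof (intro mult_right_mono)
          show "c1 powr \<nu> \<le> c1 powr 1" using c1 nu_ge_1 by (intro powr_mono') auto
        qed auto
        also have "\<dots> \<le> c / (CF * Y0) * \<beta> powr \<nu>" using c1 by (intro mult_right_mono) auto
        finally have "CF * u powr \<nu> \<le> CF * (c / (CF * Y0) * \<beta> powr \<nu>)" using F by (intro mult_left_mono) auto
        also have "\<dots> = c * \<beta> powr \<nu> / Y0" using F Y0 by simp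
        finally have "\<Phi> \<le> c * \<beta> powr \<nu> / Y0" using \<Phi> by linarith
        thus ?thesis using \<Phi>0 Y0 by (simp add: y_def field_simps)
      qed
      have Ly: "L = nat \<lfloor>y\<rfloor>" by (simp add: L_def y_def \<Phi>_def)
      have L: "real L \<le> y" "real L > y - 1" unfolding Ly using yY Y0 by linarith+
      have LY: "real L > 6 * real d0 + 7" using L yY unfolding Y0_def by linarith
      hence L1: "L \<ge> 1" "L \<ge> 4" by linarith+
      define r where "r = L div 4"
      have r: "4 * r \<le> L + 2" "r \<ge> 1" using L1 by (auto simp: r_def)
      have rd: "real (r - d0) \<ge> real L / 16"
      proof -
        have "L \<le> 4 * r + 3" by (simp add: r_def)
        hence "real L \<le> real (4 * r + 3)" by (rule of_nat_mono)
        also have "\<dots> = 4 * real r + 3" by simp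
        finally have "real L \<le> 4 * real r + 3" .
        moreover have "real (r - d0) \<ge> real r - real d0" by (cases "d0 \<le> r") (auto simp: of_nat_diff)
        ultimately show ?thesis using LY by linarith
      qed
      define M where "M = nat \<lceil>(4 * \<kappa> + 1) * real L\<rceil>"
      have M0: "(4 * \<kappa> + 1) * real L \<ge> 0" using \<kappa> by simp
      have M: "real M \<ge> (4 * \<kappa> + 1) * real L" "real M \<le> (4 * \<kappa> + 1) * real L + 1" unfolding M_def using M0 by linarith+
      have Mb: "real M \<ge> real L" "real M \<le> K0 * real L" "real M \<ge> 4 * \<kappa> * real L"
      proof -
        have "(4 * \<kappa> + 1) * real L = 4 * (\<kappa> * real L) + real L" "K0 * real L = 4 * (\<kappa> * real L) + 2 * real L"
          "4 * \<kappa> * real L = 4 * (\<kappa> * real L)" by (simp_all add: K0_def algebra_simps)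
        moreover have "\<kappa> * real L \<ge> 0" using \<kappa> by simp
        moreover have "real L \<ge> 1" using L1 by simp
        ultimately show "real M \<ge> real L" "real M \<le> K0 * real L" "real M \<ge> 4 * \<kappa> * real L" using M by linarith+
      qed
      have M1: "M \<ge> 1" using Mb(1) L1 by linarith
      define v where "v = exp (2*u) - 1"
      have v: "v \<ge> 0" "v \<le> 4 * u" using exp_minus1_bounds[of "2*u"] u u2 by (auto simp: v_def)
      define pe where "pe = 1 - exp (-4*\<beta>)"
      have pe: "pe \<ge> (4/5) * \<beta>" "pe \<le> 1" using penalty_ge[OF b] by (auto simp: pe_def)
      have Mg: "real M powr \<gamma> \<le> h0 / (20 * CG) * (\<beta> / u)"
      proof -
        have "real M \<le> K0 * y" using Mb(2) L(1) K0 mult_left_mono[OF L(1), of K0] by linarith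
        also have "\<dots> \<le> K0 * (c' * \<beta> powr \<nu> / (cF * u powr \<nu>))"
          unfolding y_def using K0 c \<Phi>(1) \<Phi>0 F(1) u b c'0 by (intro mult_left_mono frac_le mult_right_mono) auto
        also have "\<dots> = (h0 / (20 * CG)) powr \<nu> * (\<beta> powr \<nu> / u powr \<nu>)" using K0 F by (simp add: c'_def)
        also have "\<dots> = (h0 / (20 * CG) * (\<beta> / u)) powr \<nu>"
          using h0 CG b u powr_mult[of "h0 / (20 * CG)" "\<beta> / u" \<nu>] powr_divide[of \<beta> u \<nu>] by simp
        finally have "real M powr \<gamma> \<le> ((h0 / (20 * CG) * (\<beta> / u)) powr \<nu>) powr \<gamma>"
          using gamma_pos by (intro powr_mono2) auto
        also have "\<dots> = h0 / (20 * CG) * (\<beta> / u)" using h0 CG b u by (simp add: powr_powr nu_gamma)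
        finally show ?thesis .
      qed
      have vG: "4 * v * G M \<le> (4/5) * \<beta> * h0"
      proof -
        have "4 * v * G M \<le> (4 * (4 * u)) * (CG * real M powr \<gamma>)"
          using v u CG(2)[OF M1] G_ge_1[of M] by (intro mult_mono) auto
        also have "\<dots> \<le> (4 * (4 * u)) * (CG * (h0 / (20 * CG) * (\<beta> / u)))"
          using Mg u CG by (intro mult_left_mono) auto
        also have "\<dots> = (4/5) * \<beta> * h0" using u CG by simp
        finally show ?thesis .
      qed
      have vG1: "4 * v * G M \<le> pe * h0"
        by (rule order_trans[OF vG]) (use pe h0 in \<open>intro mult_right_mono\<close>, auto)
      have vG2: "4 * v * G M \<le> \<beta>" 
      proof -
        have "(4/5) * \<beta> * h0 \<le> (4/5) * \<beta> * 1" using b h0 by (intro mult_left_mono) auto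
        thus ?thesis using vG b by linarith
      qed
      define \<pi> where "\<pi> = prob {w. cycles w 0 M < r}"
      have "FE \<beta> (-\<beta> + u) \<le> (4 * v * G M / real M) * \<pi>"
      proof (rule FE_upper_windows[OF _ _ M1 v_def pe_def _ vG1])
        show "v * G M \<le> 1/2" using vG2 b by linarith
        show "Measurable.pred \<mu> (\<lambda>w. cycles w (k * M) (k * M + M) < r)" for k by measurable
        show "prob {w. cycles w (k * M) (k * M + M) < r} = \<pi>" for k unfolding \<pi>_def by (rule prob_cycles_shift)
        fix w :: "nat \<Rightarrow> real" and k x
        assume H: "\<not> cycles w (k * M) (k * M + M) < r" "k \<ge> 1" "(k-1)*M < x" "x \<le> k*M"
        have kM: "k * M \<le> (k-1)*M + M" using H(2) by (cases k) auto
        \<comment> \<open>The first \<open>d0\<close> sites are dropped, since the lower bound on \<open>U\<close> starts at \<open>d0\<close>.\<close>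
        define D where "D = {i\<in>{k*M+d0<..k*M+M}. cycle_start w i}"
        have Dc: "card D \<ge> r - d0"
        proof -
          have "{i\<in>{k*M<..k*M+M}. cycle_start w i} \<subseteq> D \<union> {k*M<..k*M+d0}" by (auto simp: D_def)
          hence "cycles w (k * M) (k * M + M) \<le> card (D \<union> {k*M<..k*M+d0})"
            unfolding cycles_def by (intro card_mono) (auto simp: D_def)
          also have "\<dots> \<le> card D + card {k*M<..k*M+d0}" by (rule card_Un_le)
          finally show ?thesis using H(1) by simp
        qed
        have finD: "finite D" by (simp add: D_def)
        have Dx: "D \<inter> {x<..(k+1)*M} = D" using H(4) by (auto simp: D_def)
        have "(real L / 16) * (cU * real M powr (\<gamma> - 1)) \<le> real (card D) * (cU * real M powr (\<gamma> - 1))"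
          using rd Dc cU by (intro mult_right_mono) auto
        also have "\<dots> = (\<Sum>m\<in>D. cU * real M powr (\<gamma> - 1))" by simp
        also have "\<dots> \<le> (\<Sum>m\<in>D \<inter> {x<..(k+1)*M}. U (m - x))"
          unfolding Dx
        proof (rule sum_mono)
          fix m assume m: "m \<in> D"
          have "d0 \<le> m - x" "m - x \<le> 2 * M" using m H(3,4) kM by (auto simp: D_def)
          thus "cU * real M powr (\<gamma> - 1) \<le> U (m - x)" by (intro cU M1)
        qed
        also have "\<dots> \<le> G M * hit D ((k+1)*M) x"
        proof (rule hit_lower)
          fix m assume m: "m \<in> D"
          have "(\<Sum>n\<in>D \<inter> {m..(k+1)*M}. U (n - m)) = (\<Sum>j\<in>(\<lambda>n. n - m) ` (D \<inter> {m..(k+1)*M}). U j)"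
            by (subst sum.reindex) (auto simp: inj_on_def)
          also have "\<dots> \<le> (\<Sum>j\<le>M. U j)"
            using m by (intro sum_mono2 U_nonneg) (auto simp: D_def)
          finally show "(\<Sum>n\<in>D \<inter> {m..(k+1)*M}. U (n - m)) \<le> G M" by (simp add: G_def)
        qed (use H(4) in auto)
        also have "\<dots> \<le> (CG * real M powr \<gamma>) * hit D ((k+1)*M) x"
          using CG(2)[OF M1] by (intro mult_right_mono hit_nonneg)
        finally have "(real L / 16) * (cU * real M powr (\<gamma> - 1)) \<le> (CG * real M powr \<gamma>) * hit D ((k+1)*M) x" .
        moreover have "real M powr \<gamma> = real M * real M powr (\<gamma> - 1)" using M1 powr_mult_base[of "real M" "\<gamma> - 1"] by simp
        ultimately have "((real L / 16) * cU) * real M powr (\<gamma> - 1) \<le> (CG * real M * hit D ((k+1)*M) x) * real M powr (\<gamma> - 1)"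
          by (simp add: algebra_simps)
        moreover have "real M powr (\<gamma> - 1) > 0" using M1 by simp
        ultimately have "(real L / 16) * cU \<le> CG * real M * hit D ((k+1)*M) x" by (rule mult_right_le_imp_le)
        also have "\<dots> \<le> CG * (K0 * real L) * hit D ((k+1)*M) x"
          using Mb CG by (intro mult_right_mono mult_left_mono hit_nonneg) auto
        finally have "real L * (cU / 16) \<le> real L * (CG * K0 * hit D ((k+1)*M) x)" by (simp add: algebra_simps)
        hence "cU / 16 \<le> CG * K0 * hit D ((k+1)*M) x" using L1 by (simp add: mult_le_cancel_left_pos)
        hence "cU / (16 * CG * K0) \<le> hit D ((k+1)*M) x" using CG K0 by (simp add: field_simps)
        hence "h0 \<le> hit D ((k+1)*M) x" using h0 by linarith
        also have "\<dots> \<le> hit ({n. w n \<noteq> 1} \<inter> {k*M<..(k+1)*M}) ((k+1)*M) x"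
          by (rule hit_mono) (auto simp: D_def cycle_start_def)
        finally show "h0 \<le> hit ({n. w n \<noteq> 1} \<inter> {k*M<..(k+1)*M}) ((k+1)*M) x" .
      qed (use b u in auto)
      also have "\<dots> \<le> (\<beta> / real M) * \<pi>"
        using vG2 M1 by (intro mult_right_mono divide_right_mono) (auto simp: \<pi>_def)
      also have "\<dots> \<le> (\<beta> / real L) * \<pi>"
        using Mb L1 b by (intro mult_right_mono divide_left_mono) (auto simp: \<pi>_def)
      finally have 1: "FE \<beta> (-\<beta> + u) \<le> (\<beta> / real L) * \<pi>" .
      define I where "I = (\<integral>w. real (switch_time w L) * indicator {w. 4 * \<kappa> * real L < real (switch_time w L)} w \<partial>hat)"
      have I0: "I \<ge> 0" unfolding I_def by (intro integral_nonneg_AE AE_I2) (simp del: switch_time.simps)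
      have "real r * \<pi> \<le> p * (\<integral>w. real (switch_time w L) * indicator {w. M < switch_time w L} w \<partial>hat)"
        unfolding \<pi>_def by (rule prob_few_cycles[OF r])
      also have "\<dots> \<le> 1 * I"
      proof -
        have "(\<integral>w. real (switch_time w L) * indicator {w. M < switch_time w L} w \<partial>hat) \<le> I"
          unfolding I_def
        proof (rule integral_mono)
          show "integrable hat (\<lambda>w. real (switch_time w L) * indicator {w. M < switch_time w L} w)"
            by (rule truncated_switch_time_integrable)
          show "integrable hat (\<lambda>w. real (switch_time w L) * indicator {w. 4 * \<kappa> * real L < real (switch_time w L)} w)"
            by (rule truncated_switch_time_integrable)
          fix w :: "nat \<Rightarrow> real"
          have "4 * \<kappa> * real L < real (switch_time w L)" if "M < switch_time w L"
            using Mb(3) that by linarith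
          thus "real (switch_time w L) * indicator {w. M < switch_time w L} w \<le> real (switch_time w L) * indicator {w. 4 * \<kappa> * real L < real (switch_time w L)} w"
            by (simp split: split_indicator del: switch_time.simps)
        qed
        moreover have "0 \<le> (\<integral>w. real (switch_time w L) * indicator {w. M < switch_time w L} w \<partial>hat)"
          by (intro integral_nonneg_AE AE_I2) (simp del: switch_time.simps)
        moreover have "p \<le> 1" by (simp add: p_def)
        ultimately show ?thesis by (intro mult_mono) auto
      qed
      finally have rI: "real r * \<pi> \<le> I" by simp
      have pi: "\<pi> \<le> 16 / real L * I"
      proof -
        have "real L / 16 * \<pi> \<le> real r * \<pi>" using rd by (intro mult_right_mono) (auto simp: \<pi>_def)
        hence "real L / 16 * \<pi> \<le> I" using rI by linarith
        thus ?thesis using L1 by (simp add: field_simps)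
      qed
      have Linv: "1 / real L \<le> 2 * \<Phi> / (c * \<beta> powr \<nu>)"
      proof -
        have "1 / real L \<le> 1 / (y / 2)" using L yY Y0 L1 by (intro divide_left_mono) auto
        also have "\<dots> = 2 * \<Phi> / (c * \<beta> powr \<nu>)" by (simp add: y_def)
        finally show ?thesis .
      qed
      have "FE \<beta> (-\<beta> + u) \<le> (\<beta> / real L) * (16 / real L * I)"
        using 1 mult_left_mono[OF pi, of "\<beta> / real L"] b by simp
      also have "\<dots> = (1 / real L) * (16 * \<beta> * (I / real L))" by simp
      also have "\<dots> \<le> (2 * \<Phi> / (c * \<beta> powr \<nu>)) * (16 * \<beta> * (I / real L))"
        using Linv b I0 by (intro mult_right_mono) auto
      also have "\<dots> = (32 / c) * (\<beta> / \<beta> powr \<nu>) * \<Phi> * (I / real L)" by simp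
      also have "\<beta> / \<beta> powr \<nu> = \<beta> powr (1 - \<nu>)" using b by (simp add: powr_diff)
      also have "I / real L = (\<integral>w. real (switch_time w L) / real L * indicator {w. 4 * \<kappa> * real L < real (switch_time w L)} w \<partial>hat)"
        unfolding I_def by (simp del: switch_time.simps flip: integral_divide_zero)
      finally show ?thesis unfolding \<Phi>_def .
    qed
    moreover have "32 / c > 0" using c by simp
    ultimately show ?thesis using c1(3) by blast
  qed
  thus ?thesis using c'0 by blast
qed

section \<open>Lower bound from long blocks\<close>

text \<open>The mean of \<open>Z_segment_chain\<close>, where \<open>S\<close> is the set of cycle starts followed by at least \<open>A\<close> plus
  sites; its density is \<open>\<rho>\<close>. Every site of these segments has weight \<open>e^u\<close>, independently of \<open>\<beta>\<close>.\<close>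

lemma FE_lower_block:
  assumes u: "0 \<le> u" and A: "A \<ge> n0 + 2" and \<rho>: "\<rho> = p * measure hat {w. A \<le> switch_time w 1}" "\<rho> > 0"
  shows "FE \<beta> (-\<beta> + u) \<ge> \<rho> * (ln (X (exp u - 1) (A - n0 - 1)) + ln k1 - (1+\<alpha>) * ln (1/\<rho>)) - (1+\<alpha>) * \<rho>"
proof -
  define v where "v = exp u - 1"
  have v: "v \<ge> 0" using u by (simp add: v_def)
  define g where "g = ln (X v (A - n0 - 1)) + ln k1 - (1+\<alpha>) * ln (1/\<rho>)"
  define Q where "Q s w \<longleftrightarrow> (seq_shift ^^ s) w 0 = -1 \<and> (\<forall>i\<in>{1..A}. (seq_shift ^^ s) w i = 1)" for s and w :: "nat \<Rightarrow> real"
  have Q_alt: "Q s w \<longleftrightarrow> w s = -1 \<and> (\<forall>i\<in>{1..A}. w (s + i) = 1)" for s w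
    by (simp add: Q_def seq_shift_pow add.commute)
  have [measurable]: "Measurable.pred \<mu> (Q s)" for s unfolding Q_alt by measurable
  have probQ: "prob {w. Q s w} = \<rho>" for s
  proof -
    have "prob {w. Q s w} = prob {w. w 0 = -1 \<and> (\<forall>i\<in>{1..A}. w i = 1)}"
      unfolding Q_def by (rule prob_shift) measurable
    also have "\<dots> = \<rho>" using first_block_prob[of A] A \<rho> by simp
    finally show ?thesis .
  qed
  define cb where "cb = k1 / \<alpha> * real n0 powr (-\<alpha>)"
  have cb: "cb > 0" using k1_pos alpha_pos n0_pos by (simp add: cb_def)
  have lnkb: "- ln (kbar N) \<le> \<bar>ln cb\<bar> + \<alpha> * ln (real N + 1)" for N
  proof -
    have "ln (cb * (real N + 1) powr (-\<alpha>)) \<le> ln (kbar N)"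
      using kbar_ge[of N, folded cb_def] cb by (intro ln_mono mult_pos_pos) auto
    moreover have "ln (cb * (real N + 1) powr (-\<alpha>)) = ln cb - \<alpha> * ln (real N + 1)"
      using cb by (simp add: ln_mult_pos ln_powr)
    ultimately show ?thesis by linarith
  qed
  define b where "b = \<bar>g\<bar> + \<bar>ln k1\<bar> + \<bar>ln cb\<bar> + \<bar>g\<bar> * \<rho> * real (A + n0)"
  have "FE \<beta> (-\<beta> + u) \<ge> g * \<rho> - (1+\<alpha>) * \<rho>"
  proof (rule FE_ge[where b=b and c="1+2*\<alpha>"])
    fix N
    define S where "S w = {s. Q s w}" for w
    define J where "J = {s. n0 \<le> s \<and> s + A \<le> N}"
    have finJ: "finite J" by (rule finite_subset[of _ "{..N}"]) (auto simp: J_def)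
    have cardJ: "\<bar>real (card J) - real N\<bar> \<le> real (A + n0)"
    proof -
      have "J = {n0..<N + 1 - A}" by (auto simp: J_def)
      thus ?thesis using A by auto
    qed
    have z_ge: "z \<beta> (-\<beta>+u) N w \<ge> g * (\<Sum>s\<in>J. indicator {w. Q s w} w) - \<bar>g\<bar> - (1+\<alpha>) * \<rho> * real N
            - (\<bar>ln k1\<bar> + (1+\<alpha>) * ln (real N + 1) - ln (kbar N))" for w
    proof -
      have "ln (Z (weight \<beta> (-\<beta>+u) w) N 0) \<ge> g * real (card {s\<in>S w. n0 \<le> s \<and> s + A \<le> N}) - \<bar>g\<bar> - (1+\<alpha>) * \<rho> * real N
            - (\<bar>ln k1\<bar> + (1+\<alpha>) * ln (real N + 1) - ln (kbar N))"
      proof (rule Z_segment_chain[OF _ v A _ _ \<rho>(2) g_def])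
        fix s i assume "s \<in> S w" "i \<in> {1..A}"
        thus "1 + v \<le> weight \<beta> (-\<beta>+u) w (s + i)" by (simp add: S_def Q_alt weight_def v_def)
      next
        fix s s' assume H: "s \<in> S w" "s' \<in> S w" "s < s'"
        show "s + A \<le> s'"
        proof (rule ccontr)
          assume "\<not> ?thesis"
          hence "s' - s \<in> {1..A}" using H(3) by auto
          hence "w (s + (s' - s)) = 1" using H(1) unfolding S_def Q_alt by blast
          thus False using H by (simp add: S_def Q_alt)
        qed
      qed simp
      moreover have "{s\<in>S w. n0 \<le> s \<and> s + A \<le> N} = {s\<in>J. Q s w}" by (auto simp: S_def J_def)
      moreover have "real (card {s\<in>J. Q s w}) = (\<Sum>s\<in>J. indicator {w. Q s w} w)"
        unfolding real_card_filter[OF finJ] by (intro sum.cong) (auto simp: indicator_def)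
      ultimately show ?thesis by (simp add: z_def)
    qed
    have Qs: "{w. Q s w} \<in> sets \<mu>" for s by (rule sets_Collect) measurable
    have ind: "integrable \<mu> (indicator {w. Q s w} :: _ \<Rightarrow> real)" for s using Qs by (simp add: emeasure_eq_measure)
    define E where "E = \<bar>g\<bar> + (1+\<alpha>) * \<rho> * real N + (\<bar>ln k1\<bar> + (1+\<alpha>) * ln (real N + 1) - ln (kbar N))"
    have intS: "integrable \<mu> (\<lambda>w. g * (\<Sum>s\<in>J. indicator {w. Q s w} w))"
      by (intro integrable_mult_right Bochner_Integration.integrable_sum ind)
    have "(\<integral>w. g * (\<Sum>s\<in>J. indicator {w. Q s w} w) - E \<partial>\<mu>) \<le> (\<integral>w. z \<beta> (-\<beta>+u) N w \<partial>\<mu>)"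
    proof (rule integral_mono)
      show "integrable \<mu> (\<lambda>w. g * (\<Sum>s\<in>J. indicator {w. Q s w} w) - E)"
        by (rule Bochner_Integration.integrable_diff[OF intS]) simp
      show "g * (\<Sum>s\<in>J. indicator {w. Q s w} w) - E \<le> z \<beta> (-\<beta>+u) N w" for w using z_ge[of w] unfolding E_def by linarith
    qed (rule z_integrable)
    also have "(\<integral>w. g * (\<Sum>s\<in>J. indicator {w. Q s w} w) - E \<partial>\<mu>) = (\<integral>w. g * (\<Sum>s\<in>J. indicator {w. Q s w} w) \<partial>\<mu>) - E"
      by (subst Bochner_Integration.integral_diff[OF intS]) simp_all
    also have "(\<integral>w. g * (\<Sum>s\<in>J. indicator {w. Q s w} w) \<partial>\<mu>) = g * (\<Sum>s\<in>J. \<integral>w. indicator {w. Q s w} w \<partial>\<mu>)"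
      using ind by (subst integral_mult_right_zero, subst Bochner_Integration.integral_sum) auto
    also have "(\<Sum>s\<in>J. \<integral>w. indicator {w. Q s w} w \<partial>\<mu>) = real (card J) * \<rho>" using Qs by (simp add: probQ)
    finally have le: "g * (real (card J) * \<rho>) - E \<le> (\<integral>w. z \<beta> (-\<beta>+u) N w \<partial>\<mu>)" .
    have "g * \<rho> * real N - g * (real (card J) * \<rho>) = - (g * \<rho> * (real (card J) - real N))" by (simp add: algebra_simps)
    also have "\<dots> \<le> \<bar>g * \<rho> * (real (card J) - real N)\<bar>" by linarith
    also have "\<dots> = \<bar>g\<bar> * \<rho> * \<bar>real (card J) - real N\<bar>" using \<rho>(2) by (simp add: abs_mult)
    also have "\<dots> \<le> \<bar>g\<bar> * \<rho> * real (A + n0)" using cardJ \<rho>(2) by (intro mult_left_mono) auto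
    finally have "g * \<rho> * real N \<le> g * (real (card J) * \<rho>) + \<bar>g\<bar> * \<rho> * real (A + n0)" by linarith
    moreover have "(g * \<rho> - (1+\<alpha>) * \<rho>) * real N = g * \<rho> * real N - (1+\<alpha>) * \<rho> * real N" by (simp add: algebra_simps)
    moreover have "(1+2*\<alpha>) * ln (real N + 1) = (1+\<alpha>) * ln (real N + 1) + \<alpha> * ln (real N + 1)" by (simp add: algebra_simps)
    ultimately show "(g * \<rho> - (1+\<alpha>) * \<rho>) * real N - b - (1+2*\<alpha>) * ln (real N + 1) \<le> (\<integral>w. z \<beta> (-\<beta>+u) N w \<partial>\<mu>)"
      using le lnkb[of N] unfolding E_def b_def by linarith
  qed
  thus ?thesis by (simp add: g_def v_def mult.commute)
qed

end

context environment begin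

definition long_block :: "nat \<Rightarrow> real" where "long_block n = measure hat {w. n \<le> switch_time w 1}"

lemma long_block_1: "long_block 1 = 1"
proof -
  have "{w. 1 \<le> switch_time w 1} \<in> sets hat" unfolding sets_hat by (rule sets_Collect) measurable
  moreover have "AE w in hat. w \<in> {w. 1 \<le> switch_time w 1}"
    using AE_hat
  proof eventually_elim
    case (elim w)
    thus ?case using switch_time_step(1)[of w 0] by (simp del: switch_time.simps(2))
  qed
  ultimately show ?thesis unfolding long_block_def using hat.prob_eq_1 by blast
qed

lemma long_block_bounds: "0 \<le> long_block n" "long_block n \<le> 1"
  by (simp_all add: long_block_def)

lemma long_block_truncated_mean:
  "real n * long_block n \<le> (\<integral>w. real (switch_time w 1) * indicator {w. n \<le> switch_time w 1} w \<partial>hat)"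
proof -
  have s: "{w. n \<le> switch_time w 1} \<in> sets hat" unfolding sets_hat by (rule sets_Collect) measurable
  have "real n * long_block n = (\<integral>w. real n * indicator {w. n \<le> switch_time w 1} w \<partial>hat)"
    using s by (simp add: long_block_def del: switch_time.simps)
  also have "\<dots> \<le> (\<integral>w. real (switch_time w 1) * indicator {w. n \<le> switch_time w 1} w \<partial>hat)"
  proof (rule integral_mono)
    show "integrable hat (\<lambda>w. real n * indicator {w. n \<le> switch_time w 1} w)"
      using s by (intro integrable_mult_right) (auto simp: hat.emeasure_eq_measure simp del: switch_time.simps)
    show "integrable hat (\<lambda>w. real (switch_time w 1) * indicator {w. n \<le> switch_time w 1} w)"
      by (rule truncated_switch_time_integrable)
  qed (simp split: split_indicator del: switch_time.simps)
  finally show ?thesis .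
qed

text \<open>The first block has finite mean.\<close>

lemma long_block_tendsto_0: "(\<lambda>n. real n * long_block n) \<longlonglongrightarrow> 0"
proof (rule tendsto_sandwich[of "\<lambda>_. 0"])
  have "(\<lambda>n. \<integral>w. real (switch_time w 1) * indicator {w. n \<le> switch_time w 1} w \<partial>hat) \<longlonglongrightarrow> (\<integral>w. 0 \<partial>hat)"
  proof (rule integral_dominated_convergence[where w="\<lambda>w. real (switch_time w 1)"])
    show "AE w in hat. (\<lambda>n. real (switch_time w 1) * indicator {w. n \<le> switch_time w 1} w) \<longlonglongrightarrow> 0"
    proof (rule AE_I2)
      fix w
      have "\<forall>\<^sub>F n in sequentially. real (switch_time w 1) * indicator {w. n \<le> switch_time w 1} w = 0"
        using eventually_gt_at_top[of "switch_time w 1"] by eventually_elim (simp add: not_le del: switch_time.simps)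
      thus "(\<lambda>n. real (switch_time w 1) * indicator {w. n \<le> switch_time w 1} w) \<longlonglongrightarrow> 0"
        by (rule tendsto_eventually)
    qed
    show "(\<lambda>w. real (switch_time w 1) * indicator {w. n \<le> switch_time w 1} w) \<in> borel_measurable hat" for n
    proof -
      have s: "{w. n \<le> switch_time w 1} \<in> sets hat" unfolding sets_hat by (rule sets_Collect) measurable
      thus ?thesis by (intro borel_measurable_times borel_measurable_integrable[OF first_block_integrable] borel_measurable_indicator)
    qed
    show "AE x in hat. norm (real (switch_time x 1) * indicator {w. n \<le> switch_time w 1} x) \<le> real (switch_time x 1)" for n
      by (intro AE_I2) (simp split: split_indicator del: switch_time.simps)
  qed (use first_block_integrable in simp_all)
  thus "(\<lambda>n. \<integral>w. real (switch_time w 1) * indicator {w. n \<le> switch_time w 1} w \<partial>hat) \<longlonglongrightarrow> 0" by simp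
qed (use long_block_bounds long_block_truncated_mean in \<open>auto intro!: always_eventually\<close>)

end

context pinning begin

text \<open>With \<open>\<rho> = p P(\<xi>_1 \<ge> A)\<close> the bound in \<open>FE_lower_block\<close> is \<open>\<rho>\<close> times the gain \<open>c A F(u)\<close> minus
  \<open>(1 + \<alpha>) ln (1/\<rho>)\<close> and a constant \<open>C\<close>. The hypothesis makes the logarithm at most a quarter of
  the gain. The constant is negligible, because \<open>A F(u)\<close> is large: it dominates
  \<open>- ln P(\<xi>_1 \<ge> A)\<close>, which is large for large \<open>A\<close>.\<close>

lemma lower_bound_long_blocks:
  "\<exists>c0>0. \<exists>D>0. \<exists>A1. \<forall>u \<beta> A. 0 < u \<longrightarrow> u < 1 \<longrightarrow> A \<ge> A1 \<longrightarrow> 0 < long_block A \<longrightarrow>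
      - ln (long_block A) \<le> c0 * FE 0 u * real A \<longrightarrow>
      FE \<beta> (-\<beta> + u) \<ge> D * (real A * long_block A * FE 0 u)"
proof -
  obtain c where c: "c > 0" "c \<le> 1" "\<And>u. 0 < u \<Longrightarrow> u < 1 \<Longrightarrow> c * u powr \<nu> \<le> FE 0 u"
     "\<And>u n. 0 < u \<Longrightarrow> u < 1 \<Longrightarrow> ln (X (exp u - 1) n) \<ge> c * FE 0 u * real n - ln 2"
    using FE_hom_bounds by blast
  define c0 where "c0 = c / (4 * (1 + \<alpha>))"
  have c0: "c0 > 0" "(1 + \<alpha>) * c0 = c / 4" using c alpha_pos by (auto simp: c0_def field_simps)
  define C where "C = real n0 + 1 + ln 2 + \<bar>ln k1\<bar> + (1+\<alpha>) * (\<bar>ln p\<bar> + 1)"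
  define D where "D = p * c / 2"
  have D: "D > 0" using p_pos c by (simp add: D_def)
  have "(1+\<alpha>) * (\<bar>ln p\<bar> + 1) \<ge> 0" using alpha_pos by simp
  moreover have "ln (2::real) > 0" by simp
  ultimately have C0: "C > 0" unfolding C_def by linarith
  define \<epsilon> where "\<epsilon> = exp (- (c0 * (4 * C / c)))"
  have "\<forall>\<^sub>F n in sequentially. real n * long_block n < \<epsilon>"
    by (intro order_tendstoD[OF long_block_tendsto_0]) (simp add: \<epsilon>_def)
  then obtain m where m: "\<And>n. n \<ge> m \<Longrightarrow> real n * long_block n < \<epsilon>" by (auto simp: eventually_sequentially)
  define A1 where "A1 = max m (n0 + 2)"
  have "FE \<beta> (-\<beta> + u) \<ge> D * (real A * long_block A * FE 0 u)"
    if u: "0 < u" "u < 1" and A: "A \<ge> A1" and pos: "0 < long_block A" and ln: "- ln (long_block A) \<le> c0 * FE 0 u * real A" for u \<beta> A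
  proof -
    define \<Phi> where "\<Phi> = FE 0 u"
    have \<Phi>: "\<Phi> \<ge> 0" "\<Phi> \<le> 1"
    proof -
      have "0 \<le> c * u powr \<nu>" using c by simp
      thus "\<Phi> \<ge> 0" using c(3)[OF u] by (simp add: \<Phi>_def)
      show "\<Phi> \<le> 1" using FE_hom_le[of u] u by (simp add: \<Phi>_def)
    qed
    have A2: "A \<ge> m" "A \<ge> n0 + 2" using A by (auto simp: A1_def)
    have "long_block A \<le> real A * long_block A" using A2 pos by (simp add: mult_le_cancel_right1)
    hence "long_block A < \<epsilon>" using m[OF A2(1)] by linarith
    hence "ln (long_block A) < ln \<epsilon>" using pos by (intro ln_less_cancel_iff[THEN iffD2]) (auto simp: \<epsilon>_def)
    hence "c0 * (4 * C / c) < c0 * (\<Phi> * real A)" using ln by (simp add: \<epsilon>_def \<Phi>_def mult.assoc)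
    hence big: "4 * C \<le> c * (\<Phi> * real A)" using c0(1) c(1) by (simp add: field_simps)
    define \<rho> where "\<rho> = p * long_block A"
    have \<rho>: "\<rho> > 0" using p_pos pos by (simp add: \<rho>_def)
    have X: "ln (X (exp u - 1) (A - n0 - 1)) \<ge> c * (\<Phi> * real A) - (real n0 + 1) - ln 2"
    proof -
      define m where "m = A - n0 - 1"
      have "real m = real A - (real n0 + 1)" using A2 by (simp add: m_def of_nat_diff)
      hence "(c * \<Phi>) * real m = c * (\<Phi> * real A) - (c * \<Phi>) * (real n0 + 1)" by (simp only: right_diff_distrib mult.assoc)
      moreover have "(c * \<Phi>) * (real n0 + 1) \<le> 1 * (real n0 + 1)"
        using c(1,2) \<Phi> mult_mono[of c 1 \<Phi> 1] by (intro mult_right_mono) auto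
      ultimately have "c * (\<Phi> * real A) - (real n0 + 1) \<le> (c * \<Phi>) * real m"
      proof -
        have aux: "a - k \<le> b" if "b = a - q" "q \<le> 1 * k" for a b k q :: real using that by simp
        show ?thesis by (rule aux) fact+
      qed
      moreover have "ln (X (exp u - 1) m) \<ge> (c * \<Phi>) * real m - ln 2" using c(4)[OF u, of m] by (simp add: \<Phi>_def)
      ultimately show ?thesis unfolding m_def[symmetric] by linarith
    qed
    have ln\<rho>: "(1+\<alpha>) * ln (1/\<rho>) \<le> (1+\<alpha>) * \<bar>ln p\<bar> + (c/4) * (\<Phi> * real A)"
    proof -
      have "ln (1/\<rho>) = - ln p - ln (long_block A)" using p_pos pos by (simp add: \<rho>_def ln_div ln_mult_pos)
      also have "\<dots> \<le> \<bar>ln p\<bar> + c0 * (\<Phi> * real A)" using ln by (simp add: \<Phi>_def mult.assoc)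
      finally have "(1+\<alpha>) * ln (1/\<rho>) \<le> (1+\<alpha>) * (\<bar>ln p\<bar> + c0 * (\<Phi> * real A))" using alpha_pos by (intro mult_left_mono) auto
      also have "\<dots> = (1+\<alpha>) * \<bar>ln p\<bar> + ((1+\<alpha>) * c0) * (\<Phi> * real A)" by (simp add: algebra_simps)
      finally show ?thesis by (simp add: c0)
    qed
    have "D * (real A * long_block A * FE 0 u) = \<rho> * ((c/2) * (\<Phi> * real A))" by (simp add: D_def \<rho>_def \<Phi>_def)
    also have "\<dots> \<le> \<rho> * (ln (X (exp u - 1) (A - n0 - 1)) + ln k1 - (1+\<alpha>) * ln (1/\<rho>) - (1+\<alpha>))"
    proof (intro mult_left_mono)
      have "C = real n0 + 1 + ln 2 + \<bar>ln k1\<bar> + (1+\<alpha>) * \<bar>ln p\<bar> + (1 + \<alpha>)" by (simp add: C_def algebra_simps)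
      moreover have "(c/2) * (\<Phi> * real A) = c * (\<Phi> * real A) / 2" "(c/4) * (\<Phi> * real A) = c * (\<Phi> * real A) / 4" by simp_all
      ultimately show "(c/2) * (\<Phi> * real A) \<le> ln (X (exp u - 1) (A - n0 - 1)) + ln k1 - (1+\<alpha>) * ln (1/\<rho>) - (1+\<alpha>)"
        using X ln\<rho> big by linarith
    qed (use \<rho> in auto)
    also have "\<dots> \<le> FE \<beta> (-\<beta> + u)"
      using FE_lower_block[of u A \<rho> \<beta>] u A2 \<rho> by (simp add: \<rho>_def long_block_def algebra_simps del: switch_time.simps)
    finally show ?thesis .
  qed
  thus ?thesis using c0(1) D by blast
qed

end

section \<open>The partition function of a renewal process\<close>

locale renewal_model = prob_space R for R :: "'r measure" +
  fixes \<tau> :: "nat \<Rightarrow> 'r \<Rightarrow> nat"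
  assumes renewal: "renewal_process R \<tau>"
begin

definition incr :: "nat \<Rightarrow> 'r \<Rightarrow> nat" where "incr i y = \<tau> (Suc i) y - \<tau> i y"
definition K :: "nat \<Rightarrow> real" where "K = interarrival_law R \<tau>"

lemma tau_0: "y \<in> space R \<Longrightarrow> \<tau> 0 y = 0"
  and tau_less: "y \<in> space R \<Longrightarrow> \<tau> i y < \<tau> (Suc i) y"
  and incr_indep: "indep_vars (\<lambda>_. count_space UNIV) incr UNIV"
  and incr_distr: "distr R (count_space UNIV) (incr i) = distr R (count_space UNIV) (\<tau> 1)"
  using renewal by (auto simp: renewal_process_def incr_def[abs_def])

lemma incr_measurable [measurable]: "incr i \<in> measurable R (count_space UNIV)"
  using incr_indep by (simp add: indep_vars_def)

lemma tau_mono: "y \<in> space R \<Longrightarrow> i \<le> j \<Longrightarrow> \<tau> i y \<le> \<tau> j y"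
  by (rule lift_Suc_mono_le[of "\<lambda>i. \<tau> i y"]) (auto intro: less_imp_le tau_less)

lemma tau_incr: "y \<in> space R \<Longrightarrow> \<tau> (Suc i) y = \<tau> i y + incr i y"
  using tau_less[of y i] by (simp add: incr_def)

lemma incr_pos: "y \<in> space R \<Longrightarrow> incr i y \<ge> 1"
  using tau_less[of y i] by (simp add: incr_def)

lemma tau_measurable [measurable]: "\<tau> i \<in> measurable R (count_space UNIV)"
proof (induction i)
  case 0
  have "(\<lambda>y. 0 :: nat) \<in> measurable R (count_space UNIV)" by simp
  thus ?case by (subst measurable_cong[of _ _ "\<lambda>_. 0"]) (simp_all add: tau_0)
next
  case (Suc i)
  have "(\<lambda>y. \<tau> i y + incr i y) \<in> measurable R (count_space UNIV)" using Suc by measurable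
  thus ?case by (subst measurable_cong[of _ _ "\<lambda>y. \<tau> i y + incr i y"]) (simp_all add: tau_incr)
qed

lemma prob_incr: "prob (incr i -` {n} \<inter> space R) = K n"
proof -
  have "prob (incr i -` {n} \<inter> space R) = measure (distr R (count_space UNIV) (incr i)) {n}"
    by (subst measure_distr) auto
  also have "\<dots> = prob (\<tau> 1 -` {n} \<inter> space R)" unfolding incr_distr by (subst measure_distr) auto
  also have "\<tau> 1 -` {n} \<inter> space R = {y\<in>space R. \<tau> 1 y = n}" by auto
  finally show ?thesis by (simp add: K_def interarrival_law_def)
qed

lemma K_zero: "K 0 = 0"
proof -
  have "\<tau> 1 y \<noteq> 0" if "y \<in> space R" for y using tau_less[OF that, of 0] by simp
  hence "{y\<in>space R. \<tau> 1 y = 0} = {}" by blast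
  thus ?thesis by (simp only: K_def interarrival_law_def measure_empty)
qed

lemma K_sums_one: "K sums 1"
proof -
  have "(\<lambda>n. prob (incr 0 -` {n} \<inter> space R)) sums prob (\<Union>n. incr 0 -` {n} \<inter> space R)"
    by (intro finite_measure_UNION) (auto simp: disjoint_family_on_def)
  moreover have "(\<Union>n. incr 0 -` {n} \<inter> space R) = space R" by auto
  ultimately show ?thesis by (simp add: prob_incr prob_space)
qed

definition prefix_event :: "nat list \<Rightarrow> 'r set" where
  "prefix_event v = {y\<in>space R. \<forall>j<length v. incr j y = v ! j}"

lemma prefix_event_sets [measurable]: "prefix_event v \<in> sets R"
  unfolding prefix_event_def by measurable

lemma prob_prefix_event: "prob (prefix_event v) = prod_list (map K v)"
proof (cases "v = []")
  case False
  have "prefix_event v = (\<Inter>j\<in>{..<length v}. incr j -` {v ! j} \<inter> space R)"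
    using False by (auto simp: prefix_event_def)
  also have "prob \<dots> = (\<Prod>j\<in>{..<length v}. prob (incr j -` {v ! j} \<inter> space R))"
    using False by (intro indep_varsD[OF incr_indep]) auto
  also have "\<dots> = prod_list (map K v)"
    by (simp add: prob_incr prod.list_conv_set_nth atLeast0LessThan)
  finally show ?thesis .
qed (simp add: prefix_event_def prob_space)

lemma tau_prefix_event: "y \<in> prefix_event v \<Longrightarrow> k \<le> length v \<Longrightarrow> \<tau> k y = sum_list (take k v)"
proof (induction k)
  case (Suc k)
  thus ?case by (auto simp: prefix_event_def tau_incr take_Suc_conv_app_nth)
qed (simp add: prefix_event_def tau_0)

lemma prefix_event_snoc: "prefix_event (v @ [n]) = {y\<in>prefix_event v. incr (length v) y = n}"
  by (auto simp: prefix_event_def nth_append less_Suc_eq)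

text \<open>The Boltzmann factor of the sites in \<open>{s<..N}\<close> for site energies \<open>c\<close>.\<close>

definition tail_weight :: "(nat \<Rightarrow> real) \<Rightarrow> nat \<Rightarrow> nat \<Rightarrow> 'r \<Rightarrow> real" where
  "tail_weight c N s y = exp (\<Sum>n\<in>{s<..N}. c n * indicator (range (\<lambda>i. \<tau> i y)) n)"

lemma tail_weight_measurable [measurable]: "tail_weight c N s \<in> borel_measurable R"
proof -
  have "(\<lambda>y. indicator (range (\<lambda>i. \<tau> i y)) n :: real) = (\<lambda>y. if \<exists>i. \<tau> i y = n then 1 else 0)" for n
    by (auto simp: fun_eq_iff indicator_def)
  moreover have "Measurable.pred R (\<lambda>y. \<exists>i. \<tau> i y = n)" for n by measurable
  ultimately have [measurable]: "(\<lambda>y. indicator (range (\<lambda>i. \<tau> i y)) n :: real) \<in> borel_measurable R" for n by simp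
  show ?thesis unfolding tail_weight_def by measurable
qed

lemma tail_weight_pos: "tail_weight c N s y > 0" by (simp add: tail_weight_def)

lemma tail_weight_le: "tail_weight c N s y \<le> exp (\<Sum>n\<in>{s<..N}. \<bar>c n\<bar>)"
  unfolding tail_weight_def by (subst exp_le_cancel_iff, intro sum_mono) (auto simp: indicator_def)

lemma tail_weight_integrable: "integrable R (\<lambda>y. indicator (prefix_event v) y * tail_weight c N s y)"
proof (rule integrable_const_bound)
  show "AE y in R. norm (indicator (prefix_event v) y * tail_weight c N s y) \<le> exp (\<Sum>n\<in>{s<..N}. \<bar>c n\<bar>)"
    using tail_weight_le[of c N s] tail_weight_pos[of c N s] by (intro AE_I2) (auto simp: indicator_def less_imp_le)
qed measurable

lemma tail_weight_no_renewal:
  assumes y: "y \<in> prefix_event v" and n: "N < sum_list v + incr (length v) y"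
  shows "tail_weight c N (sum_list v) y = 1"
proof -
  have sp: "y \<in> space R" using y by (simp add: prefix_event_def)
  have t: "\<tau> (length v) y = sum_list v" using tau_prefix_event[OF y, of "length v"] by simp
  have "m \<notin> range (\<lambda>i. \<tau> i y)" if "m \<in> {sum_list v<..N}" for m
  proof
    assume "m \<in> range (\<lambda>i. \<tau> i y)"
    then obtain i where i: "m = \<tau> i y" by auto
    show False
    proof (cases "i \<le> length v")
      case True
      thus False using tau_mono[OF sp True] t i that by auto
    next
      case False
      hence "\<tau> (Suc (length v)) y \<le> m" unfolding i by (intro tau_mono sp) auto
      thus False using tau_incr[OF sp, of "length v"] t n that by auto
    qed
  qed
  hence "(\<Sum>n\<in>{sum_list v<..N}. c n * indicator (range (\<lambda>i. \<tau> i y)) n) = 0" by (intro sum.neutral) auto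
  thus ?thesis by (simp add: tail_weight_def)
qed

lemma tail_weight_next_renewal:
  assumes y: "y \<in> prefix_event v" and n: "incr (length v) y = n" "sum_list v + n \<le> N"
  shows "tail_weight c N (sum_list v) y = exp (c (sum_list v + n)) * tail_weight c N (sum_list v + n) y"
proof -
  define s where "s = sum_list v"
  have sp: "y \<in> space R" using y by (simp add: prefix_event_def)
  have t: "\<tau> (length v) y = s" using tau_prefix_event[OF y, of "length v"] by (simp add: s_def)
  have n1: "n \<ge> 1" using incr_pos[OF sp, of "length v"] n by simp
  have "tail_weight c (s + n - 1) s y = 1" unfolding s_def by (rule tail_weight_no_renewal[OF y]) (use n n1 in auto)
  hence z: "(\<Sum>m\<in>{s<..s+n-1}. c m * indicator (range (\<lambda>i. \<tau> i y)) m) = 0" by (simp add: tail_weight_def)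
  have mem: "s + n \<in> range (\<lambda>i. \<tau> i y)" using tau_incr[OF sp, of "length v"] t n(1) by (metis rangeI)
  have split: "{s<..N} = insert (s+n) ({s<..s+n-1} \<union> {s+n<..N})" using n n1 by (auto simp: s_def)
  have "(\<Sum>m\<in>{s<..N}. c m * indicator (range (\<lambda>i. \<tau> i y)) m) = c (s+n) + (\<Sum>m\<in>{s+n<..N}. c m * indicator (range (\<lambda>i. \<tau> i y)) m)"
  proof -
    have "(\<Sum>m\<in>{s<..N}. c m * indicator (range (\<lambda>i. \<tau> i y)) m) = c (s+n) * indicator (range (\<lambda>i. \<tau> i y)) (s+n)
        + ((\<Sum>m\<in>{s<..s+n-1}. c m * indicator (range (\<lambda>i. \<tau> i y)) m) + (\<Sum>m\<in>{s+n<..N}. c m * indicator (range (\<lambda>i. \<tau> i y)) m))"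
      unfolding split using n1 by (subst sum.insert, simp, force, subst sum.union_disjoint) auto
    thus ?thesis using z mem by simp
  qed
  thus ?thesis by (simp add: tail_weight_def s_def exp_add)
qed

context
  fixes \<alpha> k1 k2 n0
  assumes kernel: "renewal_kernel K \<alpha> k1 k2 n0"
begin

interpretation renewal_kernel K \<alpha> k1 k2 n0 by (rule kernel)

text \<open>The event \<open>prefix_event v\<close> is split according to the next increment. Prescribing
  finitely many increments, instead of conditioning on the past, reduces the renewal property to the
  product formula \<open>prob_prefix_event\<close>.\<close>

lemma prefix_expectation:
  "(\<integral>y. indicator (prefix_event v) y * tail_weight c N (sum_list v) y \<partial>R)
     = prod_list (map K v) * Z (\<lambda>n. exp (c n)) N (sum_list v)"
proof (induction "N - sum_list v" arbitrary: v rule: less_induct)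
  case less
  define s where "s = sum_list v"
  show ?case
  proof (cases "N \<le> s")
    case True
    hence "tail_weight c N s y = 1" for y by (simp add: tail_weight_def)
    thus ?thesis using True by (simp add: s_def[symmetric] prob_prefix_event)
  next
    case False
    define I where "I = {1..N - s}"
    \<comment> \<open>Increments beyond \<open>N - s\<close> are grouped together: then no site up to \<open>N\<close> is visited any more.\<close>
    have pt: "indicator (prefix_event v) y * tail_weight c N s y =
       (indicator (prefix_event v) y - (\<Sum>n\<in>I. indicator (prefix_event (v @ [n])) y)) +
       (\<Sum>n\<in>I. exp (c (s + n)) * (indicator (prefix_event (v @ [n])) y * tail_weight c N (s + n) y))" (is "?l = ?r")
      if sp: "y \<in> space R" for y
    proof (cases "y \<in> prefix_event v")
      case F: False
      thus ?thesis by (simp add: prefix_event_snoc)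
    next
      case T: True
      define n where "n = incr (length v) y"
      have ev: "indicator (prefix_event (v @ [m])) y = (if m = n then 1 else 0 :: real)" for m
        using T by (simp add: prefix_event_snoc n_def)
      have n1: "n \<ge> 1" using incr_pos[OF sp] by (simp add: n_def)
      show ?thesis
      proof (cases "n \<in> I")
        case True
        have "tail_weight c N s y = exp (c (s + n)) * tail_weight c N (s + n) y"
          unfolding s_def using True False by (intro tail_weight_next_renewal[OF T]) (auto simp: n_def I_def s_def)
        moreover have "(\<Sum>m\<in>I. indicator (prefix_event (v @ [m])) y) = (1::real)"
          unfolding ev using True by (simp add: I_def)
        moreover have "(\<Sum>m\<in>I. exp (c (s + m)) * (indicator (prefix_event (v @ [m])) y * tail_weight c N (s + m) y)) = exp (c (s + n)) * tail_weight c N (s + n) y"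
        proof -
          have "(\<Sum>m\<in>I. exp (c (s + m)) * (indicator (prefix_event (v @ [m])) y * tail_weight c N (s + m) y))
             = (\<Sum>m\<in>I. if m = n then exp (c (s + n)) * tail_weight c N (s + n) y else 0)"
            unfolding ev by (intro sum.cong) auto
          thus ?thesis using True by (simp add: I_def)
        qed
        ultimately show ?thesis using T by simp
      next
        case F: False
        have "tail_weight c N s y = 1" unfolding s_def
          by (rule tail_weight_no_renewal[OF T]) (use F n1 False in \<open>auto simp: I_def n_def s_def\<close>)
        moreover have "(\<Sum>m\<in>I. indicator (prefix_event (v @ [m])) y) = (0::real)"
          unfolding ev using F by (intro sum.neutral) auto
        moreover have "(\<Sum>m\<in>I. exp (c (s + m)) * (indicator (prefix_event (v @ [m])) y * tail_weight c N (s + m) y)) = 0"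
          unfolding ev using F by (intro sum.neutral) auto
        ultimately show ?thesis using T by simp
      qed
    qed
    have i1: "integrable R (\<lambda>y. indicator (prefix_event w) y :: real)" for w by (simp add: emeasure_eq_measure)
    have i2: "integrable R (\<lambda>y. indicator (prefix_event v) y - (\<Sum>n\<in>I. indicator (prefix_event (v @ [n])) y) :: real)"
      by (intro Bochner_Integration.integrable_diff Bochner_Integration.integrable_sum i1)
    have i3: "integrable R (\<lambda>y. (\<Sum>n\<in>I. exp (c (s + n)) * (indicator (prefix_event (v @ [n])) y * tail_weight c N (s + n) y)))"
      by (intro Bochner_Integration.integrable_sum integrable_mult_right tail_weight_integrable)
    have "(\<integral>y. indicator (prefix_event v) y * tail_weight c N s y \<partial>R) =
       (\<integral>y. (indicator (prefix_event v) y - (\<Sum>n\<in>I. indicator (prefix_event (v @ [n])) y)) +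
       (\<Sum>n\<in>I. exp (c (s + n)) * (indicator (prefix_event (v @ [n])) y * tail_weight c N (s + n) y)) \<partial>R)"
      by (rule Bochner_Integration.integral_cong[OF refl pt])
    also have "\<dots> = (\<integral>y. indicator (prefix_event v) y - (\<Sum>n\<in>I. indicator (prefix_event (v @ [n])) y) \<partial>R)
       + (\<integral>y. (\<Sum>n\<in>I. exp (c (s + n)) * (indicator (prefix_event (v @ [n])) y * tail_weight c N (s + n) y)) \<partial>R)"
      by (rule Bochner_Integration.integral_add[OF i2 i3])
    also have "(\<integral>y. indicator (prefix_event v) y - (\<Sum>n\<in>I. indicator (prefix_event (v @ [n])) y) \<partial>R)
       = (\<integral>y. indicator (prefix_event v) y \<partial>R) - (\<Sum>n\<in>I. \<integral>y. (indicator (prefix_event (v @ [n])) y :: real) \<partial>R)"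
      by (subst Bochner_Integration.integral_diff[OF i1 Bochner_Integration.integrable_sum[OF i1]])
         (simp only: Bochner_Integration.integral_sum[OF i1])
    also have "\<dots> = prod_list (map K v) - (\<Sum>n\<in>I. prod_list (map K v) * K n)"
      by (simp add: prob_prefix_event)
    also have "\<dots> = prod_list (map K v) * kbar (N - s)"
    proof -
      have "kbar (N - s) = 1 - (\<Sum>n\<in>I. K n)" using kbar_alt[of "N - s"] unfolding I_def by linarith
      thus ?thesis by (simp only: sum_distrib_left[symmetric] right_diff_distrib mult_1_right)
    qed
    also have "(\<integral>y. (\<Sum>n\<in>I. exp (c (s + n)) * (indicator (prefix_event (v @ [n])) y * tail_weight c N (s + n) y)) \<partial>R)
       = (\<Sum>n\<in>I. exp (c (s + n)) * (\<integral>y. indicator (prefix_event (v @ [n])) y * tail_weight c N (s + n) y \<partial>R))"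
      by (subst Bochner_Integration.integral_sum) (auto intro!: integrable_mult_right tail_weight_integrable)
    also have "\<dots> = (\<Sum>n\<in>I. exp (c (s + n)) * (prod_list (map K v) * K n * Z (\<lambda>n. exp (c n)) N (s + n)))"
    proof (intro sum.cong refl arg_cong2[where f="(*)"])
      fix n assume n: "n \<in> I"
      have sl: "sum_list (v @ [n]) = s + n" by (simp add: s_def)
      have "N - sum_list (v @ [n]) < N - sum_list v" using n False unfolding sl by (auto simp: I_def s_def)
      from less[OF this] show "(\<integral>y. indicator (prefix_event (v @ [n])) y * tail_weight c N (s + n) y \<partial>R) = prod_list (map K v) * K n * Z (\<lambda>n. exp (c n)) N (s + n)"
        unfolding sl by simp
    qed
    also have "\<dots> = prod_list (map K v) * (\<Sum>n\<in>I. K n * exp (c (s + n)) * Z (\<lambda>n. exp (c n)) N (s + n))"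
      unfolding sum_distrib_left by (intro sum.cong) (auto simp: mult_ac)
    also have "(\<Sum>n\<in>I. K n * exp (c (s + n)) * Z (\<lambda>n. exp (c n)) N (s + n)) = (\<Sum>n\<in>{s<..N}. K (n - s) * exp (c n) * Z (\<lambda>n. exp (c n)) N n)"
      by (rule sum.reindex_bij_witness[where i="\<lambda>n. n - s" and j="\<lambda>n. s + n"]) (auto simp: I_def)
    finally show ?thesis
      unfolding s_def[symmetric] by (subst Z.simps) (simp add: algebra_simps)
  qed
qed

lemma partition_function_eq_Z:
  "partition_function R \<tau> \<beta> h w N = Z (\<lambda>n. exp (h + \<beta> * w n)) N 0"
proof -
  have "partition_function R \<tau> \<beta> h w N = (\<integral>y. indicator (prefix_event []) y * tail_weight (\<lambda>n. h + \<beta> * w n) N (sum_list []) y \<partial>R)"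
    unfolding partition_function_def
  proof (rule Bochner_Integration.integral_cong[OF refl])
    fix y assume "y \<in> space R"
    moreover have "{1..N} = {0<..N}" by auto
    ultimately show "exp (\<Sum>n=1..N. (h + \<beta> * w n) * indicator (range (\<lambda>i. \<tau> i y)) n) = indicator (prefix_event []) y * tail_weight (\<lambda>n. h + \<beta> * w n) N (sum_list []) y"
      by (simp add: prefix_event_def tail_weight_def)
  qed
  also have "\<dots> = prod_list (map K []) * Z (\<lambda>n. exp (h + \<beta> * w n)) N (sum_list [])" by (rule prefix_expectation)
  finally show ?thesis by simp
qed

end

text \<open>From \<open>n0\<close> on the ratio of \<open>K n\<close> and \<open>cK n^(-1-\<alpha>)\<close> lies between one half and two. The upper bound is
  extended to all \<open>n\<close> by enlarging the constant.\<close>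

lemma kernel_of_asymptotics:
  assumes a: "\<alpha> > 0" "\<alpha> \<noteq> 1" "cK > 0" and asy: "K \<sim>[sequentially] (\<lambda>n. cK * real n powr (-(1 + \<alpha>)))"
  shows "\<exists>k1 k2 n0. renewal_kernel K \<alpha> k1 k2 n0"
proof -
  define g where "g n = cK * real n powr (- 1 - \<alpha>)" for n
  have gpos: "g n > 0" if "n \<ge> 1" for n using that a by (simp add: g_def)
  have "K \<sim>[sequentially] g" using asy by (simp add: g_def[abs_def])
  hence lim: "((\<lambda>n. if K n = 0 \<and> g n = 0 then 1 else K n / g n) \<longlongrightarrow> 1) sequentially"
    by (simp add: asymp_equiv_def)
  have "\<forall>\<^sub>F n in sequentially. (if K n = 0 \<and> g n = 0 then 1 else K n / g n) > 1/2 \<and> (if K n = 0 \<and> g n = 0 then 1 else K n / g n) < 2"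
    using order_tendstoD(1)[OF lim, of "1/2"] order_tendstoD(2)[OF lim, of 2] by (auto elim: eventually_elim2)
  then obtain m where m: "\<And>n. n \<ge> m \<Longrightarrow> (if K n = 0 \<and> g n = 0 then 1 else K n / g n) > 1/2 \<and> (if K n = 0 \<and> g n = 0 then 1 else K n / g n) < 2"
    by (auto simp: eventually_sequentially)
  define n0 where "n0 = max 1 m"
  have bd: "K n > g n / 2" "K n < 2 * g n" if "n \<ge> n0" for n
  proof -
    have "n \<ge> m" "n \<ge> 1" using that by (auto simp: n0_def)
    thus "K n > g n / 2" "K n < 2 * g n" using m[of n] gpos[of n] by (auto simp: field_simps)
  qed
  define k2 where "k2 = max (2 * cK) (real n0 powr (1 + \<alpha>))"
  have "renewal_kernel K \<alpha> (cK / 2) k2 n0"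
  proof
    show "K 0 = 0" by (rule K_zero)
    show "K n \<ge> 0" for n by (simp add: K_def interarrival_law_def)
    show "K sums 1" by (rule K_sums_one)
    show "\<alpha> > 0" "\<alpha> \<noteq> 1" "cK / 2 > 0" "n0 \<ge> 1" using a by (auto simp: n0_def)
    show "cK / 2 * real n powr (- 1 - \<alpha>) \<le> K n" if "n \<ge> n0" for n using bd(1)[OF that] by (simp add: g_def)
    show "K n \<le> k2 * real n powr (- 1 - \<alpha>)" if n: "n \<ge> 1" for n
    proof (cases "n \<ge> n0")
      case True
      have "K n \<le> (2 * cK) * real n powr (- 1 - \<alpha>)" using bd(2)[OF True] by (simp add: g_def)
      also have "\<dots> \<le> k2 * real n powr (- 1 - \<alpha>)" by (intro mult_right_mono) (auto simp: k2_def)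
      finally show ?thesis .
    next
      case False
      have "K n \<le> 1" by (simp add: K_def interarrival_law_def)
      also have "1 = real n powr (1 + \<alpha>) * real n powr (- 1 - \<alpha>)" using n by (simp flip: powr_add)
      also have "\<dots> \<le> k2 * real n powr (- 1 - \<alpha>)"
      proof (intro mult_right_mono)
        have "real n powr (1 + \<alpha>) \<le> real n0 powr (1 + \<alpha>)" using False a by (intro powr_mono2) auto
        thus "real n powr (1 + \<alpha>) \<le> k2" by (simp add: k2_def)
      qed auto
      finally show ?thesis .
    qed
  qed
  thus ?thesis by blast
qed

end

section \<open>The rate function and its inverse\<close>

lemma rate_less_iff:
  "rate P \<omega> x < ereal t \<longleftrightarrow> (\<exists>n::nat. 1 \<le> n \<and> real n \<le> x \<and> block_tail P \<omega> (real n) < 1 \<and>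
      neg_ln (block_tail P \<omega> (real n)) / ereal (real n) < ereal t)"
  unfolding rate_def INF_less_iff by blast

lemma neg_ln_div_less_iff:
  assumes "n \<ge> 1"
  shows "neg_ln q / ereal (real n) < ereal t \<longleftrightarrow> q \<noteq> 0 \<and> - ln q < t * real n"
proof (cases "q = 0")
  case True
  hence "neg_ln q / ereal (real n) = \<infinity>" using assms by (simp add: neg_ln_def)
  thus ?thesis using True by simp
next
  case False
  hence "neg_ln q / ereal (real n) = ereal (- ln q / real n)" using assms by (simp add: neg_ln_def)
  moreover have "- ln q / real n < t \<longleftrightarrow> - ln q < t * real n" using assms by (intro pos_divide_less_eq) simp
  ultimately show ?thesis using False by simp
qed

text \<open>Let \<open>A\<close> be the least \<open>n\<close> with \<open>P(\<xi>_1 \<ge> n) < 1\<close> and \<open>- ln P(\<xi>_1 \<ge> n) < t n\<close>. The rate at \<open>x\<close> is below \<open>t\<close> exactly if \<open>A \<le> x\<close>,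
  so the supremum in the definition of the inverse is over \<open>[1, A)\<close> and equals \<open>A\<close>. Thus the
  inverse takes natural values and satisfies the defining inequality of the rate at its value.\<close>

lemma rate_inv_attained:
  assumes lim: "(rate P \<omega> \<longlongrightarrow> 0) at_top" and t: "t > 0" and one: "block_tail P \<omega> 1 = 1"
    and nonneg: "\<And>n::nat. block_tail P \<omega> (real n) \<ge> 0"
  shows "\<exists>A::nat. A \<ge> 1 \<and> rate_inv P \<omega> t = ereal (real A) \<and> 0 < block_tail P \<omega> (real A) \<and>
     block_tail P \<omega> (real A) < 1 \<and> - ln (block_tail P \<omega> (real A)) < t * real A"
proof -
  define S where "S n \<longleftrightarrow> 1 \<le> n \<and> block_tail P \<omega> (real n) < 1 \<and> neg_ln (block_tail P \<omega> (real n)) / ereal (real n) < ereal t" for n :: nat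
  have "\<forall>\<^sub>F x in at_top. rate P \<omega> x < ereal t" using t by (intro order_tendstoD[OF lim]) (auto simp: zero_ereal_def)
  then obtain x where "rate P \<omega> x < ereal t" by (auto simp: eventually_at_top_linorder)
  hence ex: "\<exists>n. S n" unfolding rate_less_iff S_def by blast
  define A where "A = (LEAST n. S n)"
  have SA: "S A" unfolding A_def using ex by (rule LeastI_ex)
  have Amin: "A \<le> n" if "S n" for n unfolding A_def using that by (rule Least_le)
  have A1: "A \<noteq> 1" using SA one by (auto simp: S_def)
  hence A2: "A \<ge> 2" using SA by (auto simp: S_def)
  have set: "{x. 1 \<le> x \<and> rate P \<omega> x \<ge> ereal t} = {1..<real A}"
  proof -
    have iff: "rate P \<omega> x < ereal t \<longleftrightarrow> real A \<le> x" for x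
    proof
      assume "rate P \<omega> x < ereal t"
      then obtain n where "S n" "real n \<le> x" unfolding rate_less_iff S_def by blast
      thus "real A \<le> x" using Amin[of n] by linarith
    next
      assume "real A \<le> x"
      thus "rate P \<omega> x < ereal t" using SA unfolding rate_less_iff S_def by blast
    qed
    have "ereal t \<le> rate P \<omega> x \<longleftrightarrow> x < real A" for x
    proof -
      have "ereal t \<le> rate P \<omega> x \<longleftrightarrow> \<not> rate P \<omega> x < ereal t" by (rule linorder_not_less[symmetric])
      also have "\<dots> \<longleftrightarrow> \<not> real A \<le> x" by (simp only: iff)
      also have "\<dots> \<longleftrightarrow> x < real A" by (rule linorder_not_le)
      finally show ?thesis .
    qed
    thus ?thesis unfolding atLeastLessThan_def atLeast_def lessThan_def by blast
  qed
  have "rate_inv P \<omega> t = ereal (real A)"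
    unfolding rate_inv_def set
  proof (rule SUP_eqI)
    fix y assume y: "\<And>x. x \<in> {1..<real A} \<Longrightarrow> ereal x \<le> y"
    show "ereal (real A) \<le> y"
    proof (rule dense_le_bounded[of 1])
      show "1 < ereal (real A)" using A2 by (simp add: one_ereal_def)
      fix w :: ereal assume w: "1 < w" "w < ereal (real A)"
      then obtain r where "w = ereal r" by (cases w) auto
      thus "w \<le> y" using w y[of r] by (simp add: one_ereal_def)
    qed
  qed auto
  moreover have "0 < block_tail P \<omega> (real A)" "- ln (block_tail P \<omega> (real A)) < t * real A"
    using SA nonneg[of A] neg_ln_div_less_iff[of A "block_tail P \<omega> (real A)" t] by (auto simp: S_def less_le)
  ultimately show ?thesis using SA by (auto simp: S_def)
qed

text \<open>The rate is positive at every \<open>x\<close>, being an infimum of finitely many positive numbers.\<close>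

lemma rate_inv_at_0:
  assumes nonneg: "\<And>n::nat. block_tail P \<omega> (real n) \<ge> 0"
  shows "(rate_inv P \<omega> \<longlongrightarrow> \<infinity>) (at_right 0)"
  unfolding tendsto_PInfty
proof
  fix r :: real
  define x where "x = max 1 (r + 1)"
  have x: "x \<ge> 1" "x > r" by (auto simp: x_def)
  define f where "f n = neg_ln (block_tail P \<omega> (real n)) / ereal (real n)" for n :: nat
  define J where "J = {n::nat. 1 \<le> n \<and> real n \<le> x \<and> block_tail P \<omega> (real n) < 1}"
  have finJ: "finite J"
  proof (rule finite_subset)
    show "J \<subseteq> {..nat \<lceil>x\<rceil>}" by (auto simp: J_def) linarith
  qed simp
  have fpos: "f n > 0" if "n \<in> J" for n
  proof (cases "block_tail P \<omega> (real n) = 0")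
    case True
    thus ?thesis using that by (simp add: f_def neg_ln_def J_def)
  next
    case False
    hence "ln (block_tail P \<omega> (real n)) < 0" using that nonneg[of n] by (simp add: J_def less_le)
    thus ?thesis using False that by (simp add: f_def neg_ln_def J_def zero_ereal_def divide_neg_pos)
  qed
  have "rate P \<omega> x > 0"
  proof (cases "J = {}")
    case True
    have "rate P \<omega> x = \<infinity>" unfolding rate_def J_def[symmetric] True by (simp add: top_ereal_def)
    thus ?thesis by simp
  next
    case False
    have "rate P \<omega> x = Min (f ` J)"
      unfolding rate_def J_def[symmetric] f_def[symmetric] using finJ False by (intro cInf_eq_Min) auto
    thus ?thesis using fpos finJ False by simp
  qed
  then obtain e where e: "0 < ereal e" "ereal e < rate P \<omega> x" using ereal_dense2 by blast
  have "ereal r < rate_inv P \<omega> u" if u: "0 < u" "u < e" for u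
  proof -
    have "ereal u \<le> rate P \<omega> x" using u e by (meson ereal_less_eq(3) less_imp_le order_trans)
    hence "ereal x \<le> rate_inv P \<omega> u" unfolding rate_inv_def using x by (intro SUP_upper2[of x]) auto
    moreover have "ereal r < ereal x" using x by simp
    ultimately show ?thesis by (rule less_le_trans[rotated])
  qed
  thus "\<forall>\<^sub>F u in at_right 0. ereal r < rate_inv P \<omega> u"
    using e by (auto simp: eventually_at_right_field zero_ereal_def)
qed

section \<open>The quenched model\<close>

text \<open>The environment is transported to its law \<open>\<mu>\<close> on the sequence space, where the shift is an ergodic
  map.\<close>

locale pm1_environment = prob_space P for P :: "'w measure" +
  fixes \<omega> :: "nat \<Rightarrow> 'w \<Rightarrow> real"
  assumes env: "nontrivial_pm1_environment P \<omega>"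
begin

definition path :: "'w \<Rightarrow> nat \<Rightarrow> real" where "path x = (\<lambda>i. \<omega> i x)"
definition \<mu> :: "(nat \<Rightarrow> real) measure" where "\<mu> = distr P seq_space path"

lemma omega_measurable [measurable]: "\<omega> i \<in> borel_measurable P"
  and omega_pm: "x \<in> space P \<Longrightarrow> \<omega> i x = 1 \<or> \<omega> i x = -1"
  and stationary: "distr P seq_space (\<lambda>x. seq_shift (path x)) = \<mu>"
  and ergodic: "A \<in> sets seq_space \<Longrightarrow> seq_shift -` A = A \<Longrightarrow> \<P>(x in P. path x \<in> A) = 0 \<or> \<P>(x in P. path x \<in> A) = 1"
  and plus: "\<P>(x in P. \<omega> 1 x = 1) > 0" and minus: "\<P>(x in P. \<omega> 1 x = -1) > 0"
proof -
  note e = env[unfolded nontrivial_pm1_environment_def stationary_sequence_def ergodic_sequence_def]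
  show "\<omega> i \<in> borel_measurable P" using e by blast
  show "x \<in> space P \<Longrightarrow> \<omega> i x = 1 \<or> \<omega> i x = -1" using e by blast
  show "distr P seq_space (\<lambda>x. seq_shift (path x)) = \<mu>" using e unfolding \<mu>_def path_def by blast
  show "A \<in> sets seq_space \<Longrightarrow> seq_shift -` A = A \<Longrightarrow> \<P>(x in P. path x \<in> A) = 0 \<or> \<P>(x in P. path x \<in> A) = 1"
    using e unfolding path_def by blast
  show "\<P>(x in P. \<omega> 1 x = 1) > 0" "\<P>(x in P. \<omega> 1 x = -1) > 0" using e by blast+
qed

lemma path_measurable [measurable]: "path \<in> measurable P seq_space"
  unfolding path_def by (rule measurable_PiM_single') auto

lemma sets_mu' [simp]: "sets \<mu> = sets seq_space" by (simp add: \<mu>_def)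

lemma space_mu' [simp]: "space \<mu> = UNIV" by (simp add: \<mu>_def space_PiM)

lemma measure_mu: "A \<in> sets seq_space \<Longrightarrow> measure \<mu> A = \<P>(x in P. path x \<in> A)"
  unfolding \<mu>_def by (subst measure_distr) (auto simp: vimage_def Int_def conj_commute)

lemma environment_mu: "environment \<mu>"
proof (intro environment.intro ergodic_map.intro ergodic_map_axioms.intro environment_axioms.intro)
  show "prob_space \<mu>" unfolding \<mu>_def by (rule prob_space_distr[OF path_measurable])
  have shift: "seq_shift \<in> measurable \<mu> \<mu>" using seq_shift_measurable by (simp cong: measurable_cong_sets)
  thus "seq_shift \<in> measurable \<mu> \<mu>" .
  have "distr \<mu> \<mu> seq_shift = distr (distr P seq_space path) seq_space seq_shift"
    unfolding \<mu>_def by (rule distr_cong) auto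
  also have "\<dots> = distr P seq_space (seq_shift \<circ> path)" by (rule distr_distr) auto
  finally show "distr \<mu> \<mu> seq_shift = \<mu>" using stationary by (simp add: comp_def)
  show "measure \<mu> A = 0 \<or> measure \<mu> A = 1" if "A \<in> sets \<mu>" "seq_shift -` A \<inter> space \<mu> = A" for A
    using ergodic[of A] that by (simp add: measure_mu)
  show "sets \<mu> = sets seq_space" by simp
  have c: "(\<lambda>w. w i) \<in> borel_measurable seq_space" for i by simp
  have pm: "{w \<in> space seq_space. \<forall>i. w i = 1 \<or> w i = -1} \<in> sets seq_space"
  proof -
    have "{w \<in> space seq_space. w i = a} \<in> sets seq_space" for i and a :: real
      by (rule borel_measurable_eq[OF c]) simp
    hence "Measurable.pred seq_space (\<lambda>w. w i = a)" for i and a :: real by (simp add: pred_def)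
    hence "Measurable.pred seq_space (\<lambda>w. \<forall>i. w i = 1 \<or> w i = -1)" by (intro pred_intros_logic pred_intros_countable)
    thus ?thesis by (simp add: pred_def)
  qed
  have "AE x in P. \<forall>i. path x i = 1 \<or> path x i = -1" using omega_pm by (intro AE_I2) (simp add: path_def)
  thus "AE w in \<mu>. \<forall>i. w i = 1 \<or> w i = -1" unfolding \<mu>_def by (subst AE_distr_iff[OF path_measurable pm])
  have s: "{w. w 1 = a} \<in> sets seq_space" for a :: real
    using borel_measurable_eq[OF c[of 1], of "\<lambda>_. a"] by (simp add: space_PiM)
  have m: "measure \<mu> {w \<in> space \<mu>. w 1 = a} = \<P>(x in P. \<omega> 1 x = a)" for a :: real
    using measure_mu[OF s[of a]] unfolding path_def by (simp only: space_mu' UNIV_I simp_thms mem_Collect_eq)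
  show "0 < measure \<mu> {w \<in> space \<mu>. w 1 = 1}" unfolding m by (rule plus)
  show "0 < measure \<mu> {w \<in> space \<mu>. w 1 = -1}" unfolding m by (rule minus)
qed

sublocale law: environment \<mu> by (rule environment_mu)

text \<open>Conditioning commutes with the passage to the sequence space.\<close>

lemma distr_conditioned: "distr (conditioned_env P \<omega>) seq_space path = law.hat"
proof (rule measure_eqI)
  show "sets (distr (conditioned_env P \<omega>) seq_space path) = sets law.hat" by simp
  define B' where "B' = {x \<in> space P. \<omega> 0 x = -1 \<and> \<omega> 1 x = 1}"
  have B': "B' = path -` law.B \<inter> space P" by (auto simp: B'_def law.B_def cycle_start_def path_def)
  have Bs: "law.B \<in> sets seq_space" using law.B_sets by simp
  have B's: "B' \<in> sets P" unfolding B' using path_measurable Bs by (rule measurable_sets)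
  have sp: "conditioned_env P \<omega> = uniform_measure P B'" by (simp add: conditioned_env_def B'_def)
  have pm: "path \<in> measurable (conditioned_env P \<omega>) seq_space"
    unfolding sp using path_measurable by (simp cong: measurable_cong_sets)
  fix A assume "A \<in> sets (distr (conditioned_env P \<omega>) seq_space path)"
  hence A: "A \<in> sets seq_space" by simp
  have "emeasure (distr (conditioned_env P \<omega>) seq_space path) A = emeasure (uniform_measure P B') (path -` A \<inter> space P)"
    using emeasure_distr[OF pm A] by (simp add: sp)
  also have "\<dots> = emeasure P (B' \<inter> (path -` A \<inter> space P)) / emeasure P B'"
    using B's measurable_sets[OF path_measurable A] by (rule emeasure_uniform_measure)
  also have "B' \<inter> (path -` A \<inter> space P) = path -` (law.B \<inter> A) \<inter> space P" by (auto simp: B')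
  also have "emeasure P (path -` (law.B \<inter> A) \<inter> space P) = emeasure \<mu> (law.B \<inter> A)"
    unfolding \<mu>_def using Bs A by (subst emeasure_distr) auto
  also have "emeasure P B' = emeasure \<mu> law.B" unfolding B' \<mu>_def using Bs by (subst emeasure_distr) auto
  also have "emeasure \<mu> (law.B \<inter> A) / emeasure \<mu> law.B = emeasure law.hat A"
    unfolding law.hat_def using Bs A by (subst emeasure_uniform_measure) auto
  finally show "emeasure (distr (conditioned_env P \<omega>) seq_space path) A = emeasure law.hat A" .
qed

lemma path_measurable_conditioned: "path \<in> measurable (conditioned_env P \<omega>) seq_space"
  using path_measurable by (simp add: conditioned_env_def cong: measurable_cong_sets)

lemma integral_conditioned:
  fixes f :: "(nat \<Rightarrow> real) \<Rightarrow> real"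
  assumes "f \<in> borel_measurable law.hat"
  shows "(\<integral>x. f (path x) \<partial>conditioned_env P \<omega>) = (\<integral>w. f w \<partial>law.hat)"
proof -
  have "f \<in> borel_measurable seq_space" using assms by (simp cong: measurable_cong_sets)
  thus ?thesis unfolding distr_conditioned[symmetric] by (intro integral_distr[symmetric] path_measurable_conditioned)
qed

lemma space_conditioned [simp]: "space (conditioned_env P \<omega>) = space P"
  by (simp add: conditioned_env_def)

lemma block_length_1: "block_length w 1 = switch_time w 1"
  by (simp add: block_length_def)

lemma long_block_eq: "\<P>(x in conditioned_env P \<omega>. real (switch_time (path x) 1) \<ge> real n) = law.long_block n"
proof -
  have s: "{w. n \<le> switch_time w 1} \<in> sets seq_space" 
  proof -
    have "Measurable.pred \<mu> (\<lambda>w. n \<le> switch_time w 1)" by measurable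
    thus ?thesis using law.sets_Collect[of "\<lambda>w. n \<le> switch_time w 1"] by simp
  qed
  have "law.long_block n = measure (distr (conditioned_env P \<omega>) seq_space path) {w. n \<le> switch_time w 1}"
    by (simp add: law.long_block_def distr_conditioned)
  also have "\<dots> = measure (conditioned_env P \<omega>) (path -` {w. n \<le> switch_time w 1} \<inter> space P)"
    using measure_distr[OF path_measurable_conditioned s] by simp
  also have "path -` {w. n \<le> switch_time w 1} \<inter> space P = {x \<in> space (conditioned_env P \<omega>). real (switch_time (path x) 1) \<ge> real n}"
    by (auto simp del: switch_time.simps)
  finally show ?thesis by simp
qed

lemma block_tail_eq: "block_tail P \<omega> (real n) = law.long_block n"
  unfolding block_tail_def path_def[symmetric] block_length_1 by (rule long_block_eq)

end

locale quenched_model = pm1_environment P \<omega> + ren: renewal_model R \<tau> 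
  for P :: "'w measure" and \<omega> and R :: "'r measure" and \<tau> +
  fixes \<alpha> k1 k2 :: real and n0 :: nat
  assumes kernel: "renewal_kernel ren.K \<alpha> k1 k2 n0"
begin

sublocale pin: pinning ren.K \<alpha> k1 k2 n0 \<mu>
  by (intro pinning.intro kernel environment_mu)

lemma partition_function_path:
  assumes "x \<in> space P"
  shows "ln (partition_function R \<tau> \<beta> h (\<lambda>i. \<omega> i x) N) = pin.z \<beta> h N (path x)"
proof -
  have "(\<lambda>n. exp (h + \<beta> * \<omega> n x)) = pin.weight \<beta> h (path x)"
  proof
    fix n
    show "exp (h + \<beta> * \<omega> n x) = pin.weight \<beta> h (path x) n"
      using omega_pm[OF assms, of n] by (auto simp: pin.weight_def path_def)
  qed
  thus ?thesis by (simp add: ren.partition_function_eq_Z[OF kernel] pin.z_def)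
qed

lemma free_energy_eq: "free_energy P \<omega> R \<tau> \<beta> h = pin.FE \<beta> h"
proof -
  have AE: "AE x in P. (\<lambda>N. 1 / real N * ln (partition_function R \<tau> \<beta> h (\<lambda>i. \<omega> i x) N)) \<longlonglongrightarrow> pin.FE \<beta> h"
  proof -
    have "AE x in P. (\<lambda>N. pin.z \<beta> h N (path x) / real N) \<longlonglongrightarrow> pin.FE \<beta> h"
      using pin.FE_AE[of \<beta> h] unfolding \<mu>_def by (rule AE_distrD[OF path_measurable])
    thus ?thesis
    proof (rule AE_mp, intro AE_I2 impI)
      fix x assume x: "x \<in> space P" and lim: "(\<lambda>N. pin.z \<beta> h N (path x) / real N) \<longlonglongrightarrow> pin.FE \<beta> h"
      show "(\<lambda>N. 1 / real N * ln (partition_function R \<tau> \<beta> h (\<lambda>i. \<omega> i x) N)) \<longlonglongrightarrow> pin.FE \<beta> h"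
        using lim by (simp add: partition_function_path[OF x])
    qed
  qed
  show ?thesis
    unfolding free_energy_def
  proof (rule the_equality)
    show "AE x in P. (\<lambda>N. 1 / real N * ln (partition_function R \<tau> \<beta> h (\<lambda>i. \<omega> i x) N)) \<longlonglongrightarrow> pin.FE \<beta> h" by (rule AE)
    fix f assume "AE x in P. (\<lambda>N. 1 / real N * ln (partition_function R \<tau> \<beta> h (\<lambda>i. \<omega> i x) N)) \<longlonglongrightarrow> f"
    with AE have "AE x in P. f = pin.FE \<beta> h" by eventually_elim (rule LIMSEQ_unique)
    thus "f = pin.FE \<beta> h" by simp
  qed
qed

lemma nu_eq: "max 1 (1 / \<alpha>) = pin.\<nu>"
  using pin.alpha_pos by (auto simp: pin.\<nu>_def pin.\<gamma>_def max_def min_def field_simps)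

definition truncated_mean :: "nat \<Rightarrow> real \<Rightarrow> real" where
  "truncated_mean L t = (\<integral>x. real (switch_time (path x) L) * indicator {x. real (switch_time (path x) L) > t} x \<partial>conditioned_env P \<omega>)"

lemma truncated_mean_eq: "truncated_mean L t = (\<integral>w. real (switch_time w L) * indicator {w. t < real (switch_time w L)} w \<partial>law.hat)"
proof -
  have "(\<integral>x. real (switch_time (path x) L) * indicator {w. t < real (switch_time w L)} (path x) \<partial>conditioned_env P \<omega>)
     = (\<integral>w. real (switch_time w L) * indicator {w. t < real (switch_time w L)} w \<partial>law.hat)"
    by (rule integral_conditioned, rule borel_measurable_integrable, rule law.truncated_switch_time_integrable)
  thus ?thesis unfolding truncated_mean_def by (simp add: indicator_def del: switch_time.simps)
qed

lemma truncated_mean_nonneg: "truncated_mean L t \<ge> 0"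
  unfolding truncated_mean_def by (intro integral_nonneg_AE AE_I2) (simp del: switch_time.simps)

lemma FE_hom_nonneg: "0 < u \<Longrightarrow> u < 1 \<Longrightarrow> pin.FE 0 u > 0"
proof -
  assume u: "0 < u" "u < 1"
  obtain c where "c > 0" "c * u powr pin.\<nu> \<le> pin.FE 0 u" using pin.FE_hom_bounds u by blast
  moreover have "c * u powr pin.\<nu> > 0" using u \<open>c > 0\<close> by simp
  ultimately show ?thesis by linarith
qed

text \<open>Both bounds hold for all sufficiently small constants \<open>c\<close>, so they hold for a common one.\<close>

lemma upper_bounds:
  assumes \<kappa>: "\<kappa> \<ge> 0"
  shows "\<exists>C\<^sub>1>0. \<exists>c\<^sub>1>0. \<exists>c>0.
           (\<forall>\<beta>\<in>{0<..<1}. \<forall>u\<in>{0<..<c\<^sub>1 * \<beta>}. \<forall>L. L = nat \<lfloor>c * \<beta> powr pin.\<nu> * inverse (pin.FE 0 u)\<rfloor> \<longrightarrow>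
              pin.FE \<beta> (-\<beta> + u) \<le> C\<^sub>1 * \<beta> powr (1 - pin.\<nu>) * pin.FE 0 u * (truncated_mean L (4 * \<kappa> * real L) / real L)) \<and>
           (\<forall>\<beta>\<in>{0<..<1}. \<forall>u\<in>{0<..<c\<^sub>1 * \<beta>}.
              pin.FE \<beta> (-\<beta> + u) \<le> C\<^sub>1 * u * truncated_mean 1 (c * \<beta> * inverse u))"
proof -
  obtain ca where ca: "ca > 0" and A: "\<And>c. 0 < c \<Longrightarrow> c \<le> ca \<Longrightarrow> (\<exists>C>0. \<exists>c1>0. \<forall>\<beta> u L. 0 < \<beta> \<longrightarrow> \<beta> < 1 \<longrightarrow> 0 < u \<longrightarrow> u < c1 * \<beta> \<longrightarrow>
     L = nat \<lfloor>c * \<beta> powr pin.\<nu> / pin.FE 0 u\<rfloor> \<longrightarrow>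
     pin.FE \<beta> (-\<beta> + u) \<le> C * \<beta> powr (1 - pin.\<nu>) * pin.FE 0 u *
        (\<integral>w. real (switch_time w L) / real L * indicator {w. 4 * \<kappa> * real L < real (switch_time w L)} w \<partial>law.hat))"
    using pin.upper_bound_cycles[OF \<kappa>] by blast
  obtain cb where cb: "cb > 0" and B: "\<And>c. 0 < c \<Longrightarrow> c \<le> cb \<Longrightarrow> (\<exists>C>0. \<exists>c1>0. \<forall>\<beta> u. 0 < \<beta> \<longrightarrow> \<beta> < 1 \<longrightarrow> 0 < u \<longrightarrow> u < c1 * \<beta> \<longrightarrow>
     pin.FE \<beta> (-\<beta> + u) \<le> C * u * (\<integral>w. real (switch_time w 1) * indicator {w. c * \<beta> / u < real (switch_time w 1)} w \<partial>law.hat))"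
    using pin.upper_bound_first_block by blast
  define c where "c = min ca cb"
  have c: "0 < c" "c \<le> ca" "c \<le> cb" using ca cb by (auto simp: c_def)
  obtain Ca c1a where a: "Ca > 0" "c1a > 0" "\<And>\<beta> u L. 0 < \<beta> \<Longrightarrow> \<beta> < 1 \<Longrightarrow> 0 < u \<Longrightarrow> u < c1a * \<beta> \<Longrightarrow>
     L = nat \<lfloor>c * \<beta> powr pin.\<nu> / pin.FE 0 u\<rfloor> \<Longrightarrow>
     pin.FE \<beta> (-\<beta> + u) \<le> Ca * \<beta> powr (1 - pin.\<nu>) * pin.FE 0 u *
        (\<integral>w. real (switch_time w L) / real L * indicator {w. 4 * \<kappa> * real L < real (switch_time w L)} w \<partial>law.hat)"
    using A[OF c(1,2)] by blast
  obtain Cb c1b where b: "Cb > 0" "c1b > 0" "\<And>\<beta> u. 0 < \<beta> \<Longrightarrow> \<beta> < 1 \<Longrightarrow> 0 < u \<Longrightarrow> u < c1b * \<beta> \<Longrightarrow>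
     pin.FE \<beta> (-\<beta> + u) \<le> Cb * u * (\<integral>w. real (switch_time w 1) * indicator {w. c * \<beta> / u < real (switch_time w 1)} w \<partial>law.hat)"
    using B[OF c(1,3)] by blast
  define C1 where "C1 = max Ca Cb"
  define c1 where "c1 = min 1 (min c1a c1b)"
  have C1: "C1 > 0" "Ca \<le> C1" "Cb \<le> C1" using a by (auto simp: C1_def)
  have c1: "c1 > 0" "c1 \<le> 1" "c1 \<le> c1a" "c1 \<le> c1b" using a b by (auto simp: c1_def)
  have "pin.FE \<beta> (-\<beta> + u) \<le> C1 * \<beta> powr (1 - pin.\<nu>) * pin.FE 0 u * (truncated_mean L (4 * \<kappa> * real L) / real L)"
    if H: "\<beta> \<in> {0<..<1}" "u \<in> {0<..<c1 * \<beta>}" "L = nat \<lfloor>c * \<beta> powr pin.\<nu> * inverse (pin.FE 0 u)\<rfloor>" for \<beta> u L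
  proof -
    have u0: "u < c1 * \<beta>" "0 < \<beta>" "\<beta> < 1" using H by auto
    have u1: "u < c1a * \<beta>" using u0(1) by (rule less_le_trans) (rule mult_right_mono[OF c1(3)], use u0 in simp)
    have "c1 * \<beta> \<le> 1 * \<beta>" using c1 u0 by (intro mult_right_mono) auto
    hence u2: "u < 1" using u0 by linarith
    have F0: "pin.FE 0 u > 0" using H u2 by (intro FE_hom_nonneg) auto
    have int: "(\<integral>w. real (switch_time w L) / real L * indicator {w. 4 * \<kappa> * real L < real (switch_time w L)} w \<partial>law.hat) = truncated_mean L (4 * \<kappa> * real L) / real L"
      unfolding truncated_mean_eq by (simp del: switch_time.simps flip: integral_divide_zero)
    have "pin.FE \<beta> (-\<beta> + u) \<le> Ca * \<beta> powr (1 - pin.\<nu>) * pin.FE 0 u * (truncated_mean L (4 * \<kappa> * real L) / real L)"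
      unfolding int[symmetric] by (rule a(3)) (use H u1 in \<open>auto simp: divide_inverse\<close>)
    also have "\<dots> \<le> C1 * \<beta> powr (1 - pin.\<nu>) * pin.FE 0 u * (truncated_mean L (4 * \<kappa> * real L) / real L)"
      using C1 F0 truncated_mean_nonneg by (intro mult_right_mono) auto
    finally show ?thesis .
  qed
  moreover have "pin.FE \<beta> (-\<beta> + u) \<le> C1 * u * truncated_mean 1 (c * \<beta> * inverse u)"
    if H: "\<beta> \<in> {0<..<1}" "u \<in> {0<..<c1 * \<beta>}" for \<beta> u
  proof -
    have u0: "u < c1 * \<beta>" "0 < \<beta>" using H by auto
    have u1: "u < c1b * \<beta>" using u0(1) by (rule less_le_trans) (rule mult_right_mono[OF c1(4)], use u0 in simp)
    have "pin.FE \<beta> (-\<beta> + u) \<le> Cb * u * truncated_mean 1 (c * \<beta> * inverse u)"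
      unfolding truncated_mean_eq divide_inverse[symmetric] by (rule b(3)) (use H u1 in auto)
    also have "\<dots> \<le> C1 * u * truncated_mean 1 (c * \<beta> * inverse u)"
      using C1 H truncated_mean_nonneg by (intro mult_right_mono) auto
    finally show ?thesis .
  qed
  ultimately show ?thesis using C1(1) c1(1) c(1) by blast
qed

lemma block_tail_1: "block_tail P \<omega> 1 = 1"
  using block_tail_eq[of 1] law.long_block_1 by simp

lemma block_tail_nonneg: "block_tail P \<omega> (real n) \<ge> 0"
  unfolding block_tail_eq by (rule law.long_block_bounds)

lemma rate_inv_eq_nat:
  assumes "(rate P \<omega> \<longlongrightarrow> 0) at_top" "t > 0"
  obtains A :: nat where "A \<ge> 1" "rate_inv P \<omega> t = ereal (real A)" "0 < law.long_block A"
    "- ln (law.long_block A) \<le> t * real A"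
proof -
  obtain A :: nat where "A \<ge> 1 \<and> rate_inv P \<omega> t = ereal (real A) \<and> 0 < law.long_block A \<and>
     law.long_block A < 1 \<and> - ln (law.long_block A) < t * real A"
    using rate_inv_attained[OF assms block_tail_1 block_tail_nonneg] unfolding block_tail_eq by (elim exE)
  thus thesis by (intro that[of A]) (simp_all add: less_imp_le)
qed

lemma long_block_mean_le:
  "real n * law.long_block n \<le> (\<integral>w. real (switch_time w 1) \<partial>law.hat)"
proof -
  have "real n * law.long_block n \<le> (\<integral>w. real (switch_time w 1) * indicator {w. n \<le> switch_time w 1} w \<partial>law.hat)"
    by (rule law.long_block_truncated_mean)
  also have "\<dots> \<le> (\<integral>w. real (switch_time w 1) \<partial>law.hat)"
    by (rule integral_mono[OF law.truncated_switch_time_integrable law.first_block_integrable])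
       (simp split: split_indicator del: switch_time.simps)
  finally show ?thesis .
qed

lemma FE_hom_tendsto_0: "filterlim (pin.FE 0) (at_right 0) (at_right 0)"
  unfolding filterlim_at
proof
  have ev: "\<forall>\<^sub>F u in at_right 0. u \<in> {0<..<1::real}" by (rule eventually_at_right_real) simp
  show "\<forall>\<^sub>F u in at_right 0. pin.FE 0 u \<in> {0<..} \<and> pin.FE 0 u \<noteq> 0"
    using ev by eventually_elim (use FE_hom_nonneg in force)
  show "(pin.FE 0 \<longlongrightarrow> 0) (at_right 0)"
  proof (rule tendsto_sandwich[of "\<lambda>_. 0" _ _ "\<lambda>u. u"])
    show "\<forall>\<^sub>F u in at_right 0. 0 \<le> pin.FE 0 u" using ev by eventually_elim (use FE_hom_nonneg in force)
    show "\<forall>\<^sub>F u in at_right 0. pin.FE 0 u \<le> u" using ev by eventually_elim (use pin.FE_hom_le in force)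
  qed (auto intro: tendsto_ident_at)
qed

lemma rate_inv_finite_near_0:
  assumes "(rate P \<omega> \<longlongrightarrow> 0) at_top"
  shows "\<forall>\<^sub>F u in at_right 0. \<bar>rate_inv P \<omega> u\<bar> \<noteq> \<infinity>"
  using eventually_at_right_less
proof eventually_elim
  case (elim u)
  show ?case by (rule rate_inv_eq_nat[OF assms elim]) simp
qed

text \<open>For \<open>u\<close> below some \<open>u1\<close> the block length \<open>A u\<close> is large enough for the bound of the pinning model. For
  larger \<open>u\<close> the left-hand side is at least its value \<open>\<eta>\<close> at \<open>u1\<close>, and \<open>A P(\<xi>_1 \<ge> A) F(u)\<close> is at
  most the mean \<open>m\<close> of the first block.\<close>

lemma lower_bound:
  assumes lim: "(rate P \<omega> \<longlongrightarrow> 0) at_top"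
  obtains c\<^sub>0 c\<^sub>0' :: real and A :: "real \<Rightarrow> nat" where "c\<^sub>0 > 0" "c\<^sub>0' > 0"
    "\<And>u. u \<in> {0<..<1} \<Longrightarrow> rate_inv P \<omega> (c\<^sub>0 * pin.FE 0 u) = ereal (real (A u))"
    "\<And>u. u \<in> {0<..<1} \<Longrightarrow> A u \<ge> 1 \<and> law.long_block (A u) > 0"
    "\<And>u \<beta>. u \<in> {0<..<1} \<Longrightarrow> pin.FE \<beta> (-\<beta> + u) \<ge> c\<^sub>0' * real (A u) * law.long_block (A u) * pin.FE 0 u"
    "filterlim A at_top (at_right 0)"
proof -
  obtain c0 D A1 where c: "c0 > 0" "D > 0" and low: "\<And>u \<beta> A. 0 < u \<Longrightarrow> u < 1 \<Longrightarrow> A \<ge> A1 \<Longrightarrow> 0 < law.long_block A \<Longrightarrow>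
      - ln (law.long_block A) \<le> c0 * pin.FE 0 u * real A \<Longrightarrow>
      pin.FE \<beta> (-\<beta> + u) \<ge> D * (real A * law.long_block A * pin.FE 0 u)"
    using pin.lower_bound_long_blocks by blast
  define A where "A u = (SOME n::nat. n \<ge> 1 \<and> rate_inv P \<omega> (c0 * pin.FE 0 u) = ereal (real n) \<and> 0 < law.long_block n \<and>
     - ln (law.long_block n) \<le> c0 * pin.FE 0 u * real n)" for u
  have A: "A u \<ge> 1" "rate_inv P \<omega> (c0 * pin.FE 0 u) = ereal (real (A u))" "0 < law.long_block (A u)"
     "- ln (law.long_block (A u)) \<le> c0 * pin.FE 0 u * real (A u)" if u: "u \<in> {0<..<1}" for u
  proof -
    have "c0 * pin.FE 0 u > 0" using u c FE_hom_nonneg by simp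
    hence "\<exists>n::nat. n \<ge> 1 \<and> rate_inv P \<omega> (c0 * pin.FE 0 u) = ereal (real n) \<and> 0 < law.long_block n \<and>
       - ln (law.long_block n) \<le> c0 * pin.FE 0 u * real n"
      using rate_inv_eq_nat[OF lim] by metis
    from someI_ex[OF this] show "A u \<ge> 1" "rate_inv P \<omega> (c0 * pin.FE 0 u) = ereal (real (A u))" "0 < law.long_block (A u)"
     "- ln (law.long_block (A u)) \<le> c0 * pin.FE 0 u * real (A u)" unfolding A_def by blast+
  qed
  have ev01: "\<forall>\<^sub>F u in at_right 0. u \<in> {0<..<1::real}" by (rule eventually_at_right_real) simp
  have "filterlim (\<lambda>u. c0 * pin.FE 0 u) (at_right 0) (at_right 0)"
    using filterlim_times_pos[OF FE_hom_tendsto_0 c(1)] by simp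
  from filterlim_compose[OF rate_inv_at_0[OF block_tail_nonneg] this]
  have "((\<lambda>u. rate_inv P \<omega> (c0 * pin.FE 0 u)) \<longlongrightarrow> \<infinity>) (at_right 0)" .
  moreover have "\<forall>\<^sub>F u in at_right 0. rate_inv P \<omega> (c0 * pin.FE 0 u) = ereal (real (A u))"
    using ev01 by eventually_elim (rule A)
  ultimately have "((\<lambda>u. ereal (real (A u))) \<longlongrightarrow> \<infinity>) (at_right 0)"
    by (simp cong: tendsto_cong)
  hence "filterlim (\<lambda>u. real (A u)) at_top (at_right 0)" by (simp add: tendsto_PInfty_eq_at_top)
  hence Atop: "filterlim A at_top (at_right 0)" by (simp add: filterlim_sequentially_iff_filterlim_real)
  hence "\<forall>\<^sub>F u in at_right 0. A u \<ge> A1" by (simp add: filterlim_at_top)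
  then obtain b where b: "b > 0" "\<And>u. 0 < u \<Longrightarrow> u < b \<Longrightarrow> A u \<ge> A1"
    unfolding eventually_at_right_field by blast
  \<comment> \<open>A value for which the bound of the pinning model is available, from which the larger values of \<open>u\<close> are reached by monotonicity.\<close>
  define u1 where "u1 = min b 1 / 2"
  have u1: "u1 \<in> {0<..<1}" "u1 < b" using b by (auto simp: u1_def)
  define \<eta> where "\<eta> = D * (real (A u1) * law.long_block (A u1) * pin.FE 0 u1)"
  have eta: "\<eta> > 0" unfolding \<eta>_def using A[OF u1(1)] u1 c FE_hom_nonneg by (intro mult_pos_pos) auto
  define m where "m = (\<integral>w. real (switch_time w 1) \<partial>law.hat)"
  have m: "m \<ge> 0" unfolding m_def by (intro integral_nonneg_AE AE_I2) simp
  \<comment> \<open>The divisor \<open>m + 1\<close> instead of \<open>m\<close> avoids the question whether \<open>m\<close> is positive.\<close>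
  define c0' where "c0' = min D (\<eta> / (m + 1))"
  have c0': "c0' > 0" "c0' \<le> D" "c0' \<le> \<eta> / (m + 1)" using c eta m by (auto simp: c0'_def)
  have main: "pin.FE \<beta> (-\<beta> + u) \<ge> c0' * real (A u) * law.long_block (A u) * pin.FE 0 u" if u: "u \<in> {0<..<1}" for u \<beta>
  proof (cases "u < u1")
    case True
    have "c0' * (real (A u) * law.long_block (A u) * pin.FE 0 u) \<le> D * (real (A u) * law.long_block (A u) * pin.FE 0 u)"
      using c0' A[OF u] FE_hom_nonneg[of u] u by (intro mult_right_mono mult_nonneg_nonneg) auto
    also have "\<dots> \<le> pin.FE \<beta> (-\<beta> + u)" using u A[OF u] True u1 b(2) by (intro low) auto
    finally show ?thesis by (simp add: mult_ac)
  next
    case False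
    have "pin.FE 0 u \<le> 1" using pin.FE_hom_le[of u] u by simp
    hence "real (A u) * law.long_block (A u) * pin.FE 0 u \<le> m * 1"
      using long_block_mean_le[of "A u"] FE_hom_nonneg[of u] u A[OF u] m unfolding m_def by (intro mult_mono) auto
    hence "c0' * (real (A u) * law.long_block (A u) * pin.FE 0 u) \<le> \<eta> / (m + 1) * m"
      using c0' A[OF u] FE_hom_nonneg[of u] u eta m by (intro mult_mono) auto
    also have "\<dots> \<le> \<eta>" using eta m by (simp add: field_simps)
    also have "\<dots> \<le> pin.FE \<beta> (-\<beta> + u1)" unfolding \<eta>_def using u1 A[OF u1(1)] b(2) by (intro low) auto
    also have "\<dots> \<le> pin.FE \<beta> (-\<beta> + u)" using False by (intro pin.FE_mono) simp
    finally show ?thesis by (simp add: mult_ac)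
  qed
  show thesis by (rule that[OF c(1) c0'(1) A(2) _ main Atop]) (use A in auto)
qed

lemma critical_point_eq:
  assumes "(rate P \<omega> \<longlongrightarrow> 0) at_top" "\<beta> > 0"
  shows "critical_point P \<omega> R \<tau> \<beta> = - \<beta>"
proof -
  obtain c0 c0' A where c: "c0 > 0" "c0' > 0"
    "\<And>u. u \<in> {0<..<1} \<Longrightarrow> rate_inv P \<omega> (c0 * pin.FE 0 u) = ereal (real (A u))"
    and A: "\<And>u. u \<in> {0<..<1} \<Longrightarrow> A u \<ge> 1 \<and> law.long_block (A u) > 0"
    and low: "\<And>u \<beta>. u \<in> {0<..<1} \<Longrightarrow> pin.FE \<beta> (-\<beta> + u) \<ge> c0' * real (A u) * law.long_block (A u) * pin.FE 0 u"
    and "filterlim A at_top (at_right 0)"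
    by (rule lower_bound[OF assms(1)]) (rule that)
  have small: "pin.FE \<beta> (-\<beta> + u) > 0" if u: "u \<in> {0<..<1}" for u
  proof -
    have "c0' * real (A u) * law.long_block (A u) * pin.FE 0 u > 0" using A[OF u] c u FE_hom_nonneg[of u] by simp
    thus ?thesis using low[OF u, of \<beta>] by linarith
  qed
  have *: "pin.FE \<beta> h > 0 \<longleftrightarrow> h > -\<beta>" for h
  proof
    assume "pin.FE \<beta> h > 0"
    thus "h > -\<beta>" using pin.FE_nonpos[of \<beta> h] assms(2) by force
  next
    assume h: "h > -\<beta>"
    define u where "u = min (h + \<beta>) (1/2)"
    have "u \<in> {0<..<1}" "-\<beta> + u \<le> h" using h by (auto simp: u_def)
    thus "pin.FE \<beta> h > 0" using small[of u] pin.FE_mono[of "-\<beta> + u" h \<beta>] by linarith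
  qed
  show ?thesis unfolding critical_point_def free_energy_eq *
  proof (rule the_equality)
    fix c assume c: "\<forall>h. (h > -\<beta>) = (h > c)"
    show "c = -\<beta>" using c[rule_format, of c] c[rule_format, of "-\<beta>"] by linarith
  qed simp
qed

end

theorem proposition2p7:
  fixes P :: "'w measure" and \<omega> :: "nat \<Rightarrow> 'w \<Rightarrow> real"
    and R :: "'r measure" and \<tau> :: "nat \<Rightarrow> 'r \<Rightarrow> nat"
    and \<alpha> c\<^sub>K :: real
  assumes "renewal_process R \<tau>"
    and "\<alpha> > 0" and "\<alpha> \<noteq> 1" and "c\<^sub>K > 0"
    and "interarrival_law R \<tau> \<sim>[sequentially] (\<lambda>n. c\<^sub>K * real n powr (-(1 + \<alpha>)))"
    and "nontrivial_pm1_environment P \<omega>"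
  shows
    "let F = free_energy P \<omega> R \<tau>;
         F0 = (\<lambda>u. free_energy P \<omega> R \<tau> 0 u);
         \<nu> = max 1 (1 / \<alpha>);
         Phat = conditioned_env P \<omega>;
         T = (\<lambda>n x. real (switch_time (\<lambda>i. \<omega> i x) n));
         \<xi> = (\<lambda>n x. real (block_length (\<lambda>i. \<omega> i x) n))
     in
      ((rate P \<omega> \<longlongrightarrow> 0) at_top \<longrightarrow>
         (\<forall>\<^sub>F u in at_right 0. \<bar>rate_inv P \<omega> u\<bar> \<noteq> \<infinity>) \<and>
         (rate_inv P \<omega> \<longlongrightarrow> \<infinity>) (at_right 0) \<and>
         (\<exists>c\<^sub>0>0. \<exists>c\<^sub>0'>0.
            let A = (\<lambda>u. real_of_ereal (rate_inv P \<omega> (c\<^sub>0 * F0 u)));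
                lower = (\<lambda>u. c\<^sub>0' * A u * \<P>(x in Phat. \<xi> 1 x \<ge> A u) * F0 u)
            in
              (\<forall>u\<in>{0<..<1}. \<bar>rate_inv P \<omega> (c\<^sub>0 * F0 u)\<bar> \<noteq> \<infinity>) \<and>
              (\<forall>u\<in>{0<..<1}. \<forall>\<beta>>0. F \<beta> (-\<beta> + u) \<ge> lower u) \<and>
              filterlim A at_top (at_right 0) \<and>
              lower \<in> o[at_right 0](F0)) \<and>
         (\<forall>\<beta>>0. critical_point P \<omega> R \<tau> \<beta> = -\<beta>))
      \<and>
      (\<exists>C\<^sub>1>0. \<exists>c\<^sub>1>0. \<exists>c>0.
         let L = (\<lambda>\<beta> u. nat \<lfloor>c * \<beta> powr \<nu> * inverse (F0 u)\<rfloor>)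
         in
           (\<forall>\<beta>\<in>{0<..<1}. \<forall>u\<in>{0<..<c\<^sub>1 * \<beta>}.
              F \<beta> (-\<beta> + u) \<le>
                C\<^sub>1 * \<beta> powr (1 - \<nu>) * F0 u *
                (\<integral>x. T (L \<beta> u) x / real (L \<beta> u) *
                     indicator {x. T (L \<beta> u) x > 4 * (\<integral>x'. T 2 x' \<partial>Phat) * real (L \<beta> u)} x \<partial>Phat)) \<and>
           (\<forall>\<beta>\<in>{0<..<1}. \<forall>u\<in>{0<..<c\<^sub>1 * \<beta>}.
              F \<beta> (-\<beta> + u) \<le>
                C\<^sub>1 * u * (\<integral>x. \<xi> 1 x * indicator {x. \<xi> 1 x > c * \<beta> * inverse u} x \<partial>Phat)))"
proof -
  interpret ren: renewal_model R \<tau>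
    using assms(1) by (intro renewal_model.intro renewal_model_axioms.intro) (auto simp: renewal_process_def)
  have "prob_space P" using assms(6) by (simp add: nontrivial_pm1_environment_def)
  obtain k1 k2 n0 where "renewal_kernel ren.K \<alpha> k1 k2 n0"
    using ren.kernel_of_asymptotics[OF assms(2-4)] assms(5) unfolding ren.K_def by blast
  then interpret quenched_model P \<omega> R \<tau> \<alpha> k1 k2 n0
    by (intro quenched_model.intro pm1_environment.intro pm1_environment_axioms.intro quenched_model_axioms.intro
        assms(6) \<open>prob_space P\<close> ren.renewal_model_axioms)
  define \<kappa> where "\<kappa> = (\<integral>x. real (switch_time (path x) 2) \<partial>conditioned_env P \<omega>)"
  have kappa: "\<kappa> \<ge> 0" unfolding \<kappa>_def by (intro integral_nonneg_AE AE_I2) simp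
  have int1: "(\<integral>x. real (switch_time (path x) L) / real L * indicator {x. t < real (switch_time (path x) L)} x \<partial>conditioned_env P \<omega>)
     = truncated_mean L t / real L" for L t
    unfolding truncated_mean_def by (simp del: switch_time.simps flip: integral_divide_zero)
  have int2: "(\<integral>x. real (block_length (path x) 1) * indicator {x. t < real (block_length (path x) 1)} x \<partial>conditioned_env P \<omega>)
     = truncated_mean 1 t" for t
    unfolding truncated_mean_def block_length_1 ..
  show ?thesis
    unfolding Let_def free_energy_eq nu_eq path_def[symmetric] \<kappa>_def[symmetric] int1 int2
  proof (intro conjI impI)
    assume lim: "(rate P \<omega> \<longlongrightarrow> 0) at_top"
    show "\<forall>\<^sub>F u in at_right 0. \<bar>rate_inv P \<omega> u\<bar> \<noteq> \<infinity>" by (rule rate_inv_finite_near_0[OF lim])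
    show "(rate_inv P \<omega> \<longlongrightarrow> \<infinity>) (at_right 0)" by (rule rate_inv_at_0[OF block_tail_nonneg])
    show "\<forall>\<beta>>0. critical_point P \<omega> R \<tau> \<beta> = - \<beta>" using critical_point_eq[OF lim] by blast
    obtain c0 c0' A where c: "c0 > 0" "c0' > 0"
      and A: "\<And>u. u \<in> {0<..<1} \<Longrightarrow> rate_inv P \<omega> (c0 * pin.FE 0 u) = ereal (real (A u))"
      and "\<And>u. u \<in> {0<..<1} \<Longrightarrow> A u \<ge> 1 \<and> law.long_block (A u) > 0"
      and low: "\<And>u \<beta>. u \<in> {0<..<1} \<Longrightarrow> pin.FE \<beta> (-\<beta> + u) \<ge> c0' * real (A u) * law.long_block (A u) * pin.FE 0 u"
      and Atop: "filterlim A at_top (at_right 0)"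
      by (rule lower_bound[OF lim]) (rule that)
    define a where "a u = real_of_ereal (rate_inv P \<omega> (c0 * pin.FE 0 u))" for u
    have a: "a u = real (A u)" if "u \<in> {0<..<1}" for u using A[OF that] by (simp add: a_def)
    have tail: "\<P>(x in conditioned_env P \<omega>. real (block_length (path x) 1) \<ge> real (A u)) = law.long_block (A u)" for u
      unfolding block_length_1 by (rule long_block_eq)
    have ev01: "\<forall>\<^sub>F u in at_right 0. u \<in> {0<..<1::real}" by (rule eventually_at_right_real) simp
    have fin: "\<forall>u\<in>{0<..<1}. \<bar>rate_inv P \<omega> (c0 * pin.FE 0 u)\<bar> \<noteq> \<infinity>" using A by auto
    have lower: "\<forall>u\<in>{0<..<1}. \<forall>\<beta>>0. c0' * a u * \<P>(x in conditioned_env P \<omega>. real (block_length (path x) 1) \<ge> a u) * pin.FE 0 u \<le> pin.FE \<beta> (-\<beta> + u)"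
    proof (intro ballI allI impI)
      fix u \<beta> :: real assume u: "u \<in> {0<..<1}"
      show "c0' * a u * \<P>(x in conditioned_env P \<omega>. real (block_length (path x) 1) \<ge> a u) * pin.FE 0 u \<le> pin.FE \<beta> (-\<beta> + u)"
        unfolding a[OF u] tail by (rule low[OF u])
    qed
    have "filterlim (\<lambda>u. real (A u)) at_top (at_right 0)"
      by (rule filterlim_compose[OF filterlim_real_sequentially Atop])
    moreover have "\<forall>\<^sub>F u in at_right 0. real (A u) = a u" using ev01 by eventually_elim (simp add: a)
    ultimately have atop: "filterlim a at_top (at_right 0)" by (simp cong: filterlim_cong)
    have small: "(\<lambda>u. c0' * a u * \<P>(x in conditioned_env P \<omega>. real (block_length (path x) 1) \<ge> a u) * pin.FE 0 u) \<in> o[at_right 0](pin.FE 0)"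
    proof (rule smalloI_tendsto)
      show "\<forall>\<^sub>F u in at_right 0. pin.FE 0 u \<noteq> 0" using ev01 by eventually_elim (use FE_hom_nonneg in force)
      have "((\<lambda>u. c0' * (real (A u) * law.long_block (A u))) \<longlongrightarrow> c0' * 0) (at_right 0)"
        by (intro tendsto_mult_left filterlim_compose[OF law.long_block_tendsto_0 Atop])
      moreover have "\<forall>\<^sub>F u in at_right 0. c0' * (real (A u) * law.long_block (A u)) =
          c0' * a u * \<P>(x in conditioned_env P \<omega>. real (block_length (path x) 1) \<ge> a u) * pin.FE 0 u / pin.FE 0 u"
        using ev01
      proof eventually_elim
        case (elim u)
        have "pin.FE 0 u > 0" using elim FE_hom_nonneg by simp
        thus ?case unfolding a[OF elim] tail by simp
      qed
      ultimately show "((\<lambda>u. c0' * a u * \<P>(x in conditioned_env P \<omega>. real (block_length (path x) 1) \<ge> a u) * pin.FE 0 u / pin.FE 0 u) \<longlongrightarrow> 0) (at_right 0)"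
        by (auto intro: Lim_transform_eventually)
    qed
    show "\<exists>c\<^sub>0>0. \<exists>c\<^sub>0'>0. 
        (\<forall>u\<in>{0<..<1}. \<bar>rate_inv P \<omega> (c\<^sub>0 * pin.FE 0 u)\<bar> \<noteq> \<infinity>) \<and>
        (\<forall>u\<in>{0<..<1}. \<forall>\<beta>>0. c\<^sub>0' * real_of_ereal (rate_inv P \<omega> (c\<^sub>0 * pin.FE 0 u)) *
           \<P>(x in conditioned_env P \<omega>. real_of_ereal (rate_inv P \<omega> (c\<^sub>0 * pin.FE 0 u)) \<le> real (block_length (path x) 1)) * pin.FE 0 u \<le> pin.FE \<beta> (-\<beta> + u)) \<and>
        filterlim (\<lambda>u. real_of_ereal (rate_inv P \<omega> (c\<^sub>0 * pin.FE 0 u))) at_top (at_right 0) \<and>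
        (\<lambda>u. c\<^sub>0' * real_of_ereal (rate_inv P \<omega> (c\<^sub>0 * pin.FE 0 u)) *
           \<P>(x in conditioned_env P \<omega>. real_of_ereal (rate_inv P \<omega> (c\<^sub>0 * pin.FE 0 u)) \<le> real (block_length (path x) 1)) * pin.FE 0 u) \<in> o[at_right 0](pin.FE 0)"
      by (rule exI[of _ c0], rule conjI, rule c(1), rule exI[of _ c0'], rule conjI, rule c(2))
         (intro conjI fin lower[unfolded a_def] atop[unfolded a_def] small[unfolded a_def])
  next
    show "\<exists>C\<^sub>1>0. \<exists>c\<^sub>1>0. \<exists>c>0.
       (\<forall>\<beta>\<in>{0<..<1}. \<forall>u\<in>{0<..<c\<^sub>1 * \<beta>}. pin.FE \<beta> (-\<beta> + u) \<le> C\<^sub>1 * \<beta> powr (1 - pin.\<nu>) * pin.FE 0 u *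
          (truncated_mean (nat \<lfloor>c * \<beta> powr pin.\<nu> * inverse (pin.FE 0 u)\<rfloor>) (4 * \<kappa> * real (nat \<lfloor>c * \<beta> powr pin.\<nu> * inverse (pin.FE 0 u)\<rfloor>)) / real (nat \<lfloor>c * \<beta> powr pin.\<nu> * inverse (pin.FE 0 u)\<rfloor>))) \<and>
       (\<forall>\<beta>\<in>{0<..<1}. \<forall>u\<in>{0<..<c\<^sub>1 * \<beta>}. pin.FE \<beta> (-\<beta> + u) \<le> C\<^sub>1 * u * truncated_mean 1 (c * \<beta> * inverse u))"
      using upper_bounds[OF kappa] by simp
  qed
qed

end
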